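(* Let $\phi\colon\mathfrak H\to\mathfrak G$ be a homomorphism of ind-groups. (1) Then $d\phi_e(L_{\mathfrak H})\subseteq L_{\mathfrak G}$. In particular, $L_{\mathfrak G}$ is invariant under every ind-group automorphism of $\mathfrak G$. (2) Assume that $\Bbbk$ is uncountable. If $\phi$ is surjective, then the differential $d\phi_e\colon L_{\mathfrak H}\to L_{\mathfrak G}$ is surjective.
   Context: $\Bbbk$ is an algebraically closed field of characteristic zero; all varieties are over $\Bbbk$. An (affine) ind-variety is a set $\mathfrak V$ with a filtration $\mathfrak V_1\subseteq\mathfrak V_2\subseteq\cdots$, $\mathfrak V=\bigcup_k\mathfrak V_k$, where each $\mathfrak V_k$ is an affine variety and is a closed subvariety of $\mathfrak V_{k+1}$. A subset is closed if its intersection with every $\mathfrak V_k$ is closed. A morphism $\mathfrak V\to\mathfrak W$ is a map which for each $k$ sends $\mathfrak V_k$ into some $\mathfrak W_l$ by a morphism of varieties. $T_x\mathfrak V=\varinjlim T_x\mathfrak V_k$. An ind-group is a group which is an ind-variety such that multiplication and inversion are morphisms; $\operatorname{Lie}\mathfrak G:=T_e\mathfrak G$ with its natural Lie algebra structure. A homomorphism of ind-groups is a group homomorphism which is a morphism. A subset is algebraic if it is contained in some $\mathfrak V_k$ and locally closed. $X_{\mathrm{reg}}$ is the set of smooth points of $X$. For an ind-group $\mathfrak G$ define $L_{\mathfrak G}:=\operatorname{span}(T_eX\mid X\subseteq\mathfrak G\text{ algebraic and }e\in X_{\mathrm{reg}})\subseteq\operatorname{Lie}\mathfrak G$. *)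

theory Defs
  imports
    "HOL-Algebra.Group"
    "HOL-Analysis.Abstract_Topology"
    "HOL-Library.Function_Algebras"
    "HOL-Library.Extended_Nat"
    "HOL-Library.Countable_Set"
    "HOL-Computational_Algebra.Polynomial"
begin

section \<open>Spaces of functions with values in a field\<close>

text \<open>Addition and multiplication of functions are the pointwise ones of
  \<^theory>\<open>HOL-Library.Function_Algebras\<close>.\<close>

definition fscale :: "'k::field \<Rightarrow> ('b \<Rightarrow> 'k) \<Rightarrow> 'b \<Rightarrow> 'k"
  where "fscale c f = (\<lambda>x. c * f x)"

global_interpretation fun_vs: vector_space "fscale :: 'k::field \<Rightarrow> ('b \<Rightarrow> 'k) \<Rightarrow> 'b \<Rightarrow> 'k"
  by unfold_locales (auto simp: fscale_def fun_eq_iff algebra_simps)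

text \<open>A function on a set \<open>S\<close> is represented by its extension by zero, so that the functions on
  \<open>S\<close> form a linear subspace of the function type. The unit of such an algebra is
  \<open>res S 1\<close>.\<close>

definition res :: "'a set \<Rightarrow> ('a \<Rightarrow> 'k::zero) \<Rightarrow> 'a \<Rightarrow> 'k"
  where "res S f = (\<lambda>x. if x \<in> S then f x else 0)"

lemma res_res: "S \<subseteq> T \<Longrightarrow> res S (res T f) = res S f"
  by (auto simp: res_def fun_eq_iff)

lemma res_add: "res S (f + g) = res S f + res S (g :: 'a \<Rightarrow> 'k::field)"
  by (auto simp: res_def fun_eq_iff)

lemma res_mult: "res S (f * g) = res S f * res S (g :: 'a \<Rightarrow> 'k::field)"
  by (auto simp: res_def fun_eq_iff)

lemma res_fscale: "res S (fscale c f) = fscale c (res S f)"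
  by (auto simp: res_def fscale_def fun_eq_iff)


section \<open>Affine varieties\<close>

text \<open>The points of affine \<open>n\<close>-space are the elements of \<open>{..<n} \<rightarrow>\<^sub>E UNIV\<close>.
  Over an infinite field polynomials may be identified with polynomial functions.\<close>

inductive_set poly_funs :: "nat \<Rightarrow> ((nat \<Rightarrow> 'k::field) \<Rightarrow> 'k) set" for n :: nat
  where
    const: "(\<lambda>_. c) \<in> poly_funs n"
  | coord: "i < n \<Longrightarrow> (\<lambda>a. a i) \<in> poly_funs n"
  | add: "p \<in> poly_funs n \<Longrightarrow> q \<in> poly_funs n \<Longrightarrow> p + q \<in> poly_funs n"
  | mult: "p \<in> poly_funs n \<Longrightarrow> q \<in> poly_funs n \<Longrightarrow> p * q \<in> poly_funs n"

definition algebraic_set :: "nat \<Rightarrow> (nat \<Rightarrow> 'k::field) set \<Rightarrow> bool"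
  where "algebraic_set n Z \<longleftrightarrow>
    (\<exists>S \<subseteq> poly_funs n. Z = {a \<in> {..<n} \<rightarrow>\<^sub>E UNIV. \<forall>p\<in>S. p a = 0})"

text \<open>An affine variety is a set together with an algebra of functions on it (its coordinate
  ring) such that some bijection onto a Zariski closed subset of an affine space identifies the
  functions with the restrictions of polynomials. Varieties need not be irreducible.\<close>

record ('a, 'k) variety =
  pts :: "'a set"
  cring :: "('a \<Rightarrow> 'k) set"

definition affine_variety :: "('a, 'k::field) variety \<Rightarrow> bool"
  where "affine_variety A \<longleftrightarrow>
    (\<exists>n Z \<phi>. algebraic_set n Z \<and> bij_betw \<phi> (pts A) Z \<and>
      cring A = (\<lambda>p. res (pts A) (p \<circ> \<phi>)) ` poly_funs n)"

definition zero_set :: "('a, 'k::field) variety \<Rightarrow> ('a \<Rightarrow> 'k) set \<Rightarrow> 'a set"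
  where "zero_set A S = {x \<in> pts A. \<forall>f\<in>S. f x = 0}"

definition zariski :: "('a, 'k::field) variety \<Rightarrow> 'a topology"
  where "zariski A = topology (\<lambda>U. U \<subseteq> pts A \<and> (\<exists>S \<subseteq> cring A. pts A - U = zero_set A S))"

definition closed_subvar :: "('a, 'k::field) variety \<Rightarrow> 'a set \<Rightarrow> ('a, 'k) variety"
  where "closed_subvar A C = \<lparr>pts = C, cring = res C ` cring A\<rparr>"

definition variety_morphism ::
  "('a, 'k::field) variety \<Rightarrow> ('b, 'k) variety \<Rightarrow> ('a \<Rightarrow> 'b) \<Rightarrow> bool"
  where "variety_morphism A B \<phi> \<longleftrightarrow>
    \<phi> ` pts A \<subseteq> pts B \<and> (\<forall>h \<in> cring B. res (pts A) (h \<circ> \<phi>) \<in> cring A)"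

text \<open>The coordinate ring of a product is the tensor product of the coordinate rings, realised as
  functions on the product set.\<close>

definition variety_prod ::
  "('a, 'k::field) variety \<Rightarrow> ('b, 'k) variety \<Rightarrow> ('a \<times> 'b, 'k) variety"
  where "variety_prod A B =
    \<lparr>pts = pts A \<times> pts B,
     cring = fun_vs.span {\<lambda>(x, y). f x * g y | f g. f \<in> cring A \<and> g \<in> cring B}\<rparr>"

lemma affine_variety_cring:
  assumes "affine_variety A"
  shows "res (pts A) 1 \<in> cring A"
    and "f \<in> cring A \<Longrightarrow> g \<in> cring A \<Longrightarrow> f + g \<in> cring A"
    and "f \<in> cring A \<Longrightarrow> g \<in> cring A \<Longrightarrow> f * g \<in> cring A"
    and "f \<in> cring A \<Longrightarrow> fscale c f \<in> cring A"
    and "f \<in> cring A \<Longrightarrow> res (pts A) f = f"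
proof -
  from assms obtain n Z \<phi> where
    A: "cring A = (\<lambda>p. res (pts A) (p \<circ> \<phi>)) ` poly_funs n"
    unfolding affine_variety_def by blast
  show "res (pts A) 1 \<in> cring A"
    unfolding A by (rule image_eqI[OF _ poly_funs.const[of 1]]) (auto simp: res_def)
  show "f + g \<in> cring A" if fg: "f \<in> cring A" "g \<in> cring A" for f g
  proof -
    from fg obtain p q where pq: "p \<in> poly_funs n" "q \<in> poly_funs n"
      "f = res (pts A) (p \<circ> \<phi>)" "g = res (pts A) (q \<circ> \<phi>)" unfolding A by auto
    show ?thesis unfolding A
      by (rule image_eqI[OF _ poly_funs.add[OF pq(1,2)]]) (auto simp: res_def pq fun_eq_iff)
  qed
  show mult: "f * g \<in> cring A" if fg: "f \<in> cring A" "g \<in> cring A" for f g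
  proof -
    from fg obtain p q where pq: "p \<in> poly_funs n" "q \<in> poly_funs n"
      "f = res (pts A) (p \<circ> \<phi>)" "g = res (pts A) (q \<circ> \<phi>)" unfolding A by auto
    show ?thesis unfolding A
      by (rule image_eqI[OF _ poly_funs.mult[OF pq(1,2)]]) (auto simp: res_def pq fun_eq_iff)
  qed
  show res: "res (pts A) f = f" if "f \<in> cring A" for f
    using that unfolding A by (auto simp: res_def fun_eq_iff)
  show "fscale c f \<in> cring A" if f: "f \<in> cring A" for f
  proof -
    have c: "res (pts A) (\<lambda>_. c) \<in> cring A"
      unfolding A by (rule image_eqI[OF _ poly_funs.const[of c]]) (auto simp: res_def)
    have "fscale c f = res (pts A) (\<lambda>_. c) * f"
      by (subst res[OF f, symmetric]) (simp add: fscale_def res_def fun_eq_iff)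
    with mult[OF c f] show ?thesis by simp
  qed
qed

lemma istopology_zariski:
  assumes "affine_variety A"
  shows "istopology (\<lambda>U. U \<subseteq> pts A \<and> (\<exists>S \<subseteq> cring A. pts A - U = zero_set A S))"
  unfolding istopology_def
proof (intro conjI allI impI)
  fix U V
  assume U: "U \<subseteq> pts A \<and> (\<exists>S \<subseteq> cring A. pts A - U = zero_set A S)"
    and V: "V \<subseteq> pts A \<and> (\<exists>S \<subseteq> cring A. pts A - V = zero_set A S)"
  from U V obtain S T where S: "S \<subseteq> cring A" "pts A - U = zero_set A S"
    and T: "T \<subseteq> cring A" "pts A - V = zero_set A T" by blast
  let ?R = "{f * g | f g. f \<in> S \<and> g \<in> T}"
  have "?R \<subseteq> cring A"
    using S T affine_variety_cring(3)[OF assms] by blast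
  moreover have "zero_set A ?R = zero_set A S \<union> zero_set A T"
    unfolding zero_set_def by (auto simp: times_fun_def) (metis mult_eq_0_iff)
  then have "pts A - U \<inter> V = zero_set A ?R"
    using S T by blast
  ultimately show "\<exists>S \<subseteq> cring A. pts A - U \<inter> V = zero_set A S" by blast
  show "U \<inter> V \<subseteq> pts A" using U by blast
next
  fix K
  assume K: "\<forall>U\<in>K. U \<subseteq> pts A \<and> (\<exists>S \<subseteq> cring A. pts A - U = zero_set A S)"
  then show "\<Union>K \<subseteq> pts A" by blast
  from K obtain S where S: "\<And>U. U \<in> K \<Longrightarrow> S U \<subseteq> cring A"
    "\<And>U. U \<in> K \<Longrightarrow> pts A - U = zero_set A (S U)" by metis
  have "pts A - \<Union>K = zero_set A (\<Union>U\<in>K. S U)"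
  proof -
    have "pts A - \<Union>K = pts A \<inter> (\<Inter>U\<in>K. pts A - U)" by blast
    also have "\<dots> = pts A \<inter> (\<Inter>U\<in>K. zero_set A (S U))" using S(2) by auto
    also have "\<dots> = zero_set A (\<Union>U\<in>K. S U)" unfolding zero_set_def by blast
    finally show ?thesis .
  qed
  then show "\<exists>S \<subseteq> cring A. pts A - \<Union>K = zero_set A S"
    using S(1) by (intro exI[of _ "\<Union>U\<in>K. S U"]) blast
qed

lemma openin_zariski:
  "affine_variety A \<Longrightarrow>
    openin (zariski A) U \<longleftrightarrow> U \<subseteq> pts A \<and> (\<exists>S \<subseteq> cring A. pts A - U = zero_set A S)"
  unfolding zariski_def by (subst topology_inverse'[OF istopology_zariski]) auto

lemma topspace_zariski:
  assumes "affine_variety A"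
  shows "topspace (zariski A) = pts A"
proof -
  have "pts A - pts A = zero_set A {res (pts A) 1}"
    by (auto simp: zero_set_def res_def)
  then have "openin (zariski A) (pts A)"
    using affine_variety_cring(1)[OF assms] unfolding openin_zariski[OF assms] by blast
  then have "pts A \<subseteq> topspace (zariski A)" by (rule openin_subset)
  moreover have "topspace (zariski A) \<subseteq> pts A"
    using openin_topspace[of "zariski A"] unfolding openin_zariski[OF assms] by (rule conjunct1)
  ultimately show ?thesis by (rule subset_antisym[rotated])
qed

lemma closedin_zariski:
  assumes "affine_variety A"
  shows "closedin (zariski A) C \<longleftrightarrow> (\<exists>S \<subseteq> cring A. C = zero_set A S)"
proof
  assume "closedin (zariski A) C"
  then have C: "C \<subseteq> pts A" "openin (zariski A) (pts A - C)"
    by (auto simp: closedin_def topspace_zariski[OF assms])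
  then show "\<exists>S \<subseteq> cring A. C = zero_set A S"
    unfolding openin_zariski[OF assms] by (metis double_diff subset_refl)
next
  assume "\<exists>S \<subseteq> cring A. C = zero_set A S"
  then obtain S where S: "S \<subseteq> cring A" "C = zero_set A S" by blast
  then have "C \<subseteq> pts A" by (auto simp: zero_set_def)
  with S show "closedin (zariski A) C"
    unfolding closedin_def topspace_zariski[OF assms] openin_zariski[OF assms]
    by (metis Diff_subset double_diff subset_refl)
qed


section \<open>Dimension, tangent spaces and smooth points\<close>

definition irreducible_in :: "'a topology \<Rightarrow> 'a set \<Rightarrow> bool"
  where "irreducible_in T S \<longleftrightarrow> S \<subseteq> topspace T \<and> S \<noteq> {} \<and>
    (\<forall>C D. closedin T C \<and> closedin T D \<and> S \<subseteq> C \<union> D \<longrightarrow> S \<subseteq> C \<or> S \<subseteq> D)"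

definition irreducible_component :: "'a topology \<Rightarrow> 'a set \<Rightarrow> bool"
  where "irreducible_component T S \<longleftrightarrow>
    irreducible_in T S \<and> (\<forall>S'. irreducible_in T S' \<and> S \<subseteq> S' \<longrightarrow> S' = S)"

definition krull_dim :: "'a topology \<Rightarrow> enat"
  where "krull_dim T = Sup {enat n | n.
    \<exists>Z :: nat \<Rightarrow> 'a set. (\<forall>i\<le>n. closedin T (Z i) \<and> irreducible_in T (Z i)) \<and>
      (\<forall>i<n. Z i \<subset> Z (Suc i))}"

definition dim_at :: "'a topology \<Rightarrow> 'a \<Rightarrow> enat"
  where "dim_at T x = Sup {krull_dim (subtopology T C) | C. irreducible_component T C \<and> x \<in> C}"

definition locally_closed_in :: "'a topology \<Rightarrow> 'a set \<Rightarrow> bool"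
  where "locally_closed_in T X \<longleftrightarrow> (\<exists>U C. openin T U \<and> closedin T C \<and> X = U \<inter> C)"

text \<open>The Zariski tangent space at \<open>x\<close>: the derivations of the coordinate ring at \<open>x\<close>,
  extended by zero to all functions so that they form a linear subspace.\<close>

definition tangent :: "('a, 'k::field) variety \<Rightarrow> 'a \<Rightarrow> (('a \<Rightarrow> 'k) \<Rightarrow> 'k) set"
  where "tangent A x = {\<delta>.
    (\<forall>f \<in> cring A. \<forall>g \<in> cring A. \<delta> (f + g) = \<delta> f + \<delta> g) \<and>
    (\<forall>c. \<forall>f \<in> cring A. \<delta> (fscale c f) = c * \<delta> f) \<and>
    (\<forall>f \<in> cring A. \<forall>g \<in> cring A. \<delta> (f * g) = f x * \<delta> g + g x * \<delta> f) \<and>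
    (\<forall>f. f \<notin> cring A \<longrightarrow> \<delta> f = 0)}"

text \<open>A locally closed subset \<open>X\<close> of \<open>A\<close> is open in its closure, which is an affine variety;
  the tangent space of \<open>X\<close> at a point of \<open>X\<close> is that of the closure.\<close>

definition closure_var :: "('a, 'k::field) variety \<Rightarrow> 'a set \<Rightarrow> ('a, 'k) variety"
  where "closure_var A X = closed_subvar A (zariski A closure_of X)"

definition smooth_points :: "('a, 'k::field) variety \<Rightarrow> 'a set \<Rightarrow> 'a set"
  where "smooth_points A X =
    {x \<in> X. enat (fun_vs.dim (tangent (closure_var A X) x)) = dim_at (subtopology (zariski A) X) x}"


section \<open>Ind-varieties\<close>

text \<open>An ind-variety is given by its filtration, here indexed from 0.\<close>

definition ind_variety :: "(nat \<Rightarrow> ('a, 'k::field) variety) \<Rightarrow> bool"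
  where "ind_variety V \<longleftrightarrow>
    (\<forall>k. affine_variety (V k) \<and> closedin (zariski (V (Suc k))) (pts (V k)) \<and>
      V k = closed_subvar (V (Suc k)) (pts (V k)))"

definition ind_set :: "(nat \<Rightarrow> ('a, 'k) variety) \<Rightarrow> 'a set"
  where "ind_set V = (\<Union>k. pts (V k))"

definition ind_topology :: "(nat \<Rightarrow> ('a, 'k::field) variety) \<Rightarrow> 'a topology"
  where "ind_topology V =
    topology (\<lambda>U. U \<subseteq> ind_set V \<and> (\<forall>k. openin (zariski (V k)) (U \<inter> pts (V k))))"

definition ind_morphism ::
  "(nat \<Rightarrow> ('a, 'k::field) variety) \<Rightarrow> (nat \<Rightarrow> ('b, 'k) variety) \<Rightarrow> ('a \<Rightarrow> 'b) \<Rightarrow> bool"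
  where "ind_morphism V W \<phi> \<longleftrightarrow> (\<forall>k. \<exists>l. variety_morphism (V k) (W l) \<phi>)"

definition ind_prod ::
  "(nat \<Rightarrow> ('a, 'k::field) variety) \<Rightarrow> (nat \<Rightarrow> ('b, 'k) variety) \<Rightarrow> nat \<Rightarrow> ('a \<times> 'b, 'k) variety"
  where "ind_prod V W = (\<lambda>k. variety_prod (V k) (W k))"

definition algebraic_in :: "(nat \<Rightarrow> ('a, 'k::field) variety) \<Rightarrow> 'a set \<Rightarrow> bool"
  where "algebraic_in V X \<longleftrightarrow> (\<exists>k. X \<subseteq> pts (V k)) \<and> locally_closed_in (ind_topology V) X"

text \<open>The coordinate ring of an ind-variety is the inverse limit of the coordinate rings of the
  steps of the filtration. Since it surjects onto each of them, the tangent spaces of the steps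
  embed compatibly into its dual (lemmas \<open>inj_on_push_tangent\<close> and
  \<open>push_tangent_compatible\<close> below). Hence the direct limit of these tangent spaces is the
  union of their images there.\<close>

definition ind_cring :: "(nat \<Rightarrow> ('a, 'k::field) variety) \<Rightarrow> ('a \<Rightarrow> 'k) set"
  where "ind_cring V =
    {f. res (ind_set V) f = f \<and> (\<forall>k. res (pts (V k)) f \<in> cring (V k))}"

text \<open>The differential of the inclusion of a subvariety with set of points \<open>S\<close>.\<close>

definition push_tangent ::
  "(nat \<Rightarrow> ('a, 'k::field) variety) \<Rightarrow> 'a set \<Rightarrow> (('a \<Rightarrow> 'k) \<Rightarrow> 'k) \<Rightarrow> (('a \<Rightarrow> 'k) \<Rightarrow> 'k)"
  where "push_tangent V S \<delta> = (\<lambda>f. if f \<in> ind_cring V then \<delta> (res S f) else 0)"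

definition ind_tangent :: "(nat \<Rightarrow> ('a, 'k::field) variety) \<Rightarrow> 'a \<Rightarrow> (('a \<Rightarrow> 'k) \<Rightarrow> 'k) set"
  where "ind_tangent V x =
    (\<Union>k \<in> {k. x \<in> pts (V k)}. push_tangent V (pts (V k)) ` tangent (V k) x)"

text \<open>The tangent space at \<open>x\<close> of a locally closed subset \<open>X\<close> of the \<open>k\<close>-th step, as a subspace
  of the tangent space of the ind-variety.\<close>

definition tangent_sub ::
  "(nat \<Rightarrow> ('a, 'k::field) variety) \<Rightarrow> nat \<Rightarrow> 'a set \<Rightarrow> 'a \<Rightarrow> (('a \<Rightarrow> 'k) \<Rightarrow> 'k) set"
  where "tangent_sub V k X x =
    push_tangent V (pts (closure_var (V k) X)) ` tangent (closure_var (V k) X) x"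

text \<open>In terms of derivations, the differential of \<open>\<phi>\<close> at a point is composition with the
  comorphism of \<open>\<phi>\<close>; the formula does not involve the point.\<close>

definition differential ::
  "(nat \<Rightarrow> ('a, 'k::field) variety) \<Rightarrow> (nat \<Rightarrow> ('b, 'k) variety) \<Rightarrow> ('a \<Rightarrow> 'b) \<Rightarrow>
    (('a \<Rightarrow> 'k) \<Rightarrow> 'k) \<Rightarrow> (('b \<Rightarrow> 'k) \<Rightarrow> 'k)"
  where "differential V W \<phi> \<delta> =
    (\<lambda>g. if g \<in> ind_cring W then \<delta> (res (ind_set V) (g \<circ> \<phi>)) else 0)"


section \<open>Ind-groups\<close>

definition ind_group :: "('a, 'm) monoid_scheme \<Rightarrow> (nat \<Rightarrow> ('a, 'k::field) variety) \<Rightarrow> bool"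
  where "ind_group G V \<longleftrightarrow>
    group G \<and> ind_variety V \<and> carrier G = ind_set V \<and>
    ind_morphism (ind_prod V V) V (\<lambda>(x, y). x \<otimes>\<^bsub>G\<^esub> y) \<and>
    ind_morphism V V (\<lambda>x. inv\<^bsub>G\<^esub> x)"

definition ind_group_hom ::
  "('a, 'm) monoid_scheme \<Rightarrow> (nat \<Rightarrow> ('a, 'k::field) variety) \<Rightarrow>
    ('b, 'n) monoid_scheme \<Rightarrow> (nat \<Rightarrow> ('b, 'k) variety) \<Rightarrow> ('a \<Rightarrow> 'b) \<Rightarrow> bool"
  where "ind_group_hom H V G W \<phi> \<longleftrightarrow> \<phi> \<in> hom H G \<and> ind_morphism V W \<phi>"

definition ind_group_aut ::
  "('a, 'm) monoid_scheme \<Rightarrow> (nat \<Rightarrow> ('a, 'k::field) variety) \<Rightarrow> ('a \<Rightarrow> 'a) \<Rightarrow> bool"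
  where "ind_group_aut G V \<alpha> \<longleftrightarrow>
    \<alpha> \<in> iso G G \<and> ind_morphism V V \<alpha> \<and> ind_morphism V V (inv_into (carrier G) \<alpha>)"

definition Lie :: "('a, 'm) monoid_scheme \<Rightarrow> (nat \<Rightarrow> ('a, 'k::field) variety) \<Rightarrow> (('a \<Rightarrow> 'k) \<Rightarrow> 'k) set"
  where "Lie G V = ind_tangent V \<one>\<^bsub>G\<^esub>"

definition L_space ::
  "('a, 'm) monoid_scheme \<Rightarrow> (nat \<Rightarrow> ('a, 'k::field) variety) \<Rightarrow> (('a \<Rightarrow> 'k) \<Rightarrow> 'k) set"
  where "L_space G V = fun_vs.span (\<Union> {tangent_sub V k X \<one>\<^bsub>G\<^esub> | k X.
    algebraic_in V X \<and> X \<subseteq> pts (V k) \<and> \<one>\<^bsub>G\<^esub> \<in> smooth_points (V k) X})"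


section \<open>Consistency of the conventions\<close>

lemma ind_varietyD:
  assumes "ind_variety V"
  shows "affine_variety (V k)"
    and "closedin (zariski (V (Suc k))) (pts (V k))"
    and "V k = closed_subvar (V (Suc k)) (pts (V k))"
  using assms unfolding ind_variety_def by blast+

lemma openin_ind_topology:
  assumes "ind_variety V"
  shows "openin (ind_topology V) U \<longleftrightarrow>
    U \<subseteq> ind_set V \<and> (\<forall>k. openin (zariski (V k)) (U \<inter> pts (V k)))"
proof -
  have "istopology (\<lambda>U. U \<subseteq> ind_set V \<and> (\<forall>k. openin (zariski (V k)) (U \<inter> pts (V k))))"
    unfolding istopology_def
  proof (intro conjI allI impI)
    fix S T k
    assume "S \<subseteq> ind_set V \<and> (\<forall>k. openin (zariski (V k)) (S \<inter> pts (V k)))"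
      and "T \<subseteq> ind_set V \<and> (\<forall>k. openin (zariski (V k)) (T \<inter> pts (V k)))"
    then have "openin (zariski (V k)) ((S \<inter> pts (V k)) \<inter> (T \<inter> pts (V k)))" by blast
    then show "openin (zariski (V k)) (S \<inter> T \<inter> pts (V k))"
      by (simp add: Int_ac)
  next
    fix K k
    assume "\<forall>U\<in>K. U \<subseteq> ind_set V \<and> (\<forall>k. openin (zariski (V k)) (U \<inter> pts (V k)))"
    then have "openin (zariski (V k)) (\<Union>U\<in>K. U \<inter> pts (V k))" by blast
    moreover have "\<Union>K \<inter> pts (V k) = (\<Union>U\<in>K. U \<inter> pts (V k))" by blast
    ultimately show "openin (zariski (V k)) (\<Union>K \<inter> pts (V k))" by (simp only:)
  qed blast+
  then show ?thesis unfolding ind_topology_def by (subst topology_inverse') auto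
qed

lemma closedin_ind_topology:
  assumes V: "ind_variety V" and C: "C \<subseteq> ind_set V"
  shows "closedin (ind_topology V) C \<longleftrightarrow> (\<forall>k. closedin (zariski (V k)) (C \<inter> pts (V k)))"
proof -
  have top: "topspace (zariski (V k)) = pts (V k)" for k
    using topspace_zariski[OF ind_varietyD(1)[OF V]] .
  have "openin (ind_topology V) (ind_set V)"
    unfolding openin_ind_topology[OF V] using top
    by (metis UN_upper UNIV_I inf.absorb2 ind_set_def openin_topspace subset_refl)
  then have "topspace (ind_topology V) = ind_set V"
    using openin_ind_topology[OF V] by (meson openin_subset openin_topspace subset_antisym)
  moreover have "(ind_set V - C) \<inter> pts (V k) = pts (V k) - C \<inter> pts (V k)" for k
    by (auto simp: ind_set_def)
  ultimately show ?thesis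
    using C by (auto simp: closedin_def openin_ind_topology[OF V] top)
qed

lemma ind_variety_pts_mono:
  assumes V: "ind_variety V" and "k \<le> l"
  shows "pts (V k) \<subseteq> pts (V l)"
  using \<open>k \<le> l\<close>
proof (induction l rule: dec_induct)
  case (step n)
  have "pts (V n) \<subseteq> pts (V (Suc n))"
    using closedin_subset[OF ind_varietyD(2)[OF V]]
    unfolding topspace_zariski[OF ind_varietyD(1)[OF V]] .
  with step.IH show ?case by (rule subset_trans)
qed simp

lemma ind_variety_cring_Suc:
  assumes "ind_variety V"
  shows "cring (V k) = res (pts (V k)) ` cring (V (Suc k))"
proof -
  have "cring (V k) = cring (closed_subvar (V (Suc k)) (pts (V k)))"
    by (rule arg_cong[of _ _ cring]) (rule ind_varietyD(3)[OF assms])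
  also have "\<dots> = res (pts (V k)) ` cring (V (Suc k))"
    by (simp add: closed_subvar_def)
  finally show ?thesis .
qed

lemma ind_variety_cring_mono:
  assumes V: "ind_variety V" and "k \<le> l" and "f \<in> cring (V l)"
  shows "res (pts (V k)) f \<in> cring (V k)"
  using assms(2,3)
proof (induction l arbitrary: f rule: dec_induct)
  case base
  then show ?case
    by (simp add: affine_variety_cring(5)[OF ind_varietyD(1)[OF V]])
next
  case (step l)
  have "res (pts (V l)) f \<in> cring (V l)"
    using step.prems ind_variety_cring_Suc[OF V] by blast
  from step.IH[OF this] show ?case
    using ind_variety_pts_mono[OF V step.hyps(1)] by (simp add: res_res)
qed

lemma ind_cring_surj:
  assumes V: "ind_variety V" and f: "f \<in> cring (V k)"
  obtains g where "g \<in> ind_cring V" "res (pts (V k)) g = f"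
proof -
  have ex: "\<exists>h'. h' \<in> cring (V (Suc (k + n))) \<and> res (pts (V (k + n))) h' = h"
    if "h \<in> cring (V (k + n))" for n h
    using that unfolding ind_variety_cring_Suc[OF V, of "k + n"] by auto
  define N where
    "N n h = (SOME h'. h' \<in> cring (V (Suc (k + n))) \<and> res (pts (V (k + n))) h' = h)" for n h
  have N: "N n h \<in> cring (V (Suc (k + n)))" "res (pts (V (k + n))) (N n h) = h"
    if "h \<in> cring (V (k + n))" for n h
    using someI_ex[OF ex[OF that]] unfolding N_def by blast+
  define F where "F = rec_nat f N"
  have F0: "F 0 = f" and FS: "F (Suc n) = N n (F n)" for n
    by (simp_all add: F_def)
  have F: "F n \<in> cring (V (k + n))" for n
    by (induction n) (use N(1) f in \<open>auto simp: F0 FS\<close>)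
  have comp: "res (pts (V (k + n))) (F m) = F n" if "n \<le> m" for n m
    using that
  proof (induction m rule: dec_induct)
    case base
    then show ?case
      using affine_variety_cring(5)[OF ind_varietyD(1)[OF V] F] .
  next
    case (step m)
    have "res (pts (V (k + n))) (res (pts (V (k + m))) (F (Suc m))) = F n"
      using step.IH N(2)[OF F] by (simp add: FS)
    then show ?case
      using ind_variety_pts_mono[OF V, of "k + n" "k + m"] step.hyps by (simp add: res_res)
  qed
  define g where "g x = (if x \<in> ind_set V then F (LEAST n. x \<in> pts (V (k + n))) x else 0)" for x
  have g: "res (pts (V (k + n))) g = F n" for n
  proof
    fix x
    show "res (pts (V (k + n))) g x = F n x"
    proof (cases "x \<in> pts (V (k + n))")
      case True
      define m where "m = (LEAST n. x \<in> pts (V (k + n)))"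
      have m: "x \<in> pts (V (k + m))" "m \<le> n"
        unfolding m_def using True by (auto intro: LeastI Least_le)
      have "F m x = F n x"
        using fun_cong[OF comp[OF m(2)], of x] m(1) by (simp add: res_def)
      moreover have "x \<in> ind_set V"
        using True unfolding ind_set_def by blast
      ultimately show ?thesis
        using True by (simp add: res_def g_def flip: m_def)
    next
      case False
      then show ?thesis
        using fun_cong[OF comp[of n n], of x] by (simp add: res_def)
    qed
  qed
  have "res (pts (V j)) g \<in> cring (V j)" for j
  proof -
    have "res (pts (V j)) (res (pts (V (k + j))) g) \<in> cring (V j)"
      using ind_variety_cring_mono[OF V, of j "k + j"] F g by simp
    then show ?thesis
      using ind_variety_pts_mono[OF V, of j "k + j"] by (simp add: res_res)
  qed
  then have "g \<in> ind_cring V"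
    by (auto simp: ind_cring_def res_def g_def fun_eq_iff)
  moreover have "res (pts (V k)) g = f"
    using g[of 0] by (simp add: F0)
  ultimately show ?thesis using that by blast
qed

lemma inj_on_push_tangent:
  assumes V: "ind_variety V"
  shows "inj_on (push_tangent V (pts (V k))) (tangent (V k) x)"
proof (rule inj_onI, rule ext)
  fix \<delta> \<epsilon> f
  assume \<delta>: "\<delta> \<in> tangent (V k) x" and \<epsilon>: "\<epsilon> \<in> tangent (V k) x"
    and eq: "push_tangent V (pts (V k)) \<delta> = push_tangent V (pts (V k)) \<epsilon>"
  show "\<delta> f = \<epsilon> f"
  proof (cases "f \<in> cring (V k)")
    case True
    from ind_cring_surj[OF V True] obtain g where
      g: "g \<in> ind_cring V" "res (pts (V k)) g = f" .
    then show ?thesis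
      using fun_cong[OF eq, of g] by (simp add: push_tangent_def)
  next
    case False
    with \<delta> \<epsilon> show ?thesis by (simp add: tangent_def)
  qed
qed

lemma tangentD:
  assumes "\<delta> \<in> tangent A x"
  shows "f \<in> cring A \<Longrightarrow> g \<in> cring A \<Longrightarrow> \<delta> (f + g) = \<delta> f + \<delta> g"
    and "f \<in> cring A \<Longrightarrow> \<delta> (fscale c f) = c * \<delta> f"
    and "f \<in> cring A \<Longrightarrow> g \<in> cring A \<Longrightarrow> \<delta> (f * g) = f x * \<delta> g + g x * \<delta> f"
    and "f \<notin> cring A \<Longrightarrow> \<delta> f = 0"
  using assms unfolding tangent_def by blast+

lemma tangentI:
  assumes "\<And>f g. f \<in> cring A \<Longrightarrow> g \<in> cring A \<Longrightarrow> \<delta> (f + g) = \<delta> f + \<delta> g"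
    and "\<And>c f. f \<in> cring A \<Longrightarrow> \<delta> (fscale c f) = c * \<delta> f"
    and "\<And>f g. f \<in> cring A \<Longrightarrow> g \<in> cring A \<Longrightarrow> \<delta> (f * g) = f x * \<delta> g + g x * \<delta> f"
    and "\<And>f. f \<notin> cring A \<Longrightarrow> \<delta> f = 0"
  shows "\<delta> \<in> tangent A x"
  using assms unfolding tangent_def by blast

lemma tangent_closed_subvar:
  assumes A: "affine_variety A" and C: "x \<in> C"
    and \<delta>: "\<delta> \<in> tangent (closed_subvar A C) x"
  shows "(\<lambda>f. if f \<in> cring A then \<delta> (res C f) else 0) \<in> tangent A x"
proof -
  have mem: "res C f \<in> cring (closed_subvar A C)" if "f \<in> cring A" for f
    using that by (simp add: closed_subvar_def)
  have x: "res C f x = f x" for f :: "'a \<Rightarrow> 'b"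
    using C by (simp add: res_def)
  show ?thesis
    by (rule tangentI)
      (simp_all add: affine_variety_cring(2-4)[OF A] res_add res_mult res_fscale
        tangentD(1-3)[OF \<delta>] mem x)
qed

lemma push_tangent_compatible:
  assumes V: "ind_variety V" and x: "x \<in> pts (V k)" and \<delta>: "\<delta> \<in> tangent (V k) x"
  obtains \<epsilon> where "\<epsilon> \<in> tangent (V (Suc k)) x"
    and "\<And>f. f \<in> cring (V (Suc k)) \<Longrightarrow> \<epsilon> f = \<delta> (res (pts (V k)) f)"
    and "push_tangent V (pts (V (Suc k))) \<epsilon> = push_tangent V (pts (V k)) \<delta>"
proof -
  define \<epsilon> where "\<epsilon> = (\<lambda>f. if f \<in> cring (V (Suc k)) then \<delta> (res (pts (V k)) f) else 0)"
  have \<delta>': "\<delta> \<in> tangent (closed_subvar (V (Suc k)) (pts (V k))) x"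
    by (rule subst[OF ind_varietyD(3)[OF V], of "\<lambda>A. \<delta> \<in> tangent A x"]) (rule \<delta>)
  have "\<epsilon> \<in> tangent (V (Suc k)) x"
    unfolding \<epsilon>_def by (rule tangent_closed_subvar[OF ind_varietyD(1)[OF V] x \<delta>'])
  moreover have "push_tangent V (pts (V (Suc k))) \<epsilon> = push_tangent V (pts (V k)) \<delta>"
    using ind_variety_pts_mono[OF V, of k "Suc k"]
    by (auto simp: push_tangent_def \<epsilon>_def res_res ind_cring_def)
  ultimately show ?thesis using that by (simp add: \<epsilon>_def)
qed

lemma push_tangent_mono:
  assumes V: "ind_variety V" and x: "x \<in> pts (V k)" and "k \<le> l"
  shows "push_tangent V (pts (V k)) ` tangent (V k) x
    \<subseteq> push_tangent V (pts (V l)) ` tangent (V l) x"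
  using \<open>k \<le> l\<close>
proof (induction l rule: dec_induct)
  case (step l)
  have xl: "x \<in> pts (V l)" using ind_variety_pts_mono[OF V step.hyps(1)] x by blast
  have "push_tangent V (pts (V l)) ` tangent (V l) x
    \<subseteq> push_tangent V (pts (V (Suc l))) ` tangent (V (Suc l)) x"
  proof (rule image_subsetI)
    fix \<delta> assume "\<delta> \<in> tangent (V l) x"
    from push_tangent_compatible[OF V xl this] obtain \<epsilon>
      where "\<epsilon> \<in> tangent (V (Suc l)) x"
        "push_tangent V (pts (V (Suc l))) \<epsilon> = push_tangent V (pts (V l)) \<delta>" by blast
    then show "push_tangent V (pts (V l)) \<delta>
      \<in> push_tangent V (pts (V (Suc l))) ` tangent (V (Suc l)) x"
      by (metis imageI)
  qed
  with step.IH show ?case by blast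
qed simp

lemma subspace_tangent:
  assumes "affine_variety A"
  shows "fun_vs.subspace (tangent A x)"
proof (rule fun_vs.subspaceI)
  show "0 \<in> tangent A x"
    by (rule tangentI) simp_all
next
  fix \<delta> \<epsilon> assume \<delta>: "\<delta> \<in> tangent A x" and \<epsilon>: "\<epsilon> \<in> tangent A x"
  show "\<delta> + \<epsilon> \<in> tangent A x"
    by (rule tangentI) (simp_all add: tangentD[OF \<delta>] tangentD[OF \<epsilon>] distrib_left)
next
  fix c \<delta> assume \<delta>: "\<delta> \<in> tangent A x"
  show "fscale c \<delta> \<in> tangent A x"
    by (rule tangentI)
      (simp_all add: tangentD[OF \<delta>] fscale_def[of _ \<delta>] distrib_left mult.left_commute)
qed

lemma subspace_ind_tangent:
  assumes V: "ind_variety V" and x: "x \<in> ind_set V"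
  shows "fun_vs.subspace (ind_tangent V x)"
proof -
  have push: "push_tangent V S 0 = 0"
    "push_tangent V S (\<delta> + \<epsilon>) = push_tangent V S \<delta> + push_tangent V S \<epsilon>"
    "push_tangent V S (fscale c \<delta>) = fscale c (push_tangent V S \<delta>)" for S \<delta> \<epsilon> c
    by (auto simp: push_tangent_def fscale_def fun_eq_iff)
  have sub: "fun_vs.subspace (tangent (V k) x)" for k
    using subspace_tangent[OF ind_varietyD(1)[OF V]] .
  show ?thesis
  proof (rule fun_vs.subspaceI)
    from x obtain k where k: "x \<in> pts (V k)" by (auto simp: ind_set_def)
    have "push_tangent V (pts (V k)) 0 \<in> push_tangent V (pts (V k)) ` tangent (V k) x"
      using fun_vs.subspace_0[OF sub[of k]] by (rule imageI)
    then show "0 \<in> ind_tangent V x"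
      using k unfolding push(1) ind_tangent_def by blast
  next
    fix a b assume "a \<in> ind_tangent V x" "b \<in> ind_tangent V x"
    then obtain k l where k: "x \<in> pts (V k)" "a \<in> push_tangent V (pts (V k)) ` tangent (V k) x"
      and l: "x \<in> pts (V l)" "b \<in> push_tangent V (pts (V l)) ` tangent (V l) x"
      by (auto simp: ind_tangent_def)
    define m where "m = max k l"
    have m: "x \<in> pts (V m)" using k(1) l(1) by (simp add: m_def max_def)
    have "a \<in> push_tangent V (pts (V m)) ` tangent (V m) x"
      "b \<in> push_tangent V (pts (V m)) ` tangent (V m) x"
      using push_tangent_mono[OF V k(1), of m] push_tangent_mono[OF V l(1), of m] k(2) l(2)
      by (auto simp: m_def)
    then obtain \<delta> \<epsilon> where d: "\<delta> \<in> tangent (V m) x" "\<epsilon> \<in> tangent (V m) x"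
      "a = push_tangent V (pts (V m)) \<delta>" "b = push_tangent V (pts (V m)) \<epsilon>" by auto
    then have "a + b = push_tangent V (pts (V m)) (\<delta> + \<epsilon>)" by (simp add: push)
    moreover have "\<delta> + \<epsilon> \<in> tangent (V m) x" using fun_vs.subspace_add[OF sub] d by blast
    ultimately show "a + b \<in> ind_tangent V x" using m by (auto simp: ind_tangent_def)
  next
    fix c a assume "a \<in> ind_tangent V x"
    then obtain k \<delta> where k: "x \<in> pts (V k)" "\<delta> \<in> tangent (V k) x"
      "a = push_tangent V (pts (V k)) \<delta>"
      by (auto simp: ind_tangent_def)
    then have "fscale c a = push_tangent V (pts (V k)) (fscale c \<delta>)" by (simp add: push)
    moreover have "fscale c \<delta> \<in> tangent (V k) x"
      using fun_vs.subspace_scale[OF sub] k by blast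
    ultimately show "fscale c a \<in> ind_tangent V x" using k by (auto simp: ind_tangent_def)
  qed
qed

lemma tangent_sub_subset:
  assumes V: "ind_variety V" and X: "X \<subseteq> pts (V k)" "x \<in> X"
  shows "tangent_sub V k X x \<subseteq> ind_tangent V x"
proof
  fix a assume "a \<in> tangent_sub V k X x"
  let ?C = "zariski (V k) closure_of X"
  from \<open>a \<in> _\<close> obtain \<delta> where \<delta>: "\<delta> \<in> tangent (closed_subvar (V k) ?C) x"
    and a: "a = push_tangent V ?C \<delta>"
    by (auto simp: tangent_sub_def closure_var_def closed_subvar_def)
  have A: "affine_variety (V k)" using ind_varietyD(1)[OF V] .
  have C: "x \<in> ?C" "?C \<subseteq> pts (V k)"
    using closure_of_subset[of X "zariski (V k)"] closure_of_subset_topspace[of "zariski (V k)" X] X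
    unfolding topspace_zariski[OF A] by auto
  let ?\<epsilon> = "\<lambda>f. if f \<in> cring (V k) then \<delta> (res ?C f) else 0"
  have "a = push_tangent V (pts (V k)) ?\<epsilon>"
    using C(2) unfolding a by (auto simp: push_tangent_def ind_cring_def res_res)
  moreover have "?\<epsilon> \<in> tangent (V k) x"
    using tangent_closed_subvar[OF A C(1) \<delta>] .
  ultimately show "a \<in> ind_tangent V x"
    using X by (auto simp: ind_tangent_def)
qed

lemma L_space_subset_Lie:
  assumes "ind_group G V"
  shows "L_space G V \<subseteq> Lie G V"
proof -
  have V: "ind_variety V" and "group G" and G: "carrier G = ind_set V"
    using assms by (auto simp: ind_group_def)
  then have "\<one>\<^bsub>G\<^esub> \<in> ind_set V"
    using group.is_monoid monoid.one_closed by metis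
  then have "fun_vs.subspace (Lie G V)"
    unfolding Lie_def by (rule subspace_ind_tangent[OF V])
  moreover have "\<Union> {tangent_sub V k X \<one>\<^bsub>G\<^esub> | k X.
    algebraic_in V X \<and> X \<subseteq> pts (V k) \<and> \<one>\<^bsub>G\<^esub> \<in> smooth_points (V k) X} \<subseteq> Lie G V"
    using tangent_sub_subset[OF V] unfolding Lie_def smooth_points_def by blast
  ultimately show ?thesis
    unfolding L_space_def by (intro fun_vs.span_minimal)
qed

end

theory Submission imports Defs
begin

text \<open>The space \<open>L\<close> is spanned by tangent spaces at the identity of algebraic sets that are smooth
  there. A smooth point has an irreducible closed model with the same tangent vectors, so \<open>L\<close> is spanned
  by the tangent spaces \<open>T\<^sub>e C\<close> of irreducible closed sets \<open>C\<close> with \<open>dim T\<^sub>e C = dim C\<close>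
  (\<open>smooth_point_irreducible_model\<close>, \<open>L_space_minimal\<close>). The obstacle in both parts is that a
  homomorphism \<open>\<phi>\<close> need not behave well at the identity itself: the closure of \<open>\<phi> C\<close> may be singular
  there, and \<open>\<phi>\<close> need not be smooth there. At a generic point \<open>x\<close> of \<open>C\<close> it does behave well, and
  translating by \<open>x\<inverse>\<close> produces statements about the differential at the identity.

  The way back from generic points to the identity is a closedness argument
  (\<open>differential_at_identity\<close>). Suppose that for \<open>x\<close> in a dense subset of \<open>C\<close> the translate of
  \<open>d\<phi> (T\<^sub>x C)\<close> to the identity lies in a linear subspace \<open>S\<close> of the tangent space of the target. If
  \<open>d\<phi> (T\<^sub>e C)\<close> were not contained in \<open>S\<close>, a linear functional vanishing on \<open>S\<close> would detect this. The
  composition of that functional with the translated differentials is a linear condition on the tangent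
  vectors of \<open>C\<close> whose coefficients are regular functions on \<open>C\<close>, because
  \<open>(x, y) \<mapsto> \<phi> (x\<inverse> y)\<close> is a morphism. It holds over a dense set, hence at
  \<open>e\<close>, where the dimension of the tangent space is minimal (\<open>linear_condition_extends\<close>).

  Part (1) is the case where \<open>S\<close> is \<open>L\<close> of the target. A generic point of \<open>C\<close> maps to a smooth point of
  the irreducible closure of \<open>\<phi> C\<close>, and the translate of the tangent space at a smooth point lies in
  \<open>L\<close> (\<open>translated_tangent_in_L_space\<close>). For an automorphism the inclusion applies to the inverse too.

  Part (2) uses the same argument for the identity map of the target, with \<open>S = d\<phi> L\<close> and \<open>C\<close> in the
  target. The preimages of \<open>C\<close> in the steps of the filtration are countably many varieties whose images
  cover \<open>C\<close>. An irreducible variety over an uncountable field is not a countable union of proper closed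
  subsets, so one of these preimages contains an irreducible closed \<open>X\<close> that dominates \<open>C\<close>
  (\<open>irreducible_subset_dominating\<close>). In characteristic zero there are points \<open>z\<close> of \<open>X\<close> that are smooth
  on \<open>X\<close> and at which the differential of \<open>X \<rightarrow> C\<close> is onto, and their images are dense in \<open>C\<close>
  (\<open>generic_smoothness\<close>). There the translate of \<open>T C\<close> is the image of the translate of \<open>T\<^sub>z X\<close>, which
  lies in \<open>L\<close> of the source.

  The algebraic geometry needed for this rests on one extension theorem (\<open>extend_points\<close>): a homomorphism
  to the field, together with its tangent vectors, extends along a finitely generated extension of a ring
  modulo a prime ideal, as soon as it does not vanish at one suitable element. Applied to the subring
  generated by algebraically independent functions, it gives points with prescribed values of these
  functions and tangent vectors with prescribed derivatives (\<open>lift_point_and_tangents\<close>). From this follow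
  the Nullstellensatz in the form needed, the equality of Krull dimension and transcendence degree, the
  equality of the latter with the generic dimension of the tangent space, and generic smoothness.\<close>

section \<open>Extending points and tangent vectors along a finitely generated extension\<close>

definition subring_set :: "'r::comm_ring_1 set \<Rightarrow> bool"
  where "subring_set B \<longleftrightarrow> 1 \<in> B \<and> (\<forall>a\<in>B. \<forall>b\<in>B. a - b \<in> B \<and> a * b \<in> B)"

text \<open>Rings of functions on a subset are not types, so that ideals are taken relative to a carrier \<open>R\<close>
  inside an ambient ring. The unit of the ring of functions on a subset differs from the unit of the ambient
  ring, hence properness is stated as \<open>P \<subset> R\<close>.\<close>

definition prime_ideal_in :: "'r::comm_ring_1 set \<Rightarrow> 'r set \<Rightarrow> bool"
  where "prime_ideal_in R P \<longleftrightarrow> P \<subset> R \<and> 0 \<in> P \<and> (\<forall>a\<in>P. \<forall>b\<in>P. a - b \<in> P) \<and>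
    (\<forall>a\<in>R. \<forall>b\<in>P. a * b \<in> P) \<and> (\<forall>a\<in>R. \<forall>b\<in>R. a * b \<in> P \<longrightarrow> a \<in> P \<or> b \<in> P)"

definition coeffs_in :: "'r::comm_ring_1 set \<Rightarrow> 'r poly \<Rightarrow> bool"
  where "coeffs_in B p \<longleftrightarrow> (\<forall>i. coeff p i \<in> B)"

definition adjoin :: "'r::comm_ring_1 set \<Rightarrow> 'r \<Rightarrow> 'r set"
  where "adjoin B x = {poly p x | p. coeffs_in B p}"

lemma subring_setD:
  assumes "subring_set B"
  shows "1 \<in> B" "0 \<in> B" "a \<in> B \<Longrightarrow> b \<in> B \<Longrightarrow> a - b \<in> B" "a \<in> B \<Longrightarrow> b \<in> B \<Longrightarrow> a * b \<in> B"
    "a \<in> B \<Longrightarrow> - a \<in> B" "a \<in> B \<Longrightarrow> b \<in> B \<Longrightarrow> a + b \<in> B" "a \<in> B \<Longrightarrow> a ^ n \<in> B"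
    "(\<And>i. i \<in> I \<Longrightarrow> f i \<in> B) \<Longrightarrow> sum f I \<in> B" "of_nat n \<in> B"
proof -
  show 1: "1 \<in> B" and d: "\<And>a b. a \<in> B \<Longrightarrow> b \<in> B \<Longrightarrow> a - b \<in> B"
    and m: "\<And>a b. a \<in> B \<Longrightarrow> b \<in> B \<Longrightarrow> a * b \<in> B"
    using assms by (auto simp: subring_set_def)
  show 0: "0 \<in> B" using d[OF 1 1] by simp
  show n: "- a \<in> B" if "a \<in> B" for a using d[OF 0 that] by simp
  show a: "a + b \<in> B" if "a \<in> B" "b \<in> B" for a b using d[OF that(1) n[OF that(2)]] by simp
  show "a ^ n \<in> B" if "a \<in> B" by (induction n) (use 1 m that in auto)
  show "sum f I \<in> B" if "\<And>i. i \<in> I \<Longrightarrow> f i \<in> B"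
    using that by (induction I rule: infinite_finite_induct) (use 0 a in auto)
  show "of_nat n \<in> B" by (induction n) (use 0 1 a in auto)
qed

lemma prime_ideal_inD:
  assumes "prime_ideal_in R P"
  shows "P \<subseteq> R" "P \<noteq> R" "0 \<in> P" "a \<in> P \<Longrightarrow> b \<in> P \<Longrightarrow> a - b \<in> P" "a \<in> R \<Longrightarrow> b \<in> P \<Longrightarrow> a * b \<in> P"
    "a \<in> R \<Longrightarrow> b \<in> R \<Longrightarrow> a * b \<in> P \<Longrightarrow> a \<in> P \<or> b \<in> P"
    "a \<in> P \<Longrightarrow> - a \<in> P" "a \<in> P \<Longrightarrow> b \<in> P \<Longrightarrow> a + b \<in> P" "a \<in> P \<Longrightarrow> b \<in> R \<Longrightarrow> a * b \<in> P"
    "(\<And>i. i \<in> I \<Longrightarrow> f i \<in> P) \<Longrightarrow> sum f I \<in> P"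
proof -
  show "P \<subseteq> R" "P \<noteq> R" and 0: "0 \<in> P" and d: "\<And>a b. a \<in> P \<Longrightarrow> b \<in> P \<Longrightarrow> a - b \<in> P"
    and m: "\<And>a b. a \<in> R \<Longrightarrow> b \<in> P \<Longrightarrow> a * b \<in> P"
    and "\<And>a b. a \<in> R \<Longrightarrow> b \<in> R \<Longrightarrow> a * b \<in> P \<Longrightarrow> a \<in> P \<or> b \<in> P"
    using assms unfolding prime_ideal_in_def by blast+
  show n: "- a \<in> P" if "a \<in> P" for a using d[OF 0 that] by simp
  show a: "a + b \<in> P" if "a \<in> P" "b \<in> P" for a b using d[OF that(1) n[OF that(2)]] by simp
  show "a * b \<in> P" if "a \<in> P" "b \<in> R" for a b using m[OF that(2,1)] by (simp add: mult.commute)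
  show "sum f I \<in> P" if "\<And>i. i \<in> I \<Longrightarrow> f i \<in> P"
    using that by (induction I rule: infinite_finite_induct) (use 0 a in auto)
qed

lemma coeffs_in_ops:
  assumes B: "subring_set B" and p: "coeffs_in B p" and q: "coeffs_in B q"
  shows "coeffs_in B (p + q)" "coeffs_in B (p - q)" "coeffs_in B (p * q)" "coeffs_in B (- p)"
  using p q by (auto simp: coeffs_in_def coeff_mult intro!: subring_setD[OF B])

lemma coeffs_in_smult: "subring_set B \<Longrightarrow> a \<in> B \<Longrightarrow> coeffs_in B p \<Longrightarrow> coeffs_in B (smult a p)"
  by (auto simp: coeffs_in_def intro!: subring_setD)

lemma coeffs_in_monom: "subring_set B \<Longrightarrow> a \<in> B \<Longrightarrow> coeffs_in B (monom a n)"
  by (auto simp: coeffs_in_def intro: subring_setD)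

lemma coeffs_in_const: "subring_set B \<Longrightarrow> a \<in> B \<Longrightarrow> coeffs_in B [:a:]"
  using coeffs_in_monom[of B a 0] by (simp add: monom_0)

text \<open>The constant \<open>pderiv\<close> demands that the coefficients have no zero divisors, which fails in rings
  of functions.\<close>

definition formal_deriv :: "'r::comm_ring_1 poly \<Rightarrow> 'r poly"
  where "formal_deriv p = (\<Sum>i\<le>degree p. monom (of_nat (Suc i) * coeff p (Suc i)) i)"

lemma coeff_formal_deriv: "coeff (formal_deriv p) i = of_nat (Suc i) * coeff p (Suc i)"
  by (auto simp: formal_deriv_def coeff_sum coeff_eq_0)

lemma coeffs_in_formal_deriv:
  "subring_set B \<Longrightarrow> coeffs_in B p \<Longrightarrow> coeffs_in B (formal_deriv p)"
  by (auto simp: coeffs_in_def coeff_formal_deriv simp del: of_nat_Suc intro!: subring_setD)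

lemma poly_coeffs_in:
  assumes "subring_set B" "coeffs_in B p" "x \<in> B"
  shows "poly p x \<in> B"
  unfolding poly_altdef using assms by (auto simp: coeffs_in_def intro!: subring_setD)

lemma adjoin_superset:
  assumes "subring_set B" shows "B \<subseteq> adjoin B x" "x \<in> adjoin B x"
proof -
  show "B \<subseteq> adjoin B x"
    unfolding adjoin_def using coeffs_in_const[OF assms] by (force intro: exI[of _ "[:_:]"])
  show "x \<in> adjoin B x"
    unfolding adjoin_def using coeffs_in_monom[OF assms subring_setD(1)[OF assms], of 1]
    by (auto intro!: exI[of _ "monom 1 1"] simp: poly_monom)
qed

lemma subring_set_adjoin:
  assumes B: "subring_set B" shows "subring_set (adjoin B x)"
  unfolding subring_set_def
proof (intro conjI ballI)
  show "1 \<in> adjoin B x" using adjoin_superset(1)[OF B] subring_setD(1)[OF B] by blast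
next
  fix a b assume "a \<in> adjoin B x" "b \<in> adjoin B x"
  then obtain p q where "a = poly p x" "b = poly q x" "coeffs_in B p" "coeffs_in B q"
    by (auto simp: adjoin_def)
  then show "a - b \<in> adjoin B x" "a * b \<in> adjoin B x"
    using coeffs_in_ops[OF B, of p q]
    by (auto simp: adjoin_def intro: exI[of _ "p - q"] exI[of _ "p * q"])
qed

lemma adjoin_subset:
  assumes "subring_set A" "B \<subseteq> A" "x \<in> A"
  shows "adjoin B x \<subseteq> A"
  using assms by (auto simp: adjoin_def coeffs_in_def intro!: poly_coeffs_in[unfolded coeffs_in_def])

text \<open>Multiplying by powers of the leading coefficient replaces division by it. The bound on the
  quotient serves comparisons with a minimal degree.\<close>

lemma pseudo_division:
  assumes B: "subring_set B" and g: "coeffs_in B g" "\<And>i. i > m \<Longrightarrow> coeff g i = 0"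
    and f: "coeffs_in B f" "\<And>i. i \<ge> n \<Longrightarrow> coeff f i = 0"
  shows "\<exists>N h r. smult (coeff g m ^ N) f = g * h + r \<and> coeffs_in B h \<and> coeffs_in B r \<and>
    (\<forall>i\<ge>m. coeff r i = 0) \<and> (\<forall>i. i + m \<ge> n \<longrightarrow> coeff h i = 0)"
  using f
proof (induction n arbitrary: f)
  case 0
  then have "f = 0" by (simp add: poly_eq_iff)
  then show ?case
    using subring_setD(2)[OF B] by (intro exI[of _ 0]) (simp add: coeffs_in_def)
next
  case (Suc n)
  let ?a = "coeff g m"
  show ?case
  proof (cases "n < m")
    case True
    then show ?thesis
      using Suc.prems subring_setD(2)[OF B]
      by (intro exI[of _ 0] exI[of _ f]) (simp add: coeffs_in_def)
  next
    case False
    define t where "t = monom (coeff f n) (n - m)"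
    define f' where "f' = smult ?a f - t * g"
    have a: "?a \<in> B" and t: "coeffs_in B t"
      using g Suc.prems(1) B by (auto simp: coeffs_in_def t_def coeffs_in_monom intro: subring_setD)
    have "coeffs_in B f'"
      unfolding f'_def by (intro coeffs_in_ops coeffs_in_smult B a t g Suc.prems)
    moreover have "coeff f' i = 0" if "i \<ge> n" for i
    proof (cases "i = n")
      case True
      then show ?thesis using False by (simp add: f'_def t_def coeff_monom_mult)
    next
      case F: False
      then have "coeff g (i - (n - m)) = 0" using that False by (intro g(2)) simp
      then show ?thesis using F that Suc.prems(2)[of i] by (simp add: f'_def t_def coeff_monom_mult)
    qed
    ultimately obtain N h r where *: "smult (?a ^ N) f' = g * h + r" "coeffs_in B h" "coeffs_in B r"
      "\<forall>i\<ge>m. coeff r i = 0" "\<forall>i. i + m \<ge> n \<longrightarrow> coeff h i = 0"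
      using Suc.IH by blast
    have "smult (?a ^ Suc N) f = smult (?a ^ N) f' + smult (?a ^ N) (t * g)"
      by (simp add: f'_def algebra_simps smult_diff_right mult.commute)
    also have "\<dots> = g * (h + smult (?a ^ N) t) + r"
      by (simp add: *(1) algebra_simps)
    finally have "smult (?a ^ Suc N) f = g * (h + smult (?a ^ N) t) + r" .
    moreover have "coeffs_in B (h + smult (?a ^ N) t)"
      by (intro coeffs_in_ops coeffs_in_smult B * t subring_setD a)
    moreover have "coeff (h + smult (?a ^ N) t) i = 0" if "i + m \<ge> Suc n" for i
      using that *(5) False by (auto simp: t_def)
    ultimately show ?thesis using *(3,4) by blast
  qed
qed

subsection \<open>Points and tangent vectors of a subring modulo a prime ideal\<close>

text \<open>A homomorphism from \<open>B\<close> modulo \<open>P\<close> to a field: a point, in the language of coordinate rings.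
  The ideal may live in a larger ring than \<open>B\<close>, and only its trace on \<open>B\<close> matters.\<close>

definition pt_on :: "'r::comm_ring_1 set \<Rightarrow> 'r set \<Rightarrow> ('r \<Rightarrow> 'k::field) \<Rightarrow> bool"
  where "pt_on B P \<psi> \<longleftrightarrow> (\<forall>a\<in>B. \<forall>b\<in>B. \<psi> (a + b) = \<psi> a + \<psi> b \<and> \<psi> (a * b) = \<psi> a * \<psi> b) \<and>
    \<psi> 1 = 1 \<and> (\<forall>a\<in>B \<inter> P. \<psi> a = 0)"

definition tangent_on :: "'r::comm_ring_1 set \<Rightarrow> 'r set \<Rightarrow> ('r \<Rightarrow> 'k::field) \<Rightarrow> ('r \<Rightarrow> 'k) \<Rightarrow> bool"
  where "tangent_on B P \<psi> \<delta> \<longleftrightarrow>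
    (\<forall>a\<in>B. \<forall>b\<in>B. \<delta> (a + b) = \<delta> a + \<delta> b \<and> \<delta> (a * b) = \<psi> a * \<delta> b + \<psi> b * \<delta> a) \<and>
    (\<forall>a\<in>B \<inter> P. \<delta> a = 0)"

lemma additive_on_simps:
  fixes f :: "'r::comm_ring_1 \<Rightarrow> 'k::field"
  assumes B: "subring_set B" and f: "\<And>a b. a \<in> B \<Longrightarrow> b \<in> B \<Longrightarrow> f (a + b) = f a + f b"
  shows "f 0 = 0" "a \<in> B \<Longrightarrow> b \<in> B \<Longrightarrow> f (a - b) = f a - f b"
    "(\<And>i. i \<in> I \<Longrightarrow> g i \<in> B) \<Longrightarrow> f (sum g I) = (\<Sum>i\<in>I. f (g i))"
    "coeffs_in B p \<Longrightarrow> coeffs_in B q \<Longrightarrow> map_poly f (p + q) = map_poly f p + map_poly f q"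
    "coeffs_in B p \<Longrightarrow> coeffs_in B q \<Longrightarrow> map_poly f (p - q) = map_poly f p - map_poly f q"
proof -
  have "f 0 = f 0 + f 0" using f[of 0 0] subring_setD(2)[OF B] by (simp only: add_0)
  then show 0: "f 0 = 0" by (simp only: add_cancel_right_right)
  show d: "f (a - b) = f a - f b" if "a \<in> B" "b \<in> B" for a b
    using f[of "a - b" b] that subring_setD(3)[OF B] by (simp add: algebra_simps)
  show "f (sum g I) = (\<Sum>i\<in>I. f (g i))" if "\<And>i. i \<in> I \<Longrightarrow> g i \<in> B"
    using that by (induction I rule: infinite_finite_induct) (auto simp: 0 f subring_setD[OF B])
  show "map_poly f (p + q) = map_poly f p + map_poly f q" if "coeffs_in B p" "coeffs_in B q"
    using that by (auto simp: poly_eq_iff coeff_map_poly 0 f coeffs_in_def)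
  show "map_poly f (p - q) = map_poly f p - map_poly f q" if "coeffs_in B p" "coeffs_in B q"
    using that by (auto simp: poly_eq_iff coeff_map_poly 0 d coeffs_in_def)
qed

lemma pt_onD:
  assumes "pt_on B P \<psi>"
  shows "a \<in> B \<Longrightarrow> b \<in> B \<Longrightarrow> \<psi> (a + b) = \<psi> a + \<psi> b" "a \<in> B \<Longrightarrow> b \<in> B \<Longrightarrow> \<psi> (a * b) = \<psi> a * \<psi> b"
    "\<psi> 1 = 1" "a \<in> B \<Longrightarrow> a \<in> P \<Longrightarrow> \<psi> a = 0"
  using assms by (auto simp: pt_on_def)

lemma tangent_onD:
  assumes "tangent_on B P \<psi> \<delta>"
  shows "a \<in> B \<Longrightarrow> b \<in> B \<Longrightarrow> \<delta> (a + b) = \<delta> a + \<delta> b"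
    "a \<in> B \<Longrightarrow> b \<in> B \<Longrightarrow> \<delta> (a * b) = \<psi> a * \<delta> b + \<psi> b * \<delta> a"
    "a \<in> B \<Longrightarrow> a \<in> P \<Longrightarrow> \<delta> a = 0"
  using assms by (auto simp: tangent_on_def)

lemma map_poly_pt_mult:
  assumes B: "subring_set B" and \<psi>: "pt_on B P \<psi>" and p: "coeffs_in B p" and q: "coeffs_in B q"
  shows "map_poly \<psi> (p * q) = map_poly \<psi> p * map_poly \<psi> q"
proof -
  note ad = additive_on_simps[OF B pt_onD(1)[OF \<psi>]]
  show ?thesis
    using p q by (auto simp: poly_eq_iff coeff_map_poly ad(1) coeff_mult ad(3) coeffs_in_def
      subring_setD[OF B] pt_onD(2)[OF \<psi>])
qed

lemma map_poly_tangent_mult: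
  assumes B: "subring_set B" and \<psi>: "pt_on B P \<psi>" and \<delta>: "tangent_on B P \<psi> \<delta>"
    and p: "coeffs_in B p" and q: "coeffs_in B q"
  shows "map_poly \<delta> (p * q) = map_poly \<psi> p * map_poly \<delta> q + map_poly \<psi> q * map_poly \<delta> p"
proof -
  note ad = additive_on_simps[OF B pt_onD(1)[OF \<psi>]]
  note ad' = additive_on_simps[OF B tangent_onD(1)[OF \<delta>]]
  have "coeff (map_poly \<delta> (p * q)) n =
    coeff (map_poly \<psi> p * map_poly \<delta> q + map_poly \<delta> p * map_poly \<psi> q) n" for n
    using p q by (simp add: coeff_map_poly ad(1) ad'(1) coeff_mult ad'(3) coeffs_in_def
      subring_setD[OF B] tangent_onD(2)[OF \<delta>] sum.distrib mult.commute[of "\<psi> (coeff q _)"])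
  then show ?thesis by (simp add: poly_eq_iff mult.commute)
qed

lemma poly_adjoin_lift:
  fixes E :: "'r::comm_ring_1 poly \<Rightarrow> 'k::field"
  assumes B: "subring_set B"
    and add: "\<And>p q. coeffs_in B p \<Longrightarrow> coeffs_in B q \<Longrightarrow> E (p + q) = E p + E q"
    and P: "prime_ideal_in A P" and wd: "\<And>p. coeffs_in B p \<Longrightarrow> poly p x \<in> P \<Longrightarrow> E p = 0"
  obtains F where "\<And>p. coeffs_in B p \<Longrightarrow> F (poly p x) = E p"
proof
  fix p assume p: "coeffs_in B p"
  define q where "q = (SOME q. coeffs_in B q \<and> poly q x = poly p x)"
  have q: "coeffs_in B q \<and> poly q x = poly p x"
    unfolding q_def by (rule someI[of _ p]) (use p in simp)
  have "E (p - q) = 0"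
    by (rule wd) (use p q coeffs_in_ops[OF B] prime_ideal_inD(3)[OF P] in auto)
  moreover have "E p = E (p - q) + E q"
    using add[of "p - q" q] p q coeffs_in_ops[OF B] by simp
  ultimately show "E (SOME q. coeffs_in B q \<and> poly q x = poly p x) = E p"
    by (simp add: q_def)
qed

text \<open>A point of \<open>B[x]\<close> above \<open>\<psi>\<close> is the choice of a value \<open>\<xi>\<close> for \<open>x\<close> that satisfies the
  relations of \<open>x\<close> specialised by \<open>\<psi>\<close>. A tangent vector above \<open>\<delta>\<close> is the choice of a derivative
  \<open>\<eta>\<close> of \<open>x\<close> that satisfies the differentiated relations.\<close>

lemma extend_from_root:
  fixes \<psi> :: "'r::comm_ring_1 \<Rightarrow> 'k::field"
  assumes B: "subring_set B" and P: "prime_ideal_in A P" and \<psi>: "pt_on B P \<psi>"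
    and wd: "\<And>p. coeffs_in B p \<Longrightarrow> poly p x \<in> P \<Longrightarrow> poly (map_poly \<psi> p) \<xi> = 0"
    and wd': "\<And>\<delta>. tangent_on B P \<psi> \<delta> \<Longrightarrow> \<exists>\<eta>. \<forall>p. coeffs_in B p \<and> poly p x \<in> P \<longrightarrow>
      poly (map_poly \<delta> p) \<xi> + \<eta> * poly (pderiv (map_poly \<psi> p)) \<xi> = 0"
  shows "\<exists>\<psi>'. pt_on (adjoin B x) P \<psi>' \<and> (\<forall>b\<in>B. \<psi>' b = \<psi> b) \<and>
    (\<forall>p. coeffs_in B p \<longrightarrow> \<psi>' (poly p x) = poly (map_poly \<psi> p) \<xi>) \<and>
    (\<forall>\<delta>. tangent_on B P \<psi> \<delta> \<longrightarrow> (\<exists>\<delta>'. tangent_on (adjoin B x) P \<psi>' \<delta>' \<and> (\<forall>b\<in>B. \<delta>' b = \<delta> b)))"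
proof -
  note ad = additive_on_simps[OF B pt_onD(1)[OF \<psi>]]
  have "\<And>p q. coeffs_in B p \<Longrightarrow> coeffs_in B q \<Longrightarrow>
      poly (map_poly \<psi> (p + q)) \<xi> = poly (map_poly \<psi> p) \<xi> + poly (map_poly \<psi> q) \<xi>"
    by (simp add: ad)
  then obtain \<psi>' where \<psi>': "\<And>p. coeffs_in B p \<Longrightarrow> \<psi>' (poly p x) = poly (map_poly \<psi> p) \<xi>"
    using poly_adjoin_lift[OF B _ P, of "\<lambda>p. poly (map_poly \<psi> p) \<xi>" x] wd by blast
  have c: "coeffs_in B [:b:]" if "b \<in> B" for b
    using that by (rule coeffs_in_const[OF B])
  have \<psi>'B: "\<psi>' b = \<psi> b" if "b \<in> B" for b
    using \<psi>'[OF c[OF that]] by (simp add: map_poly_pCons ad)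
  have pt: "pt_on (adjoin B x) P \<psi>'"
    unfolding pt_on_def
  proof (intro conjI ballI)
    fix a b assume "a \<in> adjoin B x" "b \<in> adjoin B x"
    then obtain p q where "a = poly p x" "b = poly q x" "coeffs_in B p" "coeffs_in B q"
      by (auto simp: adjoin_def)
    then show "\<psi>' (a + b) = \<psi>' a + \<psi>' b" "\<psi>' (a * b) = \<psi>' a * \<psi>' b"
      using \<psi>'[of p] \<psi>'[of q] \<psi>'[of "p + q"] \<psi>'[of "p * q"] coeffs_in_ops[OF B, of p q]
      by (simp_all add: ad map_poly_pt_mult[OF B \<psi>])
  next
    show "\<psi>' 1 = 1" using \<psi>'B[of 1] subring_setD[OF B] pt_onD[OF \<psi>] by simp
  next
    fix a assume "a \<in> adjoin B x \<inter> P"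
    then show "\<psi>' a = 0" using \<psi>' wd by (auto simp: adjoin_def)
  qed
  have "\<exists>\<delta>'. tangent_on (adjoin B x) P \<psi>' \<delta>' \<and> (\<forall>b\<in>B. \<delta>' b = \<delta> b)" if \<delta>: "tangent_on B P \<psi> \<delta>" for \<delta>
  proof -
    note ad' = additive_on_simps[OF B tangent_onD(1)[OF \<delta>]]
    obtain \<eta> where \<eta>: "\<And>p. coeffs_in B p \<Longrightarrow> poly p x \<in> P \<Longrightarrow>
        poly (map_poly \<delta> p) \<xi> + \<eta> * poly (pderiv (map_poly \<psi> p)) \<xi> = 0"
      using wd'[OF \<delta>] by blast
    \<comment> \<open>The value of the extended derivation at \<open>poly p x\<close>, forced by the product rule.\<close>
    define E where "E p = poly (map_poly \<delta> p) \<xi> + \<eta> * poly (pderiv (map_poly \<psi> p)) \<xi>" for p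
    have E0: "E p = 0" if "coeffs_in B p" "poly p x \<in> P" for p
      using \<eta>[OF that] by (simp add: E_def)
    have Eadd: "E (p + q) = E p + E q" if "coeffs_in B p" "coeffs_in B q" for p q
      using that by (simp add: E_def ad ad' pderiv_add algebra_simps)
    have Emult: "E (p * q) = poly (map_poly \<psi> p) \<xi> * E q + poly (map_poly \<psi> q) \<xi> * E p"
      if "coeffs_in B p" "coeffs_in B q" for p q
      using that by (simp add: E_def map_poly_pt_mult[OF B \<psi>] map_poly_tangent_mult[OF B \<psi> \<delta>]
        pderiv_mult algebra_simps)
    obtain \<delta>' where \<delta>': "\<And>p. coeffs_in B p \<Longrightarrow> \<delta>' (poly p x) = E p"
      using poly_adjoin_lift[OF B Eadd P E0] by blast
    have "\<delta>' b = \<delta> b" if "b \<in> B" for b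
      using \<delta>'[OF c[OF that]] by (simp add: map_poly_pCons ad' E_def ad pderiv_pCons)
    moreover have "tangent_on (adjoin B x) P \<psi>' \<delta>'"
      unfolding tangent_on_def
    proof (intro conjI ballI)
      fix a b assume "a \<in> adjoin B x" "b \<in> adjoin B x"
      then obtain p q where "a = poly p x" "b = poly q x" "coeffs_in B p" "coeffs_in B q"
        by (auto simp: adjoin_def)
      then show "\<delta>' (a + b) = \<delta>' a + \<delta>' b" "\<delta>' (a * b) = \<psi>' a * \<delta>' b + \<psi>' b * \<delta>' a"
        using \<psi>'[of p] \<psi>'[of q] \<delta>'[of p] \<delta>'[of q] \<delta>'[of "p + q"] \<delta>'[of "p * q"] coeffs_in_ops[OF B, of p q]
        by (simp_all add: Eadd Emult)
    next
      fix a assume "a \<in> adjoin B x \<inter> P"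
      then show "\<delta>' a = 0" using \<delta>' E0 by (auto simp: adjoin_def)
    qed
    ultimately show ?thesis by blast
  qed
  with \<psi>' \<psi>'B pt show ?thesis by blast
qed

lemma poly_in_ideal:
  assumes "prime_ideal_in A P" "subring_set A" "\<And>i. coeff p i \<in> P" "x \<in> A"
  shows "poly p x \<in> P"
  unfolding poly_altdef using assms
  by (auto intro!: prime_ideal_inD(10)[OF assms(1)] prime_ideal_inD(9)[OF assms(1)] subring_setD(7))

text \<open>Coefficients in \<open>P\<close> do not change the value modulo \<open>P\<close>, so the leading terms up to the last
  coefficient outside \<open>P\<close> can be cut off.\<close>

lemma truncate_mod_ideal:
  assumes A: "subring_set A" and P: "prime_ideal_in A P" and x: "x \<in> A" and B: "subring_set B"
    and r: "coeffs_in B r" "coeff r i \<notin> P"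
  obtains j r' where "coeffs_in B r'" "coeff r j \<notin> P" "coeff r' j \<notin> P" "\<And>i. i > j \<Longrightarrow> coeff r' i = 0"
    "poly r x - poly r' x \<in> P"
proof -
  let ?J = "{i. coeff r i \<notin> P}"
  have fin: "finite ?J"
  proof (rule finite_subset[of _ "{..degree r}"])
    show "?J \<subseteq> {..degree r}"
      using prime_ideal_inD(3)[OF P] by (auto intro: le_degree)
  qed simp
  define j where "j = Max ?J"
  have j: "coeff r j \<notin> P" and max: "\<And>i. coeff r i \<notin> P \<Longrightarrow> i \<le> j"
    using Max_in[OF fin] Max_ge[OF fin] r(2) unfolding j_def by auto
  let ?r = "poly_cutoff (Suc j) r"
  have "poly (r - ?r) x \<in> P"
    by (rule poly_in_ideal[OF P A _ x])
      (use max prime_ideal_inD(3)[OF P] in \<open>force simp: coeff_poly_cutoff\<close>)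
  then show ?thesis
    using that[of ?r j] r(1) j subring_setD(2)[OF B]
    by (auto simp: coeffs_in_def coeff_poly_cutoff)
qed

text \<open>Otherwise truncation would produce a relation of \<open>x\<close> modulo \<open>P\<close> whose exact degree is below the
  minimal degree \<open>m\<close>.\<close>

lemma vanishing_coeffs_below_minimal_degree:
  assumes A: "subring_set A" and P: "prime_ideal_in A P" and x: "x \<in> A" and B: "subring_set B"
    and BA: "B \<subseteq> A"
    and min: "\<And>j q. j < m \<Longrightarrow> coeffs_in B q \<Longrightarrow> (\<And>i. i > j \<Longrightarrow> coeff q i = 0) \<Longrightarrow> coeff q j \<notin> P \<Longrightarrow>
      poly q x \<notin> P"
    and r: "coeffs_in B r" "\<And>i. i \<ge> m \<Longrightarrow> coeff r i = 0" "poly r x \<in> P"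
  shows "coeff r i \<in> P"
proof (rule ccontr)
  assume i: "coeff r i \<notin> P"
  obtain j r' where r': "coeffs_in B r'" "coeff r j \<notin> P" "coeff r' j \<notin> P"
    "\<And>i. i > j \<Longrightarrow> coeff r' i = 0" "poly r x - poly r' x \<in> P"
    using truncate_mod_ideal[OF A P x B r(1) i] by metis
  have "j < m"
    using r'(2) r(2)[of j] prime_ideal_inD(3)[OF P] by (metis not_le)
  moreover have "poly r' x \<in> P"
    using prime_ideal_inD(4)[OF P r(3) r'(5)] by simp
  ultimately show False using min r' by blast
qed

text \<open>An extension that is algebraic over a domain differs from a field extension only by denominators: a
  nonzero element has a multiple that is a nonzero element of the base. The proof runs the Euclidean algorithm for
  \<open>w\<close> and the minimal polynomial \<open>p\<close> with pseudo-division.\<close>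

lemma algebraic_pseudo_inverse:
  assumes A: "subring_set A" and P: "prime_ideal_in A P" and x: "x \<in> A" and B: "subring_set B"
    and BA: "B \<subseteq> A"
    and p: "coeffs_in B p" "\<And>i. i > m \<Longrightarrow> coeff p i = 0" "coeff p m \<notin> P" "poly p x \<in> P"
    and min: "\<And>j q. j < m \<Longrightarrow> coeffs_in B q \<Longrightarrow> (\<And>i. i > j \<Longrightarrow> coeff q i = 0) \<Longrightarrow> coeff q j \<notin> P \<Longrightarrow>
      poly q x \<notin> P"
    and w: "w \<in> adjoin B x" "w \<notin> P"
  shows "\<exists>z u. coeffs_in B z \<and> u \<in> B \<and> u \<notin> P \<and> poly z x * w - u \<in> P"
proof -
  have inA: "coeffs_in B q \<Longrightarrow> poly q x \<in> A" for q
    using BA x A by (intro poly_coeffs_in) (auto simp: coeffs_in_def)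
  have wA: "w \<in> A" using w(1) adjoin_subset[OF A BA x] by blast
  note Pm = prime_ideal_inD[OF P]
  have low: "coeff r i \<in> P"
    if "coeffs_in B r" "\<And>i. i \<ge> m \<Longrightarrow> coeff r i = 0" "poly r x \<in> P" for r i
    by (rule vanishing_coeffs_below_minimal_degree[OF A P x B BA, of m, OF _ that]) (use min in blast)
  \<comment> \<open>\<open>good s\<close>: some multiple of \<open>w\<close> is a polynomial in \<open>x\<close> of exact degree \<open>s\<close> modulo \<open>P\<close>.
    The smallest good number is zero.\<close>
  define good where "good s \<longleftrightarrow> (\<exists>z r. coeffs_in B z \<and> coeffs_in B r \<and> poly z x * w - poly r x \<in> P \<and>
    coeff r s \<notin> P \<and> (\<forall>i>s. coeff r i = 0))" for s
  have goodI: "\<exists>s<n. good s"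
    if zr: "coeffs_in B z" "coeffs_in B r" "poly z x * w - poly r x \<in> P" "coeff r i0 \<notin> P"
      "\<And>i. i \<ge> n \<Longrightarrow> coeff r i = 0" for z r i0 n
  proof -
    obtain j r' where r': "coeffs_in B r'" "coeff r j \<notin> P" "coeff r' j \<notin> P"
      "\<And>i. i > j \<Longrightarrow> coeff r' i = 0" "poly r x - poly r' x \<in> P"
      using truncate_mod_ideal[OF A P x B zr(2,4)] by metis
    have "j < n" using r'(2) zr(5)[of j] Pm(3) by (metis not_le)
    moreover have "poly z x * w - poly r' x \<in> P"
      using Pm(8)[OF zr(3) r'(5)] by simp
    ultimately show ?thesis using zr(1) r' unfolding good_def by blast
  qed
  let ?a = "coeff p m"
  have a: "?a \<in> B" using p by (simp add: coeffs_in_def)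
  have powP: "c ^ N \<notin> P" if "c \<in> B" "c \<notin> P" for c N
  proof (induction N)
    case 0
    then show ?case using Pm(1,2,5) subring_setD(1)[OF A]
      by (metis mult.right_neutral power_0 subsetI subset_antisym)
  next
    case (Suc N)
    then show ?case using Pm(6)[of c "c ^ N"] that BA subring_setD(7)[OF B that(1), of N] by auto
  qed
  have "\<exists>s<m. good s"
  proof -
    obtain q where q: "w = poly q x" "coeffs_in B q" using w(1) by (auto simp: adjoin_def)
    obtain N h r where hr: "smult (?a ^ N) q = p * h + r" "coeffs_in B h" "coeffs_in B r"
      "\<forall>i\<ge>m. coeff r i = 0"
      using pseudo_division[OF B p(1,2) q(2), of m "Suc (degree q)"] coeff_eq_0[of q] by auto
    have e: "?a ^ N * w = poly p x * poly h x + poly r x"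
      using arg_cong[OF hr(1), of "\<lambda>q. poly q x"] q(1) by simp
    have "poly r x \<notin> P"
    proof
      assume "poly r x \<in> P"
      then have "?a ^ N * w \<in> P"
        unfolding e using p(4) inA[OF hr(2)] by (intro Pm(8,9)) auto
      then show False
        using Pm(6) powP[OF a p(3), of N] w(2) wA subring_setD(7)[OF B a, of N] BA by blast
    qed
    then obtain i0 where "coeff r i0 \<notin> P"
      using poly_in_ideal[OF P A _ x] by blast
    moreover have "poly [:?a ^ N:] x * w - poly r x \<in> P"
      using Pm(9)[OF p(4) inA[OF hr(2)]] e by simp
    moreover have "coeffs_in B [:?a ^ N:]"
      by (intro coeffs_in_const B subring_setD a)
    ultimately show ?thesis using goodI hr(3,4) by blast
  qed
  then obtain s0 where s0: "s0 < m" "good s0" by blast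
  define s where "s = (LEAST s. good s)"
  have s: "good s" "s < m" "\<And>t. t < s \<Longrightarrow> \<not> good t"
    using LeastI[of good, OF s0(2)] Least_le[of good, OF s0(2)] s0(1) not_less_Least
    unfolding s_def by auto
  obtain z r where zr: "coeffs_in B z" "coeffs_in B r" "poly z x * w - poly r x \<in> P"
    "coeff r s \<notin> P" "\<forall>i>s. coeff r i = 0"
    using s(1) unfolding good_def by blast
  show ?thesis
  proof (cases "s = 0")
    case True
    then have "r = [:coeff r 0:]"
      using zr(5) by (simp add: poly_eq_iff coeff_pCons split: nat.split)
    then have "poly r x = coeff r 0" by (metis add.right_neutral mult_zero_right poly_0 poly_pCons)
    then show ?thesis
      using zr True by (intro exI[of _ z] exI[of _ "coeff r 0"]) (auto simp: coeffs_in_def)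
  next
    case False
    let ?c = "coeff r s"
    have c: "?c \<in> B" using zr(2) by (simp add: coeffs_in_def)
    obtain N h r2 where hr: "smult (?c ^ N) p = r * h + r2" "coeffs_in B h" "coeffs_in B r2"
      "\<forall>i\<ge>s. coeff r2 i = 0" "\<forall>i. i + s \<ge> Suc m \<longrightarrow> coeff h i = 0"
      using pseudo_division[OF B zr(2) _ p(1), of s "Suc m"] zr(5) p(2) by auto
    have e: "?c ^ N * poly p x = poly r x * poly h x + poly r2 x"
      using arg_cong[OF hr(1), of "\<lambda>q. poly q x"] by simp
    have rx: "poly r x \<notin> P"
      using min[OF s(2) zr(2) _ zr(4)] zr(5) by blast
    have cp: "?c ^ N * poly p x \<in> P"
      using c BA p(4) subring_setD(7)[OF B c, of N] by (intro Pm(5)) auto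
    \<comment> \<open>Otherwise \<open>r\<close> times the quotient vanishes at \<open>x\<close> modulo \<open>P\<close>, and one of the two is a
      relation of degree below \<open>m\<close>.\<close>
    have ex: "\<exists>i. coeff r2 i \<notin> P"
    proof (rule ccontr)
      assume "\<nexists>i. coeff r2 i \<notin> P"
      then have r2P: "\<And>i. coeff r2 i \<in> P" by blast
      from poly_in_ideal[OF P A this x] have "poly r x * poly h x \<in> P"
        using e cp by (metis Pm(4) add_diff_cancel_right')
      then have "poly h x \<in> P" using Pm(6) rx inA hr(2) zr(2) by blast
      moreover have "coeff h i = 0" if "i \<ge> m" for i
        using hr(5) that False by simp
      ultimately have "coeff h i \<in> P" for i using low[OF hr(2)] by blast
      then have "coeff (r * h + r2) m \<in> P"
        using zr(2) BA r2P
        by (auto simp: coeff_mult coeffs_in_def intro!: Pm(8,10) Pm(5))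
      then have "?c ^ N * ?a \<in> P" by (metis coeff_smult hr(1))
      then show False
        using Pm(6) powP[OF c zr(4), of N] p(3) a BA subring_setD(7)[OF B c, of N] by blast
    qed
    have "poly (- (h * z)) x * w - poly r2 x \<in> P"
    proof -
      have "poly (- (h * z)) x * w - poly r2 x
        = - (poly h x * (poly z x * w - poly r x)) - ?c ^ N * poly p x"
        using e by (simp add: algebra_simps)
      also have "\<dots> \<in> P"
        by (rule Pm(4)[OF Pm(7)[OF Pm(5)[OF inA[OF hr(2)] zr(3)]] cp])
      finally show ?thesis .
    qed
    moreover have "coeffs_in B (- (h * z))"
      using coeffs_in_ops(3)[OF B hr(2) zr(1)] coeffs_in_ops(4)[OF B] by blast
    ultimately have "\<exists>t<s. good t"
      using goodI hr(3,4) ex by blast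
    then show ?thesis using s(3) by blast
  qed
qed

text \<open>If \<open>x\<close> is transcendental modulo \<open>P\<close>, its value is free up to finitely many exceptions, and its
  derivative can be chosen zero. If \<open>x\<close> is algebraic, its value has to be a root of the specialised
  minimal polynomial, and the derivative is determined as in the implicit function theorem provided that
  the root is simple. Minimality of the degree and characteristic zero make the derivative of the minimal
  polynomial nonzero at \<open>x\<close>; the element \<open>u\<close> ensures that it remains nonzero after specialisation.\<close>

lemma extend_points_step:
  fixes A P B :: "'r::comm_ring_1 set"
  assumes A: "subring_set A" and P: "prime_ideal_in A P" and x: "x \<in> A" and B: "subring_set B"
    and BA: "B \<subseteq> A" and char: "\<And>m. m > 0 \<Longrightarrow> of_nat m \<notin> P"
    and v: "v \<in> adjoin B x" "v \<notin> P"
  shows "\<exists>u\<in>B. u \<notin> P \<and> (\<forall>\<psi>::'r \<Rightarrow> 'k::{alg_closed_field,field_char_0}. pt_on B P \<psi> \<and> \<psi> u \<noteq> 0 \<longrightarrow>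
    (\<exists>\<psi>'. pt_on (adjoin B x) P \<psi>' \<and> (\<forall>b\<in>B. \<psi>' b = \<psi> b) \<and> \<psi>' v \<noteq> 0 \<and>
      (\<forall>\<delta>. tangent_on B P \<psi> \<delta> \<longrightarrow> (\<exists>\<delta>'. tangent_on (adjoin B x) P \<psi>' \<delta>' \<and> (\<forall>b\<in>B. \<delta>' b = \<delta> b)))))"
proof -
  obtain q where q: "v = poly q x" "coeffs_in B q" using v(1) by (auto simp: adjoin_def)
  note Pm = prime_ideal_inD[OF P]
  show ?thesis
  proof (cases "\<exists>p. coeffs_in B p \<and> poly p x \<in> P \<and> (\<exists>i. coeff p i \<notin> P)")
    case False
    then have tr: "\<And>p i. coeffs_in B p \<Longrightarrow> poly p x \<in> P \<Longrightarrow> coeff p i \<in> P" by blast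
    obtain j where j: "coeff q j \<notin> P"
      using v(2) q(1) poly_in_ideal[OF P A _ x] by blast
    show ?thesis
    proof (intro bexI[of _ "coeff q j"] conjI allI impI)
      fix \<psi> :: "'r \<Rightarrow> 'k" assume "pt_on B P \<psi> \<and> \<psi> (coeff q j) \<noteq> 0"
      then have \<psi>: "pt_on B P \<psi>" "\<psi> (coeff q j) \<noteq> 0" by auto
      note ad = additive_on_simps[OF B pt_onD(1)[OF \<psi>(1)]]
      have "map_poly \<psi> q \<noteq> 0"
        using \<psi>(2) by (metis ad(1) coeff_map_poly coeff_0)
      then have "finite {\<xi>. poly (map_poly \<psi> q) \<xi> = 0}" by (rule poly_roots_finite)
      then obtain \<xi> where \<xi>: "poly (map_poly \<psi> q) \<xi> \<noteq> 0"
        using infinite_UNIV_char_0[where 'a='k] by (metis (mono_tags) UNIV_eq_I mem_Collect_eq)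
      have 0: "map_poly f p = 0" if "\<And>b. b \<in> B \<Longrightarrow> b \<in> P \<Longrightarrow> f b = 0" "coeffs_in B p" "poly p x \<in> P" for p and f :: "'r \<Rightarrow> 'k"
        using that tr[OF that(2,3)] subring_setD(2)[OF B] Pm(3)
        by (auto simp: poly_eq_iff coeff_map_poly coeffs_in_def)
      have "\<exists>\<eta>. \<forall>p. coeffs_in B p \<and> poly p x \<in> P \<longrightarrow>
          poly (map_poly \<delta> p) \<xi> + \<eta> * poly (pderiv (map_poly \<psi> p)) \<xi> = 0"
        if "tangent_on B P \<psi> \<delta>" for \<delta>
        using 0[OF tangent_onD(3)[OF that]] by (intro exI[of _ 0]) simp
      then have "\<exists>\<psi>'. pt_on (adjoin B x) P \<psi>' \<and> (\<forall>b\<in>B. \<psi>' b = \<psi> b) \<and>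
          (\<forall>p. coeffs_in B p \<longrightarrow> \<psi>' (poly p x) = poly (map_poly \<psi> p) \<xi>) \<and>
          (\<forall>\<delta>. tangent_on B P \<psi> \<delta> \<longrightarrow> (\<exists>\<delta>'. tangent_on (adjoin B x) P \<psi>' \<delta>' \<and> (\<forall>b\<in>B. \<delta>' b = \<delta> b)))"
        using 0[OF pt_onD(4)[OF \<psi>(1)]] by (intro extend_from_root[OF B P \<psi>(1)]) simp_all
      then show "\<exists>\<psi>'. pt_on (adjoin B x) P \<psi>' \<and> (\<forall>b\<in>B. \<psi>' b = \<psi> b) \<and> \<psi>' v \<noteq> 0 \<and>
        (\<forall>\<delta>. tangent_on B P \<psi> \<delta> \<longrightarrow> (\<exists>\<delta>'. tangent_on (adjoin B x) P \<psi>' \<delta>' \<and> (\<forall>b\<in>B. \<delta>' b = \<delta> b)))"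
        using q \<xi> by metis
    qed (use j q(2) in \<open>auto simp: coeffs_in_def\<close>)
  next
    case True
    define deg where "deg m \<longleftrightarrow> (\<exists>p. coeffs_in B p \<and> (\<forall>i>m. coeff p i = 0) \<and> coeff p m \<notin> P \<and> poly p x \<in> P)" for m
    have "\<exists>m. deg m"
    proof -
      from True obtain p i where p: "coeffs_in B p" "poly p x \<in> P" "coeff p i \<notin> P" by blast
      obtain j r' where r': "coeffs_in B r'" "coeff r' j \<notin> P" "\<And>i. i > j \<Longrightarrow> coeff r' i = 0"
        "poly p x - poly r' x \<in> P"
        using truncate_mod_ideal[OF A P x B p(1,3)] by metis
      have "poly r' x \<in> P" using Pm(4)[OF p(2) r'(4)] by simp
      then show ?thesis using r' unfolding deg_def by blast
    qed
    then obtain m0 where m0: "deg m0" by blast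
    define m where "m = (LEAST m. deg m)"
    have m: "deg m" "\<And>j. j < m \<Longrightarrow> \<not> deg j"
      using LeastI[of deg, OF m0] not_less_Least unfolding m_def by auto
    obtain p where p: "coeffs_in B p" "\<And>i. i > m \<Longrightarrow> coeff p i = 0" "coeff p m \<notin> P" "poly p x \<in> P"
      using m(1) unfolding deg_def by blast
    have min: "\<And>j q. j < m \<Longrightarrow> coeffs_in B q \<Longrightarrow> (\<And>i. i > j \<Longrightarrow> coeff q i = 0) \<Longrightarrow> coeff q j \<notin> P \<Longrightarrow>
      poly q x \<notin> P"
      using m(2) unfolding deg_def by blast
    have low: "coeff r i \<in> P"
    if "coeffs_in B r" "\<And>i. i \<ge> m \<Longrightarrow> coeff r i = 0" "poly r x \<in> P" for r i
    by (rule vanishing_coeffs_below_minimal_degree[OF A P x B BA, of m, OF _ that]) (use min in blast)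
    let ?a = "coeff p m"
    have a: "?a \<in> B" using p by (simp add: coeffs_in_def)
    have "m \<noteq> 0"
    proof
      assume "m = 0"
      then have "p = [:?a:]"
        using p(2) by (simp add: poly_eq_iff coeff_pCons split: nat.split)
      then have "poly p x = ?a" by (metis add.right_neutral mult_zero_right poly_0 poly_pCons)
      then show False using p by simp
    qed
    have dp: "poly (formal_deriv p) x \<notin> P"
    proof
      assume *: "poly (formal_deriv p) x \<in> P"
      have "coeff (formal_deriv p) i = 0" if "i \<ge> m" for i
        using that p(2) by (simp add: coeff_formal_deriv)
      from low[OF coeffs_in_formal_deriv[OF B p(1)] this *]
      have "coeff (formal_deriv p) (m - 1) \<in> P" by blast
      then have "of_nat m * ?a \<in> P" using \<open>m \<noteq> 0\<close> by (simp add: coeff_formal_deriv)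
      then show False
        using Pm(6) char[of m] \<open>m \<noteq> 0\<close> p(3) a BA subring_setD(9)[OF A] by blast
    qed
    \<comment> \<open>One element is inverted for two purposes: \<open>v\<close> must not vanish at the new point, and the root
      must be simple.\<close>
    have wAd: "v * poly (formal_deriv p) x \<in> adjoin B x"
      using v(1) coeffs_in_formal_deriv[OF B p(1)] subring_setD(4)[OF subring_set_adjoin[OF B]]
      unfolding adjoin_def by blast
    have "v * poly (formal_deriv p) x \<notin> P"
      using Pm(6) v dp adjoin_subset[OF A BA x] coeffs_in_formal_deriv[OF B p(1)] unfolding adjoin_def by blast
    then have "\<exists>z u. coeffs_in B z \<and> u \<in> B \<and> u \<notin> P \<and> poly z x * (v * poly (formal_deriv p) x) - u \<in> P"
      using min by (intro algebraic_pseudo_inverse[OF A P x B BA p(1) p(2) p(3,4) _ wAd]) blast+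
    then obtain z u where
      zu: "coeffs_in B z" "u \<in> B" "u \<notin> P" "poly z x * (v * poly (formal_deriv p) x) - u \<in> P"
      by blast
    show ?thesis
    proof (intro bexI[of _ "?a * u"] conjI allI impI)
      \<comment> \<open>The factor \<open>?a\<close> keeps the degree of the minimal polynomial under specialisation.\<close>
      show "?a * u \<notin> P" using Pm(6) p(3) zu(2,3) a BA by blast
      show "?a * u \<in> B" using subring_setD(4)[OF B a zu(2)] .
      fix \<psi> :: "'r \<Rightarrow> 'k" assume "pt_on B P \<psi> \<and> \<psi> (?a * u) \<noteq> 0"
      then have \<psi>: "pt_on B P \<psi>" and "\<psi> (?a * u) \<noteq> 0" by auto
      then have a0: "\<psi> ?a \<noteq> 0" and u0: "\<psi> u \<noteq> 0" using pt_onD(2)[OF \<psi>] a zu(2) by auto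
      note ad = additive_on_simps[OF B pt_onD(1)[OF \<psi>]]
      let ?p = "map_poly \<psi> p"
      have "coeff ?p m \<noteq> 0" using a0 by (simp add: coeff_map_poly ad(1))
      then have "degree ?p > 0" using \<open>m \<noteq> 0\<close> by (metis le_degree gr0I le_zero_eq)
      then obtain \<xi> where \<xi>: "poly ?p \<xi> = 0" using alg_closed_imp_poly_has_root by blast
      \<comment> \<open>Modulo \<open>P\<close> and a power of the leading coefficient, every relation is a multiple of \<open>p\<close>.\<close>
      have div: "\<exists>N h r. smult (?a ^ N) f = p * h + r \<and> coeffs_in B h \<and> coeffs_in B r \<and> (\<forall>i. coeff r i \<in> P)"
        if f: "coeffs_in B f" "poly f x \<in> P" for f
      proof -
        obtain N h r where hr: "smult (?a ^ N) f = p * h + r" "coeffs_in B h" "coeffs_in B r"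
          "\<forall>i\<ge>m. coeff r i = 0"
          using pseudo_division[OF B p(1,2) f(1), of m "Suc (degree f)"] coeff_eq_0[of f] by auto
        have e: "?a ^ N * poly f x = poly p x * poly h x + poly r x"
          using arg_cong[OF hr(1), of "\<lambda>q. poly q x"] by simp
        have "poly h x \<in> A"
          by (rule poly_coeffs_in[OF A _ x]) (use hr(2) BA in \<open>auto simp: coeffs_in_def\<close>)
        moreover have "?a ^ N \<in> A" by (rule subring_setD(7)[OF A]) (use a BA in auto)
        ultimately have "?a ^ N * poly f x - poly p x * poly h x \<in> P"
          using f(2) p(4) by (intro Pm(4,5,9))
        then have "poly r x \<in> P" by (simp add: e)
        then have "\<And>i. coeff r i \<in> P" using low[OF hr(3)] hr(4) by blast
        with hr show ?thesis by blast
      qed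
      have 0: "map_poly f r = 0" if "\<And>b. b \<in> B \<Longrightarrow> b \<in> P \<Longrightarrow> f b = 0" "coeffs_in B r" "\<forall>i. coeff r i \<in> P" for r and f :: "'r \<Rightarrow> 'k"
        using that subring_setD(2)[OF B] Pm(3)
        by (auto simp: poly_eq_iff coeff_map_poly coeffs_in_def)
      have smult: "smult (?a ^ N) f = [:?a ^ N:] * f" "coeffs_in B [:?a ^ N:]" for f N
        by (auto intro!: coeffs_in_const B subring_setD a)
      have aN: "\<psi> (?a ^ N) \<noteq> 0" for N
        by (induction N) (use pt_onD[OF \<psi>] a0 a subring_setD(7)[OF B a] in auto)
      have wd: "poly (map_poly \<psi> f) \<xi> = 0" if f: "coeffs_in B f" "poly f x \<in> P" for f
      proof -
        from div[OF f] obtain N h r where hr: "[:?a ^ N:] * f = p * h + r" "coeffs_in B h"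
          "coeffs_in B r" "\<forall>i. coeff r i \<in> P" unfolding smult(1) by blast
        have "map_poly \<psi> ([:?a ^ N:] * f) = ?p * map_poly \<psi> h"
          unfolding hr(1) using hr coeffs_in_ops[OF B] p(1)
          by (simp add: ad map_poly_pt_mult[OF B \<psi>] 0[OF pt_onD(4)[OF \<psi>]])
        then have "[:\<psi> (?a ^ N):] * map_poly \<psi> f = ?p * map_poly \<psi> h"
          using map_poly_pt_mult[OF B \<psi> smult(2) f(1), of N] by (simp add: map_poly_pCons ad(1))
        from arg_cong[OF this, of "\<lambda>q. poly q \<xi>"] show ?thesis using \<xi> aN[of N] by simp
      qed
      have wz: "poly (map_poly \<psi> z) \<xi> * (poly (map_poly \<psi> q) \<xi> * poly (pderiv ?p) \<xi>) = \<psi> u"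
      proof -
        have cd: "coeffs_in B (formal_deriv p)" using coeffs_in_formal_deriv[OF B p(1)] .
        have "map_poly \<psi> (formal_deriv p) = pderiv ?p"
        proof (rule poly_eqI)
          fix i
          have "\<psi> (of_nat j * c) = of_nat j * \<psi> c" if "c \<in> B" for j c
            by (induction j) (use that in \<open>auto simp: ad(1) distrib_right pt_onD[OF \<psi>] subring_setD[OF B]\<close>)
          then show "coeff (map_poly \<psi> (formal_deriv p)) i = coeff (pderiv ?p) i"
            using p(1) by (simp add: coeff_map_poly ad(1) coeff_pderiv coeff_formal_deriv coeffs_in_def del: of_nat_Suc)
        qed
        moreover have "poly (map_poly \<psi> (z * (q * formal_deriv p) - [:u:])) \<xi> = 0"
          using zu q cd by (intro wd coeffs_in_ops coeffs_in_const B) auto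
        ultimately show ?thesis
          using zu q cd coeffs_in_ops[OF B] coeffs_in_const[OF B]
          by (simp add: ad map_poly_pt_mult[OF B \<psi>] map_poly_pCons)
      qed
      then have v0: "poly (map_poly \<psi> q) \<xi> \<noteq> 0" and d0: "poly (pderiv ?p) \<xi> \<noteq> 0"
        using u0 by auto
      have wd': "\<exists>\<eta>. \<forall>f. coeffs_in B f \<and> poly f x \<in> P \<longrightarrow>
          poly (map_poly \<delta> f) \<xi> + \<eta> * poly (pderiv (map_poly \<psi> f)) \<xi> = 0"
        if \<delta>: "tangent_on B P \<psi> \<delta>" for \<delta>
      proof -
        note ad' = additive_on_simps[OF B tangent_onD(1)[OF \<delta>]]
        \<comment> \<open>The solution of the differentiated equation of the minimal polynomial.\<close>
        define \<eta> where "\<eta> = - poly (map_poly \<delta> p) \<xi> / poly (pderiv ?p) \<xi>"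
        define E where "E p = poly (map_poly \<delta> p) \<xi> + \<eta> * poly (pderiv (map_poly \<psi> p)) \<xi>" for p
        have Ep: "E p = 0" using d0 by (simp add: E_def \<eta>_def)
        have Eadd: "E (p + q) = E p + E q" if "coeffs_in B p" "coeffs_in B q" for p q
          using that by (simp add: E_def ad ad' pderiv_add algebra_simps)
        have Emult: "E (p * q) = poly (map_poly \<psi> p) \<xi> * E q + poly (map_poly \<psi> q) \<xi> * E p"
          if "coeffs_in B p" "coeffs_in B q" for p q
          using that by (simp add: E_def map_poly_pt_mult[OF B \<psi>] map_poly_tangent_mult[OF B \<psi> \<delta>]
            pderiv_mult algebra_simps)
        have "E f = 0" if f: "coeffs_in B f" "poly f x \<in> P" for f
        proof -
          from div[OF f] obtain N h r where hr: "[:?a ^ N:] * f = p * h + r" "coeffs_in B h"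
            "coeffs_in B r" "\<forall>i. coeff r i \<in> P" unfolding smult(1) by blast
          have "E ([:?a ^ N:] * f) = E (p * h) + E r"
            unfolding hr(1) using hr coeffs_in_ops[OF B] p(1) by (intro Eadd) auto
          moreover have "E r = 0"
            using hr by (simp add: E_def 0[OF pt_onD(4)[OF \<psi>]] 0[OF tangent_onD(3)[OF \<delta>]])
          ultimately have "\<psi> (?a ^ N) * E f = 0"
            using Emult[OF smult(2) f(1), of N] Emult[OF p(1) hr(2)] Ep \<xi> wd[OF f]
            by (simp add: map_poly_pCons ad(1))
          then show ?thesis using aN[of N] by simp
        qed
        then show ?thesis unfolding E_def by blast
      qed
      from extend_from_root[OF B P \<psi> wd wd'] obtain \<psi>' where "pt_on (adjoin B x) P \<psi>' \<and> (\<forall>b\<in>B. \<psi>' b = \<psi> b) \<and>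
          (\<forall>p. coeffs_in B p \<longrightarrow> \<psi>' (poly p x) = poly (map_poly \<psi> p) \<xi>) \<and>
          (\<forall>\<delta>. tangent_on B P \<psi> \<delta> \<longrightarrow> (\<exists>\<delta>'. tangent_on (adjoin B x) P \<psi>' \<delta>' \<and> (\<forall>b\<in>B. \<delta>' b = \<delta> b)))"
        by blast
      then show "\<exists>\<psi>'. pt_on (adjoin B x) P \<psi>' \<and> (\<forall>b\<in>B. \<psi>' b = \<psi> b) \<and> \<psi>' v \<noteq> 0 \<and>
        (\<forall>\<delta>. tangent_on B P \<psi> \<delta> \<longrightarrow> (\<exists>\<delta>'. tangent_on (adjoin B x) P \<psi>' \<delta>' \<and> (\<forall>b\<in>B. \<delta>' b = \<delta> b)))"
        using q v0 by metis
    qed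
  qed
qed

primrec adjoin_list :: "'r::comm_ring_1 set \<Rightarrow> 'r list \<Rightarrow> 'r set"
  where "adjoin_list B [] = B" | "adjoin_list B (x # xs) = adjoin (adjoin_list B xs) x"

lemma adjoin_list_props:
  assumes "subring_set A" "subring_set B" "B \<subseteq> A" "set xs \<subseteq> A"
  shows "subring_set (adjoin_list B xs)" "B \<subseteq> adjoin_list B xs" "set xs \<subseteq> adjoin_list B xs"
    "adjoin_list B xs \<subseteq> A"
  using assms(4)
proof (induction xs)
  case (Cons x xs)
  { case 1 then show ?case using Cons by (simp add: subring_set_adjoin)
  next case 2 then show ?case using Cons adjoin_superset(1)[of "adjoin_list B xs" x] by auto
  next case 3 then show ?case using Cons adjoin_superset[of "adjoin_list B xs" x] by auto
  next case 4 then show ?case using Cons adjoin_subset[OF assms(1), of "adjoin_list B xs" x] by simp }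
qed (use assms in auto)

text \<open>Chevalley's theorem on constructible images for a finitely generated extension of rings, with tangent vectors carried
  along.\<close>

lemma extend_points:
  fixes A P B :: "'r::comm_ring_1 set"
  assumes A: "subring_set A" and P: "prime_ideal_in A P" and B: "subring_set B"
    and BA: "B \<subseteq> A" and char: "\<And>m. m > 0 \<Longrightarrow> of_nat m \<notin> P"
    and xs: "set xs \<subseteq> A" and v: "v \<in> adjoin_list B xs" "v \<notin> P"
  shows "\<exists>u\<in>B. u \<notin> P \<and> (\<forall>\<psi>::'r \<Rightarrow> 'k::{alg_closed_field,field_char_0}. pt_on B P \<psi> \<and> \<psi> u \<noteq> 0 \<longrightarrow>
    (\<exists>\<psi>'. pt_on (adjoin_list B xs) P \<psi>' \<and> (\<forall>b\<in>B. \<psi>' b = \<psi> b) \<and> \<psi>' v \<noteq> 0 \<and>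
      (\<forall>\<delta>. tangent_on B P \<psi> \<delta> \<longrightarrow>
        (\<exists>\<delta>'. tangent_on (adjoin_list B xs) P \<psi>' \<delta>' \<and> (\<forall>b\<in>B. \<delta>' b = \<delta> b)))))"
  using xs v
proof (induction xs arbitrary: v)
  case Nil
  then show ?case by (intro bexI[of _ v]) auto
next
  case (Cons x xs)
  let ?C = "adjoin_list B xs"
  have C: "subring_set ?C" "B \<subseteq> ?C" "?C \<subseteq> A" and x: "x \<in> A"
    using adjoin_list_props[OF A B BA, of xs] Cons.prems(1) by auto
  obtain w where w: "w \<in> ?C" "w \<notin> P" and
    ext: "\<And>\<psi>::'r \<Rightarrow> 'k. pt_on ?C P \<psi> \<Longrightarrow> \<psi> w \<noteq> 0 \<Longrightarrow>
      (\<exists>\<psi>'. pt_on (adjoin ?C x) P \<psi>' \<and> (\<forall>b\<in>?C. \<psi>' b = \<psi> b) \<and> \<psi>' v \<noteq> 0 \<and>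
      (\<forall>\<delta>. tangent_on ?C P \<psi> \<delta> \<longrightarrow> (\<exists>\<delta>'. tangent_on (adjoin ?C x) P \<psi>' \<delta>' \<and> (\<forall>b\<in>?C. \<delta>' b = \<delta> b))))"
    using extend_points_step[OF A P x C(1,3) char, of v, where 'k='k] Cons.prems(2,3) by auto
  obtain u where u: "u \<in> B" "u \<notin> P" and
    ext': "\<And>\<psi>::'r \<Rightarrow> 'k. pt_on B P \<psi> \<Longrightarrow> \<psi> u \<noteq> 0 \<Longrightarrow>
      (\<exists>\<psi>'. pt_on ?C P \<psi>' \<and> (\<forall>b\<in>B. \<psi>' b = \<psi> b) \<and> \<psi>' w \<noteq> 0 \<and>
      (\<forall>\<delta>. tangent_on B P \<psi> \<delta> \<longrightarrow> (\<exists>\<delta>'. tangent_on ?C P \<psi>' \<delta>' \<and> (\<forall>b\<in>B. \<delta>' b = \<delta> b))))"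
    using Cons.IH[OF _ w] Cons.prems(1) by auto
  show ?case
  proof (intro bexI[of _ u] conjI allI impI u)
    fix \<psi> :: "'r \<Rightarrow> 'k" assume "pt_on B P \<psi> \<and> \<psi> u \<noteq> 0"
    then obtain \<psi>1 where \<psi>1: "pt_on ?C P \<psi>1" "\<forall>b\<in>B. \<psi>1 b = \<psi> b" "\<psi>1 w \<noteq> 0"
      "\<And>\<delta>. tangent_on B P \<psi> \<delta> \<Longrightarrow> \<exists>\<delta>'. tangent_on ?C P \<psi>1 \<delta>' \<and> (\<forall>b\<in>B. \<delta>' b = \<delta> b)"
      using ext' by blast
    obtain \<psi>2 where \<psi>2: "pt_on (adjoin ?C x) P \<psi>2" "\<forall>b\<in>?C. \<psi>2 b = \<psi>1 b" "\<psi>2 v \<noteq> 0"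
      "\<And>\<delta>. tangent_on ?C P \<psi>1 \<delta> \<Longrightarrow> \<exists>\<delta>'. tangent_on (adjoin ?C x) P \<psi>2 \<delta>' \<and> (\<forall>b\<in>?C. \<delta>' b = \<delta> b)"
      using ext[OF \<psi>1(1,3)] by blast
    show "\<exists>\<psi>'. pt_on (adjoin_list B (x # xs)) P \<psi>' \<and> (\<forall>b\<in>B. \<psi>' b = \<psi> b) \<and> \<psi>' v \<noteq> 0 \<and>
      (\<forall>\<delta>. tangent_on B P \<psi> \<delta> \<longrightarrow>
        (\<exists>\<delta>'. tangent_on (adjoin_list B (x # xs)) P \<psi>' \<delta>' \<and> (\<forall>b\<in>B. \<delta>' b = \<delta> b)))"
    proof (rule exI[of _ \<psi>2], intro conjI allI impI)
      fix \<delta> assume "tangent_on B P \<psi> \<delta>"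
      with \<psi>1(4) obtain \<delta>1 where d1: "tangent_on ?C P \<psi>1 \<delta>1" "\<forall>b\<in>B. \<delta>1 b = \<delta> b" by blast
      with \<psi>2(4) obtain \<delta>2 where "tangent_on (adjoin ?C x) P \<psi>2 \<delta>2" "\<forall>b\<in>?C. \<delta>2 b = \<delta>1 b" by blast
      then show "\<exists>\<delta>'. tangent_on (adjoin_list B (x # xs)) P \<psi>2 \<delta>' \<and> (\<forall>b\<in>B. \<delta>' b = \<delta> b)"
        using d1(2) C(2) by (intro exI[of _ \<delta>2]) auto
    qed (use \<psi>1 \<psi>2 C(2) in auto)
  qed
qed

section \<open>Polynomial functions and their gradients\<close>

lemma const_eq_fun: "(\<lambda>_. c) = fscale c (1 :: 'b \<Rightarrow> 'k::field)"
  by (auto simp: fscale_def)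

lemma sum_fun_apply: "(sum f I) x = (\<Sum>i\<in>I. f i x)" for f :: "'i \<Rightarrow> 'b \<Rightarrow> 'k::field"
  by (induction I rule: infinite_finite_induct) auto

lemma power_fun_apply: "(f ^ n) x = f x ^ n" for f :: "'b \<Rightarrow> 'k::field"
  by (induction n) auto

lemma poly_fun_apply: "poly p f x = (\<Sum>i\<le>degree p. coeff p i x * f x ^ i)"
  for f :: "'b \<Rightarrow> 'k::field"
  by (simp add: poly_altdef sum_fun_apply power_fun_apply)

lemma poly_funs_simps:
  assumes "p \<in> poly_funs n" "q \<in> poly_funs n"
  shows "- p \<in> poly_funs n" "p - q \<in> poly_funs n" "fscale c p \<in> poly_funs n"
proof -
  have s: "fscale c r \<in> poly_funs n" if "r \<in> poly_funs n" for c and r :: "(nat \<Rightarrow> 'a) \<Rightarrow> 'a"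
    using poly_funs.mult[OF poly_funs.const[of c] that] by (simp add: fscale_def times_fun_def)
  have m: "- r \<in> poly_funs n" if "r \<in> poly_funs n" for r :: "(nat \<Rightarrow> 'a) \<Rightarrow> 'a"
    using s[OF that, of "-1"] by (simp add: fscale_def fun_Compl_def)
  show "fscale c p \<in> poly_funs n" "- p \<in> poly_funs n" using s m assms by blast+
  show "p - q \<in> poly_funs n" using poly_funs.add[OF assms(1) m[OF assms(2)]] by simp
qed

lemma subring_set_poly_funs: "subring_set (poly_funs n)"
  unfolding subring_set_def
  using poly_funs_simps poly_funs.mult poly_funs.const[of 1] by (auto simp: one_fun_def)

lemma poly_funs_cong:
  "p \<in> poly_funs n \<Longrightarrow> (\<And>i. i < n \<Longrightarrow> a i = b i) \<Longrightarrow> p a = p b"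
  by (induction rule: poly_funs.induct) auto

lemma poly_funs_Suc_expand:
  assumes "q \<in> poly_funs (Suc d)"
  shows "\<exists>c N. (\<forall>i. c i \<in> poly_funs d) \<and> (\<forall>a. q a = (\<Sum>i\<le>N. c i a * a d ^ i)) \<and> (\<forall>i>N. c i = 0)"
proof -
  let ?B = "poly_funs d :: ((nat \<Rightarrow> 'a) \<Rightarrow> 'a) set" and ?x = "\<lambda>a :: nat \<Rightarrow> 'a. a d"
  note B = subring_set_poly_funs[of d, where 'a='a]
  note A = subring_set_adjoin[OF B, of ?x]
  have "q \<in> adjoin ?B ?x"
    using assms
  proof induction
    case (const c)
    then show ?case using adjoin_superset(1)[OF B] poly_funs.const by blast
  next
    case (coord i)
    then show ?case
      using adjoin_superset[OF B, of ?x] poly_funs.coord[of i d] by (cases "i = d") auto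
  next
    case (add p q)
    then show ?case using subring_setD(6)[OF A] by blast
  next
    case (mult p q)
    then show ?case using subring_setD(4)[OF A] by blast
  qed
  then obtain p where "q = poly p ?x" "coeffs_in ?B p" by (auto simp: adjoin_def)
  then show ?thesis
    by (intro exI[of _ "coeff p"] exI[of _ "degree p"])
      (simp add: coeffs_in_def poly_fun_apply coeff_eq_0)
qed

lemma poly_funs_compose:
  assumes "q \<in> poly_funs d" and R: "subring_set R" "\<And>c. (\<lambda>_. c) \<in> R" and y: "\<And>i. i < d \<Longrightarrow> y i \<in> R"
  shows "(\<lambda>x. q (\<lambda>i. y i x)) \<in> R"
  using assms(1)
proof induction
  case (add p q)
  from subring_setD(6)[OF R(1) add.IH] show ?case by (simp add: plus_fun_def)
next
  case (mult p q)
  from subring_setD(4)[OF R(1) mult.IH] show ?case by (simp add: times_fun_def)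
qed (use R y in auto)

inductive_set gradients ::
  "nat \<Rightarrow> (((nat \<Rightarrow> 'k::field) \<Rightarrow> 'k) \<times> (nat \<Rightarrow> (nat \<Rightarrow> 'k) \<Rightarrow> 'k)) set" for n :: nat
  where
    const: "((\<lambda>_. c), (\<lambda>_. 0)) \<in> gradients n"
  | coord: "i < n \<Longrightarrow> ((\<lambda>a. a i), (\<lambda>j. if j = i then 1 else 0)) \<in> gradients n"
  | add: "(p, G) \<in> gradients n \<Longrightarrow> (q, H) \<in> gradients n \<Longrightarrow> (p + q, \<lambda>i. G i + H i) \<in> gradients n"
  | mult: "(p, G) \<in> gradients n \<Longrightarrow> (q, H) \<in> gradients n \<Longrightarrow>
      (p * q, \<lambda>i. p * H i + q * G i) \<in> gradients n"

lemma gradient_exists: "p \<in> poly_funs n \<Longrightarrow> \<exists>G. (p, G) \<in> gradients n"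
  by (induction rule: poly_funs.induct) (blast intro: gradients.intros)+

lemma gradients_poly_funs:
  "(p, G) \<in> gradients n \<Longrightarrow> p \<in> poly_funs n \<and> (\<forall>i. G i \<in> poly_funs n)"
proof (induction rule: gradients.induct)
  case (const c)
  then show ?case by (auto simp: zero_fun_def intro: poly_funs.intros)
next
  case (coord i)
  then show ?case
    by (auto simp: zero_fun_def one_fun_def intro: poly_funs.intros)
qed (blast intro: poly_funs.add poly_funs.mult)+

lemma gradient_line:
  assumes "(p, G) \<in> gradients n"
  shows "\<exists>h. (\<forall>t. poly h t = p (\<lambda>i. a i + t * v i)) \<and> coeff h 1 = (\<Sum>i<n. G i a * v i)"
  using assms
proof (induction rule: gradients.induct)
  case (const c)
  then show ?case by (intro exI[of _ "[:c:]"]) simp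
next
  case (coord i)
  then show ?case
    by (intro exI[of _ "[:a i, v i:]"]) (simp add: if_distrib[of "\<lambda>f. f a * _"] cong: if_cong)
next
  case (add p G q H)
  then obtain g h where "\<forall>t. poly g t = p (\<lambda>i. a i + t * v i)" "coeff g 1 = (\<Sum>i<n. G i a * v i)"
    "\<forall>t. poly h t = q (\<lambda>i. a i + t * v i)" "coeff h 1 = (\<Sum>i<n. H i a * v i)" by blast
  then show ?case by (intro exI[of _ "g + h"]) (simp add: sum.distrib algebra_simps)
next
  case (mult p G q H)
  then obtain g h where gh: "\<forall>t. poly g t = p (\<lambda>i. a i + t * v i)" "coeff g 1 = (\<Sum>i<n. G i a * v i)"
    "\<forall>t. poly h t = q (\<lambda>i. a i + t * v i)" "coeff h 1 = (\<Sum>i<n. H i a * v i)" by blast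
  have "coeff g 0 = p a" "coeff h 0 = q a"
    using gh(1,3) by (simp_all flip: poly_0_coeff_0)
  then have "coeff (g * h) 1 = (\<Sum>i<n. (p * H i + q * G i) a * v i)"
    using gh(2,4) by (simp add: coeff_mult sum.distrib algebra_simps sum_distrib_left)
  with gh show ?case by (intro exI[of _ "g * h"]) simp
qed

text \<open>A gradient is given along the construction of a polynomial function, and different constructions could
  lead to different gradients. The restriction to a line is a univariate polynomial, whose coefficients
  are determined by its values because the field is infinite.\<close>

lemma gradient_unique:
  fixes p :: "(nat \<Rightarrow> 'k::field_char_0) \<Rightarrow> 'k"
  assumes "(p, G) \<in> gradients n" "(p, H) \<in> gradients n"
  shows "(\<Sum>i<n. G i a * v i) = (\<Sum>i<n. H i a * v i)"
proof -
  obtain g h where "\<forall>t. poly g t = p (\<lambda>i. a i + t * v i)" "coeff g 1 = (\<Sum>i<n. G i a * v i)"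
    "\<forall>t. poly h t = p (\<lambda>i. a i + t * v i)" "coeff h 1 = (\<Sum>i<n. H i a * v i)"
    using gradient_line[OF assms(1)] gradient_line[OF assms(2)] by blast
  moreover from this have "g = h" by (intro poly_ext) simp
  ultimately show ?thesis by simp
qed

definition dirder :: "nat \<Rightarrow> ((nat \<Rightarrow> 'k::field) \<Rightarrow> 'k) \<Rightarrow> (nat \<Rightarrow> 'k) \<Rightarrow> (nat \<Rightarrow> 'k) \<Rightarrow> 'k"
  where "dirder n p a v = (\<Sum>i<n. (SOME G. (p, G) \<in> gradients n) i a * v i)"

lemma dirder_eq:
  fixes p :: "(nat \<Rightarrow> 'k::field_char_0) \<Rightarrow> 'k"
  shows "(p, G) \<in> gradients n \<Longrightarrow> dirder n p a v = (\<Sum>i<n. G i a * v i)"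
  unfolding dirder_def by (rule gradient_unique, rule someI[where P = "\<lambda>G. (p, G) \<in> gradients n"])

lemma dirder_simps:
  fixes p :: "(nat \<Rightarrow> 'k::field_char_0) \<Rightarrow> 'k"
  shows "dirder n (\<lambda>_. c) a v = 0" "i < n \<Longrightarrow> dirder n (\<lambda>a. a i) a v = v i"
    "p \<in> poly_funs n \<Longrightarrow> q \<in> poly_funs n \<Longrightarrow> dirder n (p + q) a v = dirder n p a v + dirder n q a v"
    "p \<in> poly_funs n \<Longrightarrow> q \<in> poly_funs n \<Longrightarrow> dirder n (p * q) a v = p a * dirder n q a v + q a * dirder n p a v"
proof -
  show "dirder n (\<lambda>_. c) a v = 0" using dirder_eq[OF gradients.const] by simp
  show "i < n \<Longrightarrow> dirder n (\<lambda>a. a i) a v = v i"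
    using dirder_eq[OF gradients.coord, of i n a v] by (simp add: if_distrib[of "\<lambda>f. f a * _"] cong: if_cong)
  assume "p \<in> poly_funs n" "q \<in> poly_funs n"
  then obtain G H where GH: "(p, G) \<in> gradients n" "(q, H) \<in> gradients n" using gradient_exists by blast
  then show "dirder n (p + q) a v = dirder n p a v + dirder n q a v"
    "dirder n (p * q) a v = p a * dirder n q a v + q a * dirder n p a v"
    by (simp_all add: dirder_eq[OF GH(1)] dirder_eq[OF GH(2)] dirder_eq[OF gradients.add[OF GH]]
      dirder_eq[OF gradients.mult[OF GH]] sum.distrib algebra_simps sum_distrib_left)
qed

text \<open>Induction on the number of variables: a common nonzero point of suitable coefficients leaves countably
  many nonzero polynomials in the last variable, which together have only countably many roots.\<close>

lemma common_nonzero_of_countably_many: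
  fixes q :: "nat \<Rightarrow> (nat \<Rightarrow> 'k::field) \<Rightarrow> 'k"
  assumes "uncountable (UNIV :: 'k set)"
  shows "(\<And>n. q n \<in> poly_funs d \<and> q n \<noteq> 0) \<Longrightarrow> \<exists>a. \<forall>n. q n a \<noteq> 0"
proof (induction d arbitrary: q)
  case 0
  have "q n a = q n b" for n a b using poly_funs_cong[of "q n" 0 a b] 0 by auto
  then have "q n = (\<lambda>_. q n a)" for n a by blast
  then have "q n a \<noteq> 0" for n a using 0[of n] by (metis zero_fun_def)
  then show ?case by blast
next
  case (Suc d)
  have "\<exists>c N. (\<forall>i. c i \<in> poly_funs d) \<and> (\<forall>a. q n a = (\<Sum>i\<le>N. c i a * a d ^ i))" for n
    using poly_funs_Suc_expand[OF conjunct1[OF Suc.prems[of n]]] by blast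
  then have "\<forall>n. \<exists>cN. (\<forall>i. fst cN i \<in> poly_funs d) \<and> (\<forall>a. q n a = (\<Sum>i\<le>snd cN. fst cN i a * a d ^ i))"
    by (metis fst_conv snd_conv)
  from choice[OF this] obtain cN where
    cN: "\<forall>n. (\<forall>i. fst (cN n) i \<in> poly_funs d) \<and> (\<forall>a. q n a = (\<Sum>i\<le>snd (cN n). fst (cN n) i a * a d ^ i))"
    by blast
  define c N where "c n = fst (cN n)" and "N n = snd (cN n)" for n
  have c: "c n i \<in> poly_funs d" "q n a = (\<Sum>i\<le>N n. c n i a * a d ^ i)" for n i a
    using cN by (simp_all add: c_def N_def)
  have "\<exists>i\<le>N n. c n i \<noteq> 0" for n
  proof (rule ccontr)
    assume "\<not> (\<exists>i\<le>N n. c n i \<noteq> 0)"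
    then have "q n a = 0" for a unfolding c(2) by (intro sum.neutral) simp
    then have "q n = 0" by (simp add: fun_eq_iff)
    then show False using Suc.prems by blast
  qed
  then have "\<exists>j. \<forall>n. j n \<le> N n \<and> c n (j n) \<noteq> 0" by (intro choice allI) blast
  then obtain j where j: "\<And>n. j n \<le> N n" "\<And>n. c n (j n) \<noteq> 0" by blast
  have "\<exists>b. \<forall>n. c n (j n) b \<noteq> 0" by (rule Suc.IH) (rule conjI[OF c(1) j(2)])
  then obtain b where b: "\<And>n. c n (j n) b \<noteq> 0" by blast
  define h where "h n = (\<Sum>i\<le>N n. monom (c n i b) i)" for n
  have "coeff (h n) (j n) \<noteq> 0" for n using b[of n] j(1)[of n] by (simp add: h_def coeff_sum)
  then have nz: "h n \<noteq> 0" for n by (auto simp: poly_eq_iff)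
  have "countable (\<Union>n. {t. poly (h n) t = 0})"
    using nz by (intro countable_UN) (simp_all add: countable_finite poly_roots_finite)
  then have "(\<Union>n. {t. poly (h n) t = 0}) \<noteq> UNIV"
    using assms by auto
  then obtain t where t: "\<And>n. poly (h n) t \<noteq> 0" by blast
  have "q n (b(d := t)) = poly (h n) t" for n
  proof -
    have "c n i (b(d := t)) = c n i b" for i
      by (rule poly_funs_cong[OF c(1)]) simp
    then show ?thesis by (simp add: c(2) h_def poly_sum poly_monom)
  qed
  then have "\<forall>n. q n (b(d := t)) \<noteq> 0" using t by metis
  then show ?case by blast
qed

section \<open>Lifting points and tangent vectors to a variety\<close>

definition coordinates :: "('a, 'k::field) variety \<Rightarrow> nat \<Rightarrow> ('a \<Rightarrow> nat \<Rightarrow> 'k) \<Rightarrow> bool"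
  where "coordinates A n \<phi> \<longleftrightarrow>
    cring A = (\<lambda>p. res (pts A) (\<lambda>x. p (\<phi> x))) ` poly_funs n \<and> inj_on \<phi> (pts A) \<and>
    (\<forall>x\<in>pts A. \<phi> x \<in> {..<n} \<rightarrow>\<^sub>E UNIV) \<and>
    (\<forall>a\<in>{..<n} \<rightarrow>\<^sub>E UNIV. (\<forall>p\<in>poly_funs n. res (pts A) (\<lambda>x. p (\<phi> x)) = 0 \<longrightarrow> p a = 0) \<longrightarrow>
      (\<exists>x\<in>pts A. \<phi> x = a))"

lemma coordinatesD:
  assumes "coordinates A n \<phi>"
  shows "cring A = (\<lambda>p. res (pts A) (\<lambda>x. p (\<phi> x))) ` poly_funs n" "inj_on \<phi> (pts A)"
    "x \<in> pts A \<Longrightarrow> \<phi> x \<in> {..<n} \<rightarrow>\<^sub>E UNIV"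
    "a \<in> {..<n} \<rightarrow>\<^sub>E UNIV \<Longrightarrow>
      \<forall>p\<in>poly_funs n. res (pts A) (\<lambda>x. p (\<phi> x)) = 0 \<longrightarrow> p a = 0 \<Longrightarrow> \<exists>x\<in>pts A. \<phi> x = a"
  using assms unfolding coordinates_def by simp_all

lemma variety_coordinates:
  assumes "affine_variety A"
  shows "\<exists>n \<phi>. coordinates A n \<phi>"
proof -
  from assms obtain n Z \<phi> where *: "algebraic_set n Z" "bij_betw \<phi> (pts A) Z"
    "cring A = (\<lambda>p. res (pts A) (p \<circ> \<phi>)) ` poly_funs n"
    unfolding affine_variety_def by blast
  from *(1) obtain S where S: "S \<subseteq> poly_funs n" "Z = {a \<in> {..<n} \<rightarrow>\<^sub>E UNIV. \<forall>p\<in>S. p a = 0}"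
    unfolding algebraic_set_def by blast
  have im: "\<phi> ` pts A = Z" and inj: "inj_on \<phi> (pts A)" using *(2) by (auto simp: bij_betw_def)
  show ?thesis
    unfolding coordinates_def
  proof (intro exI conjI ballI impI)
    show "cring A = (\<lambda>p. res (pts A) (\<lambda>x. p (\<phi> x))) ` poly_funs n"
      unfolding *(3) o_def ..
    show "inj_on \<phi> (pts A)" by (fact inj)
    show "\<phi> x \<in> {..<n} \<rightarrow>\<^sub>E UNIV" if "x \<in> pts A" for x
      using that im S(2) by blast
  next
    fix a assume a: "a \<in> {..<n} \<rightarrow>\<^sub>E (UNIV :: 'b set)"
      "\<forall>p\<in>poly_funs n. res (pts A) (\<lambda>x. p (\<phi> x)) = 0 \<longrightarrow> p a = 0"
    have "p a = 0" if p: "p \<in> S" for p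
    proof (rule a(2)[rule_format])
      show "p \<in> poly_funs n" using p S(1) by blast
      have "p (\<phi> x) = 0" if "x \<in> pts A" for x using p that im S(2) by blast
      then show "res (pts A) (\<lambda>x. p (\<phi> x)) = 0" by (simp add: res_def fun_eq_iff)
    qed
    then have "a \<in> Z" using a(1) S(2) by blast
    then show "\<exists>x\<in>pts A. \<phi> x = a" using im by blast
  qed
qed

definition alg_indep_mod :: "('a, 'k::field) variety \<Rightarrow> ('a \<Rightarrow> 'k) set \<Rightarrow> nat \<Rightarrow> (nat \<Rightarrow> 'a \<Rightarrow> 'k) \<Rightarrow> bool"
  where "alg_indep_mod A P d y \<longleftrightarrow> (\<forall>i<d. y i \<in> cring A) \<and>
    (\<forall>q\<in>poly_funs d. res (pts A) (\<lambda>x. q (\<lambda>i. y i x)) \<in> P \<longrightarrow> q = 0)"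

lemma alg_indep_modD:
  assumes "alg_indep_mod A P d y"
  shows "i < d \<Longrightarrow> y i \<in> cring A"
    "q \<in> poly_funs d \<Longrightarrow> res (pts A) (\<lambda>x. q (\<lambda>i. y i x)) \<in> P \<Longrightarrow> q = 0"
proof -
  note * = assms[unfolded alg_indep_mod_def]
  show "i < d \<Longrightarrow> y i \<in> cring A" by (rule conjunct1[OF *, rule_format])
  show "q \<in> poly_funs d \<Longrightarrow> res (pts A) (\<lambda>x. q (\<lambda>i. y i x)) \<in> P \<Longrightarrow> q = 0"
    by (rule conjunct2[OF *, rule_format])
qed

lemma res_const_cring: "affine_variety A \<Longrightarrow> res (pts A) (\<lambda>_. c) \<in> cring A"
  using affine_variety_cring(4)[OF _ affine_variety_cring(1), of A c] by (simp add: const_eq_fun res_fscale)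

lemma cring_closure:
  assumes A: "affine_variety A" and f: "f \<in> cring A" and g: "g \<in> cring A"
  shows "f - g \<in> cring A" "- f \<in> cring A"
proof -
  have "fscale (-1) f \<in> cring A" "fscale (-1) g \<in> cring A" by (intro affine_variety_cring(4)[OF A] f g)+
  then have "- f \<in> cring A" "- g \<in> cring A" by (simp_all add: fscale_def fun_Compl_def)
  then show "- f \<in> cring A" "f - g \<in> cring A"
    using affine_variety_cring(2)[OF A f, of "- g"] by simp_all
qed

text \<open>The unit of \<open>cring A\<close> is the indicator function of the point set. Dropping the requirement that the
  functions vanish off the variety gives a subring of the ring of all functions with the constant function
  one as its unit.\<close>

definition extend_cring :: "('a, 'k::field) variety \<Rightarrow> ('a \<Rightarrow> 'k) set"
  where "extend_cring A = {f. res (pts A) f \<in> cring A}"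

lemma subring_set_extend_cring:
  assumes A: "affine_variety A"
  shows "subring_set (extend_cring A)" "(\<lambda>_. c) \<in> extend_cring A" "cring A \<subseteq> extend_cring A"
proof -
  have minus: "res (pts A) (f - g) = res (pts A) f - res (pts A) g" for f g :: "'a \<Rightarrow> 'b"
    by (auto simp: res_def fun_eq_iff)
  show "subring_set (extend_cring A)"
    using affine_variety_cring[OF A] cring_closure[OF A]
    unfolding subring_set_def extend_cring_def by (auto simp: res_mult minus)
  show "(\<lambda>_. c) \<in> extend_cring A" using res_const_cring[OF A] by (simp add: extend_cring_def)
  show "cring A \<subseteq> extend_cring A" using affine_variety_cring(5)[OF A] by (auto simp: extend_cring_def)
qed

lemma cring_compose:
  assumes A: "affine_variety A" and q: "q \<in> poly_funs d" and y: "\<And>i. i < d \<Longrightarrow> y i \<in> cring A"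
  shows "res (pts A) (\<lambda>x. q (\<lambda>i. y i x)) \<in> cring A"
  using poly_funs_compose[OF q subring_set_extend_cring(1,2)[OF A], of y] y subring_set_extend_cring(3)[OF A]
  by (auto simp: extend_cring_def)

lemma prime_ideal_pullback:
  assumes A: "affine_variety A" and P: "prime_ideal_in (cring A) P"
    and R: "subring_set R" "R \<subseteq> extend_cring A" "cring A \<subseteq> res (pts A) ` R"
  shows "prime_ideal_in R {f \<in> R. res (pts A) f \<in> P}"
proof -
  note Pm = prime_ideal_inD[OF P]
  have minus: "res (pts A) (f - g) = res (pts A) f - res (pts A) g" for f g :: "'a \<Rightarrow> 'b"
    by (auto simp: res_def fun_eq_iff)
  have RC: "res (pts A) f \<in> cring A" if "f \<in> R" for f using R(2) that by (auto simp: extend_cring_def)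
  obtain f where "f \<in> cring A" "f \<notin> P" using Pm(1,2) by blast
  then have "{f \<in> R. res (pts A) f \<in> P} \<subset> R" using R(3) by blast
  moreover have "res (pts A) 0 = (0 :: 'a \<Rightarrow> 'b)" by (auto simp: res_def)
  ultimately show ?thesis
    using Pm RC subring_setD[OF R(1)] unfolding prime_ideal_in_def by (auto simp: minus res_mult)
qed

text \<open>\<open>x\<close> is a point over \<open>b\<close> of the subvariety defined by \<open>P\<close>, off the hypersurface of \<open>v\<close>, at
  which the map to affine space given by \<open>y\<close> is submersive.\<close>

definition submersive_lift ::
  "('a, 'k::field) variety \<Rightarrow> ('a \<Rightarrow> 'k) set \<Rightarrow> nat \<Rightarrow> (nat \<Rightarrow> 'a \<Rightarrow> 'k) \<Rightarrow> ('a \<Rightarrow> 'k) \<Rightarrow> (nat \<Rightarrow> 'k) \<Rightarrow> 'a \<Rightarrow> bool"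
  where "submersive_lift A P d y v b x \<longleftrightarrow> x \<in> pts A \<and> (\<forall>f\<in>P. f x = 0) \<and> (\<forall>i<d. y i x = b i) \<and> v x \<noteq> 0 \<and>
    (\<forall>w. \<exists>\<delta>\<in>tangent A x. (\<forall>f\<in>P. \<delta> f = 0) \<and> (\<forall>i<d. \<delta> (y i) = w i))"

lemma submersive_liftD:
  assumes "submersive_lift A P d y v b x"
  shows "x \<in> pts A" "f \<in> P \<Longrightarrow> f x = 0" "i < d \<Longrightarrow> y i x = b i" "v x \<noteq> 0"
    "\<exists>\<delta>\<in>tangent A x. (\<forall>f\<in>P. \<delta> f = 0) \<and> (\<forall>i<d. \<delta> (y i) = w i)"
  using assms unfolding submersive_lift_def by simp_all

text \<open>The subring generated by algebraically independent functions is a polynomial ring: it has a point over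
  every \<open>b\<close> and there a tangent vector for every direction \<open>w\<close>, the directional derivative. Both extend to
  the coordinate ring, which is finitely generated.\<close>

lemma lift_point_and_tangents:
  fixes A :: "('a, 'k::{alg_closed_field,field_char_0}) variety"
  assumes A: "affine_variety A" and P: "prime_ideal_in (cring A) P"
    and y: "alg_indep_mod A P d y" and v: "v \<in> cring A" "v \<notin> P"
  shows "\<exists>u\<in>poly_funs d. u \<noteq> 0 \<and> (\<forall>b. u b \<noteq> 0 \<longrightarrow> (\<exists>x. submersive_lift A P d y v b x))"
proof -
  obtain n \<phi> where co: "coordinates A n \<phi>" using variety_coordinates[OF A] by blast
  note cr = coordinatesD(1)[OF co] and pt = coordinatesD(4)[OF co]
  note Pm = prime_ideal_inD[OF P]
  \<comment> \<open>The polynomials in the coordinates as functions on the whole type, so that the unit is the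
    constant function one.\<close>
  define R where "R = (\<lambda>p x. p (\<phi> x)) ` poly_funs n"
  have const: "(\<lambda>_. c) \<in> R" for c
    unfolding R_def by (rule image_eqI[OF _ poly_funs.const[of c]]) simp
  have pc: "(\<lambda>x. p (\<phi> x)) \<in> R" if "p \<in> poly_funs n" for p using that by (auto simp: R_def)
  have R: "subring_set R"
    unfolding subring_set_def
  proof (intro conjI ballI)
    show "1 \<in> R" using const[of 1] by (simp add: one_fun_def)
    fix f g assume "f \<in> R" "g \<in> R"
    then obtain p q where "f = (\<lambda>x. p (\<phi> x))" "g = (\<lambda>x. q (\<phi> x))" "p \<in> poly_funs n" "q \<in> poly_funs n"
      by (auto simp: R_def)
    then show "f - g \<in> R" "f * g \<in> R"
      using pc[OF poly_funs_simps(2), of p q] pc[OF poly_funs.mult, of p q]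
      by (simp_all add: fun_diff_def times_fun_def)
  qed
  have cR: "cring A = res (pts A) ` R" by (auto simp: cr R_def)
  have RE: "R \<subseteq> extend_cring A" by (auto simp: extend_cring_def cR)
  define P0 where "P0 = {f \<in> R. res (pts A) f \<in> P}"
  have P0: "prime_ideal_in R P0"
    unfolding P0_def by (rule prime_ideal_pullback[OF A P R RE]) (simp add: cR)
  note P0m = prime_ideal_inD[OF P0]
  have char: "of_nat m \<notin> P0" if "m > 0" for m
  proof
    assume *: "of_nat m \<in> P0"
    have "(\<lambda>_. inverse (of_nat m)) * of_nat m \<in> P0" by (rule P0m(5)[OF const *])
    moreover have "(\<lambda>_. inverse (of_nat m)) * of_nat m = (1 :: 'a \<Rightarrow> 'k)"
      using that by (auto simp: fun_eq_iff of_nat_fun)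
    ultimately have "f \<in> P0" if "f \<in> R" for f using P0m(5)[OF that, of 1] by simp
    then show False using P0m(1,2) by blast
  qed
  have lift: "\<exists>g. g \<in> R \<and> res (pts A) g = f" if "f \<in> cring A" for f
    by (rule imageE[OF that[unfolded cR]]) (rule exI, rule conjI, assumption, rule sym)
  have exY: "\<exists>Y. Y \<in> R \<and> res (pts A) Y = y i" if "i < d" for i
    by (rule lift[OF alg_indep_modD(1)[OF y that]])
  define Y where "Y i = (SOME Y. Y \<in> R \<and> res (pts A) Y = y i)" for i
  have YR: "Y i \<in> R \<and> res (pts A) (Y i) = y i" if "i < d" for i
    unfolding Y_def by (rule someI_ex[OF exY[OF that]])
  note Y = conjunct1[OF YR] conjunct2[OF YR]
  have Yy: "q (\<lambda>i. Y i x) = q (\<lambda>i. y i x)" if "q \<in> poly_funs d" "x \<in> pts A" for q x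
  proof (rule poly_funs_cong[OF that(1)])
    fix i assume "i < d"
    from fun_cong[OF Y(2)[OF this], of x] show "Y i x = y i x" using that(2) by (simp add: res_def)
  qed
  have rY: "res (pts A) (\<lambda>x. q (\<lambda>i. Y i x)) = res (pts A) (\<lambda>x. q (\<lambda>i. y i x))" if "q \<in> poly_funs d" for q
    using Yy[OF that] by (auto simp: res_def fun_eq_iff)
  define B where "B = (\<lambda>q x. q (\<lambda>i. Y i x)) ` poly_funs d"
  have pB: "(\<lambda>x. q (\<lambda>i. Y i x)) \<in> B" if "q \<in> poly_funs d" for q using that by (auto simp: B_def)
  have constB: "(\<lambda>_. c) \<in> B" for c
    unfolding B_def by (rule image_eqI[OF _ poly_funs.const[of c]]) simp
  have B: "subring_set B"
    unfolding subring_set_def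
  proof (intro conjI ballI)
    show "1 \<in> B" using constB[of 1] by (simp add: one_fun_def)
    fix f g assume "f \<in> B" "g \<in> B"
    then obtain p q where "f = (\<lambda>x. p (\<lambda>i. Y i x))" "g = (\<lambda>x. q (\<lambda>i. Y i x))" "p \<in> poly_funs d" "q \<in> poly_funs d"
      by (auto simp: B_def)
    then show "f - g \<in> B" "f * g \<in> B"
      using pB[OF poly_funs_simps(2), of p q] pB[OF poly_funs.mult, of p q]
      by (simp_all add: fun_diff_def times_fun_def)
  qed
  have BR: "B \<subseteq> R"
    using poly_funs_compose[OF _ R const, of _ d Y] Y(1) by (auto simp: B_def)
  define xs where "xs = map (\<lambda>i x. \<phi> x i) [0..<n]"
  have xs: "set xs \<subseteq> R" by (auto simp: xs_def intro!: pc[OF poly_funs.coord])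
  note adj = adjoin_list_props[OF R B BR xs]
  have full: "adjoin_list B xs = R"
  proof
    show "R \<subseteq> adjoin_list B xs"
      unfolding R_def
    proof (rule image_subsetI)
      fix p :: "(nat \<Rightarrow> 'k) \<Rightarrow> 'k" assume "p \<in> poly_funs n"
      then show "(\<lambda>x. p (\<phi> x)) \<in> adjoin_list B xs"
        by (rule poly_funs_compose[OF _ adj(1), of p n "\<lambda>i x. \<phi> x i"])
          (use constB adj(2,3) in \<open>auto simp: xs_def\<close>)
    qed
  qed (fact adj(4))
  obtain v0 where v0: "v0 \<in> R" "res (pts A) v0 = v" using v(1) cR by auto
  have "v0 \<in> adjoin_list B xs" "v0 \<notin> P0" using v0 v(2) full by (auto simp: P0_def)
  from extend_points[OF R P0 B BR char xs this, where 'k='k] obtain u0 where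
    u0: "u0 \<in> B" "u0 \<notin> P0" and ext: "\<And>\<psi>::('a \<Rightarrow> 'k) \<Rightarrow> 'k. pt_on B P0 \<psi> \<Longrightarrow> \<psi> u0 \<noteq> 0 \<Longrightarrow>
    (\<exists>\<psi>'. pt_on R P0 \<psi>' \<and> (\<forall>b\<in>B. \<psi>' b = \<psi> b) \<and> \<psi>' v0 \<noteq> 0 \<and>
      (\<forall>\<delta>. tangent_on B P0 \<psi> \<delta> \<longrightarrow> (\<exists>\<delta>'. tangent_on R P0 \<psi>' \<delta>' \<and> (\<forall>b\<in>B. \<delta>' b = \<delta> b))))"
    unfolding full by blast
  obtain u where u: "u \<in> poly_funs d" "u0 = (\<lambda>x. u (\<lambda>i. Y i x))" using u0(1) by (auto simp: B_def)
  have indep: "q = 0" if "q \<in> poly_funs d" "(\<lambda>x. q (\<lambda>i. Y i x)) \<in> P0" for q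
    using that(2) unfolding P0_def by (intro alg_indep_modD(2)[OF y that(1)]) (simp add: rY[OF that(1)])
  have uniq: "q = q'" if "q \<in> poly_funs d" "q' \<in> poly_funs d"
    "(\<lambda>x. q (\<lambda>i. Y i x)) = (\<lambda>x. q' (\<lambda>i. Y i x))" for q q'
  proof -
    have "(\<lambda>x. (q - q') (\<lambda>i. Y i x)) = 0" using fun_cong[OF that(3)] by (auto simp: fun_eq_iff)
    then have "q - q' = 0" using indep[OF poly_funs_simps(2)[OF that(1,2)]] P0m(3) by simp
    then show ?thesis by simp
  qed
  \<comment> \<open>By independence an element of \<open>B\<close> is a polynomial in \<open>Y\<close> in only one way.\<close>
  define rep where "rep f = (SOME q. q \<in> poly_funs d \<and> f = (\<lambda>x. q (\<lambda>i. Y i x)))" for f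
  have rep: "rep (\<lambda>x. q (\<lambda>i. Y i x)) = q" if "q \<in> poly_funs d" for q
    unfolding rep_def by (rule some_equality) (use that uniq in auto)
  have rep_const: "rep (\<lambda>_. c) = (\<lambda>_. c)" for c by (rule rep[OF poly_funs.const])
  show ?thesis
  proof (intro bexI[OF _ u(1)] conjI allI impI)
    show "u \<noteq> 0" using u0(2) u(2) P0m(3) by (auto simp: zero_fun_def)
    fix b assume b: "u b \<noteq> 0"
    define \<psi> where "\<psi> f = rep f b" for f
    have \<psi>: "pt_on B P0 \<psi>"
      unfolding pt_on_def
    proof (intro conjI ballI)
      show "\<psi> 1 = 1" using rep_const[of 1] by (simp add: \<psi>_def one_fun_def)
      fix f g assume "f \<in> B" "g \<in> B"
      then obtain p q where pq: "f = (\<lambda>x. p (\<lambda>i. Y i x))" "g = (\<lambda>x. q (\<lambda>i. Y i x))" "p \<in> poly_funs d" "q \<in> poly_funs d"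
        by (auto simp: B_def)
      then show "\<psi> (f + g) = \<psi> f + \<psi> g" "\<psi> (f * g) = \<psi> f * \<psi> g"
        using rep[OF poly_funs.add, of p q] rep[OF poly_funs.mult, of p q]
        by (simp_all add: \<psi>_def rep plus_fun_def times_fun_def)
    next
      fix f assume "f \<in> B \<inter> P0"
      then obtain q where "f = (\<lambda>x. q (\<lambda>i. Y i x))" "q \<in> poly_funs d" "f \<in> P0" by (auto simp: B_def)
      then show "\<psi> f = 0" using indep[of q] rep[of q] by (simp add: \<psi>_def)
    qed
    have tan: "tangent_on B P0 \<psi> (\<lambda>f. dirder d (rep f) b w)" for w
      unfolding tangent_on_def
    proof (intro conjI ballI)
      fix f g assume "f \<in> B" "g \<in> B"
      then obtain p q where pq: "f = (\<lambda>x. p (\<lambda>i. Y i x))" "g = (\<lambda>x. q (\<lambda>i. Y i x))" "p \<in> poly_funs d" "q \<in> poly_funs d"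
        by (auto simp: B_def)
      have "rep (f + g) = p + q" "rep (f * g) = p * q"
        using rep[OF poly_funs.add, of p q] rep[OF poly_funs.mult, of p q] pq
        by (simp_all add: plus_fun_def times_fun_def)
      then show "dirder d (rep (f + g)) b w = dirder d (rep f) b w + dirder d (rep g) b w"
        "dirder d (rep (f * g)) b w = \<psi> f * dirder d (rep g) b w + \<psi> g * dirder d (rep f) b w"
        using pq by (simp_all add: rep dirder_simps(3,4) \<psi>_def)
    next
      fix f assume "f \<in> B \<inter> P0"
      then obtain q where "f = (\<lambda>x. q (\<lambda>i. Y i x))" "q \<in> poly_funs d" "f \<in> P0" by (auto simp: B_def)
      then have "rep f = (\<lambda>_. 0)" using indep[of q] rep[of q] by (simp add: zero_fun_def)
      then show "dirder d (rep f) b w = 0" by (simp add: dirder_simps)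
    qed
    have "\<psi> u0 \<noteq> 0" using b u rep by (simp add: \<psi>_def)
    from ext[OF \<psi> this] obtain \<psi>' where \<psi>': "pt_on R P0 \<psi>'" "\<And>b. b \<in> B \<Longrightarrow> \<psi>' b = \<psi> b" "\<psi>' v0 \<noteq> 0"
      and ext': "\<And>\<delta>. tangent_on B P0 \<psi> \<delta> \<Longrightarrow> \<exists>\<delta>'. tangent_on R P0 \<psi>' \<delta>' \<and> (\<forall>b\<in>B. \<delta>' b = \<delta> b)"
      by blast
    \<comment> \<open>The coordinates of the point that belongs to the extended homomorphism.\<close>
    define a where "a = restrict (\<lambda>i. \<psi>' (\<lambda>x. \<phi> x i)) {..<n}"
    have ev: "\<psi>' (\<lambda>x. p (\<phi> x)) = p a" if "p \<in> poly_funs n" for p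
      using that
    proof induction
      case (const c)
      have "\<psi> (\<lambda>_. c) = c" by (simp add: \<psi>_def rep_const)
      then show ?case using \<psi>'(2)[OF constB] by simp
    next
      case (coord i)
      then show ?case by (simp add: a_def)
    next
      case (add p q)
      then show ?case using pt_onD(1)[OF \<psi>'(1) pc pc, of p q] by (simp add: plus_fun_def)
    next
      case (mult p q)
      then show ?case using pt_onD(2)[OF \<psi>'(1) pc pc, of p q] by (simp add: times_fun_def)
    qed
    have "\<exists>x\<in>pts A. \<phi> x = a"
    proof (rule pt, safe)
      fix p assume p: "p \<in> poly_funs n" "res (pts A) (\<lambda>x. p (\<phi> x)) = 0"
      then have "(\<lambda>x. p (\<phi> x)) \<in> P0" using pc Pm(3) by (simp add: P0_def)
      then show "p a = 0" using pt_onD(4)[OF \<psi>'(1) pc] ev p by metis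
    qed (auto simp: a_def restrict_def split: if_splits)
    then obtain x where x: "x \<in> pts A" "\<phi> x = a" by blast
    have evR: "\<psi>' f = f x" if "f \<in> R" for f using that ev x by (auto simp: R_def)
    have resx: "res (pts A) f x = f x" for f :: "'a \<Rightarrow> 'k" using x by (simp add: res_def)
    have lift_P: "\<And>g. g \<in> R \<Longrightarrow> res (pts A) g \<in> P \<Longrightarrow> g \<in> P0" by (simp add: P0_def)
    show "\<exists>x. submersive_lift A P d y v b x"
      unfolding submersive_lift_def
    proof (rule exI[of _ x], intro x(1) conjI ballI allI impI)
      fix f assume "f \<in> P"
      then obtain g where "g \<in> P0" "res (pts A) g = f" using lift Pm(1) lift_P by (metis subsetD)
      then show "f x = 0" using evR pt_onD(4)[OF \<psi>'(1)] P0m(1) resx by (metis subsetD)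
    next
      fix i assume i: "i < d"
      have "Y i \<in> B" using pB[OF poly_funs.coord[OF i]] by simp
      then have "Y i x = \<psi> (Y i)" using evR \<psi>'(2) BR by (metis subsetD)
      also have "\<dots> = b i" using rep[OF poly_funs.coord[OF i]] by (simp add: \<psi>_def)
      finally show "y i x = b i" using Y(2)[OF i] resx by metis
    next
      show "v x \<noteq> 0" using \<psi>'(3) evR[OF v0(1)] v0(2) resx by metis
    next
      fix w
      obtain \<epsilon> where \<epsilon>: "tangent_on R P0 \<psi>' \<epsilon>" "\<And>f. f \<in> B \<Longrightarrow> \<epsilon> f = dirder d (rep f) b w"
        using ext'[OF tan] by blast
      note ead = additive_on_simps(2)[of R \<epsilon>, OF R tangent_onD(1)[OF \<epsilon>(1)]]
      define \<delta> where "\<delta> f = (if f \<in> cring A then \<epsilon> (SOME g. g \<in> R \<and> res (pts A) g = f) else 0)" for f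
      have \<delta>: "\<delta> (res (pts A) g) = \<epsilon> g" if g: "g \<in> R" for g
      proof -
        define h where "h = (SOME h. h \<in> R \<and> res (pts A) h = res (pts A) g)"
        have h: "h \<in> R \<and> res (pts A) h = res (pts A) g" unfolding h_def by (rule someI[of _ g]) (use g in simp)
        then have "res (pts A) (h - g) = 0" by (auto simp: res_def fun_eq_iff split: if_splits)
        then have "h - g \<in> P0" using subring_setD(3)[OF R] h g Pm(3) by (simp add: P0_def)
        then have "\<epsilon> (h - g) = 0" using tangent_onD(3)[OF \<epsilon>(1)] P0m(1) by blast
        then have "\<epsilon> h = \<epsilon> g" using ead h g by simp
        moreover have "res (pts A) g \<in> cring A" using g cR by blast
        ultimately show ?thesis unfolding \<delta>_def by (simp flip: h_def)
      qed
      have mem: "\<delta> \<in> tangent A x"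
      proof (rule tangentI)
        fix f assume "f \<notin> cring A" then show "\<delta> f = 0" by (simp add: \<delta>_def)
      next
        fix f g assume "f \<in> cring A" "g \<in> cring A"
        then obtain f' g' where "f' \<in> R" "g' \<in> R" "res (pts A) f' = f" "res (pts A) g' = g" using lift by metis
        then show "\<delta> (f + g) = \<delta> f + \<delta> g" "\<delta> (f * g) = f x * \<delta> g + g x * \<delta> f"
          using \<delta>[of f'] \<delta>[of g'] \<delta>[of "f' + g'"] \<delta>[of "f' * g'"] subring_setD(4,6)[OF R, of f' g']
            tangent_onD(1,2)[OF \<epsilon>(1), of f' g'] evR resx
          by (auto simp: res_add res_mult)
      next
        fix c f assume "f \<in> cring A"
        then obtain g where g: "g \<in> R" "res (pts A) g = f" using lift by metis
        have "fscale c g = (\<lambda>_. c) * g" by (auto simp: fscale_def)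
        moreover have "\<epsilon> (\<lambda>_. c) = 0"
          using \<epsilon>(2)[OF constB] by (simp add: rep_const dirder_simps)
        ultimately have "\<epsilon> (fscale c g) = c * \<epsilon> g"
          using tangent_onD(2)[OF \<epsilon>(1) const g(1), of c] evR[OF const] by simp
        moreover have "fscale c g \<in> R"
          unfolding \<open>fscale c g = (\<lambda>_. c) * g\<close> by (rule subring_setD(4)[OF R const g(1)])
        moreover have "res (pts A) (fscale c g) = fscale c f" by (simp add: res_fscale g(2))
        ultimately show "\<delta> (fscale c f) = c * \<delta> f"
          using \<delta>[OF g(1)] \<delta>[of "fscale c g"] g(2) by simp
      qed
      moreover have "\<forall>f\<in>P. \<delta> f = 0"
      proof
        fix f assume "f \<in> P"
        then obtain g where "g \<in> P0" "res (pts A) g = f" using lift Pm(1) lift_P by (metis subsetD)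
        then show "\<delta> f = 0" using \<delta> tangent_onD(3)[OF \<epsilon>(1)] P0m(1) by (metis subsetD)
      qed
      moreover have "\<delta> (y i) = w i" if i: "i < d" for i
      proof -
        have "Y i \<in> B" using pB[OF poly_funs.coord[OF i]] by simp
        then have "\<epsilon> (Y i) = w i"
          using \<epsilon>(2) rep[OF poly_funs.coord[OF i]] by (simp add: dirder_simps i)
        then show ?thesis using \<delta>[OF Y(1)[OF i]] Y(2)[OF i] by simp
      qed
      ultimately show "\<exists>\<delta>\<in>tangent A x. (\<forall>f\<in>P. \<delta> f = 0) \<and> (\<forall>i<d. \<delta> (y i) = w i)" by blast
    qed
  qed
qed

section \<open>Irreducible closed subsets\<close>

definition zero_ideal :: "('a, 'k::field) variety \<Rightarrow> 'a set \<Rightarrow> ('a \<Rightarrow> 'k) set"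
  where "zero_ideal A C = {f \<in> cring A. \<forall>x\<in>C. f x = 0}"

lemma closedin_zero_set: "affine_variety A \<Longrightarrow> S \<subseteq> cring A \<Longrightarrow> closedin (zariski A) (zero_set A S)"
  unfolding closedin_zariski by blast

lemma closedin_zariski_subset: "affine_variety A \<Longrightarrow> closedin (zariski A) C \<Longrightarrow> C \<subseteq> pts A"
  using closedin_subset[of "zariski A" C] by (simp add: topspace_zariski)

lemma separating_function:
  assumes "affine_variety A" "closedin (zariski A) C" "x \<in> pts A" "x \<notin> C"
  obtains f where "f \<in> zero_ideal A C" "f x \<noteq> 0"
proof -
  obtain S where S: "S \<subseteq> cring A" "C = zero_set A S"
    using assms(2) unfolding closedin_zariski[OF assms(1)] by blast
  then obtain f where "f \<in> S" "f x \<noteq> 0" using assms(3,4) by (auto simp: zero_set_def)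
  then show ?thesis using that[of f] S by (auto simp: zero_ideal_def zero_set_def)
qed

lemma zero_idealD: "f \<in> zero_ideal A C \<Longrightarrow> f \<in> cring A" "f \<in> zero_ideal A C \<Longrightarrow> x \<in> C \<Longrightarrow> f x = 0"
  by (auto simp: zero_ideal_def)

lemma ideal_zero_ideal:
  assumes A: "affine_variety A"
  shows "0 \<in> zero_ideal A C" "f \<in> zero_ideal A C \<Longrightarrow> g \<in> zero_ideal A C \<Longrightarrow> f - g \<in> zero_ideal A C"
    "f \<in> cring A \<Longrightarrow> g \<in> zero_ideal A C \<Longrightarrow> f * g \<in> zero_ideal A C"
proof -
  have "0 = fscale 0 (res (pts A) 1 :: 'a \<Rightarrow> 'b)" by (auto simp: fscale_def)
  then have "0 \<in> cring A" using affine_variety_cring(4)[OF A affine_variety_cring(1)[OF A]] by metis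
  then show "0 \<in> zero_ideal A C" by (simp add: zero_ideal_def)
  show "f \<in> zero_ideal A C \<Longrightarrow> g \<in> zero_ideal A C \<Longrightarrow> f - g \<in> zero_ideal A C"
    using cring_closure(1)[OF A] by (simp add: zero_ideal_def)
  show "f \<in> cring A \<Longrightarrow> g \<in> zero_ideal A C \<Longrightarrow> f * g \<in> zero_ideal A C"
    using affine_variety_cring(3)[OF A] by (simp add: zero_ideal_def)
qed

lemma cring_outside: "affine_variety A \<Longrightarrow> f \<in> cring A \<Longrightarrow> x \<notin> pts A \<Longrightarrow> f x = 0"
  using fun_cong[OF affine_variety_cring(5), of A f x] by (simp add: res_def)

lemma irreducible_in_iff_prime:
  assumes A: "affine_variety A" and C: "closedin (zariski A) C"
  shows "irreducible_in (zariski A) C \<longleftrightarrow> prime_ideal_in (cring A) (zero_ideal A C)"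
proof
  note CA = closedin_zariski_subset[OF A C]
  assume irr: "irreducible_in (zariski A) C"
  then obtain x where x: "x \<in> C" by (auto simp: irreducible_in_def)
  have "res (pts A) 1 \<notin> zero_ideal A C"
    using x CA by (auto simp: zero_ideal_def res_def)
  then have "zero_ideal A C \<subset> cring A"
    using affine_variety_cring(1)[OF A] unfolding zero_ideal_def by blast
  moreover have "f \<in> zero_ideal A C \<or> g \<in> zero_ideal A C"
    if fg: "f \<in> cring A" "g \<in> cring A" "f * g \<in> zero_ideal A C" for f g
  proof -
    have "C \<subseteq> zero_set A {f} \<union> zero_set A {g}"
      using fg(3) CA by (auto simp: zero_ideal_def zero_set_def)
    moreover have "closedin (zariski A) (zero_set A {f})" "closedin (zariski A) (zero_set A {g})"
      using fg by (auto intro!: closedin_zero_set[OF A])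
    ultimately have "C \<subseteq> zero_set A {f} \<or> C \<subseteq> zero_set A {g}"
      using irr unfolding irreducible_in_def by blast
    then show ?thesis using fg by (auto simp: zero_ideal_def zero_set_def)
  qed
  ultimately show "prime_ideal_in (cring A) (zero_ideal A C)"
    using ideal_zero_ideal[OF A] unfolding prime_ideal_in_def by blast
next
  note CA = closedin_zariski_subset[OF A C]
  assume P: "prime_ideal_in (cring A) (zero_ideal A C)"
  note Pm = prime_ideal_inD[OF P]
  have "C \<noteq> {}" using Pm(2) by (auto simp: zero_ideal_def)
  moreover have "C \<subseteq> D \<or> C \<subseteq> E"
    if DE: "closedin (zariski A) D" "closedin (zariski A) E" "C \<subseteq> D \<union> E" for D E
  proof (rule ccontr)
    assume "\<not> (C \<subseteq> D \<or> C \<subseteq> E)"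
    then obtain x x' where x: "x \<in> C" "x \<notin> D" "x' \<in> C" "x' \<notin> E" by blast
    obtain f where f: "f \<in> zero_ideal A D" "f x \<noteq> 0"
      using separating_function[OF A DE(1)] x CA by blast
    obtain g where g: "g \<in> zero_ideal A E" "g x' \<noteq> 0"
      using separating_function[OF A DE(2)] x CA by blast
    have "f * g \<in> cring A" using f g affine_variety_cring(3)[OF A] by (simp add: zero_ideal_def)
    moreover have "(f * g) z = 0" if "z \<in> C" for z using f(1) g(1) DE(3) that by (auto simp: zero_ideal_def)
    ultimately have "f * g \<in> zero_ideal A C" by (simp add: zero_ideal_def)
    then have "f \<in> zero_ideal A C \<or> g \<in> zero_ideal A C"
      using Pm(6) f(1) g(1) by (simp add: zero_ideal_def)
    then show False using x f(2) g(2) by (auto simp: zero_ideal_def)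
  qed
  ultimately show "irreducible_in (zariski A) C"
    using CA unfolding irreducible_in_def topspace_zariski[OF A] by blast
qed

definition irreducible_closed :: "('a, 'k::field) variety \<Rightarrow> 'a set \<Rightarrow> bool"
  where "irreducible_closed A C \<longleftrightarrow> closedin (zariski A) C \<and> irreducible_in (zariski A) C"

lemma irreducible_closedD:
  assumes A: "affine_variety A" and C: "irreducible_closed A C"
  shows "closedin (zariski A) C" "irreducible_in (zariski A) C" "C \<subseteq> pts A" "C \<noteq> {}"
    "prime_ideal_in (cring A) (zero_ideal A C)"
proof -
  show cl: "closedin (zariski A) C" and irr: "irreducible_in (zariski A) C"
    using C by (auto simp: irreducible_closed_def)
  show "C \<subseteq> pts A" by (rule closedin_zariski_subset[OF A cl])
  show "C \<noteq> {}" using irr by (simp add: irreducible_in_def)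
  show "prime_ideal_in (cring A) (zero_ideal A C)" using irr irreducible_in_iff_prime[OF A cl] by simp
qed

lemma zero_set_zero_ideal:
  assumes "affine_variety A" "closedin (zariski A) C" "x \<in> pts A" "\<forall>f\<in>zero_ideal A C. f x = 0"
  shows "x \<in> C"
  using separating_function[OF assms(1-3)] assms(4) by blast

definition alg_indep_on :: "('a, 'k::field) variety \<Rightarrow> 'a set \<Rightarrow> nat \<Rightarrow> (nat \<Rightarrow> 'a \<Rightarrow> 'k) \<Rightarrow> bool"
  where "alg_indep_on A C d y \<longleftrightarrow> (\<forall>i<d. y i \<in> cring A) \<and>
    (\<forall>q\<in>poly_funs d. (\<forall>x\<in>C. q (\<lambda>i. y i x) = 0) \<longrightarrow> q = 0)"

lemma alg_indep_onD:
  assumes "alg_indep_on A C d y"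
  shows "i < d \<Longrightarrow> y i \<in> cring A"
    "q \<in> poly_funs d \<Longrightarrow> \<forall>x\<in>C. q (\<lambda>i. y i x) = 0 \<Longrightarrow> q = 0"
proof -
  note * = assms[unfolded alg_indep_on_def]
  show "i < d \<Longrightarrow> y i \<in> cring A" by (rule conjunct1[OF *, rule_format])
  show "q \<in> poly_funs d \<Longrightarrow> \<forall>x\<in>C. q (\<lambda>i. y i x) = 0 \<Longrightarrow> q = 0"
    by (rule conjunct2[OF *, THEN bspec, THEN mp])
qed

lemma alg_indep_onI:
  assumes "\<And>i. i < d \<Longrightarrow> y i \<in> cring A"
    "\<And>q. q \<in> poly_funs d \<Longrightarrow> \<forall>x\<in>C. q (\<lambda>i. y i x) = 0 \<Longrightarrow> q = 0"
  shows "alg_indep_on A C d y"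
  unfolding alg_indep_on_def by (intro conjI allI impI ballI) (rule assms, assumption+)+

lemma alg_indep_on_imp_mod:
  assumes A: "affine_variety A" and C: "C \<subseteq> pts A" and y: "alg_indep_on A C d y"
  shows "alg_indep_mod A (zero_ideal A C) d y"
  unfolding alg_indep_mod_def
proof (intro conjI allI ballI impI)
  fix q assume q: "q \<in> poly_funs d" "res (pts A) (\<lambda>x. q (\<lambda>i. y i x)) \<in> zero_ideal A C"
  show "q = 0"
  proof (rule alg_indep_onD(2)[OF y q(1)], rule ballI)
    fix x assume "x \<in> C"
    from zero_idealD(2)[OF q(2) this] show "q (\<lambda>i. y i x) = 0"
      using C \<open>x \<in> C\<close> by (auto simp: res_def)
  qed
qed (rule alg_indep_onD(1)[OF y])

lemma poly_funs_common_nonzero: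
  fixes p q :: "(nat \<Rightarrow> 'k::field_char_0) \<Rightarrow> 'k"
  assumes "p \<in> poly_funs d" "q \<in> poly_funs d" "p \<noteq> 0" "q \<noteq> 0"
  shows "\<exists>a. p a \<noteq> 0 \<and> q a \<noteq> 0"
proof -
  obtain a b where ab: "p a \<noteq> 0" "q b \<noteq> 0" using assms(3,4) by (auto simp: fun_eq_iff)
  obtain G H where "(p, G) \<in> gradients d" "(q, H) \<in> gradients d" using gradient_exists assms(1,2) by blast
  from gradient_line[OF this(1), of a "\<lambda>i. b i - a i"] gradient_line[OF this(2), of a "\<lambda>i. b i - a i"] obtain g h where
    gh: "\<And>t. poly g t = p (\<lambda>i. a i + t * (b i - a i))" "\<And>t. poly h t = q (\<lambda>i. a i + t * (b i - a i))"
    by blast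
  have "g \<noteq> 0" using ab(1) gh(1)[of 0] by auto
  moreover have "h \<noteq> 0" using ab(2) gh(2)[of 1] by auto
  ultimately have "g * h \<noteq> 0" by simp
  then obtain t where "poly (g * h) t \<noteq> 0" using poly_all_0_iff_0[of "g * h"] by blast
  then show ?thesis using gh by auto
qed

text \<open>Independence on \<open>Z\<close> means that the ideal of \<open>Z\<close> avoids the multiplicative set of nonzero polynomials
  in \<open>y\<close>. An ideal containing it that is maximal with this property is prime, and it is the full ideal of
  its zero set \<open>C\<close>: a function outside it is nonzero at some point of \<open>C\<close> by the lifting of points.
  This replaces the decomposition into irreducible components.\<close>

lemma exists_irreducible_with_independence:
  fixes A :: "('a, 'k::{alg_closed_field,field_char_0}) variety"
  assumes A: "affine_variety A" and Z: "closedin (zariski A) Z" and y: "alg_indep_on A Z d y"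
  shows "\<exists>C\<subseteq>Z. irreducible_closed A C \<and> alg_indep_on A C d y"
proof -
  let ?R = "cring A" and ?I = "zero_ideal A Z"
  define val where "val q = res (pts A) (\<lambda>x. q (\<lambda>i. y i x))" for q :: "(nat \<Rightarrow> 'k) \<Rightarrow> 'k"
  have val: "val q \<in> ?R" if "q \<in> poly_funs d" for q
    unfolding val_def by (rule cring_compose[OF A that alg_indep_onD(1)[OF y]])
  define S where "S = val ` (poly_funs d - {0})"
  define JJ where "JJ = {J. ?I \<subseteq> J \<and> J \<subseteq> ?R \<and> (\<forall>f\<in>J. \<forall>g\<in>J. f - g \<in> J) \<and>
    (\<forall>f\<in>?R. \<forall>g\<in>J. f * g \<in> J) \<and> J \<inter> S = {}}"
  have "?I \<inter> S = {}"
  proof -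
    have "val q \<notin> ?I" if "q \<in> poly_funs d" "q \<noteq> 0" for q
      using alg_indep_modD(2)[OF alg_indep_on_imp_mod[OF A closedin_zariski_subset[OF A Z] y] that(1)] that(2)
      unfolding val_def by metis
    then show ?thesis by (auto simp: S_def)
  qed
  then have IJ: "?I \<in> JJ"
    using ideal_zero_ideal[OF A] zero_idealD(1) unfolding JJ_def by blast
  have "\<exists>M\<in>JJ. \<forall>X\<in>JJ. M \<subseteq> X \<longrightarrow> X = M"
  proof (rule subset_Zorn_nonempty)
    fix K assume K: "K \<noteq> {}" "subset.chain JJ K"
    then have KJ: "K \<subseteq> JJ" and tot: "\<And>X Y. X \<in> K \<Longrightarrow> Y \<in> K \<Longrightarrow> X \<subseteq> Y \<or> Y \<subseteq> X"
      by (auto simp: subset_chain_def)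
    have "f - g \<in> \<Union>K" if "f \<in> \<Union>K" "g \<in> \<Union>K" for f g
    proof -
      from that obtain X Y where XY: "X \<in> K" "Y \<in> K" "f \<in> X" "g \<in> Y" by blast
      then have "\<exists>X\<in>K. f \<in> X \<and> g \<in> X" using tot[OF XY(1,2)] by blast
      then show ?thesis using KJ unfolding JJ_def by blast
    qed
    moreover have "f * g \<in> \<Union>K" if "f \<in> ?R" "g \<in> \<Union>K" for f g
      using that KJ unfolding JJ_def by blast
    moreover have "?I \<subseteq> \<Union>K" "\<Union>K \<subseteq> ?R" "\<Union>K \<inter> S = {}"
      using K(1) KJ unfolding JJ_def by blast+
    ultimately show "\<Union>K \<in> JJ" unfolding JJ_def by blast
  qed (use IJ in blast)
  then obtain M where MJ: "M \<in> JJ" and max: "\<And>X. X \<in> JJ \<Longrightarrow> M \<subseteq> X \<Longrightarrow> X = M" by blast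
  have M: "?I \<subseteq> M" "M \<subseteq> ?R" "\<And>f g. f \<in> M \<Longrightarrow> g \<in> M \<Longrightarrow> f - g \<in> M"
    "\<And>f g. f \<in> ?R \<Longrightarrow> g \<in> M \<Longrightarrow> f * g \<in> M" "M \<inter> S = {}"
    using MJ unfolding JJ_def by blast+
  have M0: "0 \<in> M" using M(1) ideal_zero_ideal(1)[OF A] by blast
  have Mneg: "- f \<in> M" if "f \<in> M" for f using M(3)[OF M0 that] by simp
  have Madd: "f + g \<in> M" if "f \<in> M" "g \<in> M" for f g using M(3)[OF that(1) Mneg[OF that(2)]] by simp
  have Mr: "g * f \<in> M" if "f \<in> ?R" "g \<in> M" for f g using M(4)[OF that] by (simp add: mult.commute)
  have S1: "\<exists>m\<in>M. \<exists>r\<in>?R. \<exists>q\<in>poly_funs d. q \<noteq> 0 \<and> m + a * r = val q" if a: "a \<in> ?R" "a \<notin> M" for a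
  proof -
    define X where "X = {m + a * r | m r. m \<in> M \<and> r \<in> ?R}"
    have inX: "m + a * r \<in> X" if "m \<in> M" "r \<in> ?R" for m r using that unfolding X_def by blast
    have MX: "M \<subseteq> X"
    proof
      fix m assume "m \<in> M"
      from inX[OF this zero_idealD(1)[OF ideal_zero_ideal(1)[OF A]]] show "m \<in> X" by simp
    qed
    have "a \<in> X"
    proof -
      have "a * res (pts A) 1 = a"
        using cring_outside[OF A a(1)] by (auto simp: res_def fun_eq_iff)
      then show ?thesis using inX[OF M0 affine_variety_cring(1)[OF A]] by simp
    qed
    then have "X \<notin> JJ" using max[OF _ MX] a(2) by blast
    moreover have "?I \<subseteq> X" using M(1) MX by blast
    moreover have "X \<subseteq> ?R"
      using M(2) affine_variety_cring(2,3)[OF A] a(1) unfolding X_def by blast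
    moreover have "f - g \<in> X" if fg: "f \<in> X" "g \<in> X" for f g
    proof -
      from fg obtain m r m' r' where mr: "f = m + a * r" "g = m' + a * r'" "m \<in> M" "m' \<in> M" "r \<in> ?R" "r' \<in> ?R"
        unfolding X_def by blast
      then have "f - g = (m - m') + a * (r - r')" by (simp add: algebra_simps)
      then show ?thesis using inX M(3) cring_closure(1)[OF A] mr by metis
    qed
    moreover have "f * g \<in> X" if fg: "f \<in> ?R" "g \<in> X" for f g
    proof -
      from fg obtain m r where mr: "g = m + a * r" "m \<in> M" "r \<in> ?R" unfolding X_def by blast
      then have "f * g = f * m + a * (f * r)" by (simp add: algebra_simps)
      then show ?thesis using inX M(4) affine_variety_cring(3)[OF A] mr fg by metis
    qed
    ultimately have "X \<inter> S \<noteq> {}" unfolding JJ_def by blast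
    then obtain f where "f \<in> X" "f \<in> S" by blast
    then obtain m r q where mrq: "m \<in> M" "r \<in> ?R" "f = m + a * r" "q \<in> poly_funs d" "q \<noteq> 0" "f = val q"
      unfolding X_def S_def by blast
    then have "m + a * r = val q" by simp
    with mrq show ?thesis by blast
  qed
  have one: "res (pts A) 1 \<notin> M"
  proof -
    have "res (pts A) 1 = val (\<lambda>_. 1)" by (simp add: val_def one_fun_def)
    moreover have "(\<lambda>_. 1) \<noteq> (0 :: (nat \<Rightarrow> 'k) \<Rightarrow> 'k)" by (simp add: fun_eq_iff)
    ultimately have "res (pts A) 1 \<in> S" unfolding S_def using poly_funs.const[of 1] by blast
    then show ?thesis using M(5) by blast
  qed
  have prime: "prime_ideal_in ?R M"
    unfolding prime_ideal_in_def
  proof (intro conjI ballI impI)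
    show "M \<subset> ?R" using M(2) one affine_variety_cring(1)[OF A] by blast
    fix a b assume ab: "a \<in> ?R" "b \<in> ?R" "a * b \<in> M"
    show "a \<in> M \<or> b \<in> M"
    proof (rule ccontr)
      assume "\<not> (a \<in> M \<or> b \<in> M)"
      then have n: "a \<notin> M" "b \<notin> M" by auto
      obtain m r q where q: "m \<in> M" "r \<in> ?R" "q \<in> poly_funs d" "q \<noteq> 0" "m + a * r = val q"
        using S1[OF ab(1) n(1)] by blast
      obtain m' r' q' where q': "m' \<in> M" "r' \<in> ?R" "q' \<in> poly_funs d" "q' \<noteq> 0" "m' + b * r' = val q'"
        using S1[OF ab(2) n(2)] by blast
      have "(m + a * r) * (m' + b * r') = m * m' + (b * r') * m + (a * r) * m' + (r * r') * (a * b)"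
        by (simp add: algebra_simps)
      also have "\<dots> \<in> M"
      proof -
        have "m \<in> ?R" using q(1) M(2) by blast
        moreover have "b * r' \<in> ?R" "a * r \<in> ?R" "r * r' \<in> ?R"
          using ab q(2) q'(2) by (simp_all add: affine_variety_cring(3)[OF A])
        ultimately show ?thesis using q(1) q'(1) ab(3) by (simp add: Madd M(4))
      qed
      finally have "val q * val q' \<in> M" using q(5) q'(5) by simp
      moreover have "val q * val q' = val (q * q')" by (simp add: val_def fun_eq_iff res_def)
      moreover have "q * q' \<noteq> 0"
        using poly_funs_common_nonzero[OF q(3) q'(3) q(4) q'(4)] by (auto simp: fun_eq_iff)
      ultimately show False using M(5) poly_funs.mult[OF q(3) q'(3)] unfolding S_def by auto
    qed
  qed (use M M0 in blast)+
  have yM: "alg_indep_mod A M d y"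
    unfolding alg_indep_mod_def
  proof (intro conjI allI ballI impI)
    fix q assume q: "q \<in> poly_funs d" "res (pts A) (\<lambda>x. q (\<lambda>i. y i x)) \<in> M"
    then have "val q \<in> M" by (simp add: val_def)
    then show "q = 0" using M(5) q(1) unfolding S_def by blast
  qed (rule alg_indep_onD(1)[OF y])
  define C where "C = zero_set A M"
  have C: "closedin (zariski A) C" unfolding C_def by (rule closedin_zero_set[OF A M(2)])
  have CM: "zero_ideal A C = M"
  proof
    show "M \<subseteq> zero_ideal A C" using M(2) by (auto simp: zero_ideal_def C_def zero_set_def)
    show "zero_ideal A C \<subseteq> M"
    proof (rule ccontr)
      assume "\<not> zero_ideal A C \<subseteq> M"
      then obtain f where f: "f \<in> zero_ideal A C" "f \<notin> M" by blast
      from lift_point_and_tangents[OF A prime yM zero_idealD(1)[OF f(1)] f(2)] obtain u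
        where u: "u \<in> poly_funs d" "u \<noteq> 0" "\<forall>b. u b \<noteq> 0 \<longrightarrow> (\<exists>x. submersive_lift A M d y f b x)" by blast
      obtain b where "u b \<noteq> 0" using u(2) by (auto simp: fun_eq_iff)
      with u(3) obtain x where x: "submersive_lift A M d y f b x" by blast
      note x = submersive_liftD(1,2,4)[OF x]
      then show False using zero_idealD(2)[OF f(1), of x] by (simp add: C_def zero_set_def)
    qed
  qed
  have "irreducible_closed A C"
    unfolding irreducible_closed_def using irreducible_in_iff_prime[OF A C] prime CM C by simp
  moreover have "alg_indep_on A C d y"
  proof (rule alg_indep_onI[OF alg_indep_onD(1)[OF y]])
    fix q assume q: "q \<in> poly_funs d" "\<forall>x\<in>C. q (\<lambda>i. y i x) = 0"
    then have "val q \<in> zero_ideal A C" using val by (auto simp: zero_ideal_def val_def res_def)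
    then show "q = 0" using alg_indep_modD(2)[OF yM q(1)] CM by (simp add: val_def)
  qed
  moreover have "C \<subseteq> Z"
    using zero_set_zero_ideal[OF A Z] M(1) unfolding C_def zero_set_def by blast
  ultimately show ?thesis by blast
qed


section \<open>Transcendence degree and Krull dimension\<close>

lemma lift_point:
  fixes A :: "('a, 'k::{alg_closed_field,field_char_0}) variety"
  assumes A: "affine_variety A" and C: "irreducible_closed A C"
    and y: "alg_indep_on A C d y" and v: "v \<in> cring A" "v \<notin> zero_ideal A C"
  shows "\<exists>u\<in>poly_funs d. u \<noteq> 0 \<and> (\<forall>b. u b \<noteq> 0 \<longrightarrow> (\<exists>x\<in>C. (\<forall>i<d. y i x = b i) \<and> v x \<noteq> 0))"
proof -
  note CD = irreducible_closedD[OF A C]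
  from lift_point_and_tangents[OF A CD(5) alg_indep_on_imp_mod[OF A CD(3) y] v] obtain u where
    u: "u \<in> poly_funs d" "u \<noteq> 0" "\<forall>b. u b \<noteq> 0 \<longrightarrow> (\<exists>x. submersive_lift A (zero_ideal A C) d y v b x)" by blast
  show ?thesis
  proof (intro bexI[OF _ u(1)] conjI allI impI u(2))
    fix b assume "u b \<noteq> 0"
    with u(3) obtain x where "submersive_lift A (zero_ideal A C) d y v b x" by blast
    note x = submersive_liftD[OF this]
    have "x \<in> C" by (rule zero_set_zero_ideal[OF A CD(1) x(1)]) (simp add: x(2))
    then show "\<exists>x\<in>C. (\<forall>i<d. y i x = b i) \<and> v x \<noteq> 0"
      using x(3,4) by (intro bexI[of _ x]) simp_all
  qed
qed

text \<open>A function \<open>f\<close> that vanishes on \<open>Z\<close> but not on \<open>C\<close> is independent of \<open>y\<close>: in a relation on \<open>C\<close>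
  the powers of \<open>f\<close> common to all terms can be divided out because \<open>C\<close> is irreducible, and the restriction
  of the rest to \<open>Z\<close> is a relation for \<open>y\<close> alone.\<close>

lemma alg_indep_on_Suc:
  fixes A :: "('a, 'k::{alg_closed_field,field_char_0}) variety"
  assumes A: "affine_variety A" and C: "irreducible_closed A C" and Z: "closedin (zariski A) Z" "Z \<subset> C"
    and y: "alg_indep_on A Z d y"
  shows "\<exists>f. alg_indep_on A C (Suc d) (y(d := f))"
proof -
  note CD = irreducible_closedD[OF A C]
  obtain x where x: "x \<in> C" "x \<notin> Z" using Z(2) by blast
  then obtain f where f: "f \<in> zero_ideal A Z" "f x \<noteq> 0"
    using separating_function[OF A Z(1)] CD(3) by blast
  have "alg_indep_on A C (Suc d) (y(d := f))"
  proof (rule alg_indep_onI)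
    fix i assume "i < Suc d"
    then show "(y(d := f)) i \<in> cring A"
      using alg_indep_onD(1)[OF y, of i] zero_idealD(1)[OF f(1)] by (cases "i = d") auto
  next
    fix q assume q: "q \<in> poly_funs (Suc d)" "\<forall>x\<in>C. q (\<lambda>i. (y(d := f)) i x) = 0"
    obtain c N where c: "\<forall>i. c i \<in> poly_funs d" "\<forall>a. q a = (\<Sum>i\<le>N. c i a * a d ^ i)"
      using poly_funs_Suc_expand[OF q(1)] by blast
    show "q = 0"
    proof (rule ccontr)
      assume "q \<noteq> 0"
      have "\<exists>j. j \<le> N \<and> c j \<noteq> 0"
      proof (rule ccontr)
        assume *: "\<not> (\<exists>j. j \<le> N \<and> c j \<noteq> 0)"
        have "q a = 0" for a using * unfolding c(2)[rule_format] by (intro sum.neutral) auto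
        then show False using \<open>q \<noteq> 0\<close> by (simp add: fun_eq_iff)
      qed
      then obtain j0 where j0: "j0 \<le> N \<and> c j0 \<noteq> 0" by blast
      define j where "j = (LEAST j. j \<le> N \<and> c j \<noteq> 0)"
      have j: "j \<le> N" "c j \<noteq> 0"
        using LeastI[of "\<lambda>j. j \<le> N \<and> c j \<noteq> 0", OF j0] unfolding j_def by auto
      have min: "c i = 0" if "i < j" for i
        using not_less_Least[of i "\<lambda>j. j \<le> N \<and> c j \<noteq> 0"] that j(1) unfolding j_def by auto
      \<comment> \<open>The lowest nonzero coefficient survives division by a power of \<open>f\<close>.\<close>
      define g where "g = res (pts A) (\<lambda>x. \<Sum>i=j..N. c i (\<lambda>i. y i x) * f x ^ (i - j))"
      have yd: "c i (\<lambda>i. (y(d := f)) i x) = c i (\<lambda>i. y i x)" for i x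
        by (rule poly_funs_cong[OF c(1)[rule_format]]) simp
      have fg: "f x ^ j * g x = 0" if "x \<in> C" for x
      proof -
        have "0 = (\<Sum>i\<le>N. c i (\<lambda>i. y i x) * f x ^ i)"
          using q(2) that c(2) yd by simp
        also have "\<dots> = (\<Sum>i=j..N. c i (\<lambda>i. y i x) * f x ^ i)"
        proof (rule sum.mono_neutral_right)
          show "\<forall>i\<in>{..N} - {j..N}. c i (\<lambda>i. y i x) * f x ^ i = 0"
          proof
            fix i assume "i \<in> {..N} - {j..N}"
            then have "i < j" by auto
            from min[OF this] show "c i (\<lambda>i. y i x) * f x ^ i = 0" by simp
          qed
        qed auto
        also have "\<dots> = f x ^ j * (\<Sum>i=j..N. c i (\<lambda>i. y i x) * f x ^ (i - j))"
          unfolding sum_distrib_left by (rule sum.cong) (auto simp flip: power_add)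
        finally show ?thesis using that CD(3) by (auto simp: g_def res_def)
      qed
      have gA: "g \<in> cring A"
      proof -
        have "(\<lambda>x. \<Sum>i=j..N. c i (\<lambda>i. y i x) * f x ^ (i - j)) = (\<Sum>i=j..N. (\<lambda>x. c i (\<lambda>i. y i x)) * f ^ (i - j))"
          by (simp add: fun_eq_iff sum_fun_apply power_fun_apply)
        moreover have "\<dots> \<in> extend_cring A"
        proof (intro subring_setD(8)[OF subring_set_extend_cring(1)[OF A]] subring_setD(4,7)[OF subring_set_extend_cring(1)[OF A]])
          show "f \<in> extend_cring A" using subring_set_extend_cring(3)[OF A] zero_idealD(1)[OF f(1)] by blast
          show "(\<lambda>x. c i (\<lambda>i. y i x)) \<in> extend_cring A" for i
            unfolding extend_cring_def mem_Collect_eq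
            by (rule cring_compose[OF A c(1)[rule_format]]) (rule alg_indep_onD(1)[OF y])
        qed
        ultimately show ?thesis by (simp add: g_def extend_cring_def)
      qed
      have gC: "g \<in> zero_ideal A C"
      proof -
        have fnA: "f ^ n * g \<in> cring A" for n
        proof (induction n)
          case (Suc n)
          from affine_variety_cring(3)[OF A zero_idealD(1)[OF f(1)] this] show ?case
            by (simp only: power_Suc mult.assoc)
        qed (use gA in \<open>simp only: power_0 mult_1_left\<close>)
        have "f ^ n * g \<in> zero_ideal A C \<Longrightarrow> g \<in> zero_ideal A C" for n
        proof (induction n)
          case (Suc n)
          have "f * (f ^ n * g) \<in> zero_ideal A C" using Suc.prems by (simp only: power_Suc mult.assoc)
          then have "f \<in> zero_ideal A C \<or> f ^ n * g \<in> zero_ideal A C"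
            using prime_ideal_inD(6)[OF CD(5) zero_idealD(1)[OF f(1)] fnA] by blast
          then show ?case using Suc.IH f(2) zero_idealD(2)[OF _ x(1)] by blast
        qed (simp only: power_0 mult_1_left)
        moreover have "f ^ j * g \<in> zero_ideal A C"
          unfolding zero_ideal_def using fnA fg by (simp add: power_fun_apply)
        ultimately show ?thesis by blast
      qed
      have "c j (\<lambda>i. y i x) = 0" if "x \<in> Z" for x
      proof -
        have x: "x \<in> C" "x \<in> pts A" using that Z(2) CD(3) by auto
        then have "0 = (\<Sum>i=j..N. c i (\<lambda>i. y i x) * f x ^ (i - j))"
          using zero_idealD(2)[OF gC x(1)] by (simp add: g_def res_def)
        also have "\<dots> = (\<Sum>i=j..N. if i = j then c j (\<lambda>i. y i x) else 0)"
          using zero_idealD(2)[OF f(1) that] by (intro sum.cong) auto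
        also have "\<dots> = c j (\<lambda>i. y i x)" using j by simp
        finally show ?thesis by simp
      qed
      then show False using alg_indep_onD(2)[OF y c(1)[rule_format, of j]] j(2) by blast
    qed
  qed
  then show ?thesis by blast
qed


text \<open>Almost every value of \<open>y\<close> is attained on \<open>C\<close>, so a suitable hyperplane section where the last
  function is constant still has the other functions independent.\<close>

lemma hyperplane_section:
  fixes A :: "('a, 'k::{alg_closed_field,field_char_0}) variety"
  assumes A: "affine_variety A" and C: "irreducible_closed A C" and y: "alg_indep_on A C (Suc e) y"
  shows "\<exists>D. irreducible_closed A D \<and> D \<subset> C \<and> alg_indep_on A D e y"
proof -
  note CD = irreducible_closedD[OF A C]
  have one: "res (pts A) 1 \<in> cring A" "res (pts A) 1 \<notin> zero_ideal A C"
    using affine_variety_cring(1)[OF A] CD(3,4) by (auto simp: zero_ideal_def res_def)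
  obtain u where u1: "u \<in> poly_funs (Suc e)"
    and u23: "u \<noteq> 0 \<and> (\<forall>b. u b \<noteq> 0 \<longrightarrow> (\<exists>x\<in>C. (\<forall>i<Suc e. y i x = b i) \<and> res (pts A) (1 :: 'a \<Rightarrow> 'k) x \<noteq> 0))"
    using lift_point[OF A C y one] by (rule bexE) (erule (1) that)
  note u = u1 conjunct1[OF u23] conjunct2[OF u23]
  obtain b0 where b0: "u b0 \<noteq> 0" using u(2) by (auto simp: fun_eq_iff)
  define c where "c = b0 e"
  \<comment> \<open>The restriction of \<open>u\<close> to the hyperplane on which the last coordinate equals \<open>c\<close>.\<close>
  define u' where "u' = (\<lambda>a. u (\<lambda>i. if i < e then a i else c))"
  have u': "u' \<in> poly_funs e"
  proof -
    have "(\<lambda>a. u (\<lambda>i. (\<lambda>i a. if i < e then a i else c) i a)) \<in> poly_funs e"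
    proof (rule poly_funs_compose[OF u(1) subring_set_poly_funs poly_funs.const])
      show "(\<lambda>a. if i < e then a i else c) \<in> poly_funs e" for i
        using poly_funs.coord[of i e] poly_funs.const[of c e] by (cases "i < e") simp_all
    qed
    then show ?thesis by (simp add: u'_def)
  qed
  have "u' b0 = u b0"
    unfolding u'_def by (rule poly_funs_cong[OF u(1)]) (auto simp: c_def less_Suc_eq)
  then have "u' \<noteq> 0" using b0 by auto
  define h where "h = y e - fscale c (res (pts A) 1)"
  have hA: "h \<in> cring A"
    unfolding h_def using alg_indep_onD(1)[OF y, of e] affine_variety_cring(4)[OF A one(1)] cring_closure(1)[OF A] by blast
  have hx: "h x = y e x - c" if "x \<in> C" for x using that CD(3) by (auto simp: h_def fscale_def res_def)
  define Z where "Z = C \<inter> zero_set A {h}"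
  have Z: "closedin (zariski A) Z"
    unfolding Z_def using CD(1) closedin_zero_set[OF A, of "{h}"] hA by (intro closedin_Int) auto
  have yZ: "alg_indep_on A Z e y"
  proof (rule alg_indep_onI)
    fix q assume q: "q \<in> poly_funs e" "\<forall>x\<in>Z. q (\<lambda>i. y i x) = 0"
    show "q = 0"
    proof (rule ccontr)
      assume "q \<noteq> 0"
      from poly_funs_common_nonzero[OF q(1) u' this \<open>u' \<noteq> 0\<close>] obtain a where a: "q a \<noteq> 0 \<and> u' a \<noteq> 0" ..
      have "u (\<lambda>i. if i < e then a i else c) \<noteq> 0" using a unfolding u'_def by (rule conjunct2)
      from u(3)[rule_format, OF this] obtain x where
        "x \<in> C" and x': "(\<forall>i<Suc e. y i x = (if i < e then a i else c)) \<and> res (pts A) (1 :: 'a \<Rightarrow> 'k) x \<noteq> 0"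
        by (rule bexE) (erule (1) that)
      note x = \<open>x \<in> C\<close> conjunct1[OF x']
      have ye: "y e x = c" using x(2) by simp
      have "h x = 0" using hx[OF x(1)] ye by simp
      then have "x \<in> Z" using x(1) CD(3) by (auto simp: Z_def zero_set_def)
      moreover have "q (\<lambda>i. y i x) = q a" by (rule poly_funs_cong[OF q(1)]) (use x(2) in simp)
      ultimately show False using q(2) conjunct1[OF a] by simp
    qed
  qed (use alg_indep_onD(1)[OF y] in simp)
  obtain D where D: "D \<subseteq> Z" "irreducible_closed A D" "alg_indep_on A D e y"
    using exists_irreducible_with_independence[OF A Z yZ] by blast
  have "D \<noteq> C"
  proof
    assume "D = C"
    let ?q = "(\<lambda>a. a e - c) :: (nat \<Rightarrow> 'k) \<Rightarrow> 'k"
    have "?q = (\<lambda>a. a e) - (\<lambda>_. c)" by (simp add: fun_eq_iff)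
    then have q: "?q \<in> poly_funs (Suc e)"
      using poly_funs_simps(2)[OF poly_funs.coord[of e "Suc e"] poly_funs.const[of c]] by simp
    have "?q (\<lambda>i. y i x) = 0" if "x \<in> C" for x
      using that D(1) \<open>D = C\<close> hx[OF that] by (auto simp: Z_def zero_set_def)
    then have "?q = 0" using alg_indep_onD(2)[OF y q] by blast
    from fun_cong[OF this, of "\<lambda>_. c + 1"] show False by simp
  qed
  then show ?thesis using D Z_def by blast
qed

definition irreducible_chain :: "('a, 'k::field) variety \<Rightarrow> nat \<Rightarrow> (nat \<Rightarrow> 'a set) \<Rightarrow> bool"
  where "irreducible_chain A n Z \<longleftrightarrow> (\<forall>i\<le>n. irreducible_closed A (Z i)) \<and> (\<forall>i<n. Z i \<subset> Z (Suc i))"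

lemma alg_indep_on_imp_chain:
  fixes A :: "('a, 'k::{alg_closed_field,field_char_0}) variety"
  assumes A: "affine_variety A"
  shows "irreducible_closed A C \<Longrightarrow> alg_indep_on A C d y \<Longrightarrow> \<exists>Z. irreducible_chain A d Z \<and> Z d = C"
proof (induction d arbitrary: C)
  case 0
  then show ?case by (intro exI[of _ "\<lambda>_. C"]) (simp add: irreducible_chain_def)
next
  case (Suc d)
  obtain D where D: "irreducible_closed A D" "D \<subset> C" "alg_indep_on A D d y"
    using hyperplane_section[OF A Suc.prems] by blast
  obtain Z where Z: "irreducible_chain A d Z" "Z d = D" using Suc.IH[OF D(1,3)] by blast
  have "irreducible_chain A (Suc d) (Z(Suc d := C))"
    using Z D(2) Suc.prems(1) by (auto simp: irreducible_chain_def le_Suc_eq less_Suc_eq)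
  then show ?case by (intro exI[of _ "Z(Suc d := C)"] conjI fun_upd_same)
qed

text \<open>Each strict inclusion contributes one independent function. With the preceding lemma, lengths of
  chains and numbers of independent functions have the same bound.\<close>

lemma chain_imp_alg_indep_on:
  fixes A :: "('a, 'k::{alg_closed_field,field_char_0}) variety"
  assumes A: "affine_variety A"
  shows "irreducible_chain A n Z \<Longrightarrow> \<exists>y. alg_indep_on A (Z n) n y"
proof (induction n)
  case 0
  then have "irreducible_closed A (Z 0)" by (simp add: irreducible_chain_def)
  note CD = irreducible_closedD[OF A this]
  have "alg_indep_on A (Z 0) 0 (\<lambda>_. 0)"
  proof (rule alg_indep_onI)
    fix q :: "(nat \<Rightarrow> 'k) \<Rightarrow> 'k" assume q: "q \<in> poly_funs 0" "\<forall>x\<in>Z 0. q (\<lambda>i. 0 x) = 0"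
    then have "q a = 0" for a
    proof -
      obtain x where "x \<in> Z 0" using CD(4) by blast
      then have "q (\<lambda>i. 0 x) = 0" using q(2) by blast
      then show ?thesis using poly_funs_cong[OF q(1), of a "\<lambda>i. 0 x"] by simp
    qed
    then show "q = 0" by (simp add: fun_eq_iff)
  qed simp
  then show ?case by blast
next
  case (Suc n)
  then have "irreducible_chain A n Z" "irreducible_closed A (Z (Suc n))" "irreducible_closed A (Z n)" "Z n \<subset> Z (Suc n)"
    by (auto simp: irreducible_chain_def)
  then show ?case
    using Suc.IH alg_indep_on_Suc[OF A, of "Z (Suc n)" "Z n" n] irreducible_closedD(1)[OF A, of "Z n"] by blast
qed

lemma irreducible_inD:
  "irreducible_in T S \<Longrightarrow> closedin T D \<Longrightarrow> closedin T E \<Longrightarrow> S \<subseteq> D \<union> E \<Longrightarrow> S \<subseteq> D \<or> S \<subseteq> E"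
  "irreducible_in T S \<Longrightarrow> S \<subseteq> topspace T" "irreducible_in T S \<Longrightarrow> S \<noteq> {}"
  by (simp_all add: irreducible_in_def)

lemma irreducible_inI:
  "S \<subseteq> topspace T \<Longrightarrow> S \<noteq> {} \<Longrightarrow>
    (\<And>D E. closedin T D \<Longrightarrow> closedin T E \<Longrightarrow> S \<subseteq> D \<union> E \<Longrightarrow> S \<subseteq> D \<or> S \<subseteq> E) \<Longrightarrow> irreducible_in T S"
  unfolding irreducible_in_def by (intro conjI allI impI) auto

lemma irreducible_in_subtopology:
  assumes "S \<subseteq> C"
  shows "irreducible_in (subtopology T C) S \<longleftrightarrow> irreducible_in T S"
proof
  assume S: "irreducible_in (subtopology T C) S"
  show "irreducible_in T S"
  proof (rule irreducible_inI)
    show "S \<subseteq> topspace T" using irreducible_inD(2)[OF S] by (simp add: topspace_subtopology)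
    show "S \<noteq> {}" by (rule irreducible_inD(3)[OF S])
    fix D E assume DE: "closedin T D" "closedin T E" "S \<subseteq> D \<union> E"
    have "closedin (subtopology T C) (C \<inter> D)" "closedin (subtopology T C) (C \<inter> E)"
      using DE(1,2) by (auto intro: closedin_subtopology_Int_closed)
    moreover have "S \<subseteq> (C \<inter> D) \<union> (C \<inter> E)" using DE(3) assms by blast
    ultimately have "S \<subseteq> C \<inter> D \<or> S \<subseteq> C \<inter> E" by (rule irreducible_inD(1)[OF S])
    then show "S \<subseteq> D \<or> S \<subseteq> E" by blast
  qed
next
  assume S: "irreducible_in T S"
  show "irreducible_in (subtopology T C) S"
  proof (rule irreducible_inI)
    show "S \<subseteq> topspace (subtopology T C)"
      using irreducible_inD(2)[OF S] assms by (simp add: topspace_subtopology)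
    show "S \<noteq> {}" by (rule irreducible_inD(3)[OF S])
    fix D E assume DE: "closedin (subtopology T C) D" "closedin (subtopology T C) E" "S \<subseteq> D \<union> E"
    obtain D' where D': "closedin T D'" "D = D' \<inter> C" using DE(1) unfolding closedin_subtopology by blast
    obtain E' where E': "closedin T E'" "E = E' \<inter> C" using DE(2) unfolding closedin_subtopology by blast
    have "S \<subseteq> D' \<union> E'" using DE(3) D'(2) E'(2) by blast
    then have "S \<subseteq> D' \<or> S \<subseteq> E'" by (rule irreducible_inD(1)[OF S D'(1) E'(1)])
    then show "S \<subseteq> D \<or> S \<subseteq> E" using D'(2) E'(2) assms by blast
  qed
qed

lemma irreducible_in_closure:
  assumes S: "irreducible_in T S"
  shows "irreducible_in T (T closure_of S)"
proof (rule irreducible_inI)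
  show "T closure_of S \<subseteq> topspace T" by (rule closure_of_subset_topspace)
  note sub = closure_of_subset[OF irreducible_inD(2)[OF S]]
  show "T closure_of S \<noteq> {}" using sub irreducible_inD(3)[OF S] by blast
  fix D E assume DE: "closedin T D" "closedin T E" "T closure_of S \<subseteq> D \<union> E"
  have "S \<subseteq> D \<union> E" using sub DE(3) by (rule subset_trans)
  from irreducible_inD(1)[OF S DE(1,2) this] show "T closure_of S \<subseteq> D \<or> T closure_of S \<subseteq> E"
    using closure_of_minimal[OF _ DE(1), of S] closure_of_minimal[OF _ DE(2), of S] by (elim disjE) simp_all
qed

text \<open>The closure of a member meets the subspace in that member, so that the inclusions stay strict.\<close>

lemma krull_chain_closure:
  assumes A: "affine_variety A" and X: "X \<subseteq> pts A"
    and Z: "\<forall>i\<le>n. closedin (subtopology (zariski A) X) (Z i) \<and> irreducible_in (subtopology (zariski A) X) (Z i)"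
    "\<forall>i<n. Z i \<subset> Z (Suc i)"
  shows "irreducible_chain A n (\<lambda>i. zariski A closure_of (Z i))"
proof -
  let ?T = "zariski A"
  have Zc: "closedin (subtopology ?T X) (Z i)" and Zi: "irreducible_in (subtopology ?T X) (Z i)" if "i \<le> n" for i
    using Z(1)[rule_format, OF that] by simp_all
  have ZX: "Z i \<subseteq> X" if "i \<le> n" for i
    using closedin_subset[OF Zc[OF that]] by (simp add: topspace_subtopology)
  have cl: "?T closure_of (Z i) \<inter> X = Z i" if i: "i \<le> n" for i
  proof -
    obtain D where D: "closedin ?T D" "Z i = D \<inter> X" using Zc[OF i] unfolding closedin_subtopology by blast
    have "Z i \<subseteq> D" using D(2) by blast
    then have "?T closure_of (Z i) \<subseteq> D" using D(1) by (rule closure_of_minimal)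
    moreover have "Z i \<subseteq> ?T closure_of (Z i)"
      using ZX[OF i] X by (intro closure_of_subset) (simp add: topspace_zariski[OF A])
    ultimately show ?thesis using D(2) by blast
  qed
  have "irreducible_closed A (?T closure_of (Z i))" if "i \<le> n" for i
    unfolding irreducible_closed_def
    using irreducible_in_closure[OF Zi[OF that, unfolded irreducible_in_subtopology[OF ZX[OF that]]]]
    by (intro conjI closedin_closure_of)
  moreover have "?T closure_of (Z i) \<subset> ?T closure_of (Z (Suc i))" if i: "i < n" for i
  proof (rule psubsetI)
    have lt: "Z i \<subset> Z (Suc i)" by (rule Z(2)[rule_format, OF i])
    show "?T closure_of (Z i) \<subseteq> ?T closure_of (Z (Suc i))"
      by (rule closure_of_mono[OF psubset_imp_subset[OF lt]])
    show "?T closure_of (Z i) \<noteq> ?T closure_of (Z (Suc i))"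
    proof
      assume eq: "?T closure_of (Z i) = ?T closure_of (Z (Suc i))"
      have "Z i = ?T closure_of (Z i) \<inter> X" using cl[of i] i by simp
      also have "\<dots> = Z (Suc i)" unfolding eq using cl[of "Suc i"] i by simp
      finally show False using lt by blast
    qed
  qed
  ultimately show ?thesis unfolding irreducible_chain_def by blast
qed

section \<open>Finite-dimensional spaces of functions\<close>

global_interpretation fun_pair: vector_space_pair
  "fscale :: 'k::field \<Rightarrow> ('b \<Rightarrow> 'k) \<Rightarrow> 'b \<Rightarrow> 'k" "fscale :: 'k \<Rightarrow> ('c \<Rightarrow> 'k) \<Rightarrow> 'c \<Rightarrow> 'k"
  by unfold_locales

definition fin_dim :: "('b \<Rightarrow> 'k::field) set \<Rightarrow> bool"
  where "fin_dim U \<longleftrightarrow> (\<exists>S. finite S \<and> U \<subseteq> fun_vs.span S)"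

lemma fin_dim_subset: "fin_dim W \<Longrightarrow> U \<subseteq> W \<Longrightarrow> fin_dim U"
  unfolding fin_dim_def by blast

lemma finite_basis:
  fixes U :: "('b \<Rightarrow> 'k::field) set"
  assumes "fin_dim U"
  obtains B where "B \<subseteq> U" "fun_vs.independent B" "U \<subseteq> fun_vs.span B" "card B = fun_vs.dim U" "finite B"
proof -
  obtain B where B: "B \<subseteq> U" "fun_vs.independent B" "U \<subseteq> fun_vs.span B" "card B = fun_vs.dim U"
    using fun_vs.basis_exists .
  obtain S where "finite S" "U \<subseteq> fun_vs.span S" using assms unfolding fin_dim_def by blast
  then have "finite B" using fun_vs.independent_span_bound[of S B] B(1,2) by blast
  with B show ?thesis by (rule that)
qed

lemma dim_mono_fin:
  fixes U :: "('b \<Rightarrow> 'k::field) set"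
  assumes "fin_dim W" "U \<subseteq> W" shows "fun_vs.dim U \<le> fun_vs.dim W"
proof -
  obtain B where "W \<subseteq> fun_vs.span B" "card B = fun_vs.dim W" "finite B" using finite_basis[OF assms(1)] .
  then show ?thesis using fun_vs.dim_le_card[OF subset_trans[OF assms(2)], of B] by simp
qed

lemma card_independent_le_dim:
  fixes U :: "('b \<Rightarrow> 'k::field) set"
  assumes "fin_dim U" "B \<subseteq> U" "fun_vs.independent B" shows "finite B" "card B \<le> fun_vs.dim U"
proof -
  obtain C where C: "U \<subseteq> fun_vs.span C" "card C = fun_vs.dim U" "finite C" using finite_basis[OF assms(1)] .
  from fun_vs.independent_span_bound[OF C(3) assms(3) subset_trans[OF assms(2) C(1)]]
  show "finite B" "card B \<le> fun_vs.dim U" unfolding C(2) by simp_all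
qed

lemma subspace_eq_if_dim_le:
  fixes U :: "('b \<Rightarrow> 'k::field) set"
  assumes W: "fin_dim W" and U: "fun_vs.subspace U" "U \<subseteq> W" and dim: "fun_vs.dim W \<le> fun_vs.dim U"
  shows "U = W"
proof (rule ccontr)
  assume "U \<noteq> W"
  then obtain w where w: "w \<in> W" "w \<notin> U" using U(2) by blast
  obtain B where B: "B \<subseteq> U" "fun_vs.independent B" "U \<subseteq> fun_vs.span B" "card B = fun_vs.dim U" "finite B"
    using finite_basis[OF fin_dim_subset[OF W U(2)]] .
  have "w \<notin> fun_vs.span B" using fun_vs.span_minimal[OF B(1) U(1)] w(2) by blast
  then have "fun_vs.independent (insert w B)" "w \<notin> B"
    using fun_vs.independent_insertI[OF _ B(2)] fun_vs.span_base[of w B] by auto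
  then have "card B + 1 \<le> fun_vs.dim W"
    using card_independent_le_dim(2)[OF W, of "insert w B"] B(1,5) U(2) w(1) by auto
  then show False using dim B(4) by simp
qed

lemma fun_linearI:
  fixes f :: "('b \<Rightarrow> 'k::field) \<Rightarrow> 'c \<Rightarrow> 'k"
  assumes "\<And>u v. f (u + v) = f u + f v" "\<And>c u. f (fscale c u) = fscale c (f u)"
  shows "Vector_Spaces.linear fscale fscale f"
  unfolding Vector_Spaces.linear_iff by (intro conjI allI fun_vs.vector_space_axioms assms)

lemma dim_inj_image:
  fixes f :: "('b \<Rightarrow> 'k::field) \<Rightarrow> 'c \<Rightarrow> 'k"
  assumes f: "Vector_Spaces.linear fscale fscale f" and U: "fun_vs.subspace U" "fin_dim U" and inj: "inj_on f U"
  shows "fun_vs.dim (f ` U) = fun_vs.dim U" "fin_dim (f ` U)"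
proof -
  obtain B where B: "B \<subseteq> U" "fun_vs.independent B" "U \<subseteq> fun_vs.span B" "card B = fun_vs.dim U" "finite B"
    using finite_basis[OF U(2)] .
  have span: "fun_vs.span B = U" using fun_vs.span_minimal[OF B(1) U(1)] B(3) by blast
  have im: "f ` U = fun_vs.span (f ` B)" using fun_pair.linear_span_image[OF f, of B] span by simp
  have "fun_vs.independent (f ` B)"
    using fun_pair.linear_independent_injective_image[OF f B(2)] inj span by simp
  from fun_vs.dim_span_eq_card_independent[OF this] have "fun_vs.dim (f ` U) = card (f ` B)" unfolding im .
  also have "card (f ` B) = card B" by (rule card_image[OF inj_on_subset[OF inj B(1)]])
  finally show "fun_vs.dim (f ` U) = fun_vs.dim U" using B(4) by simp
  show "fin_dim (f ` U)" unfolding fin_dim_def im using finite_imageI[OF B(5)] by blast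
qed

definition supported :: "nat set \<Rightarrow> (nat \<Rightarrow> 'k::field) set"
  where "supported I = {v. \<forall>i. i \<notin> I \<longrightarrow> v i = 0}"

lemma supported_span:
  assumes "finite I"
  shows "supported I \<subseteq> fun_vs.span ((\<lambda>i j. if j = i then 1 else (0::'k::field)) ` I)" (is "_ \<subseteq> fun_vs.span (?e ` I)")
proof
  fix v :: "nat \<Rightarrow> 'k" assume v: "v \<in> supported I"
  have "v = (\<Sum>i\<in>I. fscale (v i) (?e i))"
  proof
    fix j
    have "(\<Sum>i\<in>I. fscale (v i) (?e i)) j = (\<Sum>i\<in>I. if j = i then v i else 0)"
      unfolding sum_fun_apply by (rule sum.cong) (auto simp: fscale_def)
    also have "\<dots> = v j" using v assms by (simp add: supported_def)
    finally show "v j = (\<Sum>i\<in>I. fscale (v i) (?e i)) j" by simp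
  qed
  also have "\<dots> \<in> fun_vs.span (?e ` I)"
    by (intro fun_vs.span_sum fun_vs.span_scale fun_vs.span_base imageI)
  finally show "v \<in> fun_vs.span (?e ` I)" .
qed

lemma fin_dim_supported: "finite I \<Longrightarrow> fin_dim (supported I)"
  unfolding fin_dim_def using supported_span by blast

lemma dim_supported_le: "finite I \<Longrightarrow> fun_vs.dim (supported I :: (nat \<Rightarrow> 'k::field) set) \<le> card I"
  by (rule le_trans[OF fun_vs.dim_le_card[OF supported_span finite_imageI] card_image_le])

lemma dim_ge_if_dual_basis:
  fixes U :: "('b \<Rightarrow> 'k::field) set"
  assumes U: "fin_dim U" and \<delta>: "\<And>j. j < d \<Longrightarrow> \<delta> j \<in> U"
    and y: "\<And>i j. i < d \<Longrightarrow> j < d \<Longrightarrow> \<delta> j (y i) = (if i = j then 1 else 0)"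
  shows "d \<le> fun_vs.dim U"
proof -
  have inj: "inj_on \<delta> {..<d}"
  proof (rule inj_onI)
    fix i j assume "i \<in> {..<d}" "j \<in> {..<d}" "\<delta> i = \<delta> j"
    then show "i = j" using y[of i i] y[of i j] by (auto split: if_splits)
  qed
  have "fun_vs.independent (\<delta> ` {..<d})"
  proof (rule fun_vs.independent_if_scalars_zero)
    fix c x assume *: "(\<Sum>x\<in>\<delta> ` {..<d}. fscale (c x) x) = 0" "x \<in> \<delta> ` {..<d}"
    then obtain i where i: "i < d" "x = \<delta> i" by auto
    have "0 = (\<Sum>x\<in>\<delta> ` {..<d}. fscale (c x) x) (y i)" using *(1) by simp
    also have "\<dots> = (\<Sum>j<d. c (\<delta> j) * \<delta> j (y i))"
      by (simp add: sum.reindex[OF inj] sum_fun_apply fscale_def)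
    also have "\<dots> = (\<Sum>j<d. if i = j then c (\<delta> j) else 0)"
      using y i(1) by (intro sum.cong) auto
    also have "\<dots> = c x" using i by simp
    finally show "c x = 0" by simp
  qed simp
  moreover have "\<delta> ` {..<d} \<subseteq> U" using \<delta> by blast
  ultimately have "card (\<delta> ` {..<d}) \<le> fun_vs.dim U" by (intro card_independent_le_dim(2)[OF U])
  then show ?thesis using card_image[OF inj] by simp
qed

section \<open>Semicontinuity of solution spaces\<close>

definition solutions :: "nat set \<Rightarrow> (nat \<Rightarrow> 'a \<Rightarrow> 'k::field) set \<Rightarrow> 'a \<Rightarrow> (nat \<Rightarrow> 'k) set"
  where "solutions I Q x = {v \<in> supported I. \<forall>q\<in>Q. (\<Sum>i\<in>I. q i x * v i) = 0}"

lemma subspace_solutions: "fun_vs.subspace (solutions I Q x)"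
  by (rule fun_vs.subspaceI)
    (auto simp: solutions_def supported_def fscale_def sum.distrib algebra_simps simp flip: sum_distrib_left)

text \<open>One step of Gaussian elimination without division: the pivot row \<open>q0\<close> determines the unknown \<open>i0\<close>,
  and the other rows are multiplied by the pivot before \<open>i0\<close> is eliminated. The new rows are again regular
  functions of the point.\<close>

lemma dim_solutions_eliminate:
  fixes Q :: "(nat \<Rightarrow> 'a \<Rightarrow> 'k::field) set"
  assumes I: "finite I" "i0 \<in> I" and q0: "q0 \<in> Q" "q0 i0 x \<noteq> 0"
  shows "fun_vs.dim (solutions I Q x) =
    fun_vs.dim (solutions (I - {i0}) ((\<lambda>q i. q0 i0 * q i - q i0 * q0 i) ` Q) x)"
    (is "_ = fun_vs.dim (solutions ?I ?Q x)")
proof -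
  let ?f = "\<lambda>v :: nat \<Rightarrow> 'k. (\<lambda>i. if i = i0 then 0 else v i)"
  have lin: "Vector_Spaces.linear fscale fscale ?f"
    by (rule fun_linearI) (auto simp: fscale_def fun_eq_iff)
  have split: "(\<Sum>i\<in>I. q i x * v i) = q i0 x * v i0 + (\<Sum>i\<in>?I. q i x * v i)" for q v
    using I by (rule sum.remove)
  have fsum: "(\<Sum>i\<in>?I. q i x * ?f v i) = (\<Sum>i\<in>?I. q i x * v i)" for q v
    by (rule sum.cong) auto
  have Qsum: "(\<Sum>i\<in>?I. (q0 i0 * q i - q i0 * q0 i) x * v i) =
    q0 i0 x * (\<Sum>i\<in>?I. q i x * v i) - q i0 x * (\<Sum>i\<in>?I. q0 i x * v i)" for q v
    by (simp add: sum_subtractf sum_distrib_left algebra_simps)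
  have inj: "inj_on ?f (solutions I Q x)"
  proof (rule inj_onI)
    fix v w assume v: "v \<in> solutions I Q x" and w: "w \<in> solutions I Q x" and eq: "?f v = ?f w"
    have vw: "v i = w i" if "i \<noteq> i0" for i using fun_cong[OF eq, of i] that by simp
    then have "(\<Sum>i\<in>?I. q0 i x * v i) = (\<Sum>i\<in>?I. q0 i x * w i)" by (intro sum.cong) auto
    moreover have "(\<Sum>i\<in>I. q0 i x * v i) = 0" "(\<Sum>i\<in>I. q0 i x * w i) = 0"
      using v w q0(1) by (auto simp: solutions_def)
    ultimately have "q0 i0 x * v i0 = q0 i0 x * w i0"
      using split[of q0 v] split[of q0 w] by (metis add_right_cancel)
    then have "v i0 = w i0" using q0(2) by simp
    then show "v = w" using vw by (intro ext) metis
  qed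
  have "?f ` solutions I Q x = solutions ?I ?Q x"
  proof
    show "?f ` solutions I Q x \<subseteq> solutions ?I ?Q x"
    proof (rule image_subsetI)
      fix v assume v: "v \<in> solutions I Q x"
      have "(\<Sum>i\<in>?I. (q0 i0 * q i - q i0 * q0 i) x * ?f v i) = 0" if q: "q \<in> Q" for q
      proof -
        have "(\<Sum>i\<in>I. q i x * v i) = 0" "(\<Sum>i\<in>I. q0 i x * v i) = 0"
          using v q q0(1) by (simp_all add: solutions_def)
        then have "(\<Sum>i\<in>?I. q i x * v i) = - (q i0 x * v i0)" "(\<Sum>i\<in>?I. q0 i x * v i) = - (q0 i0 x * v i0)"
          using split[of q v] split[of q0 v] by (simp_all add: eq_neg_iff_add_eq_0 add.commute)
        then have "q0 i0 x * (\<Sum>i\<in>?I. q i x * v i) - q i0 x * (\<Sum>i\<in>?I. q0 i x * v i) = 0" by simp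
        then show ?thesis
          using Qsum[of q v] fsum[of "\<lambda>i. q0 i0 * q i - q i0 * q0 i" v] by (simp only:)
      qed
      moreover have "?f v \<in> supported ?I" using v by (auto simp: solutions_def supported_def)
      ultimately show "?f v \<in> solutions ?I ?Q x" unfolding solutions_def by blast
    qed
    show "solutions ?I ?Q x \<subseteq> ?f ` solutions I Q x"
    proof
      fix w assume w: "w \<in> solutions ?I ?Q x"
      define t where "t = - (\<Sum>i\<in>?I. q0 i x * w i) / q0 i0 x"
      define v where "v i = (if i = i0 then t else w i)" for i
      have vs: "(\<Sum>i\<in>?I. q i x * v i) = (\<Sum>i\<in>?I. q i x * w i)" for q
        by (rule sum.cong) (auto simp: v_def)
      have "(\<Sum>i\<in>I. q i x * v i) = 0" if q: "q \<in> Q" for q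
      proof -
        have "w \<in> supported ?I \<and> (\<forall>q\<in>?Q. (\<Sum>i\<in>?I. q i x * w i) = 0)"
          using w unfolding solutions_def by (rule CollectD)
        from bspec[OF conjunct2[OF this] imageI[OF q]] have "(\<Sum>i\<in>?I. (q0 i0 * q i - q i0 * q0 i) x * w i) = 0" .
        then have aS: "q0 i0 x * (\<Sum>i\<in>?I. q i x * w i) = q i0 x * (\<Sum>i\<in>?I. q0 i x * w i)"
          unfolding Qsum by (rule eq_iff_diff_eq_0[THEN iffD2])
        have at: "q0 i0 x * t = - (\<Sum>i\<in>?I. q0 i x * w i)" using q0(2) by (simp add: t_def)
        have "(\<Sum>i\<in>I. q i x * v i) = q i0 x * t + (\<Sum>i\<in>?I. q i x * w i)"
          unfolding split[of q v] vs by (simp add: v_def)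
        then have "q0 i0 x * (\<Sum>i\<in>I. q i x * v i) = q i0 x * (q0 i0 x * t) + q0 i0 x * (\<Sum>i\<in>?I. q i x * w i)"
          by (simp only: distrib_left mult.left_commute)
        also have "\<dots> = 0" unfolding aS at by simp
        finally have "q0 i0 x * (\<Sum>i\<in>I. q i x * v i) = 0" .
        then show ?thesis using q0(2) by simp
      qed
      moreover have "v \<in> supported I" using w I(2) by (auto simp: solutions_def supported_def v_def)
      ultimately have "v \<in> solutions I Q x" by (simp add: solutions_def)
      moreover have "w = ?f v" using w by (auto simp: v_def solutions_def supported_def fun_eq_iff)
      ultimately show "w \<in> ?f ` solutions I Q x" by blast
    qed
  qed
  moreover have "fin_dim (solutions I Q x)"
    by (rule fin_dim_subset[OF fin_dim_supported[OF I(1)]]) (auto simp: solutions_def)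
  ultimately show ?thesis using dim_inj_image(1)[OF lin subspace_solutions _ inj] by metis
qed

text \<open>Eliminate at \<open>x0\<close> until all rows vanish there. At points where no pivot vanishes the same elimination
  is valid, and the remaining system has the whole space as its solutions at \<open>x0\<close>. The function \<open>f\<close> is
  the product of the pivots.\<close>

lemma solutions_semicontinuous:
  fixes Q :: "(nat \<Rightarrow> 'a \<Rightarrow> 'k::field) set"
  assumes R: "subring_set R" and "finite I" and Q: "\<And>q i. q \<in> Q \<Longrightarrow> i \<in> I \<Longrightarrow> q i \<in> R"
  shows "\<exists>f\<in>R. f x0 \<noteq> 0 \<and> (\<forall>x. f x \<noteq> 0 \<longrightarrow> fun_vs.dim (solutions I Q x) \<le> fun_vs.dim (solutions I Q x0))"
  using assms(2,3)
proof (induction "card I" arbitrary: I Q)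
  case 0
  then have "I = {}" by simp
  then have "fun_vs.dim (solutions I Q x) \<le> fun_vs.dim (solutions I Q x0)" for x
    by (simp add: solutions_def)
  then show ?case using subring_setD(1)[OF R] by (intro bexI[of _ 1]) simp_all
next
  case (Suc n)
  show ?case
  proof (cases "\<exists>q\<in>Q. \<exists>i\<in>I. q i x0 \<noteq> 0")
    case False
    then have "solutions I Q x0 = supported I" by (auto simp: solutions_def intro!: sum.neutral)
    moreover have "solutions I Q x \<subseteq> supported I" for x by (auto simp: solutions_def)
    ultimately have "fun_vs.dim (solutions I Q x) \<le> fun_vs.dim (solutions I Q x0)" for x
      using dim_mono_fin[OF fin_dim_supported[OF Suc.prems(1)], of "solutions I Q x"] by simp
    then show ?thesis using subring_setD(1)[OF R] by (intro bexI[of _ 1]) simp_all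
  next
    case True
    then obtain q0 i0 where q0: "q0 \<in> Q" "i0 \<in> I" "q0 i0 x0 \<noteq> 0" by blast
    let ?I = "I - {i0}" and ?Q = "(\<lambda>q i. q0 i0 * q i - q i0 * q0 i) ` Q"
    have "n = card ?I" using Suc.hyps(2) q0(2) Suc.prems(1) by simp
    moreover have "q i \<in> R" if qi: "q \<in> ?Q" "i \<in> ?I" for q i
    proof -
      obtain q' where q': "q' \<in> Q" "q = (\<lambda>i. q0 i0 * q' i - q' i0 * q0 i)" using qi(1) by blast
      have "q0 i0 * q' i - q' i0 * q0 i \<in> R"
        using Suc.prems(2) q0(1,2) q'(1) qi(2) by (intro subring_setD(3,4)[OF R]) blast+
      then show ?thesis using q'(2) by simp
    qed
    ultimately obtain f where f: "f \<in> R" "f x0 \<noteq> 0"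
      "\<forall>x. f x \<noteq> 0 \<longrightarrow> fun_vs.dim (solutions ?I ?Q x) \<le> fun_vs.dim (solutions ?I ?Q x0)"
      using Suc.hyps(1)[of ?I ?Q] Suc.prems(1) by blast
    have elim: "fun_vs.dim (solutions I Q x) = fun_vs.dim (solutions ?I ?Q x)" if "q0 i0 x \<noteq> 0" for x
      by (rule dim_solutions_eliminate[OF Suc.prems(1) q0(2,1) that])
    show ?thesis
    proof (intro bexI[of _ "q0 i0 * f"] conjI allI impI)
      show "q0 i0 * f \<in> R" using subring_setD(4)[OF R Suc.prems(2)[OF q0(1,2)] f(1)] .
      show "(q0 i0 * f) x0 \<noteq> 0" using q0(3) f(2) by simp
      fix x assume "(q0 i0 * f) x \<noteq> 0"
      then have "q0 i0 x \<noteq> 0" "f x \<noteq> 0" by auto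
      then show "fun_vs.dim (solutions I Q x) \<le> fun_vs.dim (solutions I Q x0)"
        using elim[of x] elim[OF q0(3)] f(3) by simp
    qed
  qed
qed

section \<open>Tangent spaces in coordinates\<close>

lemma tangent_zero: "affine_variety A \<Longrightarrow> \<delta> \<in> tangent A x \<Longrightarrow> \<delta> 0 = 0"
proof -
  assume A: "affine_variety A" and \<delta>: "\<delta> \<in> tangent A x"
  have "0 \<in> cring A" using ideal_zero_ideal(1)[OF A] by (simp add: zero_ideal_def)
  from tangentD(2)[OF \<delta> this, of 0] show ?thesis by (simp add: fun_vs.scale_zero_right)
qed

lemma tangent_const:
  assumes A: "affine_variety A" and x: "x \<in> pts A" and \<delta>: "\<delta> \<in> tangent A x"
  shows "\<delta> (res (pts A) (\<lambda>_. c)) = 0"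
proof -
  note one = affine_variety_cring(1)[OF A]
  have "res (pts A) 1 * res (pts A) 1 = (res (pts A) 1 :: 'a \<Rightarrow> 'b)" by (auto simp: res_def fun_eq_iff)
  then have "\<delta> (res (pts A) 1) = \<delta> (res (pts A) 1) + \<delta> (res (pts A) 1)"
    using tangentD(3)[OF \<delta> one one] x by (simp add: res_def)
  then have "\<delta> (res (pts A) 1) = 0" by (simp only: add_cancel_right_right)
  then show ?thesis using tangentD(2)[OF \<delta> one, of c] by (simp add: const_eq_fun res_fscale)
qed

lemma tangent_chain_rule:
  assumes A: "affine_variety A" and x: "x \<in> pts A" and \<delta>: "\<delta> \<in> tangent A x"
    and y: "\<And>i. i < d \<Longrightarrow> y i \<in> cring A" and "(q, G) \<in> gradients d"
  shows "\<delta> (res (pts A) (\<lambda>x. q (\<lambda>i. y i x))) = (\<Sum>i<d. G i (\<lambda>i. y i x) * \<delta> (y i))"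
  using assms(5)
proof (induction rule: gradients.induct)
  case (const c)
  then show ?case by (simp add: tangent_const[OF A x \<delta>])
next
  case (coord i)
  have "(\<Sum>j<d. (if j = i then 1 else 0) (\<lambda>i. y i x) * \<delta> (y j)) = (\<Sum>j<d. if j = i then \<delta> (y j) else 0)"
    by (rule sum.cong) auto
  moreover have "res (pts A) (\<lambda>x. y i x) = y i" using affine_variety_cring(5)[OF A y[OF coord]] by simp
  ultimately show ?case using coord by simp
next
  case (add p G q H)
  have c: "res (pts A) (\<lambda>x. p (\<lambda>i. y i x)) \<in> cring A" "res (pts A) (\<lambda>x. q (\<lambda>i. y i x)) \<in> cring A"
    using gradients_poly_funs[OF add.hyps(1)] gradients_poly_funs[OF add.hyps(2)]
    by (auto intro: cring_compose[OF A _ y])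
  have eq: "res (pts A) (\<lambda>x. (p + q) (\<lambda>i. y i x)) = res (pts A) (\<lambda>x. p (\<lambda>i. y i x)) + res (pts A) (\<lambda>x. q (\<lambda>i. y i x))"
    by (auto simp: res_def fun_eq_iff)
  have "(\<Sum>i<d. (G i + H i) (\<lambda>i. y i x) * \<delta> (y i)) =
      (\<Sum>i<d. G i (\<lambda>i. y i x) * \<delta> (y i)) + (\<Sum>i<d. H i (\<lambda>i. y i x) * \<delta> (y i))"
    by (simp add: sum.distrib distrib_right)
  then show ?case unfolding eq tangentD(1)[OF \<delta> c] add.IH by (rule sym)
next
  case (mult p G q H)
  have c: "res (pts A) (\<lambda>x. p (\<lambda>i. y i x)) \<in> cring A" "res (pts A) (\<lambda>x. q (\<lambda>i. y i x)) \<in> cring A"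
    using gradients_poly_funs[OF mult.hyps(1)] gradients_poly_funs[OF mult.hyps(2)]
    by (auto intro: cring_compose[OF A _ y])
  have eq: "res (pts A) (\<lambda>x. (p * q) (\<lambda>i. y i x)) = res (pts A) (\<lambda>x. p (\<lambda>i. y i x)) * res (pts A) (\<lambda>x. q (\<lambda>i. y i x))"
    by (auto simp: res_def fun_eq_iff)
  have "\<delta> (res (pts A) (\<lambda>x. (p * q) (\<lambda>i. y i x))) =
      p (\<lambda>i. y i x) * (\<Sum>i<d. H i (\<lambda>i. y i x) * \<delta> (y i)) + q (\<lambda>i. y i x) * (\<Sum>i<d. G i (\<lambda>i. y i x) * \<delta> (y i))"
    unfolding eq tangentD(3)[OF \<delta> c] mult.IH using x by (simp add: res_def)
  also have "\<dots> = (\<Sum>i<d. (p * H i + q * G i) (\<lambda>i. y i x) * \<delta> (y i))"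
    by (simp add: sum_distrib_left sum.distrib algebra_simps)
  finally show ?case .
qed

lemma fin_dim_inj:
  fixes f :: "('b \<Rightarrow> 'k::field) \<Rightarrow> 'c \<Rightarrow> 'k"
  assumes f: "Vector_Spaces.linear fscale fscale f" and U: "fun_vs.subspace U" and inj: "inj_on f U"
    and W: "fin_dim W" "f ` U \<subseteq> W"
  shows "fin_dim U" "fun_vs.dim U \<le> fun_vs.dim W"
proof -
  obtain B where B: "B \<subseteq> U" "fun_vs.independent B" "U \<subseteq> fun_vs.span B" "card B = fun_vs.dim U"
    using fun_vs.basis_exists .
  have span: "fun_vs.span B = U" using fun_vs.span_minimal[OF B(1) U] B(3) by blast
  have ind: "fun_vs.independent (f ` B)"
    using fun_pair.linear_independent_injective_image[OF f B(2)] inj span by simp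
  have fBW: "f ` B \<subseteq> W" using B(1) W(2) by blast
  have injB: "inj_on f B" by (rule inj_on_subset[OF inj B(1)])
  have "finite B" using card_independent_le_dim(1)[OF W(1) fBW ind] finite_image_iff[OF injB] by blast
  then show "fin_dim U" unfolding fin_dim_def using B(3) by blast
  show "fun_vs.dim U \<le> fun_vs.dim W"
    using card_independent_le_dim(2)[OF W(1) fBW ind] card_image[OF injB] B(4) by simp
qed

lemma solutionsD:
  assumes "v \<in> solutions I Q x"
  shows "v \<in> supported I" "q \<in> Q \<Longrightarrow> (\<Sum>i\<in>I. q i x * v i) = 0"
  using assms by (simp_all add: solutions_def)

definition generates :: "('a, 'k::field) variety \<Rightarrow> nat \<Rightarrow> (nat \<Rightarrow> 'a \<Rightarrow> 'k) \<Rightarrow> bool"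
  where "generates A n w \<longleftrightarrow> (\<forall>i<n. w i \<in> cring A) \<and>
    (\<forall>f\<in>cring A. \<exists>p\<in>poly_funs n. f = res (pts A) (\<lambda>x. p (\<lambda>i. w i x)))"

lemma generates_exists:
  assumes A: "affine_variety A"
  shows "\<exists>n w. generates A n w"
proof -
  obtain n \<phi> where co: "coordinates A n \<phi>" using variety_coordinates[OF A] by blast
  define w where "w i = res (pts A) (\<lambda>x. \<phi> x i)" for i
  have eq: "res (pts A) (\<lambda>x. p (\<phi> x)) = res (pts A) (\<lambda>x. p (\<lambda>i. w i x))" for p
    by (auto simp: res_def w_def fun_eq_iff)
  have "w i \<in> cring A" if "i < n" for i
    unfolding coordinatesD(1)[OF co] w_def by (rule image_eqI[OF _ poly_funs.coord[OF that]]) simp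
  moreover have "\<exists>p\<in>poly_funs n. f = res (pts A) (\<lambda>x. p (\<lambda>i. w i x))" if "f \<in> cring A" for f
    using that unfolding coordinatesD(1)[OF co] eq by (rule imageE) (rule bexI)
  ultimately have "generates A n w" unfolding generates_def by simp
  then show ?thesis by blast
qed

lemma generatesD:
  assumes "generates A n w"
  shows "i < n \<Longrightarrow> w i \<in> cring A"
    "f \<in> cring A \<Longrightarrow> \<exists>p\<in>poly_funs n. f = res (pts A) (\<lambda>x. p (\<lambda>i. w i x))"
proof -
  note * = assms[unfolded generates_def]
  show "i < n \<Longrightarrow> w i \<in> cring A" by (rule conjunct1[OF *, rule_format])
  show "f \<in> cring A \<Longrightarrow> \<exists>p\<in>poly_funs n. f = res (pts A) (\<lambda>x. p (\<lambda>i. w i x))"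
    by (rule bspec[OF conjunct2[OF *]])
qed

lemma gradient_of_cring:
  assumes w: "generates A n w" and f: "f \<in> cring A"
  shows "\<exists>p G. (p, G) \<in> gradients n \<and> f = res (pts A) (\<lambda>x. p (\<lambda>i. w i x))"
proof -
  obtain p where p: "p \<in> poly_funs n" "f = res (pts A) (\<lambda>x. p (\<lambda>i. w i x))"
    by (rule bexE[OF generatesD(2)[OF w f]]) (erule (1) that)
  obtain G where "(p, G) \<in> gradients n" using gradient_exists[OF p(1)] ..
  with p(2) show ?thesis by (intro exI conjI)
qed

lemma tangent_chain_generators:
  assumes "affine_variety A" "x \<in> pts A" "\<delta> \<in> tangent A x" "generates A n w" "(p, G) \<in> gradients n"
  shows "\<delta> (res (pts A) (\<lambda>x. p (\<lambda>i. w i x))) = (\<Sum>i<n. G i (\<lambda>i. w i x) * \<delta> (w i))"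
  by (rule tangent_chain_rule[OF assms(1-3) _ assms(5)]) (rule generatesD(1)[OF assms(4)])

lemma cring_compose_generators:
  assumes "affine_variety A" "generates A n w" "p \<in> poly_funs n"
  shows "res (pts A) (\<lambda>x. p (\<lambda>i. w i x)) \<in> cring A"
  by (rule cring_compose[OF assms(1,3)]) (rule generatesD(1)[OF assms(2)])

definition relation_rows :: "('a, 'k::field) variety \<Rightarrow> nat \<Rightarrow> (nat \<Rightarrow> 'a \<Rightarrow> 'k) \<Rightarrow> (nat \<Rightarrow> 'a \<Rightarrow> 'k) set"
  where "relation_rows A n w = {q. \<exists>p G. (p, G) \<in> gradients n \<and>
    res (pts A) (\<lambda>x. p (\<lambda>i. w i x)) = 0 \<and> q = (\<lambda>i x. G i (\<lambda>i. w i x))}"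

definition eval_at :: "nat \<Rightarrow> (nat \<Rightarrow> 'a \<Rightarrow> 'k) \<Rightarrow> (('a \<Rightarrow> 'k) \<Rightarrow> 'k::field) \<Rightarrow> nat \<Rightarrow> 'k"
  where "eval_at n w \<delta> = (\<lambda>i. if i < n then \<delta> (w i) else 0)"

lemma linear_eval_at: "Vector_Spaces.linear fscale fscale (eval_at n w)"
  by (rule fun_linearI) (auto simp: eval_at_def fscale_def fun_eq_iff)

lemma tangent_eqI:
  assumes A: "affine_variety A" and w: "generates A n w" and x: "x \<in> pts A"
    and \<delta>: "\<delta> \<in> tangent A x" and \<epsilon>: "\<epsilon> \<in> tangent A x" and eq: "\<And>i. i < n \<Longrightarrow> \<delta> (w i) = \<epsilon> (w i)"
  shows "\<delta> = \<epsilon>"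
proof
  fix f
  show "\<delta> f = \<epsilon> f"
  proof (cases "f \<in> cring A")
    case True
    obtain p G where pG: "(p, G) \<in> gradients n" "f = res (pts A) (\<lambda>x. p (\<lambda>i. w i x))"
      using gradient_of_cring[OF w True] by (elim exE conjE) (erule (1) that)
    have "(\<Sum>i<n. G i (\<lambda>i. w i x) * \<delta> (w i)) = (\<Sum>i<n. G i (\<lambda>i. w i x) * \<epsilon> (w i))"
      by (rule sum.cong) (simp_all add: eq)
    then show ?thesis
      unfolding pG(2) using tangent_chain_generators[OF A x \<delta> w pG(1)]
        tangent_chain_generators[OF A x \<epsilon> w pG(1)] by simp
  qed (simp add: tangentD(4)[OF \<delta>] tangentD(4)[OF \<epsilon>])
qed

lemma inj_on_eval_at:
  assumes A: "affine_variety A" and w: "generates A n w" and x: "x \<in> pts A"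
  shows "inj_on (eval_at n w) (tangent A x)"
proof (rule inj_onI)
  fix \<delta> \<epsilon> assume \<delta>: "\<delta> \<in> tangent A x" "\<epsilon> \<in> tangent A x" and eq: "eval_at n w \<delta> = eval_at n w \<epsilon>"
  show "\<delta> = \<epsilon>"
  proof (rule tangent_eqI[OF A w x \<delta>])
    fix i assume "i < n"
    then show "\<delta> (w i) = \<epsilon> (w i)" using fun_cong[OF eq, of i] by (simp add: eval_at_def)
  qed
qed

text \<open>In the coordinates given by generators a tangent vector is a vector that annihilates the gradients of
  all relations (the Jacobian criterion). Conversely such a vector defines a derivation, because a directional
  derivative along it depends only on the function on the variety that a polynomial represents.\<close>

lemma eval_at_tangent:
  fixes A :: "('a, 'k::field_char_0) variety"
  assumes A: "affine_variety A" and w: "generates A n w" and x: "x \<in> pts A"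
  shows "eval_at n w ` tangent A x = solutions {..<n} (relation_rows A n w) x"
proof
  show "eval_at n w ` tangent A x \<subseteq> solutions {..<n} (relation_rows A n w) x"
  proof (rule image_subsetI)
    fix \<delta> assume \<delta>: "\<delta> \<in> tangent A x"
    have "(\<Sum>i<n. q i x * eval_at n w \<delta> i) = 0" if q: "q \<in> relation_rows A n w" for q
    proof -
      obtain p G where pG: "(p, G) \<in> gradients n" "res (pts A) (\<lambda>x. p (\<lambda>i. w i x)) = 0" "q = (\<lambda>i x. G i (\<lambda>i. w i x))"
        using q unfolding relation_rows_def by blast
      have "(\<Sum>i<n. q i x * eval_at n w \<delta> i) = (\<Sum>i<n. G i (\<lambda>i. w i x) * \<delta> (w i))"
        by (rule sum.cong) (simp_all add: pG(3) eval_at_def)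
      also have "\<dots> = \<delta> 0" using tangent_chain_generators[OF A x \<delta> w pG(1)] pG(2) by simp
      finally show ?thesis using tangent_zero[OF A \<delta>] by simp
    qed
    then show "eval_at n w \<delta> \<in> solutions {..<n} (relation_rows A n w) x"
      by (simp add: solutions_def supported_def eval_at_def)
  qed
next
  show "solutions {..<n} (relation_rows A n w) x \<subseteq> eval_at n w ` tangent A x"
  proof
    fix v assume v: "v \<in> solutions {..<n} (relation_rows A n w) x"
    let ?a = "\<lambda>i. w i x"
    define S where "S p = res (pts A) (\<lambda>x. p (\<lambda>i. w i x))" for p :: "(nat \<Rightarrow> 'k) \<Rightarrow> 'k"
    have rel: "dirder n p ?a v = 0" if p: "p \<in> poly_funs n" "S p = 0" for p
    proof -
      obtain G where G: "(p, G) \<in> gradients n" using gradient_exists[OF p(1)] ..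
      have "(\<lambda>i x. G i (\<lambda>i. w i x)) \<in> relation_rows A n w"
        unfolding relation_rows_def using G p(2) by (auto simp: S_def)
      from solutionsD(2)[OF v this] show ?thesis by (simp add: dirder_eq[OF G])
    qed
    have wd: "dirder n p ?a v = dirder n q ?a v" if pq: "p \<in> poly_funs n" "q \<in> poly_funs n" "S p = S q" for p q
    proof -
      have d: "p - q \<in> poly_funs n" by (rule poly_funs_simps(2)[OF pq(1,2)])
      have "S (p - q) = S p - S q" by (auto simp: S_def res_def fun_eq_iff)
      then have "S (p - q) = 0" using pq(3) by simp
      then have "dirder n (p - q) ?a v = 0" by (rule rel[OF d])
      then show ?thesis using dirder_simps(3)[OF d pq(2), of ?a v] by simp
    qed
    define rep where "rep f = (SOME p. p \<in> poly_funs n \<and> f = S p)" for f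
    have rep: "rep f \<in> poly_funs n \<and> f = S (rep f)" if "f \<in> cring A" for f
      unfolding rep_def
    proof (rule someI_ex[where P = "\<lambda>p. p \<in> poly_funs n \<and> f = S p"])
      show "\<exists>p. p \<in> poly_funs n \<and> f = S p" using generatesD(2)[OF w that] unfolding S_def by blast
    qed
    define \<delta> where "\<delta> f = (if f \<in> cring A then dirder n (rep f) ?a v else 0)" for f
    have SC: "S p \<in> cring A" if "p \<in> poly_funs n" for p
      unfolding S_def by (rule cring_compose_generators[OF A w that])
    have \<delta>: "\<delta> (S p) = dirder n p ?a v" if "p \<in> poly_funs n" for p
    proof -
      note r = rep[OF SC[OF that]]
      have "\<delta> (S p) = dirder n (rep (S p)) ?a v" unfolding \<delta>_def using SC[OF that] by (rule if_P)
      also have "\<dots> = dirder n p ?a v"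
        by (rule wd[OF conjunct1[OF r] that conjunct2[OF r, symmetric]])
      finally show ?thesis .
    qed
    have Sx: "S p x = p ?a" for p using x by (simp add: S_def res_def)
    have Sadd: "S (p + q) = S p + S q" and Smult: "S (p * q) = S p * S q" for p q
      by (auto simp: S_def res_def fun_eq_iff)
    have Sscale: "S (fscale c p) = fscale c (S p)" for c p by (auto simp: S_def res_def fscale_def fun_eq_iff)
    have "\<delta> \<in> tangent A x"
    proof (rule tangentI)
      fix f g assume fg: "f \<in> cring A" "g \<in> cring A"
      obtain p where p: "p \<in> poly_funs n" "f = S p" using rep[OF fg(1)] by blast
      obtain q where q: "q \<in> poly_funs n" "g = S q" using rep[OF fg(2)] by blast
      show "\<delta> (f + g) = \<delta> f + \<delta> g"
        unfolding p(2) q(2) Sadd[symmetric] \<delta>[OF p(1)] \<delta>[OF q(1)] \<delta>[OF poly_funs.add[OF p(1) q(1)]]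
        by (rule dirder_simps(3)[OF p(1) q(1)])
      show "\<delta> (f * g) = f x * \<delta> g + g x * \<delta> f"
        unfolding p(2) q(2) Smult[symmetric] \<delta>[OF p(1)] \<delta>[OF q(1)] \<delta>[OF poly_funs.mult[OF p(1) q(1)]] Sx
        by (rule dirder_simps(4)[OF p(1) q(1)])
    next
      fix c f assume f: "f \<in> cring A"
      obtain p where p: "p \<in> poly_funs n" "f = S p" using rep[OF f] by blast
      have "fscale c p = (\<lambda>_. c) * p" by (auto simp: fscale_def)
      then have "dirder n (fscale c p) ?a v = c * dirder n p ?a v"
        using dirder_simps(4)[OF poly_funs.const[of c] p(1), of ?a v] by (simp add: dirder_simps(1))
      then show "\<delta> (fscale c f) = c * \<delta> f"
        unfolding p(2) Sscale[symmetric] \<delta>[OF p(1)] \<delta>[OF poly_funs_simps(3)[OF p(1) p(1)]] .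
    qed (simp add: \<delta>_def)
    moreover have "v = eval_at n w \<delta>"
    proof
      fix i
      show "v i = eval_at n w \<delta> i"
      proof (cases "i < n")
        case True
        have "S (\<lambda>a. a i) = w i" using affine_variety_cring(5)[OF A generatesD(1)[OF w True]] by (simp add: S_def)
        then show ?thesis using \<delta>[OF poly_funs.coord[OF True]] True by (simp add: eval_at_def dirder_simps)
      qed (use v in \<open>simp add: eval_at_def solutions_def supported_def\<close>)
    qed
    ultimately show "v \<in> eval_at n w ` tangent A x" by blast
  qed
qed

lemma fin_dim_tangent:
  assumes A: "affine_variety A" and x: "x \<in> pts A"
  shows "fin_dim (tangent A x)"
proof -
  obtain n w where w: "generates A n w" using generates_exists[OF A] by blast
  show ?thesis
  proof (rule fin_dim_inj(1)[OF linear_eval_at subspace_tangent[OF A] inj_on_eval_at[OF A w x]])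
    show "fin_dim (supported {..<n} :: (nat \<Rightarrow> 'b) set)" by (rule fin_dim_supported) simp
    show "eval_at n w ` tangent A x \<subseteq> supported {..<n}" by (auto simp: eval_at_def supported_def)
  qed
qed

lemma dim_tangent_solutions:
  fixes A :: "('a, 'k::field_char_0) variety"
  assumes A: "affine_variety A" and w: "generates A n w" and x: "x \<in> pts A"
  shows "fun_vs.dim (tangent A x) = fun_vs.dim (solutions {..<n} (relation_rows A n w) x)"
  using dim_inj_image(1)[OF linear_eval_at subspace_tangent[OF A] fin_dim_tangent[OF A x] inj_on_eval_at[OF A w x]]
  unfolding eval_at_tangent[OF A w x] by (rule sym)

lemma compose_extend_cring:
  assumes A: "affine_variety A" and w: "generates A n w" and p: "p \<in> poly_funs n"
  shows "(\<lambda>x. p (\<lambda>i. w i x)) \<in> extend_cring A"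
  unfolding extend_cring_def mem_Collect_eq by (rule cring_compose_generators[OF A w p])

lemma relation_rows_extend_cring:
  assumes A: "affine_variety A" and w: "generates A n w" and q: "q \<in> relation_rows A n w"
  shows "q i \<in> extend_cring A"
proof -
  obtain p G where pG: "(p, G) \<in> gradients n" "q = (\<lambda>i x. G i (\<lambda>i. w i x))"
    using q unfolding relation_rows_def by blast
  have "G i \<in> poly_funs n" using gradients_poly_funs[OF pG(1)] by blast
  from compose_extend_cring[OF A w this] show ?thesis by (simp add: pG(2))
qed

lemma dim_tangent_semicontinuous:
  fixes A :: "('a, 'k::field_char_0) variety"
  assumes A: "affine_variety A" and x0: "x0 \<in> pts A"
  shows "\<exists>f\<in>cring A. f x0 \<noteq> 0 \<and>
    (\<forall>x\<in>pts A. f x \<noteq> 0 \<longrightarrow> fun_vs.dim (tangent A x) \<le> fun_vs.dim (tangent A x0))"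
proof -
  obtain n w where w: "generates A n w" using generates_exists[OF A] by blast
  have "\<exists>f\<in>extend_cring A. f x0 \<noteq> 0 \<and>
    (\<forall>x. f x \<noteq> 0 \<longrightarrow> fun_vs.dim (solutions {..<n} (relation_rows A n w) x)
      \<le> fun_vs.dim (solutions {..<n} (relation_rows A n w) x0))"
    by (rule solutions_semicontinuous[OF subring_set_extend_cring(1)[OF A] finite_lessThan])
      (rule relation_rows_extend_cring[OF A w])
  then obtain f where f: "f \<in> extend_cring A" "f x0 \<noteq> 0"
    "\<forall>x. f x \<noteq> 0 \<longrightarrow> fun_vs.dim (solutions {..<n} (relation_rows A n w) x)
      \<le> fun_vs.dim (solutions {..<n} (relation_rows A n w) x0)"
    by blast
  have fx: "res (pts A) f x = f x" if "x \<in> pts A" for x using that by (simp add: res_def)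
  show ?thesis
  proof (intro bexI[of _ "res (pts A) f"] conjI ballI impI)
    show "res (pts A) f \<in> cring A" using f(1) by (simp add: extend_cring_def)
    show "res (pts A) f x0 \<noteq> 0" using fx[OF x0] f(2) by simp
    fix x assume "x \<in> pts A" "res (pts A) f x \<noteq> 0"
    then show "fun_vs.dim (tangent A x) \<le> fun_vs.dim (tangent A x0)"
      using f(3) fx dim_tangent_solutions[OF A w] x0 by simp
  qed
qed

text \<open>In coordinates the condition is one further row in the system that defines the tangent spaces. On \<open>D\<close>
  the enlarged system has the same solutions as the original one. By semicontinuity the enlarged system
  has at \<open>e\<close> a solution space of at least the dimension that it has at some point of \<open>D\<close>, which is at
  least the dimension of the tangent space at \<open>e\<close>. So the additional row changes nothing at \<open>e\<close>.\<close>

lemma linear_condition_extends: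
  fixes A :: "('a, 'k::field_char_0) variety"
  assumes A: "affine_variety A" and e: "e \<in> pts A" and D: "D \<subseteq> pts A"
    and dense: "\<And>f. f \<in> cring A \<Longrightarrow> (\<And>x. x \<in> D \<Longrightarrow> f x = 0) \<Longrightarrow> f e = 0"
    and dim: "\<And>x. x \<in> D \<Longrightarrow> fun_vs.dim (tangent A e) \<le> fun_vs.dim (tangent A x)"
    and gh: "\<And>s. s \<in> I \<Longrightarrow> g s \<in> cring A" "\<And>s. s \<in> I \<Longrightarrow> h s \<in> cring A"
    and zero: "\<And>x \<delta>. x \<in> D \<Longrightarrow> \<delta> \<in> tangent A x \<Longrightarrow> (\<Sum>s\<in>I. g s x * \<delta> (h s)) = 0"
    and \<delta>: "\<delta> \<in> tangent A e"
  shows "(\<Sum>s\<in>I. g s e * \<delta> (h s)) = (0::'k)"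
proof -
  obtain n w where w: "generates A n w" using generates_exists[OF A] by blast
  define PG where "PG s = (SOME pG. pG \<in> gradients n \<and> h s = res (pts A) (\<lambda>x. fst pG (\<lambda>i. w i x)))" for s
  have PG: "PG s \<in> gradients n \<and> h s = res (pts A) (\<lambda>x. fst (PG s) (\<lambda>i. w i x))" if s: "s \<in> I" for s
    unfolding PG_def
  proof (rule someI_ex[where P = "\<lambda>pG. pG \<in> gradients n \<and> h s = res (pts A) (\<lambda>x. fst pG (\<lambda>i. w i x))"])
    obtain p G where "(p, G) \<in> gradients n" "h s = res (pts A) (\<lambda>x. p (\<lambda>i. w i x))"
      using gradient_of_cring[OF w gh(2)[OF s]] by (elim exE conjE) (erule (1) that)
    then show "\<exists>pG. pG \<in> gradients n \<and> h s = res (pts A) (\<lambda>x. fst pG (\<lambda>i. w i x))"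
      by (intro exI[of _ "(p, G)"]) simp
  qed
  define H where "H s = snd (PG s)" for s
  have hH: "\<delta> (h s) = (\<Sum>i<n. H s i (\<lambda>i. w i x) * \<delta> (w i))"
    if s: "s \<in> I" and x: "x \<in> pts A" and \<delta>: "\<delta> \<in> tangent A x" for s x \<delta>
    using tangent_chain_generators[OF A x \<delta> w, of "fst (PG s)" "H s"] PG[OF s]
    by (simp add: H_def)
  have Hp: "H s i \<in> poly_funs n" if s: "s \<in> I" for s i
    using gradients_poly_funs[of "fst (PG s)" "H s" n] PG[OF s] by (simp add: H_def)
  define r where "r i = (\<Sum>s\<in>I. g s * (\<lambda>x. H s i (\<lambda>i. w i x)))" for i
  have rx: "(\<Sum>i<n. r i x * eval_at n w \<delta> i) = (\<Sum>s\<in>I. g s x * \<delta> (h s))"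
    if x: "x \<in> pts A" and \<delta>: "\<delta> \<in> tangent A x" for x \<delta>
  proof -
    have "(\<Sum>i<n. r i x * eval_at n w \<delta> i) = (\<Sum>i<n. \<Sum>s\<in>I. g s x * (H s i (\<lambda>i. w i x) * \<delta> (w i)))"
      by (rule sum.cong) (simp_all add: r_def sum_fun_apply eval_at_def sum_distrib_right mult.assoc)
    also have "\<dots> = (\<Sum>s\<in>I. \<Sum>i<n. g s x * (H s i (\<lambda>i. w i x) * \<delta> (w i)))" by (rule sum.swap)
    also have "\<dots> = (\<Sum>s\<in>I. g s x * \<delta> (h s))"
      by (rule sum.cong) (simp_all add: hH[OF _ x \<delta>] sum_distrib_left)
    finally show ?thesis .
  qed
  note RE = subring_set_extend_cring[OF A]
  have rE: "r i \<in> extend_cring A" for i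
    unfolding r_def
  proof (rule subring_setD(8)[OF RE(1)])
    fix s assume s: "s \<in> I"
    show "g s * (\<lambda>x. H s i (\<lambda>i. w i x)) \<in> extend_cring A"
      using RE(3) gh(1)[OF s] by (intro subring_setD(4)[OF RE(1)] compose_extend_cring[OF A w Hp[OF s]]) blast
  qed
  let ?N = "\<lambda>x. solutions {..<n} (relation_rows A n w) x"
  let ?N' = "\<lambda>x. solutions {..<n} (insert r (relation_rows A n w)) x"
  have N': "v \<in> ?N' x \<longleftrightarrow> v \<in> ?N x \<and> (\<Sum>i<n. r i x * v i) = 0" for v x
    by (auto simp: solutions_def)
  have "\<exists>f\<in>extend_cring A. f e \<noteq> 0 \<and> (\<forall>x. f x \<noteq> 0 \<longrightarrow> fun_vs.dim (?N' x) \<le> fun_vs.dim (?N' e))"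
  proof (rule solutions_semicontinuous[OF RE(1) finite_lessThan])
    fix q i assume "q \<in> insert r (relation_rows A n w)"
    then show "q i \<in> extend_cring A" using relation_rows_extend_cring[OF A w] rE by blast
  qed
  then obtain f where f: "f \<in> extend_cring A" "f e \<noteq> 0" "\<forall>x. f x \<noteq> 0 \<longrightarrow> fun_vs.dim (?N' x) \<le> fun_vs.dim (?N' e)"
    by blast
  have "\<exists>x\<in>D. f x \<noteq> 0"
  proof (rule ccontr)
    assume *: "\<not> (\<exists>x\<in>D. f x \<noteq> 0)"
    have "res (pts A) f e = 0"
    proof (rule dense)
      show "res (pts A) f \<in> cring A" using f(1) by (simp add: extend_cring_def)
      show "res (pts A) f x = 0" if "x \<in> D" for x using * that by (simp add: res_def)
    qed
    then show False using f(2) e by (simp add: res_def)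
  qed
  then obtain x where x: "x \<in> D" "f x \<noteq> 0" by blast
  have xA: "x \<in> pts A" using x(1) D by blast
  have "?N' x = ?N x"
  proof -
    have "(\<Sum>i<n. r i x * v i) = 0" if "v \<in> ?N x" for v
    proof -
      have "v \<in> eval_at n w ` tangent A x" using that eval_at_tangent[OF A w xA] by simp
      then obtain \<delta> where "\<delta> \<in> tangent A x" "v = eval_at n w \<delta>" by blast
      then show ?thesis using rx[OF xA] zero[OF x(1)] by simp
    qed
    then show ?thesis using N' by blast
  qed
  then have "fun_vs.dim (?N e) \<le> fun_vs.dim (?N' e)"
    using dim[OF x(1)] f(3)[rule_format, OF x(2)] dim_tangent_solutions[OF A w xA] dim_tangent_solutions[OF A w e]
    by simp
  moreover have "fin_dim (?N e)"
    by (rule fin_dim_subset[OF fin_dim_supported[of "{..<n}"]]) (auto simp: solutions_def)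
  ultimately have "?N' e = ?N e"
    using N' by (intro subspace_eq_if_dim_le subspace_solutions) blast+
  moreover have "eval_at n w \<delta> \<in> ?N e" using eval_at_tangent[OF A w e] \<delta> by blast
  ultimately have "(\<Sum>i<n. r i e * eval_at n w \<delta> i) = 0" using N' by blast
  then show ?thesis using rx[OF e \<delta>] by simp
qed

section \<open>The dimension of an irreducible variety\<close>

definition irreducible_variety :: "('a, 'k::field) variety \<Rightarrow> bool"
  where "irreducible_variety A \<longleftrightarrow> affine_variety A \<and> irreducible_closed A (pts A)"

abbreviation nonvanishing :: "('a, 'k::field) variety \<Rightarrow> ('a \<Rightarrow> 'k) \<Rightarrow> bool"
  where "nonvanishing A f \<equiv> f \<in> cring A \<and> f \<notin> zero_ideal A (pts A)"

lemma irreducible_varietyD: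
  assumes "irreducible_variety A"
  shows "affine_variety A" "irreducible_closed A (pts A)"
  using assms by (simp_all add: irreducible_variety_def)

lemma nonvanishing_mult:
  assumes A: "irreducible_variety A" and "nonvanishing A f" "nonvanishing A g"
  shows "nonvanishing A (f * g)"
  using prime_ideal_inD(6)[OF irreducible_closedD(5)[OF irreducible_varietyD[OF A]], of f g]
    affine_variety_cring(3)[OF irreducible_varietyD(1)[OF A], of f g] assms(2,3) by blast

lemma nonvanishing_one:
  assumes A: "irreducible_variety A"
  shows "nonvanishing A (res (pts A) 1)"
proof -
  obtain x where "x \<in> pts A" using irreducible_closedD(4)[OF irreducible_varietyD[OF A]] by blast
  then have "res (pts A) 1 \<notin> zero_ideal A (pts A)" by (auto simp: zero_ideal_def res_def)
  then show ?thesis using affine_variety_cring(1)[OF irreducible_varietyD(1)[OF A]] by blast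
qed

lemma nonvanishingI: "f \<in> cring A \<Longrightarrow> x \<in> pts A \<Longrightarrow> f x \<noteq> 0 \<Longrightarrow> nonvanishing A f"
  by (auto simp: zero_ideal_def)

lemma submersive_lift_exists:
  fixes A :: "('a, 'k::{alg_closed_field,field_char_0}) variety"
  assumes A: "irreducible_variety A" and y: "alg_indep_on A (pts A) d y" and v: "nonvanishing A v"
  shows "\<exists>b x. submersive_lift A (zero_ideal A (pts A)) d y v b x"
proof -
  note AD = irreducible_varietyD[OF A]
  note CD = irreducible_closedD[OF AD]
  obtain u where u: "u \<in> poly_funs d" "u \<noteq> 0"
    "\<forall>b. u b \<noteq> 0 \<longrightarrow> (\<exists>x. submersive_lift A (zero_ideal A (pts A)) d y v b x)"
    using lift_point_and_tangents[OF AD(1) CD(5) alg_indep_on_imp_mod[OF AD(1) CD(3) y]] v by blast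
  obtain b where "u b \<noteq> 0" using u(2) by (auto simp: fun_eq_iff)
  then show ?thesis using u(3) by blast
qed

text \<open>At some point the tangent space maps onto the \<open>d\<close> coordinate directions, and such a point exists where
  the dimension of the tangent space is at most the one at \<open>x0\<close>.\<close>

lemma alg_indep_le_dim_tangent:
  fixes A :: "('a, 'k::{alg_closed_field,field_char_0}) variety"
  assumes A: "irreducible_variety A" and y: "alg_indep_on A (pts A) d y" and x0: "x0 \<in> pts A"
  shows "d \<le> fun_vs.dim (tangent A x0)"
proof -
  note AD = irreducible_varietyD[OF A]
  obtain f where f: "f \<in> cring A" "f x0 \<noteq> 0"
    "\<forall>x\<in>pts A. f x \<noteq> 0 \<longrightarrow> fun_vs.dim (tangent A x) \<le> fun_vs.dim (tangent A x0)"
    using dim_tangent_semicontinuous[OF AD(1) x0] by blast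
  have "nonvanishing A f" by (rule nonvanishingI[OF f(1) x0 f(2)])
  from submersive_lift_exists[OF A y this] obtain b x where
    "submersive_lift A (zero_ideal A (pts A)) d y f b x" by blast
  note x = submersive_liftD[OF this]
  have "\<exists>\<delta>. \<delta> \<in> tangent A x \<and> (\<forall>i<d. \<delta> (y i) = (if i = j then 1 else 0))" for j
    using x(5)[of "\<lambda>i. if i = j then 1 else 0"] by blast
  then have "\<exists>\<delta>. \<forall>j. \<delta> j \<in> tangent A x \<and> (\<forall>i<d. \<delta> j (y i) = (if i = j then 1 else 0))"
    by (intro choice allI)
  then obtain \<delta> where "\<forall>j. \<delta> j \<in> tangent A x \<and> (\<forall>i<d. \<delta> j (y i) = (if i = j then 1 else 0))" ..
  then have "d \<le> fun_vs.dim (tangent A x)"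
    by (intro dim_ge_if_dual_basis[OF fin_dim_tangent[OF AD(1) x(1)], of d \<delta> y]) simp_all
  also have "\<dots> \<le> fun_vs.dim (tangent A x0)" using f(3) x(1,4) by blast
  finally show ?thesis .
qed

definition trdeg :: "('a, 'k::field) variety \<Rightarrow> nat"
  where "trdeg A = (GREATEST d. \<exists>y. alg_indep_on A (pts A) d y)"

text \<open>The dimension of any tangent space bounds the numbers in question, so that the greatest one exists.\<close>

lemma trdeg:
  fixes A :: "('a, 'k::{alg_closed_field,field_char_0}) variety"
  assumes A: "irreducible_variety A"
  shows "\<exists>y. alg_indep_on A (pts A) (trdeg A) y"
    "alg_indep_on A (pts A) d y \<Longrightarrow> d \<le> trdeg A"
    "x \<in> pts A \<Longrightarrow> trdeg A \<le> fun_vs.dim (tangent A x)"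
proof -
  note AD = irreducible_varietyD[OF A]
  obtain x0 where x0: "x0 \<in> pts A" using irreducible_closedD(4)[OF AD] by blast
  have bound: "d \<le> fun_vs.dim (tangent A x0)" if "\<exists>y. alg_indep_on A (pts A) d y" for d
    using alg_indep_le_dim_tangent[OF A _ x0] that by blast
  have "irreducible_chain A 0 (\<lambda>_. pts A)" using AD(2) by (simp add: irreducible_chain_def)
  from chain_imp_alg_indep_on[OF AD(1) this] have ex: "\<exists>y. alg_indep_on A (pts A) 0 y" .
  show max: "\<exists>y. alg_indep_on A (pts A) (trdeg A) y"
    unfolding trdeg_def by (rule GreatestI_nat[where P = "\<lambda>d. \<exists>y. alg_indep_on A (pts A) d y", OF ex bound])
  show "d \<le> trdeg A" if y: "alg_indep_on A (pts A) d y"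
  proof -
    have "\<exists>y. alg_indep_on A (pts A) d y" using y by blast
    then show ?thesis
      unfolding trdeg_def
      by (rule Greatest_le_nat[where P = "\<lambda>d. \<exists>y. alg_indep_on A (pts A) d y", OF _ bound])
  qed
  show "trdeg A \<le> fun_vs.dim (tangent A x)" if "x \<in> pts A"
    using alg_indep_le_dim_tangent[OF A _ that] max by blast
qed

definition immersive :: "('a, 'k::field) variety \<Rightarrow> nat \<Rightarrow> (nat \<Rightarrow> 'a \<Rightarrow> 'k) \<Rightarrow> ('a \<Rightarrow> 'k) \<Rightarrow> ('a \<Rightarrow> 'k) \<Rightarrow> bool"
  where "immersive A d y g f \<longleftrightarrow>
    (\<forall>x\<in>pts A. g x \<noteq> 0 \<longrightarrow> (\<forall>\<delta>\<in>tangent A x. (\<forall>j<d. \<delta> (y j) = 0) \<longrightarrow> \<delta> f = 0))"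

lemma tangent_monomial:
  assumes A: "affine_variety A" and \<delta>: "\<delta> \<in> tangent A x"
    and F: "F \<in> cring A" "\<delta> F = 0" and f: "f \<in> cring A"
  shows "F * f ^ i \<in> cring A \<and> \<delta> (F * f ^ i) = of_nat i * F x * f x ^ (i - 1) * \<delta> f"
proof (induction i)
  case 0
  then show ?case using F by (simp only: power_0 mult_1_right of_nat_0 mult_zero_left)
next
  case (Suc i)
  have eq: "F * f ^ Suc i = f * (F * f ^ i)" by (simp only: power_Suc mult.left_commute)
  have "\<delta> (F * f ^ Suc i) = f x * \<delta> (F * f ^ i) + (F * f ^ i) x * \<delta> f"
    unfolding eq using tangentD(3)[OF \<delta> f conjunct1[OF Suc]] .
  also have "\<dots> = f x * (of_nat i * F x * f x ^ (i - 1) * \<delta> f) + F x * f x ^ i * \<delta> f"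
    by (simp add: conjunct2[OF Suc] power_fun_apply)
  also have "\<dots> = of_nat (Suc i) * F x * f x ^ (Suc i - 1) * \<delta> f"
    by (cases i) (simp_all add: algebra_simps)
  finally show ?case
    unfolding eq using affine_variety_cring(3)[OF A f conjunct1[OF Suc]] by blast
qed

lemma tangent_sum:
  assumes A: "affine_variety A" and \<delta>: "\<delta> \<in> tangent A x" and f: "\<And>i. i \<in> I \<Longrightarrow> f i \<in> cring A"
  shows "sum f I \<in> cring A \<and> \<delta> (sum f I) = (\<Sum>i\<in>I. \<delta> (f i))"
  using f
proof (induction I rule: infinite_finite_induct)
  case (insert i I)
  then have IH: "sum f I \<in> cring A \<and> \<delta> (sum f I) = (\<Sum>i\<in>I. \<delta> (f i))" and fi: "f i \<in> cring A" by auto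
  show ?case
    unfolding sum.insert[OF insert.hyps] tangentD(1)[OF \<delta> fi conjunct1[OF IH]] conjunct2[OF IH]
    by (rule conjI[OF affine_variety_cring(2)[OF A fi conjunct1[OF IH]] refl])
qed (use tangent_zero[OF A \<delta>] zero_idealD(1)[OF ideal_zero_ideal(1)[OF A]] in simp_all)

text \<open>The function \<open>f\<close> satisfies an algebraic relation over the functions \<open>y\<close>. Applying \<open>\<delta>\<close> to the relation
  leaves the derivative of the relation with respect to \<open>f\<close>, times \<open>\<delta> f\<close>. This derivative, the
  function \<open>g\<close>, is not identically zero because the degree is minimal and the characteristic is zero.\<close>

lemma immersive_exists:
  fixes A :: "('a, 'k::{alg_closed_field,field_char_0}) variety"
  assumes A: "irreducible_variety A" and y: "alg_indep_on A (pts A) (trdeg A) y" and f: "f \<in> cring A"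
  shows "\<exists>g. nonvanishing A g \<and> immersive A (trdeg A) y g f"
proof -
  note AD = irreducible_varietyD[OF A]
  let ?d = "trdeg A"
  define C where "C c = res (pts A) (\<lambda>x. c (\<lambda>i. y i x))" for c :: "(nat \<Rightarrow> 'k) \<Rightarrow> 'k"
  have CA: "C c \<in> cring A" if "c \<in> poly_funs ?d" for c
    unfolding C_def by (rule cring_compose[OF AD(1) that]) (rule alg_indep_onD(1)[OF y])
  have C0: "c = 0" if "c \<in> poly_funs ?d" "\<forall>x\<in>pts A. c (\<lambda>i. y i x) = 0" for c
    by (rule alg_indep_onD(2)[OF y that])
  define deg where "deg N \<longleftrightarrow> (\<exists>c. (\<forall>i. c i \<in> poly_funs ?d) \<and> c N \<noteq> 0 \<and>
    (\<forall>x\<in>pts A. (\<Sum>i\<le>N. c i (\<lambda>i. y i x) * f x ^ i) = 0))" for N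
  have "\<exists>N. deg N"
  proof -
    have "\<not> alg_indep_on A (pts A) (Suc ?d) (y(?d := f))" using trdeg(2)[OF A] by fastforce
    moreover have "(y(?d := f)) i \<in> cring A" if "i < Suc ?d" for i
      using that f alg_indep_onD(1)[OF y, of i] by (cases "i = ?d") simp_all
    ultimately obtain q where q: "q \<in> poly_funs (Suc ?d)" "\<forall>x\<in>pts A. q (\<lambda>i. (y(?d := f)) i x) = 0" "q \<noteq> 0"
      unfolding alg_indep_on_def by blast
    obtain c N where c: "\<forall>i. c i \<in> poly_funs ?d" "\<forall>a. q a = (\<Sum>i\<le>N. c i a * a ?d ^ i)"
      using poly_funs_Suc_expand[OF q(1)] by blast
    have "\<exists>j\<le>N. c j \<noteq> 0"
    proof (rule ccontr)
      assume *: "\<not> (\<exists>j\<le>N. c j \<noteq> 0)"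
      have "q a = 0" for a using * unfolding c(2)[rule_format] by (intro sum.neutral) auto
      then show False using q(3) by (simp add: fun_eq_iff)
    qed
    then have J: "finite {j. j \<le> N \<and> c j \<noteq> 0}" "{j. j \<le> N \<and> c j \<noteq> 0} \<noteq> {}" by auto
    define M where "M = Max {j. j \<le> N \<and> c j \<noteq> 0}"
    have M: "M \<le> N" "c M \<noteq> 0" using Max_in[OF J] unfolding M_def by auto
    have above: "c i = 0" if "M < i" "i \<le> N" for i
    proof (rule ccontr)
      assume "c i \<noteq> 0"
      then have "i \<le> M" unfolding M_def using that(2) by (intro Max_ge[OF J(1)]) simp
      then show False using that(1) by simp
    qed
    have yd: "c i (\<lambda>i. (y(?d := f)) i x) = c i (\<lambda>i. y i x)" for i x
      by (rule poly_funs_cong[OF c(1)[rule_format]]) simp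
    have "(\<Sum>i\<le>M. c i (\<lambda>i. y i x) * f x ^ i) = 0" if x: "x \<in> pts A" for x
    proof -
      have "(\<Sum>i\<le>M. c i (\<lambda>i. y i x) * f x ^ i) = (\<Sum>i\<le>N. c i (\<lambda>i. y i x) * f x ^ i)"
      proof (rule sum.mono_neutral_left)
        show "\<forall>i\<in>{..N} - {..M}. c i (\<lambda>i. y i x) * f x ^ i = 0"
        proof
          fix i assume "i \<in> {..N} - {..M}"
          then have "c i = 0" by (intro above) auto
          then show "c i (\<lambda>i. y i x) * f x ^ i = 0" by simp
        qed
      qed (use M(1) in auto)
      also have "\<dots> = q (\<lambda>i. (y(?d := f)) i x)" unfolding c(2)[rule_format] yd by simp
      finally show ?thesis using q(2) x by simp
    qed
    then have "deg M" unfolding deg_def using c(1) M(2) by blast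
    then show ?thesis ..
  qed
  then obtain N0 where N0: "deg N0" ..
  define N where "N = (LEAST N. deg N)"
  have N: "deg N" and min: "\<And>M. M < N \<Longrightarrow> \<not> deg M"
    using LeastI[of deg, OF N0] not_less_Least unfolding N_def by auto
  obtain c where c: "\<And>i. c i \<in> poly_funs ?d" "c N \<noteq> 0"
    "\<And>x. x \<in> pts A \<Longrightarrow> (\<Sum>i\<le>N. c i (\<lambda>i. y i x) * f x ^ i) = 0"
    using N unfolding deg_def by blast
  have "N \<noteq> 0"
  proof
    assume "N = 0"
    then have "c 0 = 0" using c(3) by (intro C0[OF c(1)]) simp
    then show False using c(2) \<open>N = 0\<close> by simp
  qed
  then obtain M where M: "N = Suc M" by (cases N) auto
  define g where "g = res (pts A) (\<lambda>x. \<Sum>i\<le>M. of_nat (Suc i) * c (Suc i) (\<lambda>i. y i x) * f x ^ i)"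
  have gx: "g x = (\<Sum>i\<le>M. of_nat (Suc i) * c (Suc i) (\<lambda>i. y i x) * f x ^ i)" if "x \<in> pts A" for x
    using that by (simp add: g_def res_def)
  have gA: "g \<in> cring A"
  proof -
    note RE = subring_set_extend_cring[OF AD(1)]
    have "(\<lambda>x. \<Sum>i\<le>M. of_nat (Suc i) * c (Suc i) (\<lambda>i. y i x) * f x ^ i)
      = (\<Sum>i\<le>M. (\<lambda>_. of_nat (Suc i)) * (\<lambda>x. c (Suc i) (\<lambda>i. y i x)) * f ^ i)"
      by (simp add: fun_eq_iff sum_fun_apply power_fun_apply)
    moreover have "\<dots> \<in> extend_cring A"
    proof (intro subring_setD(8)[OF RE(1)] subring_setD(4,7)[OF RE(1)] RE(2))
      show "f \<in> extend_cring A" using RE(3) f by blast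
      show "(\<lambda>x. c (Suc i) (\<lambda>i. y i x)) \<in> extend_cring A" for i
        using CA[OF c(1)] unfolding extend_cring_def C_def by blast
    qed
    ultimately show ?thesis by (simp add: g_def extend_cring_def)
  qed
  have "g \<notin> zero_ideal A (pts A)"
  proof
    assume gz: "g \<in> zero_ideal A (pts A)"
    define c' where "c' i = fscale (of_nat (Suc i)) (c (Suc i))" for i
    have "c' i \<in> poly_funs ?d" for i unfolding c'_def by (rule poly_funs_simps(3)[OF c(1) c(1)])
    moreover have "c' M \<noteq> 0"
    proof
      assume z: "c' M = 0"
      have "c N a = 0" for a
        using fun_cong[OF z, of a] M by (simp add: c'_def fscale_def del: of_nat_Suc)
      then show False using c(2) by (simp add: fun_eq_iff)
    qed
    moreover have "(\<Sum>i\<le>M. c' i (\<lambda>i. y i x) * f x ^ i) = 0" if "x \<in> pts A" for x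
      using zero_idealD(2)[OF gz that] gx[OF that] by (simp add: c'_def fscale_def del: of_nat_Suc)
    ultimately have "deg M" unfolding deg_def by blast
    then show False using min M by simp
  qed
  moreover have "immersive A ?d y g f"
    unfolding immersive_def
  proof (intro ballI impI)
    fix x \<delta> assume x: "x \<in> pts A" "g x \<noteq> 0" and \<delta>: "\<delta> \<in> tangent A x" "\<forall>j<?d. \<delta> (y j) = 0"
    have \<delta>C: "\<delta> (C p) = 0" if p: "p \<in> poly_funs ?d" for p
    proof -
      obtain G where G: "(p, G) \<in> gradients ?d" using gradient_exists[OF p] ..
      have "\<delta> (C p) = (\<Sum>i<?d. G i (\<lambda>i. y i x) * \<delta> (y i))"
        unfolding C_def by (rule tangent_chain_rule[OF AD(1) x(1) \<delta>(1) _ G]) (rule alg_indep_onD(1)[OF y])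
      also have "\<dots> = 0" using \<delta>(2) by (intro sum.neutral) simp
      finally show ?thesis .
    qed
    note mon = tangent_monomial[OF AD(1) \<delta>(1) CA[OF c(1)] \<delta>C[OF c(1)] f]
    have "(\<Sum>i\<le>N. C (c i) * f ^ i) = 0"
    proof
      fix z
      show "(\<Sum>i\<le>N. C (c i) * f ^ i) z = 0 z"
        using c(3)[of z] by (cases "z \<in> pts A") (simp_all add: C_def res_def sum_fun_apply power_fun_apply)
    qed
    then have "0 = \<delta> (\<Sum>i\<le>N. C (c i) * f ^ i)" using tangent_zero[OF AD(1) \<delta>(1)] by simp
    also have "\<dots> = (\<Sum>i\<le>N. \<delta> (C (c i) * f ^ i))"
      by (rule conjunct2[OF tangent_sum[OF AD(1) \<delta>(1)]]) (rule conjunct1[OF mon])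
    also have "\<dots> = (\<Sum>i\<le>N. of_nat i * C (c i) x * f x ^ (i - 1) * \<delta> f)"
      by (rule sum.cong) (simp_all add: conjunct2[OF mon])
    also have "\<dots> = (\<Sum>i\<le>M. of_nat (Suc i) * C (c (Suc i)) x * f x ^ i * \<delta> f)"
      unfolding M sum.atMost_Suc_shift by simp
    also have "\<dots> = g x * \<delta> f"
      unfolding gx[OF x(1)] sum_distrib_right by (rule sum.cong) (use x(1) in \<open>simp_all add: C_def res_def\<close>)
    finally show "\<delta> f = 0" using x(2) by simp
  qed
  ultimately show ?thesis using gA by blast
qed

definition unramified_off :: "('a, 'k::field) variety \<Rightarrow> nat \<Rightarrow> (nat \<Rightarrow> 'a \<Rightarrow> 'k) \<Rightarrow> ('a \<Rightarrow> 'k) \<Rightarrow> bool"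
  where "unramified_off A d y g \<longleftrightarrow>
    (\<forall>x\<in>pts A. g x \<noteq> 0 \<longrightarrow> (\<forall>\<delta>\<in>tangent A x. (\<forall>j<d. \<delta> (y j) = 0) \<longrightarrow> \<delta> = 0))"

text \<open>It suffices that the finitely many generators of the coordinate ring are covered, and the corresponding
  exceptional sets can be united because the variety is irreducible.\<close>

lemma generically_unramified:
  fixes A :: "('a, 'k::{alg_closed_field,field_char_0}) variety"
  assumes A: "irreducible_variety A" and y: "alg_indep_on A (pts A) (trdeg A) y"
  shows "\<exists>g. nonvanishing A g \<and> unramified_off A (trdeg A) y g"
proof -
  note AD = irreducible_varietyD[OF A]
  obtain n w where w: "generates A n w" using generates_exists[OF AD(1)] by blast
  have "\<exists>g. nonvanishing A g \<and> (\<forall>i<m. immersive A (trdeg A) y g (w i))" if "m \<le> n" for m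
    using that
  proof (induction m)
    case 0
    then show ?case using nonvanishing_one[OF A] by (intro exI[of _ "res (pts A) 1"]) simp
  next
    case (Suc m)
    then obtain g where g: "nonvanishing A g" "\<forall>i<m. immersive A (trdeg A) y g (w i)" by auto
    obtain h where h: "nonvanishing A h" "immersive A (trdeg A) y h (w m)"
      using immersive_exists[OF A y generatesD(1)[OF w]] Suc.prems by (meson Suc_le_lessD)
    have "immersive A (trdeg A) y (g * h) (w i)" if "i < Suc m" for i
      using that g(2) h(2) unfolding less_Suc_eq immersive_def by auto
    then show ?case using nonvanishing_mult[OF A g(1) h(1)] by blast
  qed
  then obtain g where g: "nonvanishing A g" "\<forall>i<n. immersive A (trdeg A) y g (w i)" by blast
  have "unramified_off A (trdeg A) y g"
    unfolding unramified_off_def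
  proof (intro ballI impI)
    fix x \<delta> assume x: "x \<in> pts A" "g x \<noteq> 0" and \<delta>: "\<delta> \<in> tangent A x" "\<forall>j<trdeg A. \<delta> (y j) = 0"
    show "\<delta> = 0"
    proof (rule tangent_eqI[OF AD(1) w x(1) \<delta>(1) fun_vs.subspace_0[OF subspace_tangent[OF AD(1)]]])
      fix i assume "i < n"
      then show "\<delta> (w i) = 0 (w i)" using g(2) x \<delta> unfolding immersive_def by simp
    qed
  qed
  with g(1) show ?thesis by blast
qed

lemma dim_tangent_unramified:
  assumes A: "affine_variety A" and g: "unramified_off A d y g" and x: "x \<in> pts A" "g x \<noteq> 0"
  shows "fun_vs.dim (tangent A x) \<le> d"
proof -
  have "inj_on (eval_at d y) (tangent A x)"
  proof (rule inj_onI)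
    fix \<delta> \<epsilon> assume *: "\<delta> \<in> tangent A x" "\<epsilon> \<in> tangent A x" "eval_at d y \<delta> = eval_at d y \<epsilon>"
    have "\<delta> - \<epsilon> \<in> tangent A x" by (rule fun_vs.subspace_diff[OF subspace_tangent[OF A] *(1,2)])
    moreover have "(\<delta> - \<epsilon>) (y j) = 0" if "j < d" for j
      using fun_cong[OF *(3), of j] that by (simp add: eval_at_def)
    ultimately have "\<delta> - \<epsilon> = 0" using g x unfolding unramified_off_def by blast
    then show "\<delta> = \<epsilon>" by simp
  qed
  moreover have "fin_dim (supported {..<d} :: (nat \<Rightarrow> 'b) set)" by (rule fin_dim_supported) simp
  moreover have "eval_at d y ` tangent A x \<subseteq> supported {..<d}" by (auto simp: eval_at_def supported_def)
  ultimately have "fun_vs.dim (tangent A x) \<le> fun_vs.dim (supported {..<d} :: (nat \<Rightarrow> 'b) set)"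
    using fin_dim_inj(2)[OF linear_eval_at subspace_tangent[OF A]] by blast
  also have "\<dots> \<le> d" using dim_supported_le[of "{..<d}"] by simp
  finally show ?thesis .
qed

section \<open>Closed subvarieties\<close>

lemma pts_closed_subvar [simp]: "pts (closed_subvar A C) = C"
  and cring_closed_subvar: "cring (closed_subvar A C) = res C ` cring A"
  by (simp_all add: closed_subvar_def)

lemma closed_subvar_closed_subvar:
  assumes "D \<subseteq> C" shows "closed_subvar (closed_subvar A C) D = closed_subvar A D"
proof -
  have "res D ` res C ` cring A = res D ` cring A" unfolding image_image res_res[OF assms] ..
  then show ?thesis by (simp add: closed_subvar_def)
qed

lemma affine_closed_subvar:
  assumes A: "affine_variety A" and C: "closedin (zariski A) C"
  shows "affine_variety (closed_subvar A C)"
proof -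
  note CA = closedin_zariski_subset[OF A C]
  obtain S where S: "S \<subseteq> cring A" "C = zero_set A S" using C unfolding closedin_zariski[OF A] by blast
  obtain n Z \<phi> where Z: "algebraic_set n Z" "bij_betw \<phi> (pts A) Z"
    and cr: "cring A = (\<lambda>p. res (pts A) (p \<circ> \<phi>)) ` poly_funs n"
    using A unfolding affine_variety_def by blast
  obtain T0 where T0: "T0 \<subseteq> poly_funs n" "Z = {a \<in> {..<n} \<rightarrow>\<^sub>E UNIV. \<forall>p\<in>T0. p a = 0}"
    using Z(1) unfolding algebraic_set_def by blast
  define T where "T = {p \<in> poly_funs n. res (pts A) (p \<circ> \<phi>) \<in> S}"
  have iff: "(\<forall>p\<in>T. p (\<phi> x) = 0) \<longleftrightarrow> x \<in> C" if x: "x \<in> pts A" for x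
  proof -
    have rx: "res (pts A) (p \<circ> \<phi>) x = p (\<phi> x)" for p :: "(nat \<Rightarrow> 'b) \<Rightarrow> 'b" using x by (simp add: res_def)
    show ?thesis
    proof
      assume *: "\<forall>p\<in>T. p (\<phi> x) = 0"
      have "f x = 0" if f: "f \<in> S" for f
      proof -
        obtain p where "p \<in> poly_funs n" "f = res (pts A) (p \<circ> \<phi>)" using f S(1) cr by blast
        then show ?thesis using * f rx by (auto simp: T_def)
      qed
      then show "x \<in> C" using x by (simp add: S(2) zero_set_def)
    next
      assume "x \<in> C"
      then have "\<forall>f\<in>S. f x = 0" by (simp add: S(2) zero_set_def)
      then show "\<forall>p\<in>T. p (\<phi> x) = 0" using rx by (auto simp: T_def)
    qed
  qed
  have "\<phi> ` C = {a \<in> {..<n} \<rightarrow>\<^sub>E UNIV. \<forall>p\<in>T0 \<union> T. p a = 0}"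
  proof -
    have "\<phi> ` C = {a \<in> Z. \<forall>p\<in>T. p a = 0}"
    proof
      show "\<phi> ` C \<subseteq> {a \<in> Z. \<forall>p\<in>T. p a = 0}"
        using iff CA Z(2) unfolding bij_betw_def by blast
      show "{a \<in> Z. \<forall>p\<in>T. p a = 0} \<subseteq> \<phi> ` C"
      proof
        fix a assume a: "a \<in> {a \<in> Z. \<forall>p\<in>T. p a = 0}"
        then obtain x where "x \<in> pts A" "a = \<phi> x" using Z(2) unfolding bij_betw_def by blast
        then show "a \<in> \<phi> ` C" using a iff by blast
      qed
    qed
    then show ?thesis unfolding T0(2) by auto
  qed
  then have "algebraic_set n (\<phi> ` C)"
    unfolding algebraic_set_def using T0(1) by (intro exI[of _ "T0 \<union> T"]) (auto simp: T_def)
  moreover have "bij_betw \<phi> C (\<phi> ` C)"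
    using Z(2) CA by (auto simp: bij_betw_def intro: inj_on_subset)
  moreover have "cring (closed_subvar A C) = (\<lambda>p. res C (p \<circ> \<phi>)) ` poly_funs n"
    unfolding cring_closed_subvar cr image_image res_res[OF CA] ..
  ultimately show ?thesis unfolding affine_variety_def pts_closed_subvar by blast
qed

lemma closedin_closed_subvar:
  assumes A: "affine_variety A" and C: "closedin (zariski A) C"
  shows "closedin (zariski (closed_subvar A C)) D \<longleftrightarrow> closedin (zariski A) D \<and> D \<subseteq> C"
proof -
  note CA = closedin_zariski_subset[OF A C]
  have zs: "zero_set (closed_subvar A C) (res C ` S) = C \<inter> zero_set A S" for S
    using CA by (auto simp: zero_set_def res_def)
  show ?thesis
  proof
    assume "closedin (zariski (closed_subvar A C)) D"
    then obtain S' where S': "S' \<subseteq> res C ` cring A" "D = zero_set (closed_subvar A C) S'"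
      unfolding closedin_zariski[OF affine_closed_subvar[OF A C]] cring_closed_subvar by blast
    obtain S where S: "S \<subseteq> cring A" "S' = res C ` S" using S'(1) by (auto simp: subset_image_iff)
    have "D = C \<inter> zero_set A S" using S'(2) unfolding S(2) zs .
    then show "closedin (zariski A) D \<and> D \<subseteq> C"
      using closedin_Int[OF C closedin_zero_set[OF A S(1)]] by simp
  next
    assume D: "closedin (zariski A) D \<and> D \<subseteq> C"
    then obtain S where S: "S \<subseteq> cring A" "D = zero_set A S" unfolding closedin_zariski[OF A] by blast
    have "D = zero_set (closed_subvar A C) (res C ` S)" unfolding zs using S(2) D by blast
    then show "closedin (zariski (closed_subvar A C)) D"
      unfolding closedin_zariski[OF affine_closed_subvar[OF A C]] cring_closed_subvar using S(1) by blast
  qed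
qed

lemma irreducible_closed_closed_subvar:
  assumes A: "affine_variety A" and C: "closedin (zariski A) C" and DC: "D \<subseteq> C"
  shows "irreducible_closed (closed_subvar A C) D \<longleftrightarrow> irreducible_closed A D"
proof -
  note A' = affine_closed_subvar[OF A C]
  have cl: "closedin (zariski (closed_subvar A C)) E \<longleftrightarrow> closedin (zariski A) E \<and> E \<subseteq> C" for E
    by (rule closedin_closed_subvar[OF A C])
  have ts: "topspace (zariski (closed_subvar A C)) = C" "topspace (zariski A) = pts A"
    by (simp_all add: topspace_zariski A A')
  show ?thesis
  proof
    assume *: "irreducible_closed (closed_subvar A C) D"
    then have D: "closedin (zariski A) D" and irr: "irreducible_in (zariski (closed_subvar A C)) D"
      by (simp_all add: irreducible_closed_def cl)
    have "irreducible_in (zariski A) D"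
    proof (rule irreducible_inI)
      show "D \<subseteq> topspace (zariski A)" unfolding ts by (rule closedin_zariski_subset[OF A D])
      show "D \<noteq> {}" by (rule irreducible_inD(3)[OF irr])
      fix E F assume EF: "closedin (zariski A) E" "closedin (zariski A) F" "D \<subseteq> E \<union> F"
      have "closedin (zariski (closed_subvar A C)) (C \<inter> E)" "closedin (zariski (closed_subvar A C)) (C \<inter> F)"
        unfolding cl using closedin_Int[OF C EF(1)] closedin_Int[OF C EF(2)] by auto
      moreover have "D \<subseteq> (C \<inter> E) \<union> (C \<inter> F)" using EF(3) DC by blast
      ultimately have "D \<subseteq> C \<inter> E \<or> D \<subseteq> C \<inter> F" by (rule irreducible_inD(1)[OF irr])
      then show "D \<subseteq> E \<or> D \<subseteq> F" by blast
    qed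
    with D show "irreducible_closed A D" by (simp add: irreducible_closed_def)
  next
    assume *: "irreducible_closed A D"
    then have D: "closedin (zariski A) D" and irr: "irreducible_in (zariski A) D"
      by (simp_all add: irreducible_closed_def)
    have "irreducible_in (zariski (closed_subvar A C)) D"
    proof (rule irreducible_inI)
      show "D \<subseteq> topspace (zariski (closed_subvar A C))" unfolding ts by (rule DC)
      show "D \<noteq> {}" by (rule irreducible_inD(3)[OF irr])
      fix E F assume "closedin (zariski (closed_subvar A C)) E" "closedin (zariski (closed_subvar A C)) F" "D \<subseteq> E \<union> F"
      then show "D \<subseteq> E \<or> D \<subseteq> F" unfolding cl using irreducible_inD(1)[OF irr] by blast
    qed
    with D DC show "irreducible_closed (closed_subvar A C) D" by (simp add: irreducible_closed_def cl)
  qed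
qed

lemma irreducible_variety_closed_subvar:
  assumes A: "affine_variety A" and C: "irreducible_closed A C"
  shows "irreducible_variety (closed_subvar A C)"
  using irreducible_closed_closed_subvar[OF A irreducible_closedD(1)[OF A C] subset_refl] C
    affine_closed_subvar[OF A irreducible_closedD(1)[OF A C]] by (simp add: irreducible_variety_def)

lemma alg_indep_on_mono:
  assumes y: "alg_indep_on A D d y" and DC: "D \<subseteq> C"
  shows "alg_indep_on A C d y"
proof (rule alg_indep_onI[OF alg_indep_onD(1)[OF y]])
  fix q assume "q \<in> poly_funs d" "\<forall>x\<in>C. q (\<lambda>i. y i x) = 0"
  then show "q = 0" using DC by (intro alg_indep_onD(2)[OF y]) blast+
qed

lemma alg_indep_on_closed_subvar:
  assumes y: "alg_indep_on A D d y" and DC: "D \<subseteq> C"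
  shows "alg_indep_on (closed_subvar A C) D d (\<lambda>i. res C (y i))"
proof (rule alg_indep_onI)
  show "res C (y i) \<in> cring (closed_subvar A C)" if "i < d" for i
    unfolding cring_closed_subvar by (rule imageI[OF alg_indep_onD(1)[OF y that]])
  fix q assume q: "q \<in> poly_funs d" "\<forall>x\<in>D. q (\<lambda>i. res C (y i) x) = 0"
  have "(\<lambda>i. res C (y i) x) = (\<lambda>i. y i x)" if "x \<in> D" for x using that DC by (auto simp: res_def)
  then show "q = 0" using q(2) by (intro alg_indep_onD(2)[OF y q(1)]) simp
qed

lemma alg_indep_on_of_closed_subvar:
  assumes y: "alg_indep_on (closed_subvar A C) D d y" and DC: "D \<subseteq> C"
  shows "\<exists>y'. alg_indep_on A D d y'"
proof -
  define y' where "y' i = (SOME f. f \<in> cring A \<and> y i = res C f)" for i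
  have y': "y' i \<in> cring A \<and> y i = res C (y' i)" if i: "i < d" for i
    unfolding y'_def
  proof (rule someI_ex[where P = "\<lambda>f. f \<in> cring A \<and> y i = res C f"])
    show "\<exists>f. f \<in> cring A \<and> y i = res C f"
      using alg_indep_onD(1)[OF y i] unfolding cring_closed_subvar by blast
  qed
  have "alg_indep_on A D d y'"
  proof (rule alg_indep_onI)
    show "y' i \<in> cring A" if "i < d" for i using y'[OF that] by blast
    fix q assume q: "q \<in> poly_funs d" "\<forall>x\<in>D. q (\<lambda>i. y' i x) = 0"
    have "q (\<lambda>i. y i x) = q (\<lambda>i. y' i x)" if x: "x \<in> D" for x
    proof (rule poly_funs_cong[OF q(1)])
      fix i assume "i < d"
      then have "y i = res C (y' i)" using y' by blast
      then show "y i x = y' i x" using x DC by (auto simp: res_def)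
    qed
    then show "q = 0" using q(2) by (intro alg_indep_onD(2)[OF y q(1)]) simp
  qed
  then show ?thesis by blast
qed

abbreviation trdeg_on :: "('a, 'k::field) variety \<Rightarrow> 'a set \<Rightarrow> nat"
  where "trdeg_on A C \<equiv> trdeg (closed_subvar A C)"

lemma trdeg_on:
  fixes A :: "('a, 'k::{alg_closed_field,field_char_0}) variety"
  assumes A: "affine_variety A" and C: "irreducible_closed A C"
  shows "\<exists>y. alg_indep_on A C (trdeg_on A C) y" "alg_indep_on A C d y \<Longrightarrow> d \<le> trdeg_on A C"
    "e \<in> C \<Longrightarrow> trdeg_on A C \<le> fun_vs.dim (tangent (closed_subvar A C) e)"
proof -
  note irr = irreducible_variety_closed_subvar[OF A C]
  show "\<exists>y. alg_indep_on A C (trdeg_on A C) y"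
    using trdeg(1)[OF irr] alg_indep_on_of_closed_subvar[OF _ subset_refl, of A C] by auto
  show "d \<le> trdeg_on A C" if "alg_indep_on A C d y"
    using trdeg(2)[OF irr] alg_indep_on_closed_subvar[OF that subset_refl] by simp
  show "trdeg_on A C \<le> fun_vs.dim (tangent (closed_subvar A C) e)" if "e \<in> C"
    using trdeg(3)[OF irr] that by simp
qed

lemma chain_le_trdeg_on:
  fixes A :: "('a, 'k::{alg_closed_field,field_char_0}) variety"
  assumes A: "affine_variety A" and C: "irreducible_closed A C" and X: "X \<subseteq> C"
    and Z: "\<forall>i\<le>n. closedin (subtopology (zariski A) X) (Z i) \<and> irreducible_in (subtopology (zariski A) X) (Z i)"
    "\<forall>i<n. Z i \<subset> Z (Suc i)"
  shows "n \<le> trdeg_on A C"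
proof -
  note CD = irreducible_closedD[OF A C]
  have XA: "X \<subseteq> pts A" using X CD(3) by blast
  obtain y where y: "alg_indep_on A (zariski A closure_of (Z n)) n y"
    using chain_imp_alg_indep_on[OF A krull_chain_closure[OF A XA Z]] by blast
  have "Z n \<subseteq> C"
    using closedin_subset[of "subtopology (zariski A) X" "Z n"] Z(1)[rule_format, of n] X
    by (auto simp: topspace_subtopology)
  then have "zariski A closure_of (Z n) \<subseteq> C" by (rule closure_of_minimal[OF _ CD(1)])
  from trdeg_on(2)[OF A C alg_indep_on_mono[OF y this]] show ?thesis .
qed

lemma krull_dim_irreducible_closed:
  fixes A :: "('a, 'k::{alg_closed_field,field_char_0}) variety"
  assumes A: "affine_variety A" and C: "irreducible_closed A C"
  shows "krull_dim (subtopology (zariski A) C) = enat (trdeg_on A C)"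
proof (rule antisym)
  show "krull_dim (subtopology (zariski A) C) \<le> enat (trdeg_on A C)"
    unfolding krull_dim_def
  proof (rule Sup_least)
    fix m assume "m \<in> {enat n |n. \<exists>Z. (\<forall>i\<le>n. closedin (subtopology (zariski A) C) (Z i) \<and>
      irreducible_in (subtopology (zariski A) C) (Z i)) \<and> (\<forall>i<n. Z i \<subset> Z (Suc i))}"
    then obtain n Z where m: "m = enat n" and Z: "\<forall>i\<le>n. closedin (subtopology (zariski A) C) (Z i) \<and>
      irreducible_in (subtopology (zariski A) C) (Z i)" "\<forall>i<n. Z i \<subset> Z (Suc i)" by blast
    show "m \<le> enat (trdeg_on A C)" unfolding m using chain_le_trdeg_on[OF A C subset_refl Z] by simp
  qed
next
  let ?d = "trdeg_on A C"
  obtain y where y: "alg_indep_on A C ?d y" using trdeg_on(1)[OF A C] ..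
  obtain Z where Z: "irreducible_chain A ?d Z" "Z ?d = C" using alg_indep_on_imp_chain[OF A C y] by blast
  have sub: "Z i \<subseteq> C" if "i \<le> ?d" for i
    using that
  proof (induction i rule: inc_induct)
    case (step n)
    then have "Z n \<subset> Z (Suc n)" using Z(1) by (simp add: irreducible_chain_def)
    then show ?case using step.IH by blast
  qed (simp add: Z(2))
  have "closedin (subtopology (zariski A) C) (Z i) \<and> irreducible_in (subtopology (zariski A) C) (Z i)" if i: "i \<le> ?d" for i
  proof -
    have "irreducible_closed A (Z i)" using Z(1) i by (simp add: irreducible_chain_def)
    then show ?thesis
      using irreducible_in_subtopology[OF sub[OF i]] closedin_closed_subtopology[OF irreducible_closedD(1)[OF A C]] sub[OF i]
      by (simp add: irreducible_closed_def)
  qed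
  moreover have "Z i \<subset> Z (Suc i)" if "i < ?d" for i using Z(1) that by (simp add: irreducible_chain_def)
  ultimately show "enat ?d \<le> krull_dim (subtopology (zariski A) C)"
    unfolding krull_dim_def by (intro Sup_upper) blast
qed

text \<open>The only irreducible component is the whole set.\<close>

lemma dim_at_irreducible_closed:
  fixes A :: "('a, 'k::{alg_closed_field,field_char_0}) variety"
  assumes A: "affine_variety A" and C: "irreducible_closed A C" and e: "e \<in> C"
  shows "dim_at (subtopology (zariski A) C) e = enat (trdeg_on A C)"
proof -
  let ?T = "subtopology (zariski A) C"
  note CD = irreducible_closedD[OF A C]
  have irrC: "irreducible_in ?T C" using irreducible_in_subtopology[OF subset_refl] CD(2) by blast
  have sub: "S \<subseteq> C" if "irreducible_in ?T S" for S
    using irreducible_inD(2)[OF that] by (simp add: topspace_subtopology)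
  have comp: "irreducible_component ?T S \<longleftrightarrow> S = C" for S
  proof
    assume "irreducible_component ?T S"
    then show "S = C" unfolding irreducible_component_def using irrC sub by blast
  next
    assume "S = C"
    then show "irreducible_component ?T S" unfolding irreducible_component_def using irrC sub by blast
  qed
  have "{krull_dim (subtopology ?T S) | S. irreducible_component ?T S \<and> e \<in> S} = {krull_dim ?T}"
    using e by (auto simp: comp subtopology_subtopology)
  then show ?thesis unfolding dim_at_def using krull_dim_irreducible_closed[OF A C] by simp
qed

lemma tangent_zero_if_dim_0:
  assumes A: "affine_variety A" and x: "x \<in> pts A" and dim: "fun_vs.dim (tangent A x) = 0"
  shows "tangent A x = {0}"
proof -
  have "{0} = tangent A x"
  proof (rule subspace_eq_if_dim_le[OF fin_dim_tangent[OF A x]])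
    show "fun_vs.subspace ({0} :: (('a \<Rightarrow> 'b) \<Rightarrow> 'b) set)" by (rule fun_vs.subspace_single_0)
    show "{0} \<subseteq> tangent A x" using fun_vs.subspace_0[OF subspace_tangent[OF A]] by blast
  qed (simp add: dim)
  then show ?thesis by (rule sym)
qed

text \<open>Restriction of functions embeds the tangent space of a closed subvariety into that of the ambient one.\<close>

lemma tangent_restriction:
  fixes A :: "('a, 'k::field) variety"
  assumes A: "affine_variety A" and Y: "closedin (zariski A) Y" and C: "closedin (zariski A) C" "C \<subseteq> Y" and e: "e \<in> C"
  defines "j \<equiv> \<lambda>\<delta> f. if f \<in> cring (closed_subvar A Y) then \<delta> (res C f) else (0::'k)"
  shows "Vector_Spaces.linear fscale fscale j"
    "j ` tangent (closed_subvar A C) e \<subseteq> tangent (closed_subvar A Y) e"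
    "inj_on j (tangent (closed_subvar A C) e)"
    "f \<in> cring A \<Longrightarrow> j \<delta> (res Y f) = \<delta> (res C f)"
proof -
  show "Vector_Spaces.linear fscale fscale j"
    by (rule fun_linearI) (auto simp: j_def fscale_def fun_eq_iff)
  show jf: "j \<delta> (res Y f) = \<delta> (res C f)" if "f \<in> cring A" for f \<delta>
    using that by (simp add: j_def cring_closed_subvar res_res[OF C(2)])
  show "j ` tangent (closed_subvar A C) e \<subseteq> tangent (closed_subvar A Y) e"
  proof (rule image_subsetI)
    fix \<delta> assume "\<delta> \<in> tangent (closed_subvar A C) e"
    then have "\<delta> \<in> tangent (closed_subvar (closed_subvar A Y) C) e" unfolding closed_subvar_closed_subvar[OF C(2)] .
    from tangent_closed_subvar[OF affine_closed_subvar[OF A Y] e this]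
    show "j \<delta> \<in> tangent (closed_subvar A Y) e" unfolding j_def .
  qed
  show "inj_on j (tangent (closed_subvar A C) e)"
  proof (rule inj_onI)
    fix \<delta> \<epsilon> assume *: "\<delta> \<in> tangent (closed_subvar A C) e" "\<epsilon> \<in> tangent (closed_subvar A C) e" "j \<delta> = j \<epsilon>"
    show "\<delta> = \<epsilon>"
    proof
      fix f
      show "\<delta> f = \<epsilon> f"
      proof (cases "f \<in> cring (closed_subvar A C)")
        case True
        then obtain g where "g \<in> cring A" "f = res C g" unfolding cring_closed_subvar by blast
        then show ?thesis using jf fun_cong[OF *(3), of "res Y g"] by simp
      qed (simp add: tangentD(4)[OF *(1)] tangentD(4)[OF *(2)])
    qed
  qed
qed

text \<open>By smoothness some irreducible component through \<open>e\<close> has chains as long as the dimension of the tangent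
  space of \<open>Y\<close>. Its closure \<open>C\<close> has a tangent space of at least that dimension, and this is a subspace of
  the tangent space of \<open>Y\<close>; so the two coincide and \<open>C\<close> is smooth at \<open>e\<close>.\<close>

lemma smooth_point_irreducible_model:
  fixes A :: "('a, 'k::{alg_closed_field,field_char_0}) variety"
  assumes A: "affine_variety A" and X: "X \<subseteq> pts A" and e: "e \<in> smooth_points A X"
  defines "Y \<equiv> zariski A closure_of X"
  shows "tangent (closed_subvar A Y) e = {0} \<or>
    (\<exists>C. irreducible_closed A C \<and> e \<in> C \<and> fun_vs.dim (tangent (closed_subvar A C) e) \<le> trdeg_on A C \<and>
      (\<forall>\<delta>\<in>tangent (closed_subvar A Y) e. \<exists>\<epsilon>\<in>tangent (closed_subvar A C) e.
        \<forall>f\<in>cring A. \<delta> (res Y f) = \<epsilon> (res C f)))"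
proof -
  let ?T = "subtopology (zariski A) X"
  let ?d = "fun_vs.dim (tangent (closed_subvar A Y) e)"
  have eX: "e \<in> X" and dim: "enat ?d = dim_at ?T e"
    using e by (simp_all add: smooth_points_def closure_var_def Y_def)
  have Y: "closedin (zariski A) Y" unfolding Y_def by (rule closedin_closure_of)
  have XY: "X \<subseteq> Y" unfolding Y_def using X by (intro closure_of_subset) (simp add: topspace_zariski[OF A])
  note AY = affine_closed_subvar[OF A Y]
  show ?thesis
  proof (cases "?d = 0")
    case True
    have "tangent (closed_subvar A Y) e = {0}"
      by (rule tangent_zero_if_dim_0[OF AY _ True]) (use eX XY in auto)
    then show ?thesis by blast
  next
    \<comment> \<open>Only a number strictly below the supremum singles out a component, hence the case of dimension
      zero is separate.\<close>
    case False
    then have "enat (?d - 1) < dim_at ?T e" unfolding dim[symmetric] by simp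
    then obtain C1 where C1: "irreducible_component ?T C1" "e \<in> C1" "enat (?d - 1) < krull_dim (subtopology ?T C1)"
      unfolding dim_at_def less_Sup_iff by blast
    have irr1: "irreducible_in ?T C1" using C1(1) by (simp add: irreducible_component_def)
    have C1X: "C1 \<subseteq> X" using irreducible_inD(2)[OF irr1] by (simp add: topspace_subtopology)
    have ss: "subtopology ?T C1 = subtopology (zariski A) C1"
      unfolding subtopology_subtopology using C1X by (simp add: inf.absorb2)
    from C1(3) obtain n Z where n: "?d - 1 < n"
      and Z: "\<forall>i\<le>n. closedin (subtopology (zariski A) C1) (Z i) \<and> irreducible_in (subtopology (zariski A) C1) (Z i)"
        "\<forall>i<n. Z i \<subset> Z (Suc i)"
      unfolding krull_dim_def less_Sup_iff ss by auto
    define C where "C = zariski A closure_of C1"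
    have C: "irreducible_closed A C"
      unfolding irreducible_closed_def C_def
      using irreducible_in_closure[OF irr1[unfolded irreducible_in_subtopology[OF C1X]]] by simp
    note CD = irreducible_closedD[OF A C]
    have C1C: "C1 \<subseteq> C"
      unfolding C_def using C1X X by (intro closure_of_subset) (auto simp: topspace_zariski[OF A])
    have CY: "C \<subseteq> Y" unfolding C_def Y_def by (rule closure_of_mono[OF C1X])
    have eC: "e \<in> C" using C1(2) C1C by blast
    have dn: "?d \<le> trdeg_on A C" using chain_le_trdeg_on[OF A C C1C Z] n by simp
    let ?TC = "tangent (closed_subvar A C) e"
    define j where "j = (\<lambda>\<delta> f. if f \<in> cring (closed_subvar A Y) then \<delta> (res C f) else (0::'k))"
    note j = tangent_restriction[OF A Y CD(1) CY eC, folded j_def]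
    note AC = affine_closed_subvar[OF A CD(1)]
    have finC: "fin_dim ?TC" by (rule fin_dim_tangent[OF AC]) (simp add: eC)
    have finY: "fin_dim (tangent (closed_subvar A Y) e)" by (rule fin_dim_tangent[OF AY]) (use eX XY in auto)
    note di = dim_inj_image(1)[OF j(1) subspace_tangent[OF AC] finC j(3)]
    have sub: "fun_vs.subspace (j ` ?TC)"
      by (rule fun_pair.linear_subspace_image[OF j(1) subspace_tangent[OF AC]])
    have "?d \<le> fun_vs.dim (j ` ?TC)" unfolding di using dn trdeg_on(3)[OF A C eC] by simp
    from subspace_eq_if_dim_le[OF finY sub j(2) this] have im: "j ` ?TC = tangent (closed_subvar A Y) e" .
    have "fun_vs.dim ?TC \<le> trdeg_on A C" using di im dn by simp
    moreover have "\<exists>\<epsilon>\<in>?TC. \<forall>f\<in>cring A. \<delta> (res Y f) = \<epsilon> (res C f)" if "\<delta> \<in> tangent (closed_subvar A Y) e" for \<delta>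
    proof -
      have "\<delta> \<in> j ` ?TC" using that im by simp
      then obtain \<epsilon> where \<epsilon>: "\<epsilon> \<in> ?TC" "\<delta> = j \<epsilon>" by blast
      have "\<delta> (res Y f) = \<epsilon> (res C f)" if "f \<in> cring A" for f
        unfolding \<epsilon>(2) using that by (simp add: j_def cring_closed_subvar res_res[OF CY])
      then show ?thesis using \<epsilon>(1) by blast
    qed
    ultimately show ?thesis using C eC by blast
  qed
qed

section \<open>Dominant morphisms\<close>

definition pullback :: "('a, 'k::field) variety \<Rightarrow> ('a \<Rightarrow> 'b) \<Rightarrow> ('b \<Rightarrow> 'k) \<Rightarrow> 'a \<Rightarrow> 'k"
  where "pullback A F h = res (pts A) (h \<circ> F)"

lemma pullback_apply [simp]: "x \<in> pts A \<Longrightarrow> pullback A F h x = h (F x)"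
  by (simp add: pullback_def res_def)

lemma variety_morphismD:
  assumes "variety_morphism A B F"
  shows "x \<in> pts A \<Longrightarrow> F x \<in> pts B" "h \<in> cring B \<Longrightarrow> pullback A F h \<in> cring A"
  using assms by (auto simp: variety_morphism_def pullback_def)

definition push_forward ::
  "('a, 'k::field) variety \<Rightarrow> ('b, 'k) variety \<Rightarrow> ('a \<Rightarrow> 'b) \<Rightarrow> (('a \<Rightarrow> 'k) \<Rightarrow> 'k) \<Rightarrow> (('b \<Rightarrow> 'k) \<Rightarrow> 'k)"
  where "push_forward A B F \<delta> = (\<lambda>h. if h \<in> cring B then \<delta> (pullback A F h) else 0)"

lemma linear_push_forward: "Vector_Spaces.linear fscale fscale (push_forward A B F)"
  by (rule fun_linearI) (auto simp: push_forward_def fscale_def fun_eq_iff)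

lemma push_forward_tangent:
  fixes A :: "('a, 'k::field) variety" and B :: "('b, 'k) variety"
  assumes B: "affine_variety B" and F: "variety_morphism A B F" and x: "x \<in> pts A" and \<delta>: "\<delta> \<in> tangent A x"
  shows "push_forward A B F \<delta> \<in> tangent B (F x)"
proof -
  have ops: "pullback A F (f + g) = pullback A F f + pullback A F g"
    "pullback A F (f * g) = pullback A F f * pullback A F g"
    "pullback A F (fscale c f) = fscale c (pullback A F f)" for f g :: "'b \<Rightarrow> 'k" and c
    by (auto simp: pullback_def res_def fscale_def fun_eq_iff)
  note pb = variety_morphismD(2)[OF F]
  show ?thesis
  proof (rule tangentI)
    fix f g assume fg: "f \<in> cring B" "g \<in> cring B"
    note cl = affine_variety_cring(2,3)[OF B fg]
    show "push_forward A B F \<delta> (f + g) = push_forward A B F \<delta> f + push_forward A B F \<delta> g"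
      unfolding push_forward_def ops if_P[OF fg(1)] if_P[OF fg(2)] if_P[OF cl(1)]
      by (rule tangentD(1)[OF \<delta> pb[OF fg(1)] pb[OF fg(2)]])
    show "push_forward A B F \<delta> (f * g) = f (F x) * push_forward A B F \<delta> g + g (F x) * push_forward A B F \<delta> f"
      unfolding push_forward_def ops if_P[OF fg(1)] if_P[OF fg(2)] if_P[OF cl(2)]
      using tangentD(3)[OF \<delta> pb[OF fg(1)] pb[OF fg(2)]] x by simp
  next
    fix c f assume f: "f \<in> cring B"
    show "push_forward A B F \<delta> (fscale c f) = c * push_forward A B F \<delta> f"
      unfolding push_forward_def ops if_P[OF f] if_P[OF affine_variety_cring(4)[OF B f]]
      by (rule tangentD(2)[OF \<delta> pb[OF f]])
  qed (simp add: push_forward_def)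
qed

text \<open>Density of the image, in terms of the functions vanishing on it.\<close>

definition dominant :: "('a, 'k::field) variety \<Rightarrow> ('b, 'k) variety \<Rightarrow> ('a \<Rightarrow> 'b) \<Rightarrow> bool"
  where "dominant A B F \<longleftrightarrow> variety_morphism A B F \<and>
    (\<forall>h\<in>cring B. (\<forall>x\<in>pts A. h (F x) = 0) \<longrightarrow> h \<in> zero_ideal B (pts B))"

lemma dominant_alg_indep_pullback:
  assumes B: "affine_variety B" and F: "variety_morphism A B F" and y: "alg_indep_on B (pts B) d y" and Z: "Z \<subseteq> pts A"
    and dom: "\<And>h. h \<in> cring B \<Longrightarrow> \<forall>x\<in>Z. h (F x) = 0 \<Longrightarrow> h \<in> zero_ideal B (pts B)"
  shows "alg_indep_on A Z d (\<lambda>i. pullback A F (y i))"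
proof (rule alg_indep_onI)
  show "pullback A F (y i) \<in> cring A" if "i < d" for i
    by (rule variety_morphismD(2)[OF F alg_indep_onD(1)[OF y that]])
  fix q assume q: "q \<in> poly_funs d" "\<forall>x\<in>Z. q (\<lambda>i. pullback A F (y i) x) = 0"
  define h where "h = res (pts B) (\<lambda>z. q (\<lambda>i. y i z))"
  have "h \<in> cring B" unfolding h_def by (rule cring_compose[OF B q(1)]) (rule alg_indep_onD(1)[OF y])
  moreover have "\<forall>x\<in>Z. h (F x) = 0"
  proof
    fix x assume x: "x \<in> Z"
    then have xA: "x \<in> pts A" using Z by blast
    have "(\<lambda>i. pullback A F (y i) x) = (\<lambda>i. y i (F x))" using xA by simp
    then have "q (\<lambda>i. y i (F x)) = 0" using bspec[OF q(2) x] by simp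
    then show "h (F x) = 0" using variety_morphismD(1)[OF F xA] by (simp add: h_def res_def)
  qed
  ultimately have "h \<in> zero_ideal B (pts B)" by (rule dom)
  then have "\<forall>z\<in>pts B. q (\<lambda>i. y i z) = 0" using zero_idealD(2)[of h B "pts B"] by (simp add: h_def res_def)
  then show "q = 0" by (rule alg_indep_onD(2)[OF y q(1)])
qed

text \<open>A transcendence basis \<open>y\<close> of \<open>B\<close> stays independent on \<open>A\<close>, so at a generic point of \<open>A\<close> there are
  tangent vectors with arbitrary derivatives of the pulled back functions. At a generic point of \<open>B\<close> a
  tangent vector is determined by its values on \<open>y\<close>. Together this makes the differential surjective.\<close>

lemma generic_smoothness:
  fixes A :: "('a, 'k::{alg_closed_field,field_char_0}) variety" and B :: "('b, 'k) variety"
  assumes A: "irreducible_variety A" and B: "irreducible_variety B" and F: "dominant A B F" and v: "nonvanishing A v"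
  shows "\<exists>z\<in>pts A. v z \<noteq> 0 \<and> fun_vs.dim (tangent A z) \<le> trdeg A \<and>
    tangent B (F z) \<subseteq> push_forward A B F ` tangent A z"
proof -
  note AD = irreducible_varietyD[OF A] and BD = irreducible_varietyD[OF B]
  have mor: "variety_morphism A B F"
    and dom: "\<And>h. h \<in> cring B \<Longrightarrow> \<forall>x\<in>pts A. h (F x) = 0 \<Longrightarrow> h \<in> zero_ideal B (pts B)"
    using F by (simp_all add: dominant_def)
  let ?d = "trdeg B"
  obtain y where y: "alg_indep_on B (pts B) ?d y" using trdeg(1)[OF B] ..
  obtain g where g: "nonvanishing B g" "unramified_off B ?d y g" using generically_unramified[OF B y] by blast
  obtain yA where yA: "alg_indep_on A (pts A) (trdeg A) yA" using trdeg(1)[OF A] ..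
  obtain gA where gA: "nonvanishing A gA" "unramified_off A (trdeg A) yA gA" using generically_unramified[OF A yA] by blast
  have pg: "nonvanishing A (pullback A F g)"
  proof -
    have "\<not> (\<forall>x\<in>pts A. g (F x) = 0)" using dom g(1) by blast
    then obtain x where "x \<in> pts A" "g (F x) \<noteq> 0" by blast
    then show ?thesis using variety_morphismD(2)[OF mor] g(1) by (intro nonvanishingI[of _ _ x]) simp_all
  qed
  have py: "alg_indep_on A (pts A) ?d (\<lambda>i. pullback A F (y i))"
    by (rule dominant_alg_indep_pullback[OF BD(1) mor y subset_refl dom])
  obtain b z where "submersive_lift A (zero_ideal A (pts A)) ?d (\<lambda>i. pullback A F (y i)) (v * gA * pullback A F g) b z"
    using submersive_lift_exists[OF A py nonvanishing_mult[OF A nonvanishing_mult[OF A v gA(1)] pg]] by blast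
  note z = submersive_liftD[OF this]
  have nz: "v z \<noteq> 0" "gA z \<noteq> 0" "g (F z) \<noteq> 0" using z(1,4) by auto
  have Fz: "F z \<in> pts B" by (rule variety_morphismD(1)[OF mor z(1)])
  have "tangent B (F z) \<subseteq> push_forward A B F ` tangent A z"
  proof
    fix \<epsilon> assume \<epsilon>: "\<epsilon> \<in> tangent B (F z)"
    obtain \<delta> where \<delta>: "\<delta> \<in> tangent A z" "\<forall>i<?d. \<delta> (pullback A F (y i)) = \<epsilon> (y i)"
      using z(5)[of "\<lambda>i. \<epsilon> (y i)"] by blast
    let ?\<eta> = "push_forward A B F \<delta> - \<epsilon>"
    have "?\<eta> \<in> tangent B (F z)"
      by (rule fun_vs.subspace_diff[OF subspace_tangent[OF BD(1)] push_forward_tangent[OF BD(1) mor z(1) \<delta>(1)] \<epsilon>])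
    moreover have "\<forall>j<?d. ?\<eta> (y j) = 0"
      using \<delta>(2) alg_indep_onD(1)[OF y] by (simp add: push_forward_def)
    ultimately have "?\<eta> = 0" using g(2) Fz nz(3) unfolding unramified_off_def by blast
    then have "\<epsilon> = push_forward A B F \<delta>" by simp
    then show "\<epsilon> \<in> push_forward A B F ` tangent A z" using \<delta>(1) by (rule image_eqI)
  qed
  moreover have "fun_vs.dim (tangent A z) \<le> trdeg A"
    by (rule dim_tangent_unramified[OF AD(1) gA(2) z(1) nz(2)])
  ultimately show ?thesis using z(1) nz(1) by blast
qed

text \<open>A transcendence basis \<open>y\<close> maps each proper closed subset into a hypersurface, for otherwise a further
  independent function would exist. Over an uncountable field countably many hypersurfaces do not cover affine space, even
  after one more hypersurface outside which \<open>y\<close> reaches all points is added.\<close>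

lemma not_countable_union_of_proper_closed:
  fixes B :: "('b, 'k::{alg_closed_field,field_char_0}) variety"
  assumes B: "irreducible_variety B" and unc: "uncountable (UNIV :: 'k set)"
    and Z: "\<And>j::nat. closedin (zariski B) (Z j)" and cover: "pts B \<subseteq> (\<Union>j. Z j)"
  shows "\<exists>j. Z j = pts B"
proof (rule ccontr)
  assume no: "\<nexists>j. Z j = pts B"
  note BD = irreducible_varietyD[OF B]
  let ?d = "trdeg B"
  obtain y where y: "alg_indep_on B (pts B) ?d y" using trdeg(1)[OF B] ..
  have "\<exists>a. a \<in> poly_funs ?d \<and> a \<noteq> 0 \<and> (\<forall>x\<in>Z j. a (\<lambda>i. y i x) = 0)" for j
  proof (rule ccontr)
    assume *: "\<not> (\<exists>a. a \<in> poly_funs ?d \<and> a \<noteq> 0 \<and> (\<forall>x\<in>Z j. a (\<lambda>i. y i x) = 0))"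
    have "alg_indep_on B (Z j) ?d y"
    proof (rule alg_indep_onI[OF alg_indep_onD(1)[OF y]])
      fix q assume "q \<in> poly_funs ?d" "\<forall>x\<in>Z j. q (\<lambda>i. y i x) = 0"
      then show "q = 0" using * by auto
    qed
    moreover have "Z j \<subset> pts B" using closedin_zariski_subset[OF BD(1) Z] no by blast
    ultimately obtain f where "alg_indep_on B (pts B) (Suc ?d) (y(?d := f))"
      using alg_indep_on_Suc[OF BD(1) BD(2) Z] by blast
    from trdeg(2)[OF B this] show False by simp
  qed
  then have "\<exists>a. \<forall>j. a j \<in> poly_funs ?d \<and> a j \<noteq> 0 \<and> (\<forall>x\<in>Z j. a j (\<lambda>i. y i x) = 0)"
    by (intro choice allI)
  then obtain a where a: "\<forall>j. a j \<in> poly_funs ?d \<and> a j \<noteq> 0 \<and> (\<forall>x\<in>Z j. a j (\<lambda>i. y i x) = 0)" ..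
  have one: "res (pts B) 1 \<in> cring B" "res (pts B) 1 \<notin> zero_ideal B (pts B)" using nonvanishing_one[OF B] by auto
  obtain u where u: "u \<in> poly_funs ?d" "u \<noteq> 0"
    "\<forall>b. u b \<noteq> 0 \<longrightarrow> (\<exists>x\<in>pts B. (\<forall>i<?d. y i x = b i) \<and> res (pts B) (1 :: 'b \<Rightarrow> 'k) x \<noteq> 0)"
    using lift_point[OF BD y one] by (elim bexE conjE) (erule (2) that)
  \<comment> \<open>Index zero is reserved for the hypersurface outside which \<open>y\<close> is onto.\<close>
  define q where "q n = (case n of 0 \<Rightarrow> u | Suc j \<Rightarrow> a j)" for n
  have "q n \<in> poly_funs ?d \<and> q n \<noteq> 0" for n
    using u(1,2) a by (cases n) (simp_all add: q_def)
  then obtain b where b: "\<forall>n. q n b \<noteq> 0" using common_nonzero_of_countably_many[OF unc, of q ?d] by blast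
  have "u b \<noteq> 0" using b[rule_format, of 0] by (simp add: q_def)
  then obtain x where x: "x \<in> pts B" "\<forall>i<?d. y i x = b i" using u(3) by blast
  from x(1) cover obtain j where "x \<in> Z j" by blast
  then have "a j (\<lambda>i. y i x) = 0" using a by blast
  moreover have "a j (\<lambda>i. y i x) = a j b" by (rule poly_funs_cong[of _ ?d]) (use a x(2) in simp_all)
  ultimately show False using b[rule_format, of "Suc j"] by (simp add: q_def)
qed

text \<open>The closures of the images cover \<open>B\<close>, so one image is dense. A transcendence basis of \<open>B\<close> pulled back
  to that variety stays independent on some irreducible closed subset, whose image then cannot lie in a
  proper closed subset.\<close>

lemma irreducible_subset_dominating:
  fixes A :: "nat \<Rightarrow> ('a, 'k::{alg_closed_field,field_char_0}) variety" and B :: "('b, 'k) variety"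
  assumes B: "irreducible_variety B" and unc: "uncountable (UNIV :: 'k set)"
    and A: "\<And>j. affine_variety (A j)" and F: "\<And>j. variety_morphism (A j) B F"
    and cover: "pts B \<subseteq> (\<Union>j. F ` pts (A j))"
  shows "\<exists>j Z. irreducible_closed (A j) Z \<and> dominant (closed_subvar (A j) Z) B F"
proof -
  note BD = irreducible_varietyD[OF B]
  let ?cl = "\<lambda>S. zariski B closure_of S"
  have FB: "F ` pts (A j) \<subseteq> pts B" for j using variety_morphismD(1)[OF F] by blast
  have sub: "S \<subseteq> ?cl S" if "S \<subseteq> pts B" for S
    by (rule closure_of_subset) (simp add: topspace_zariski[OF BD(1)] that)
  have "\<exists>j. ?cl (F ` pts (A j)) = pts B"
  proof (rule not_countable_union_of_proper_closed[OF B unc])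
    show "closedin (zariski B) (?cl (F ` pts (A j)))" for j by (rule closedin_closure_of)
    show "pts B \<subseteq> (\<Union>j. ?cl (F ` pts (A j)))" using cover sub[OF FB] by blast
  qed
  then obtain j where j: "?cl (F ` pts (A j)) = pts B" ..
  have dom: "h \<in> zero_ideal B (pts B)" if h: "h \<in> cring B" "\<forall>x\<in>S. h (F x) = 0" and S: "?cl (F ` S) = pts B" "S \<subseteq> pts (A j)" for h S
  proof -
    have "F ` S \<subseteq> zero_set B {h}" using h(2) S(2) FB[of j] by (auto simp: zero_set_def)
    then have "?cl (F ` S) \<subseteq> zero_set B {h}" using h(1) by (intro closure_of_minimal closedin_zero_set[OF BD(1)]) simp_all
    then show ?thesis using h(1) S(1) by (auto simp: zero_ideal_def zero_set_def)
  qed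
  let ?d = "trdeg B"
  obtain y where y: "alg_indep_on B (pts B) ?d y" using trdeg(1)[OF B] ..
  have "alg_indep_on (A j) (pts (A j)) ?d (\<lambda>i. pullback (A j) F (y i))"
    by (rule dominant_alg_indep_pullback[OF BD(1) F y subset_refl]) (rule dom[OF _ _ j subset_refl])
  moreover have "closedin (zariski (A j)) (pts (A j))" using closedin_topspace[of "zariski (A j)"] by (simp add: topspace_zariski[OF A])
  ultimately obtain Z where Z: "Z \<subseteq> pts (A j)" "irreducible_closed (A j) Z" "alg_indep_on (A j) Z ?d (\<lambda>i. pullback (A j) F (y i))"
    using exists_irreducible_with_independence[OF A] by blast
  have clZ: "?cl (F ` Z) = pts B"
  proof (rule ccontr)
    assume ne: "?cl (F ` Z) \<noteq> pts B"
    have cl: "closedin (zariski B) (?cl (F ` Z))" by (rule closedin_closure_of)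
    have "alg_indep_on B (?cl (F ` Z)) ?d y"
    proof (rule alg_indep_onI[OF alg_indep_onD(1)[OF y]])
      fix q assume q: "q \<in> poly_funs ?d" "\<forall>x\<in>?cl (F ` Z). q (\<lambda>i. y i x) = 0"
      have "\<forall>x\<in>Z. q (\<lambda>i. pullback (A j) F (y i) x) = 0"
      proof
        fix x assume x: "x \<in> Z"
        then have "F x \<in> ?cl (F ` Z)" using sub[of "F ` Z"] FB[of j] Z(1) by blast
        from bspec[OF q(2) this] have "q (\<lambda>i. y i (F x)) = 0" .
        moreover have "(\<lambda>i. pullback (A j) F (y i) x) = (\<lambda>i. y i (F x))" using x Z(1) by auto
        ultimately show "q (\<lambda>i. pullback (A j) F (y i) x) = 0" by simp
      qed
      then show "q = 0" by (rule alg_indep_onD(2)[OF Z(3) q(1)])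
    qed
    moreover have "?cl (F ` Z) \<subset> pts B" using closedin_zariski_subset[OF BD(1) cl] ne by blast
    ultimately obtain f where "alg_indep_on B (pts B) (Suc ?d) (y(?d := f))"
      using alg_indep_on_Suc[OF BD cl] by blast
    from trdeg(2)[OF B this] show False by simp
  qed
  have "variety_morphism (closed_subvar (A j) Z) B F"
    unfolding variety_morphism_def pts_closed_subvar cring_closed_subvar
  proof (intro conjI ballI)
    show "F ` Z \<subseteq> pts B" using FB[of j] Z(1) by blast
    fix h assume "h \<in> cring B"
    from variety_morphismD(2)[OF F this] have "res Z (pullback (A j) F h) \<in> res Z ` cring (A j)" by (rule imageI)
    then show "res Z (h \<circ> F) \<in> res Z ` cring (A j)" unfolding pullback_def res_res[OF Z(1)] .
  qed
  then have "dominant (closed_subvar (A j) Z) B F"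
    unfolding dominant_def pts_closed_subvar using dom[OF _ _ clZ Z(1)] by blast
  with Z(2) show ?thesis by blast
qed

section \<open>Ind-varieties and their tangent spaces\<close>

lemma closed_subvar_self: "affine_variety A \<Longrightarrow> closed_subvar A (pts A) = A"
proof -
  assume A: "affine_variety A"
  have "res (pts A) ` cring A = id ` cring A"
    using affine_variety_cring(5)[OF A] by (intro image_cong) simp_all
  then show ?thesis by (simp add: closed_subvar_def)
qed

lemma ind_step_closed:
  assumes V: "ind_variety V" and "k \<le> l"
  shows "closedin (zariski (V l)) (pts (V k)) \<and> V k = closed_subvar (V l) (pts (V k))"
  using assms(2)
proof (induction l rule: dec_induct)
  case base
  have "closedin (zariski (V k)) (pts (V k))"
    using closedin_topspace[of "zariski (V k)"] by (simp add: topspace_zariski[OF ind_varietyD(1)[OF V]])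
  then show ?case using closed_subvar_self[OF ind_varietyD(1)[OF V]] by metis
next
  case (step l)
  note A = ind_varietyD(1)[OF V, of "Suc l"] and cl = ind_varietyD(2)[OF V, of l]
  have eq: "closed_subvar (V (Suc l)) (pts (V l)) = V l" by (rule ind_varietyD(3)[OF V, symmetric])
  have sub: "pts (V k) \<subseteq> pts (V l)" by (rule ind_variety_pts_mono[OF V step.hyps(1)])
  have "closedin (zariski (V (Suc l))) (pts (V k))"
    using conjunct1[OF step.IH] closedin_closed_subvar[OF A cl, of "pts (V k)"] unfolding eq by blast
  moreover have "closed_subvar (V (Suc l)) (pts (V k)) = V k"
    using conjunct2[OF step.IH] closed_subvar_closed_subvar[OF sub, of "V (Suc l)"] unfolding eq by simp
  ultimately show ?case by simp
qed

lemma ind_closed_iff: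
  assumes V: "ind_variety V" and kl: "k \<le> l" and C: "C \<subseteq> pts (V k)"
  shows "closedin (zariski (V k)) C \<longleftrightarrow> closedin (zariski (V l)) C"
    "closed_subvar (V k) C = closed_subvar (V l) C"
    "irreducible_closed (V k) C \<longleftrightarrow> irreducible_closed (V l) C"
proof -
  have cl: "closedin (zariski (V l)) (pts (V k))" and eq: "closed_subvar (V l) (pts (V k)) = V k"
    using ind_step_closed[OF V kl] by simp_all
  note A = ind_varietyD(1)[OF V, of l]
  show "closedin (zariski (V k)) C \<longleftrightarrow> closedin (zariski (V l)) C"
    using closedin_closed_subvar[OF A cl, of C] C unfolding eq by simp
  show "closed_subvar (V k) C = closed_subvar (V l) C"
    using closed_subvar_closed_subvar[OF C, of "V l"] unfolding eq .
  show "irreducible_closed (V k) C \<longleftrightarrow> irreducible_closed (V l) C"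
    using irreducible_closed_closed_subvar[OF A cl C] unfolding eq .
qed

lemma closed_imp_algebraic_in:
  assumes V: "ind_variety V" and C: "closedin (zariski (V k)) C"
  shows "algebraic_in V C"
proof -
  have Ck: "C \<subseteq> pts (V k)" by (rule closedin_zariski_subset[OF ind_varietyD(1)[OF V] C])
  have "closedin (zariski (V j)) (C \<inter> pts (V j))" for j
  proof (cases "j \<le> k")
    case True
    have "closedin (zariski (V k)) (C \<inter> pts (V j))"
      using closedin_Int[OF C conjunct1[OF ind_step_closed[OF V True]]] .
    then show ?thesis using ind_closed_iff(1)[OF V True, of "C \<inter> pts (V j)"] by simp
  next
    case False
    then have kj: "k \<le> j" by simp
    have "C \<inter> pts (V j) = C" using Ck ind_variety_pts_mono[OF V kj] by blast
    then show ?thesis using C ind_closed_iff(1)[OF V kj Ck] by simp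
  qed
  moreover have "C \<subseteq> ind_set V" using Ck by (auto simp: ind_set_def)
  ultimately have cl: "closedin (ind_topology V) C" using closedin_ind_topology[OF V] by simp
  have "C = topspace (ind_topology V) \<inter> C" using closedin_subset[OF cl] by blast
  then have "locally_closed_in (ind_topology V) C"
    unfolding locally_closed_in_def using cl by (intro exI[of _ "topspace (ind_topology V)"] exI[of _ C]) simp
  then show ?thesis unfolding algebraic_in_def using Ck by blast
qed

lemma variety_morphism_raise:
  assumes W: "ind_variety W" and F: "variety_morphism A (W l) F" and lm: "l \<le> m"
  shows "variety_morphism A (W m) F"
  unfolding variety_morphism_def
proof (intro conjI ballI)
  show "F ` pts A \<subseteq> pts (W m)" using variety_morphismD(1)[OF F] ind_variety_pts_mono[OF W lm] by blast
  fix h assume "h \<in> cring (W m)"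
  from variety_morphismD(2)[OF F ind_variety_cring_mono[OF W lm this]]
  have "pullback A F (res (pts (W l)) h) \<in> cring A" .
  moreover have "pullback A F (res (pts (W l)) h) = res (pts A) (h \<circ> F)"
    using variety_morphismD(1)[OF F] by (auto simp: pullback_def res_def fun_eq_iff)
  ultimately show "res (pts A) (h \<circ> F) \<in> cring A" by simp
qed

lemma variety_morphism_restrict:
  assumes F: "variety_morphism A B F" and C: "C \<subseteq> pts A" and D: "F ` C \<subseteq> D"
  shows "variety_morphism (closed_subvar A C) (closed_subvar B D) F"
  unfolding variety_morphism_def pts_closed_subvar cring_closed_subvar
proof (intro conjI ballI D)
  fix h assume "h \<in> res D ` cring B"
  then obtain h0 where h0: "h0 \<in> cring B" "h = res D h0" by blast
  have "res C (h \<circ> F) = res C (pullback A F h0)"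
    using C D h0(2) by (auto simp: pullback_def res_def fun_eq_iff)
  then show "res C (h \<circ> F) \<in> res C ` cring A" using variety_morphismD(2)[OF F h0(1)] by simp
qed

lemma variety_morphism_comp:
  assumes F: "variety_morphism A B F" and E: "variety_morphism B C E"
  shows "variety_morphism A C (\<lambda>x. E (F x))"
  unfolding variety_morphism_def
proof (intro conjI ballI)
  show "(\<lambda>x. E (F x)) ` pts A \<subseteq> pts C" using variety_morphismD(1)[OF F] variety_morphismD(1)[OF E] by blast
  fix h assume "h \<in> cring C"
  from variety_morphismD(2)[OF F variety_morphismD(2)[OF E this]]
  have "pullback A F (pullback B E h) \<in> cring A" .
  moreover have "pullback A F (pullback B E h) = res (pts A) (h \<circ> (\<lambda>x. E (F x)))"
    using variety_morphismD(1)[OF F] by (auto simp: pullback_def res_def fun_eq_iff)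
  ultimately show "res (pts A) (h \<circ> (\<lambda>x. E (F x))) \<in> cring A" by simp
qed

lemma variety_morphism_closed_preimage:
  assumes A: "affine_variety A" and B: "affine_variety B" and F: "variety_morphism A B F" and D: "closedin (zariski B) D"
  shows "closedin (zariski A) {x \<in> pts A. F x \<in> D}"
proof -
  obtain S where S: "S \<subseteq> cring B" "D = zero_set B S" using D unfolding closedin_zariski[OF B] by blast
  have "{x \<in> pts A. F x \<in> D} = zero_set A (pullback A F ` S)"
    using variety_morphismD(1)[OF F] by (auto simp: S(2) zero_set_def)
  moreover have "pullback A F ` S \<subseteq> cring A" using variety_morphismD(2)[OF F] S(1) by blast
  ultimately show ?thesis using closedin_zero_set[OF A] by simp
qed

lemma irreducible_closed_closure_image:
  assumes A: "affine_variety A" and B: "affine_variety B" and F: "variety_morphism A B F" and C: "irreducible_closed A C"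
  shows "irreducible_closed B (zariski B closure_of (F ` C))"
proof -
  note CD = irreducible_closedD[OF A C]
  have FC: "F ` C \<subseteq> pts B" using CD(3) variety_morphismD(1)[OF F] by blast
  have "irreducible_in (zariski B) (F ` C)"
  proof (rule irreducible_inI)
    show "F ` C \<subseteq> topspace (zariski B)" unfolding topspace_zariski[OF B] by (rule FC)
    show "F ` C \<noteq> {}" using CD(4) by blast
    fix D E assume DE: "closedin (zariski B) D" "closedin (zariski B) E" "F ` C \<subseteq> D \<union> E"
    have "C \<subseteq> {x \<in> pts A. F x \<in> D} \<union> {x \<in> pts A. F x \<in> E}" using CD(3) DE(3) by blast
    from irreducible_inD(1)[OF CD(2) variety_morphism_closed_preimage[OF A B F DE(1)]
        variety_morphism_closed_preimage[OF A B F DE(2)] this]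
    show "F ` C \<subseteq> D \<or> F ` C \<subseteq> E" by blast
  qed
  from irreducible_in_closure[OF this] show ?thesis unfolding irreducible_closed_def by simp
qed

lemma ind_morphism_above:
  assumes W: "ind_variety W" and F: "ind_morphism V W F"
  obtains l where "n \<le> l" "variety_morphism (V k) (W l) F"
proof -
  obtain l0 where "variety_morphism (V k) (W l0) F" using F unfolding ind_morphism_def by blast
  then have "variety_morphism (V k) (W (max n l0)) F" by (rule variety_morphism_raise[OF W]) simp
  then show ?thesis using that[of "max n l0"] by simp
qed

lemma ind_morphism_ind_set: "ind_morphism V W F \<Longrightarrow> x \<in> ind_set V \<Longrightarrow> F x \<in> ind_set W"
  unfolding ind_morphism_def ind_set_def using variety_morphismD(1) by fastforce

lemma ind_morphism_comp:
  assumes F: "ind_morphism V W F" and E: "ind_morphism W U E"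
  shows "ind_morphism V U (\<lambda>x. E (F x))"
  unfolding ind_morphism_def
proof
  fix k
  obtain l where l: "variety_morphism (V k) (W l) F" using F unfolding ind_morphism_def by blast
  obtain m where m: "variety_morphism (W l) (U m) E" using E unfolding ind_morphism_def by blast
  from variety_morphism_comp[OF l m] show "\<exists>m. variety_morphism (V k) (U m) (\<lambda>x. E (F x))" ..
qed

lemma ind_cringD: "g \<in> ind_cring V \<Longrightarrow> res (ind_set V) g = g" "g \<in> ind_cring V \<Longrightarrow> res (pts (V k)) g \<in> cring (V k)"
  by (simp_all add: ind_cring_def)

lemma ind_cring_pullback:
  assumes F: "ind_morphism V W F" and g: "g \<in> ind_cring W"
  shows "res (ind_set V) (g \<circ> F) \<in> ind_cring V"
proof -
  have "res (pts (V k)) (res (ind_set V) (g \<circ> F)) \<in> cring (V k)" for k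
  proof -
    obtain l where l: "variety_morphism (V k) (W l) F" using F unfolding ind_morphism_def by blast
    have "pullback (V k) F (res (pts (W l)) g) \<in> cring (V k)"
      by (rule variety_morphismD(2)[OF l ind_cringD(2)[OF g]])
    moreover have "pullback (V k) F (res (pts (W l)) g) = res (pts (V k)) (res (ind_set V) (g \<circ> F))"
      using variety_morphismD(1)[OF l] by (auto simp: pullback_def res_def ind_set_def fun_eq_iff)
    ultimately show ?thesis by simp
  qed
  then show ?thesis by (simp add: ind_cring_def res_res)
qed

lemma differential_comp:
  assumes F: "ind_morphism V W F" and E: "ind_morphism W U E"
  shows "differential W U E (differential V W F \<delta>) = differential V U (\<lambda>x. E (F x)) \<delta>"
proof
  fix g
  show "differential W U E (differential V W F \<delta>) g = differential V U (\<lambda>x. E (F x)) \<delta> g"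
  proof (cases "g \<in> ind_cring U")
    case True
    have "res (ind_set V) (res (ind_set W) (g \<circ> E) \<circ> F) = res (ind_set V) (g \<circ> (\<lambda>x. E (F x)))"
      using ind_morphism_ind_set[OF F] by (auto simp: res_def fun_eq_iff)
    then show ?thesis using True ind_cring_pullback[OF E True] by (simp add: differential_def)
  qed (simp add: differential_def)
qed

lemma differential_cong:
  fixes V :: "nat \<Rightarrow> ('a, 'k::field) variety" and W :: "nat \<Rightarrow> ('b, 'k) variety"
  assumes "\<And>x. x \<in> ind_set V \<Longrightarrow> F x = E x"
  shows "differential V W F \<delta> = differential V W E \<delta>"
proof -
  have "res (ind_set V) (g \<circ> F) = res (ind_set V) (g \<circ> E)" for g :: "'b \<Rightarrow> 'k"
    using assms by (auto simp: res_def fun_eq_iff)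
  then have "differential V W F \<delta> g = differential V W E \<delta> g" for g
    unfolding differential_def by (rule arg_cong[where f = "\<lambda>u. if g \<in> ind_cring W then \<delta> u else 0"])
  then show ?thesis by (rule ext)
qed

lemma linear_differential: "Vector_Spaces.linear fscale fscale (differential V W F)"
  by (rule fun_linearI) (auto simp: differential_def fscale_def fun_eq_iff)

lemma differential_push_tangent:
  assumes W: "ind_variety W" and F: "ind_morphism V W F" and C: "C \<subseteq> pts (V k)" and D: "D \<subseteq> pts (W l)" "F ` C \<subseteq> D"
  shows "differential V W F (push_tangent V C \<delta>) =
    push_tangent W D (push_forward (closed_subvar (V k) C) (closed_subvar (W l) D) F \<delta>)"
proof
  fix g
  show "differential V W F (push_tangent V C \<delta>) g =
    push_tangent W D (push_forward (closed_subvar (V k) C) (closed_subvar (W l) D) F \<delta>) g"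
  proof (cases "g \<in> ind_cring W")
    case True
    have "res D g = res D (res (pts (W l)) g)" by (simp add: res_res[OF D(1)])
    then have "res D g \<in> cring (closed_subvar (W l) D)"
      unfolding cring_closed_subvar using imageI[OF ind_cringD(2)[OF True, of l], of "res D"] by simp
    moreover have "res C (res (ind_set V) (g \<circ> F)) = pullback (closed_subvar (V k) C) F (res D g)"
      using C D(2) by (auto simp: pullback_def res_def ind_set_def fun_eq_iff)
    ultimately show ?thesis
      using True ind_cring_pullback[OF F True] by (simp add: differential_def push_tangent_def push_forward_def)
  qed (simp add: differential_def push_tangent_def)
qed

lemma linear_push_tangent: "Vector_Spaces.linear fscale fscale (push_tangent V C)"
  by (rule fun_linearI) (auto simp: push_tangent_def fscale_def fun_eq_iff)

text \<open>A tangent vector to a step of the filtration is a linear combination of finitely many fixed functionals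
  on the functions of the ind-variety. The coefficients are the values of the vector on the generators \<open>w\<close>; in
  a family of tangent vectors only they vary.\<close>

lemma push_tangent_expansion:
  fixes W :: "nat \<Rightarrow> ('b, 'k::field) variety"
  assumes W: "ind_variety W" and e: "e \<in> pts (W m)"
  shows "\<exists>(n::nat) w E. (\<forall>j<n. w j \<in> cring (W m)) \<and>
    (\<forall>\<theta>\<in>tangent (W m) e. push_tangent W (pts (W m)) \<theta> = (\<Sum>j<n. fscale (\<theta> (w j)) (E j)))"
proof -
  note A = ind_varietyD(1)[OF W, of m]
  obtain n w where w: "generates (W m) n w" using generates_exists[OF A] by blast
  define PG where "PG h = (SOME pG. pG \<in> gradients n \<and>
    res (pts (W m)) h = res (pts (W m)) (\<lambda>x. fst pG (\<lambda>i. w i x)))" for h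
  have PG: "PG h \<in> gradients n \<and> res (pts (W m)) h = res (pts (W m)) (\<lambda>x. fst (PG h) (\<lambda>i. w i x))"
    if h: "h \<in> ind_cring W" for h
    unfolding PG_def
  proof (rule someI_ex[where P = "\<lambda>pG. pG \<in> gradients n \<and>
      res (pts (W m)) h = res (pts (W m)) (\<lambda>x. fst pG (\<lambda>i. w i x))"])
    obtain p G where "(p, G) \<in> gradients n" "res (pts (W m)) h = res (pts (W m)) (\<lambda>x. p (\<lambda>i. w i x))"
      using gradient_of_cring[OF w ind_cringD(2)[OF h]] by (elim exE conjE) (erule (1) that)
    then show "\<exists>pG. pG \<in> gradients n \<and> res (pts (W m)) h = res (pts (W m)) (\<lambda>x. fst pG (\<lambda>i. w i x))"
      by (intro exI[of _ "(p, G)"]) simp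
  qed
  define E where "E j h = (if h \<in> ind_cring W then snd (PG h) j (\<lambda>i. w i e) else 0)" for j h
  have "push_tangent W (pts (W m)) \<theta> = (\<Sum>j<n. fscale (\<theta> (w j)) (E j))" if \<theta>: "\<theta> \<in> tangent (W m) e" for \<theta>
  proof
    fix h
    show "push_tangent W (pts (W m)) \<theta> h = (\<Sum>j<n. fscale (\<theta> (w j)) (E j)) h"
    proof (cases "h \<in> ind_cring W")
      case True
      have "\<theta> (res (pts (W m)) h) = (\<Sum>j<n. snd (PG h) j (\<lambda>i. w i e) * \<theta> (w j))"
        using tangent_chain_generators[OF A e \<theta> w, of "fst (PG h)" "snd (PG h)"] PG[OF True] by simp
      then show ?thesis using True by (simp add: push_tangent_def sum_fun_apply fscale_def E_def mult.commute)
    qed (simp add: push_tangent_def sum_fun_apply fscale_def E_def)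
  qed
  then have "\<forall>\<theta>\<in>tangent (W m) e. push_tangent W (pts (W m)) \<theta> = (\<Sum>j<n. fscale (\<theta> (w j)) (E j))" ..
  moreover have "\<forall>j<n. w j \<in> cring (W m)" using generatesD(1)[OF w] by simp
  ultimately show ?thesis by (intro exI[of _ n] exI[of _ w] exI[of _ E] conjI)
qed

section \<open>Translations in ind-groups\<close>

lemma product_cring_expansion:
  fixes A :: "('a, 'k::field) variety" and B :: "('b, 'k) variety"
  assumes B: "affine_variety B" and F: "F \<in> cring (variety_prod A B)"
  shows "\<exists>N f g. (\<forall>s<N. f s \<in> cring A \<and> g s \<in> cring B) \<and> (\<forall>x y. F (x, y) = (\<Sum>s<(N::nat). f s x * g s y))"
proof -
  have "F \<in> fun_vs.span {\<lambda>(x, y). f x * g y | f g. f \<in> cring A \<and> g \<in> cring B}"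
    using F by (simp add: variety_prod_def)
  then show ?thesis
  proof (induction rule: fun_vs.span_induct_alt)
    case base
    show ?case by (intro exI[of _ 0]) simp
  next
    case (step c u v)
    obtain f0 g0 where fg0: "u = (\<lambda>(x, y). f0 x * g0 y)" "f0 \<in> cring A" "g0 \<in> cring B" using step.hyps by blast
    obtain N f g where N: "\<forall>s<N. f s \<in> cring A \<and> g s \<in> cring B" "\<forall>x y. v (x, y) = (\<Sum>s<(N::nat). f s x * g s y)"
      using step.IH by blast
    define f' g' where "f' s = (if s = N then f0 else f s)" and "g' s = (if s = N then fscale c g0 else g s)" for s
    have "\<forall>s<Suc N. f' s \<in> cring A \<and> g' s \<in> cring B"
      using N(1) fg0(2) affine_variety_cring(4)[OF B fg0(3)] by (simp add: f'_def g'_def less_Suc_eq)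
    moreover have "(fscale c u + v) (x, y) = (\<Sum>s<Suc N. f' s x * g' s y)" for x y
    proof -
      have "(\<Sum>s<N. f' s x * g' s y) = (\<Sum>s<N. f s x * g s y)" by (rule sum.cong) (simp_all add: f'_def g'_def)
      then show ?thesis using N(2) by (simp add: fg0(1) fscale_def f'_def g'_def)
    qed
    ultimately show ?case by blast
  qed
qed

lemma ind_groupD:
  assumes "ind_group H V"
  shows "group H" "ind_variety V" "carrier H = ind_set V"
    "ind_morphism (ind_prod V V) V (\<lambda>(x, y). x \<otimes>\<^bsub>H\<^esub> y)" "ind_morphism V V (\<lambda>x. inv\<^bsub>H\<^esub> x)"
  using assms by (simp_all add: ind_group_def)

lemma pts_ind_set: "x \<in> pts (V k) \<Longrightarrow> x \<in> ind_set V"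
  by (auto simp: ind_set_def)

text \<open>The functions on a product are sums of products of functions on the factors. Hence the map
  \<open>(x, y) \<mapsto> \<phi> (x\<inverse> y)\<close>, read as a family of maps in \<open>y\<close>, has coefficients that are regular
  in \<open>x\<close>.\<close>

lemma division_expansion:
  fixes V :: "nat \<Rightarrow> ('a, 'k::field) variety" and W :: "nat \<Rightarrow> ('b, 'k) variety"
  assumes H: "ind_group H V" and W: "ind_variety W" and \<phi>: "ind_morphism V W \<phi>"
  shows "\<exists>m. (\<forall>x\<in>pts (V k). \<forall>y\<in>pts (V k). \<phi> (inv\<^bsub>H\<^esub> x \<otimes>\<^bsub>H\<^esub> y) \<in> pts (W m)) \<and>
    (\<forall>w\<in>cring (W m). \<exists>N f g. (\<forall>s<N. f s \<in> cring (V k) \<and> g s \<in> cring (V k)) \<and>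
      (\<forall>x\<in>pts (V k). \<forall>y\<in>pts (V k). w (\<phi> (inv\<^bsub>H\<^esub> x \<otimes>\<^bsub>H\<^esub> y)) = (\<Sum>s<(N::nat). f s x * g s y)))"
proof -
  note HD = ind_groupD[OF H]
  note V = HD(2)
  obtain M where M: "k \<le> M" and inv: "variety_morphism (V k) (V M) (\<lambda>x. inv\<^bsub>H\<^esub> x)"
    using ind_morphism_above[OF V HD(5)] .
  obtain j where "variety_morphism (ind_prod V V M) (V j) (\<lambda>(x, y). x \<otimes>\<^bsub>H\<^esub> y)"
    using HD(4) unfolding ind_morphism_def by blast
  then have mult: "variety_morphism (variety_prod (V M) (V M)) (V j) (\<lambda>(x, y). x \<otimes>\<^bsub>H\<^esub> y)"
    by (simp add: ind_prod_def)
  obtain m where m: "variety_morphism (V j) (W m) \<phi>" using \<phi> unfolding ind_morphism_def by blast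
  have pp: "pts (variety_prod (V M) (V M)) = pts (V M) \<times> pts (V M)" by (simp add: variety_prod_def)
  have dv: "inv\<^bsub>H\<^esub> x \<otimes>\<^bsub>H\<^esub> y \<in> pts (V j)" and invM: "inv\<^bsub>H\<^esub> x \<in> pts (V M)" and yM: "y \<in> pts (V M)"
    if x: "x \<in> pts (V k)" and y: "y \<in> pts (V k)" for x y
  proof -
    show 1: "inv\<^bsub>H\<^esub> x \<in> pts (V M)" using variety_morphismD(1)[OF inv x] .
    show 2: "y \<in> pts (V M)" using ind_variety_pts_mono[OF V M] y by blast
    have "(inv\<^bsub>H\<^esub> x, y) \<in> pts (variety_prod (V M) (V M))" using 1 2 by (simp add: pp)
    from variety_morphismD(1)[OF mult this] show "inv\<^bsub>H\<^esub> x \<otimes>\<^bsub>H\<^esub> y \<in> pts (V j)" by simp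
  qed
  have "\<exists>N f g. (\<forall>s<N. f s \<in> cring (V k) \<and> g s \<in> cring (V k)) \<and>
      (\<forall>x\<in>pts (V k). \<forall>y\<in>pts (V k). w (\<phi> (inv\<^bsub>H\<^esub> x \<otimes>\<^bsub>H\<^esub> y)) = (\<Sum>s<(N::nat). f s x * g s y))"
    if w: "w \<in> cring (W m)" for w
  proof -
    let ?w = "pullback (V j) \<phi> w"
    let ?F = "pullback (variety_prod (V M) (V M)) (\<lambda>(x, y). x \<otimes>\<^bsub>H\<^esub> y) ?w"
    have "?F \<in> cring (variety_prod (V M) (V M))"
      by (rule variety_morphismD(2)[OF mult variety_morphismD(2)[OF m w]])
    then obtain N f g where fg: "\<forall>s<N. f s \<in> cring (V M) \<and> g s \<in> cring (V M)"
      "\<forall>x y. ?F (x, y) = (\<Sum>s<(N::nat). f s x * g s y)"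
      using product_cring_expansion[OF ind_varietyD(1)[OF V]] by blast
    define f' g' where "f' s = pullback (V k) (\<lambda>x. inv\<^bsub>H\<^esub> x) (f s)" and "g' s = res (pts (V k)) (g s)" for s
    have "\<forall>s<N. f' s \<in> cring (V k) \<and> g' s \<in> cring (V k)"
      using fg(1) variety_morphismD(2)[OF inv] ind_variety_cring_mono[OF V M] by (simp add: f'_def g'_def)
    moreover have "w (\<phi> (inv\<^bsub>H\<^esub> x \<otimes>\<^bsub>H\<^esub> y)) = (\<Sum>s<N. f' s x * g' s y)"
      if x: "x \<in> pts (V k)" and y: "y \<in> pts (V k)" for x y
    proof -
      have "(inv\<^bsub>H\<^esub> x, y) \<in> pts (variety_prod (V M) (V M))" using invM[OF x y] yM[OF x y] by (simp add: pp)
      then have "?F (inv\<^bsub>H\<^esub> x, y) = w (\<phi> (inv\<^bsub>H\<^esub> x \<otimes>\<^bsub>H\<^esub> y))" using dv[OF x y] by simp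
      moreover have "?F (inv\<^bsub>H\<^esub> x, y) = (\<Sum>s<N. f s (inv\<^bsub>H\<^esub> x) * g s y)" using fg(2) by blast
      moreover have "\<dots> = (\<Sum>s<N. f' s x * g' s y)"
        by (rule sum.cong) (use x y in \<open>simp_all add: f'_def g'_def res_def\<close>)
      ultimately show ?thesis by simp
    qed
    ultimately show ?thesis by blast
  qed
  then show ?thesis using dv variety_morphismD(1)[OF m] by blast
qed

lemma ind_morphism_id:
  assumes V: "ind_variety V"
  shows "ind_morphism V V (\<lambda>x. x)"
  unfolding ind_morphism_def
proof
  fix k
  have "variety_morphism (V k) (V k) (\<lambda>x. x)"
    unfolding variety_morphism_def o_def by (simp add: affine_variety_cring(5)[OF ind_varietyD(1)[OF V]])
  then show "\<exists>l. variety_morphism (V k) (V l) (\<lambda>x. x)" ..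
qed

text \<open>The translation by \<open>g\<close> is the member at \<open>x = g\<inverse>\<close> of the family \<open>y \<mapsto> x\<inverse> y\<close>.\<close>

lemma translation_ind_morphism:
  fixes V :: "nat \<Rightarrow> ('a, 'k::field) variety"
  assumes H: "ind_group H V" and g: "g \<in> carrier H"
  shows "ind_morphism V V (\<lambda>y. g \<otimes>\<^bsub>H\<^esub> y)"
  unfolding ind_morphism_def
proof
  fix k
  note HD = ind_groupD[OF H]
  note V = HD(2)
  have "inv\<^bsub>H\<^esub> g \<in> ind_set V" using group.inv_closed[OF HD(1) g] HD(3) by simp
  then obtain k' where k': "inv\<^bsub>H\<^esub> g \<in> pts (V k')" by (auto simp: ind_set_def)
  define K where "K = max k k'"
  have gK: "inv\<^bsub>H\<^esub> g \<in> pts (V K)" using ind_variety_pts_mono[OF V, of k' K] k' by (auto simp: K_def)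
  have kK: "pts (V k) \<subseteq> pts (V K)" using ind_variety_pts_mono[OF V, of k K] by (simp add: K_def)
  note id = ind_morphism_id[OF V]
  have gg: "inv\<^bsub>H\<^esub> (inv\<^bsub>H\<^esub> g) = g" by (rule group.inv_inv[OF HD(1) g])
  obtain m where m: "\<forall>x\<in>pts (V K). \<forall>y\<in>pts (V K). inv\<^bsub>H\<^esub> x \<otimes>\<^bsub>H\<^esub> y \<in> pts (V m)"
    "\<forall>w\<in>cring (V m). \<exists>N f h. (\<forall>s<N. f s \<in> cring (V K) \<and> h s \<in> cring (V K)) \<and>
      (\<forall>x\<in>pts (V K). \<forall>y\<in>pts (V K). w (inv\<^bsub>H\<^esub> x \<otimes>\<^bsub>H\<^esub> y) = (\<Sum>s<(N::nat). f s x * h s y))"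
    using division_expansion[OF H V id, of K] by (elim exE conjE) (erule (1) that)
  have "variety_morphism (V k) (V m) (\<lambda>y. g \<otimes>\<^bsub>H\<^esub> y)"
    unfolding variety_morphism_def
  proof (intro conjI ballI)
    show "(\<lambda>y. g \<otimes>\<^bsub>H\<^esub> y) ` pts (V k) \<subseteq> pts (V m)"
      using bspec[OF m(1) gK] kK unfolding gg by blast
    fix w assume "w \<in> cring (V m)"
    from bspec[OF m(2) this] obtain N f h where fh: "\<forall>s<N. f s \<in> cring (V K) \<and> h s \<in> cring (V K)"
      "\<forall>x\<in>pts (V K). \<forall>y\<in>pts (V K). w (inv\<^bsub>H\<^esub> x \<otimes>\<^bsub>H\<^esub> y) = (\<Sum>s<(N::nat). f s x * h s y)" by blast
    note wg = bspec[OF fh(2) gK, unfolded gg]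
    have "res (pts (V k)) (w \<circ> (\<lambda>y. g \<otimes>\<^bsub>H\<^esub> y)) = (\<Sum>s<N. fscale (f s (inv\<^bsub>H\<^esub> g)) (res (pts (V k)) (h s)))"
      using wg kK by (auto simp: res_def fscale_def sum_fun_apply fun_eq_iff)
    also have "\<dots> \<in> cring (V k)"
    proof -
      have s: "fscale c (res (pts (V k)) (h s)) \<in> cring (V k)" if "s < N" for c s
        using fh(1) that ind_variety_cring_mono[OF V, of k K] affine_variety_cring(4)[OF ind_varietyD(1)[OF V]]
        by (simp add: K_def)
      have "(\<Sum>s<N'. fscale (f s (inv\<^bsub>H\<^esub> g)) (res (pts (V k)) (h s))) \<in> cring (V k)" if "N' \<le> N" for N'
        using that
      proof (induction N')
        case 0
        have "(0::'a \<Rightarrow> 'k) \<in> cring (V k)"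
          by (rule zero_idealD(1)[OF ideal_zero_ideal(1)[OF ind_varietyD(1)[OF V]]])
        moreover have "(\<Sum>s<0. fscale (f s (inv\<^bsub>H\<^esub> g)) (res (pts (V k)) (h s))) = 0" by (rule sum.neutral) simp
        ultimately show ?case by (simp only:)
      next
        case (Suc n)
        then have IH: "(\<Sum>s<n. fscale (f s (inv\<^bsub>H\<^esub> g)) (res (pts (V k)) (h s))) \<in> cring (V k)" and n: "n < N" by auto
        show ?case
          unfolding sum.lessThan_Suc by (rule affine_variety_cring(2)[OF ind_varietyD(1)[OF V] IH s[OF n]])
      qed
      then show ?thesis by blast
    qed
    finally show "res (pts (V k)) (w \<circ> (\<lambda>y. g \<otimes>\<^bsub>H\<^esub> y)) \<in> cring (V k)" .
  qed
  then show "\<exists>m. variety_morphism (V k) (V m) (\<lambda>y. g \<otimes>\<^bsub>H\<^esub> y)" ..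
qed

text \<open>The scalars are modelled by functions on a one-point type, which makes them one of the spaces of
  functions to which the linear algebra applies.\<close>

lemma separating_functional:
  fixes S :: "('b \<Rightarrow> 'k::field) set"
  assumes S: "fun_vs.subspace S" and \<theta>: "\<theta> \<notin> S"
  shows "\<exists>lf :: ('b \<Rightarrow> 'k) \<Rightarrow> unit \<Rightarrow> 'k. Vector_Spaces.linear fscale fscale lf \<and> (\<forall>\<eta>\<in>S. lf \<eta> = 0) \<and> lf \<theta> () \<noteq> 0"
proof -
  obtain B where B: "B \<subseteq> S" "fun_vs.independent B" "S \<subseteq> fun_vs.span B" "card B = fun_vs.dim S"
    using fun_vs.basis_exists .
  have span: "fun_vs.span B = S" using fun_vs.span_minimal[OF B(1) S] B(3) by blast
  have "\<theta> \<notin> fun_vs.span B" using \<theta> span by simp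
  from fun_vs.independent_insertI[OF this B(2)] have "fun_vs.independent (insert \<theta> B)" .
  from fun_pair.linear_independent_extend[OF this, of "\<lambda>v (_ :: unit). if v = \<theta> then 1 else 0"]
  obtain lf :: "('b \<Rightarrow> 'k) \<Rightarrow> unit \<Rightarrow> 'k" where lf: "Vector_Spaces.linear fscale fscale lf"
    "\<forall>v\<in>insert \<theta> B. lf v = (\<lambda>_. if v = \<theta> then 1 else 0)" by blast
  have "\<theta> \<notin> B" using \<theta> B(1) by blast
  have zB: "lf v = 0" if v: "v \<in> B" for v
  proof -
    have "v \<noteq> \<theta>" using v \<open>\<theta> \<notin> B\<close> by blast
    moreover have "lf v = (\<lambda>_. if v = \<theta> then 1 else 0)" using lf(2) v by blast
    ultimately show ?thesis by (simp add: zero_fun_def)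
  qed
  have "lf ` S = fun_vs.span (lf ` B)" using fun_pair.linear_span_image[OF lf(1), of B] span by simp
  also have "\<dots> \<subseteq> {0}" by (rule fun_vs.span_minimal) (use zB in \<open>auto intro: fun_vs.subspace_single_0\<close>)
  finally have "\<forall>\<eta>\<in>S. lf \<eta> = 0" by blast
  moreover have "lf \<theta> () \<noteq> 0" using bspec[OF lf(2) insertI1] by simp
  ultimately show ?thesis using lf(1) by blast
qed

text \<open>For a fixed \<open>x\<close> the map \<open>y \<mapsto> \<phi> (x\<inverse> y)\<close> takes \<open>x\<close> to the image of the identity, so all
  the translated differentials have values in one tangent space and can be tested by one functional. The
  result is a linear condition on the tangent spaces of \<open>C\<close> with regular coefficients, to which the
  preceding extension principle applies; tangent spaces of \<open>C\<close> do not jump at the identity by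
  assumption.\<close>

lemma differential_at_identity:
  fixes V :: "nat \<Rightarrow> ('a, 'k::{alg_closed_field,field_char_0}) variety" and W :: "nat \<Rightarrow> ('b, 'k) variety"
  assumes H: "ind_group H V" and W: "ind_variety W" and \<phi>: "ind_morphism V W \<phi>"
    and C: "irreducible_closed (V k) C" and e: "\<one>\<^bsub>H\<^esub> \<in> C"
    and dim: "fun_vs.dim (tangent (closed_subvar (V k) C) \<one>\<^bsub>H\<^esub>) \<le> trdeg_on (V k) C"
    and D: "D \<subseteq> C" and dense: "\<And>f. f \<in> cring (closed_subvar (V k) C) \<Longrightarrow> (\<And>x. x \<in> D \<Longrightarrow> f x = 0) \<Longrightarrow> f \<one>\<^bsub>H\<^esub> = 0"
    and S: "fun_vs.subspace S"
    and mem: "\<And>x \<delta>. x \<in> D \<Longrightarrow> \<delta> \<in> tangent (closed_subvar (V k) C) x \<Longrightarrow>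
      differential V W (\<lambda>y. \<phi> (inv\<^bsub>H\<^esub> x \<otimes>\<^bsub>H\<^esub> y)) (push_tangent V C \<delta>) \<in> S"
    and \<delta>0: "\<delta>0 \<in> tangent (closed_subvar (V k) C) \<one>\<^bsub>H\<^esub>"
  shows "differential V W \<phi> (push_tangent V C \<delta>0) \<in> S"
proof (rule ccontr)
  assume notS: "differential V W \<phi> (push_tangent V C \<delta>0) \<notin> S"
  obtain lf :: "(('b \<Rightarrow> 'k) \<Rightarrow> 'k) \<Rightarrow> unit \<Rightarrow> 'k" where lf: "Vector_Spaces.linear fscale fscale lf"
    "\<forall>\<eta>\<in>S. lf \<eta> = 0" "lf (differential V W \<phi> (push_tangent V C \<delta>0)) () \<noteq> 0"
    using separating_functional[OF S notS] by (elim exE conjE) (erule (2) that)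
  note HD = ind_groupD[OF H]
  note V = HD(2)
  note Vk = ind_varietyD(1)[OF V, of k]
  note CD = irreducible_closedD[OF Vk C]
  interpret H: group H by (rule HD(1))
  let ?A = "closed_subvar (V k) C"
  have A: "affine_variety ?A" by (rule affine_closed_subvar[OF Vk CD(1)])
  have Cc: "x \<in> carrier H" if "x \<in> C" for x
    unfolding HD(3) by (rule pts_ind_set) (rule subsetD[OF CD(3) that])
  obtain m where m: "\<forall>x\<in>pts (V k). \<forall>y\<in>pts (V k). \<phi> (inv\<^bsub>H\<^esub> x \<otimes>\<^bsub>H\<^esub> y) \<in> pts (W m)"
    "\<forall>w\<in>cring (W m). \<exists>N f h. (\<forall>s<N. f s \<in> cring (V k) \<and> h s \<in> cring (V k)) \<and>
      (\<forall>x\<in>pts (V k). \<forall>y\<in>pts (V k). w (\<phi> (inv\<^bsub>H\<^esub> x \<otimes>\<^bsub>H\<^esub> y)) = (\<Sum>s<(N::nat). f s x * h s y))"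
    using division_expansion[OF H W \<phi>, of k] by (elim exE conjE) (erule (1) that)
  have e1: "\<one>\<^bsub>H\<^esub> \<in> pts (V k)" using e CD(3) by blast
  have "\<phi> (inv\<^bsub>H\<^esub> \<one>\<^bsub>H\<^esub> \<otimes>\<^bsub>H\<^esub> \<one>\<^bsub>H\<^esub>) \<in> pts (W m)" using m(1) e1 by blast
  then have eW: "\<phi> \<one>\<^bsub>H\<^esub> \<in> pts (W m)" by simp
  obtain n w E where w: "\<forall>j<n. w j \<in> cring (W m)"
    "\<forall>\<theta>\<in>tangent (W m) (\<phi> \<one>\<^bsub>H\<^esub>). push_tangent W (pts (W m)) \<theta> = (\<Sum>j<(n::nat). fscale (\<theta> (w j)) (E j))"
    using push_tangent_expansion[OF W eW] by (elim exE conjE) (erule (1) that)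
  define R where "R j q \<longleftrightarrow> (\<forall>s<fst q. fst (snd q) s \<in> cring (V k) \<and> snd (snd q) s \<in> cring (V k)) \<and>
      (\<forall>x\<in>pts (V k). \<forall>y\<in>pts (V k). w j (\<phi> (inv\<^bsub>H\<^esub> x \<otimes>\<^bsub>H\<^esub> y)) = (\<Sum>s<fst q. fst (snd q) s x * snd (snd q) s y))"
      for j and q :: "nat \<times> (nat \<Rightarrow> 'a \<Rightarrow> 'k) \<times> (nat \<Rightarrow> 'a \<Rightarrow> 'k)"
    have "\<exists>q. j < n \<longrightarrow> R j q" for j
    proof (cases "j < n")
      case True
      then have "w j \<in> cring (W m)" using w(1) by blast
      from bspec[OF m(2) this] obtain N f h where "(\<forall>s<N. f s \<in> cring (V k) \<and> h s \<in> cring (V k)) \<and>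
        (\<forall>x\<in>pts (V k). \<forall>y\<in>pts (V k). w j (\<phi> (inv\<^bsub>H\<^esub> x \<otimes>\<^bsub>H\<^esub> y)) = (\<Sum>s<(N::nat). f s x * h s y))"
        by (elim exE) (erule that)
      then have "R j (N, f, h)" by (simp add: R_def)
      then show ?thesis by blast
    qed simp
  then have "\<exists>q. \<forall>j. j < n \<longrightarrow> R j (q j)" by (intro choice allI)
  then obtain q where q: "\<forall>j. j < n \<longrightarrow> R j (q j)" ..
  define N f h where "N j = fst (q j)" and "f j = fst (snd (q j))" and "h j = snd (snd (q j))" for j
  have fh: "f j s \<in> cring (V k)" "h j s \<in> cring (V k)" if "j < n" "s < N j" for j s
    using q that by (simp_all add: R_def N_def f_def h_def)
  have wfh: "w j (\<phi> (inv\<^bsub>H\<^esub> x \<otimes>\<^bsub>H\<^esub> y)) = (\<Sum>s<N j. f j s x * h j s y)"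
    if "j < n" "x \<in> pts (V k)" "y \<in> pts (V k)" for j x y
    using q that by (simp add: R_def N_def f_def h_def)
  \<comment> \<open>The condition is a sum over generators \<open>j\<close> of the target and summands \<open>s\<close> of the expansion of
    the \<open>j\<close>-th generator.\<close>
  define I where "I = Sigma {..<n} (\<lambda>j. {..<N j})"
  define gI where "gI = (\<lambda>(j, s). fscale (lf (E j) ()) (res C (f j s)))"
  define hI where "hI = (\<lambda>(j, s). res C (h j s))"
  have I: "gI p \<in> cring ?A" "hI p \<in> cring ?A" if p: "p \<in> I" for p
  proof -
    obtain j s where js: "p = (j, s)" "j < n" "s < N j" using p by (auto simp: I_def)
    have "res C (f j s) \<in> cring ?A" "res C (h j s) \<in> cring ?A"
      unfolding cring_closed_subvar by (intro imageI fh[OF js(2,3)])+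
    then show "gI p \<in> cring ?A" "hI p \<in> cring ?A"
      using affine_variety_cring(4)[OF A] by (simp_all add: js(1) gI_def hI_def)
  qed
  have val: "lf (differential V W (\<lambda>y. \<phi> (inv\<^bsub>H\<^esub> x \<otimes>\<^bsub>H\<^esub> y)) (push_tangent V C \<delta>)) () = (\<Sum>p\<in>I. gI p x * \<delta> (hI p))"
    if x: "x \<in> C" and \<delta>: "\<delta> \<in> tangent ?A x" for x \<delta>
  proof -
    let ?F = "\<lambda>y. \<phi> (inv\<^bsub>H\<^esub> x \<otimes>\<^bsub>H\<^esub> y)"
    have xc: "x \<in> carrier H" by (rule Cc[OF x])
    have xk: "x \<in> pts (V k)" using x CD(3) by blast
    have F: "ind_morphism V W ?F"
      by (rule ind_morphism_comp[OF translation_ind_morphism[OF H H.inv_closed[OF xc]] \<phi>])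
    have FC: "?F ` C \<subseteq> pts (W m)" using m(1) xk CD(3) by blast
    have Wm: "closed_subvar (W m) (pts (W m)) = W m" by (rule closed_subvar_self[OF ind_varietyD(1)[OF W]])
    let ?\<theta> = "push_forward ?A (W m) ?F \<delta>"
    have eq: "differential V W ?F (push_tangent V C \<delta>) = push_tangent W (pts (W m)) ?\<theta>"
      using differential_push_tangent[OF W F CD(3) subset_refl FC, of \<delta>] unfolding Wm .
    have pb: "pullback ?A ?F (w j) = (\<Sum>s<N j. fscale (f j s x) (res C (h j s)))" if j: "j < n" for j
    proof
      fix y
      show "pullback ?A ?F (w j) y = (\<Sum>s<N j. fscale (f j s x) (res C (h j s))) y"
      proof (cases "y \<in> C")
        case True
        then have "y \<in> pts (V k)" using CD(3) by blast
        from wfh[OF j xk this] show ?thesis using True by (simp add: sum_fun_apply fscale_def res_def)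
      qed (simp add: pullback_def res_def sum_fun_apply fscale_def)
    qed
    have mor: "variety_morphism ?A (W m) ?F"
    proof -
      obtain l where l: "m \<le> l" "variety_morphism (V k) (W l) ?F" using ind_morphism_above[OF W F] .
      have "variety_morphism ?A (closed_subvar (W l) (pts (W m))) ?F"
        by (rule variety_morphism_restrict[OF l(2) CD(3) FC])
      then show ?thesis using ind_step_closed[OF W l(1)] by simp
    qed
    have "?\<theta> \<in> tangent (W m) (?F x)"
      by (rule push_forward_tangent[OF ind_varietyD(1)[OF W] mor _ \<delta>]) (simp add: x)
    then have "?\<theta> \<in> tangent (W m) (\<phi> \<one>\<^bsub>H\<^esub>)" using H.l_inv[OF xc] by simp
    then have "push_tangent W (pts (W m)) ?\<theta> = (\<Sum>j<n. fscale (?\<theta> (w j)) (E j))" using w(2) by blast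
    then have "lf (differential V W ?F (push_tangent V C \<delta>)) = (\<Sum>j<n. fscale (?\<theta> (w j)) (lf (E j)))"
      unfolding eq by (simp only: fun_pair.linear_sum[OF lf(1)] fun_pair.linear_scale[OF lf(1)])
    then have "lf (differential V W ?F (push_tangent V C \<delta>)) () = (\<Sum>j<n. ?\<theta> (w j) * lf (E j) ())"
      by (simp add: sum_fun_apply fscale_def)
    also have "\<dots> = (\<Sum>j<n. \<Sum>s<N j. gI (j, s) x * \<delta> (hI (j, s)))"
    proof (rule sum.cong[OF refl])
      fix j assume "j \<in> {..<n}"
      then have j: "j < n" by simp
      have hA: "res C (h j s) \<in> cring ?A" if "s < N j" for s
        unfolding cring_closed_subvar by (rule imageI[OF fh(2)[OF j that]])
      have "?\<theta> (w j) = \<delta> (\<Sum>s<N j. fscale (f j s x) (res C (h j s)))"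
        using w(1) j by (simp add: push_forward_def pb)
      also have "\<dots> = (\<Sum>s<N j. \<delta> (fscale (f j s x) (res C (h j s))))"
        by (rule conjunct2[OF tangent_sum[OF A \<delta>]]) (simp add: affine_variety_cring(4)[OF A] hA)
      also have "\<dots> = (\<Sum>s<N j. f j s x * \<delta> (res C (h j s)))"
        by (rule sum.cong) (simp_all add: tangentD(2)[OF \<delta> hA])
      finally have "?\<theta> (w j) * lf (E j) () = (\<Sum>s<N j. f j s x * \<delta> (res C (h j s)) * lf (E j) ())"
        by (simp add: sum_distrib_right)
      also have "\<dots> = (\<Sum>s<N j. gI (j, s) x * \<delta> (hI (j, s)))"
        by (rule sum.cong) (simp_all add: gI_def hI_def fscale_def res_def x)
      finally show "?\<theta> (w j) * lf (E j) () = (\<Sum>s<N j. gI (j, s) x * \<delta> (hI (j, s)))" .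
    qed
    also have "\<dots> = (\<Sum>p\<in>I. gI p x * \<delta> (hI p))"
      unfolding I_def by (subst sum.Sigma) simp_all
    finally show ?thesis .
  qed
  have "(\<Sum>p\<in>I. gI p \<one>\<^bsub>H\<^esub> * \<delta>0 (hI p)) = 0"
  proof (rule linear_condition_extends[OF A _ _ _ _ I _ \<delta>0])
    show "\<one>\<^bsub>H\<^esub> \<in> pts ?A" "D \<subseteq> pts ?A" using e D by simp_all
    show "f \<one>\<^bsub>H\<^esub> = 0" if "f \<in> cring ?A" "\<And>x. x \<in> D \<Longrightarrow> f x = 0" for f using dense that .
    show "fun_vs.dim (tangent ?A \<one>\<^bsub>H\<^esub>) \<le> fun_vs.dim (tangent ?A x)" if "x \<in> D" for x
      using dim trdeg_on(3)[OF Vk C, of x] that D by (meson le_trans subsetD)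
    fix x \<delta> assume x: "x \<in> D" and \<delta>: "\<delta> \<in> tangent ?A x"
    have "x \<in> C" using x D by blast
    from val[OF this \<delta>] lf(2) mem[OF x \<delta>] show "(\<Sum>p\<in>I. gI p x * \<delta> (hI p)) = 0" by simp
  qed
  moreover have "differential V W (\<lambda>y. \<phi> (inv\<^bsub>H\<^esub> \<one>\<^bsub>H\<^esub> \<otimes>\<^bsub>H\<^esub> y)) (push_tangent V C \<delta>0) = differential V W \<phi> (push_tangent V C \<delta>0)"
    by (rule differential_cong) (simp flip: HD(3))
  ultimately show False using val[OF e \<delta>0] lf(3) by simp
qed

section \<open>The space \<open>L\<close> of an ind-group\<close>

text \<open>The hypothesis on the dimension says that \<open>C\<close> is smooth at the identity, since the Krull dimension of
  \<open>C\<close> is its transcendence degree.\<close>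

lemma irreducible_smooth_in_L_space:
  fixes W :: "nat \<Rightarrow> ('b, 'k::{alg_closed_field,field_char_0}) variety"
  assumes G: "ind_group G W" and C: "irreducible_closed (W k) C" and e: "\<one>\<^bsub>G\<^esub> \<in> C"
    and dim: "fun_vs.dim (tangent (closed_subvar (W k) C) \<one>\<^bsub>G\<^esub>) \<le> trdeg_on (W k) C"
    and \<delta>: "\<delta> \<in> tangent (closed_subvar (W k) C) \<one>\<^bsub>G\<^esub>"
  shows "push_tangent W C \<delta> \<in> L_space G W"
proof -
  note W = ind_groupD(2)[OF G]
  note A = ind_varietyD(1)[OF W, of k]
  note CD = irreducible_closedD[OF A C]
  have cv: "closure_var (W k) C = closed_subvar (W k) C"
    unfolding closure_var_def using closure_of_closedin[OF CD(1)] by simp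
  have "fun_vs.dim (tangent (closed_subvar (W k) C) \<one>\<^bsub>G\<^esub>) = trdeg_on (W k) C"
    using dim trdeg_on(3)[OF A C e] by (rule antisym)
  then have "\<one>\<^bsub>G\<^esub> \<in> smooth_points (W k) C"
    unfolding smooth_points_def cv using e dim_at_irreducible_closed[OF A C e] by simp
  moreover have "algebraic_in W C" by (rule closed_imp_algebraic_in[OF W CD(1)])
  moreover have "push_tangent W C \<delta> \<in> tangent_sub W k C \<one>\<^bsub>G\<^esub>"
    unfolding tangent_sub_def cv using \<delta> by simp
  ultimately show ?thesis
    unfolding L_space_def using CD(3) by (intro fun_vs.span_base) blast
qed

text \<open>Smooth points have irreducible models, so the sets in the preceding lemma already span \<open>L\<close>.\<close>

lemma L_space_minimal:
  fixes V :: "nat \<Rightarrow> ('a, 'k::{alg_closed_field,field_char_0}) variety"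
  assumes H: "ind_group H V" and T: "fun_vs.subspace T"
    and mem: "\<And>k C \<delta>. irreducible_closed (V k) C \<Longrightarrow> \<one>\<^bsub>H\<^esub> \<in> C \<Longrightarrow>
      fun_vs.dim (tangent (closed_subvar (V k) C) \<one>\<^bsub>H\<^esub>) \<le> trdeg_on (V k) C \<Longrightarrow>
      \<delta> \<in> tangent (closed_subvar (V k) C) \<one>\<^bsub>H\<^esub> \<Longrightarrow> push_tangent V C \<delta> \<in> T"
  shows "L_space H V \<subseteq> T"
  unfolding L_space_def
proof (rule fun_vs.span_minimal[OF _ T], rule Union_least)
  note V = ind_groupD(2)[OF H]
  fix U assume "U \<in> {tangent_sub V k X \<one>\<^bsub>H\<^esub> | k X.
    algebraic_in V X \<and> X \<subseteq> pts (V k) \<and> \<one>\<^bsub>H\<^esub> \<in> smooth_points (V k) X}"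
  then obtain k X where U: "U = tangent_sub V k X \<one>\<^bsub>H\<^esub>" and X: "X \<subseteq> pts (V k)" "\<one>\<^bsub>H\<^esub> \<in> smooth_points (V k) X" by blast
  note A = ind_varietyD(1)[OF V, of k]
  let ?Y = "zariski (V k) closure_of X"
  have Yk: "?Y \<subseteq> pts (V k)" by (rule closedin_zariski_subset[OF A closedin_closure_of])
  show "U \<subseteq> T"
  proof
    fix \<theta> assume "\<theta> \<in> U"
    then obtain \<delta> where \<delta>: "\<delta> \<in> tangent (closed_subvar (V k) ?Y) \<one>\<^bsub>H\<^esub>" "\<theta> = push_tangent V ?Y \<delta>"
      unfolding U tangent_sub_def closure_var_def by auto
    from smooth_point_irreducible_model[OF A X] show "\<theta> \<in> T"
    proof
      assume "tangent (closed_subvar (V k) ?Y) \<one>\<^bsub>H\<^esub> = {0}"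
      then have "\<theta> = push_tangent V ?Y 0" using \<delta> by simp
      also have "\<dots> = 0" by (rule fun_pair.linear_0[OF linear_push_tangent])
      finally show "\<theta> \<in> T" using fun_vs.subspace_0[OF T] by simp
    next
      assume "\<exists>C. irreducible_closed (V k) C \<and> \<one>\<^bsub>H\<^esub> \<in> C \<and>
        fun_vs.dim (tangent (closed_subvar (V k) C) \<one>\<^bsub>H\<^esub>) \<le> trdeg_on (V k) C \<and>
        (\<forall>\<delta>\<in>tangent (closed_subvar (V k) ?Y) \<one>\<^bsub>H\<^esub>. \<exists>\<epsilon>\<in>tangent (closed_subvar (V k) C) \<one>\<^bsub>H\<^esub>.
          \<forall>f\<in>cring (V k). \<delta> (res ?Y f) = \<epsilon> (res C f))"
      then obtain C where C: "irreducible_closed (V k) C" "\<one>\<^bsub>H\<^esub> \<in> C"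
        "fun_vs.dim (tangent (closed_subvar (V k) C) \<one>\<^bsub>H\<^esub>) \<le> trdeg_on (V k) C"
        and ex: "\<forall>\<delta>\<in>tangent (closed_subvar (V k) ?Y) \<one>\<^bsub>H\<^esub>. \<exists>\<epsilon>\<in>tangent (closed_subvar (V k) C) \<one>\<^bsub>H\<^esub>.
          \<forall>f\<in>cring (V k). \<delta> (res ?Y f) = \<epsilon> (res C f)"
        by (elim exE conjE) (erule (3) that)
      from bspec[OF ex \<delta>(1)] obtain \<epsilon> where \<epsilon>: "\<epsilon> \<in> tangent (closed_subvar (V k) C) \<one>\<^bsub>H\<^esub>"
        "\<forall>f\<in>cring (V k). \<delta> (res ?Y f) = \<epsilon> (res C f)" ..
      note Ck = irreducible_closedD(3)[OF A C(1)]
      have "\<delta> (res ?Y f) = \<epsilon> (res C f)" if f: "f \<in> ind_cring V" for f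
        using bspec[OF \<epsilon>(2) ind_cringD(2)[OF f, of k]] by (simp add: res_res[OF Yk] res_res[OF Ck])
      then have "\<theta> = push_tangent V C \<epsilon>" unfolding \<delta>(2) push_tangent_def by auto
      then show "\<theta> \<in> T" using mem[OF C \<epsilon>(1)] by simp
    qed
  qed
qed

text \<open>The translate of \<open>Y\<close> by \<open>x\<inverse>\<close> is an irreducible closed set, isomorphic to \<open>Y\<close>, with \<open>x\<close>
  corresponding to the identity. Transcendence degree and dimension of the tangent space are preserved, so
  the translate is smooth at the identity.\<close>

lemma translated_tangent_in_L_space:
  fixes W :: "nat \<Rightarrow> ('b, 'k::{alg_closed_field,field_char_0}) variety"
  assumes G: "ind_group G W" and Y: "irreducible_closed (W l) Y" and x: "x \<in> Y"
    and dim: "fun_vs.dim (tangent (closed_subvar (W l) Y) x) \<le> trdeg_on (W l) Y"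
    and \<delta>: "\<delta> \<in> tangent (closed_subvar (W l) Y) x"
  shows "differential W W (\<lambda>y. inv\<^bsub>G\<^esub> x \<otimes>\<^bsub>G\<^esub> y) (push_tangent W Y \<delta>) \<in> L_space G W"
proof -
  note GD = ind_groupD[OF G]
  note W = GD(2)
  interpret G: group G by (rule GD(1))
  note Al = ind_varietyD(1)[OF W]
  note YD = irreducible_closedD[OF Al Y]
  have Yc: "y \<in> carrier G" if "y \<in> Y" for y
    unfolding GD(3) by (rule pts_ind_set) (rule subsetD[OF YD(3) that])
  note xc = Yc[OF x]
  let ?F = "\<lambda>y. inv\<^bsub>G\<^esub> x \<otimes>\<^bsub>G\<^esub> y" and ?F' = "\<lambda>y. x \<otimes>\<^bsub>G\<^esub> y"
  have F: "ind_morphism W W ?F" by (rule translation_ind_morphism[OF G G.inv_closed[OF xc]])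
  have F': "ind_morphism W W ?F'" by (rule translation_ind_morphism[OF G xc])
  have FF': "?F (?F' z) = z" if "z \<in> carrier G" for z using xc that by (simp flip: G.m_assoc)
  have F'F: "?F' (?F z) = z" if "z \<in> carrier G" for z using xc that by (simp flip: G.m_assoc)
  obtain m where m: "l \<le> m" "variety_morphism (W l) (W m) ?F" using ind_morphism_above[OF W F] .
  obtain m' where m': "l \<le> m'" "variety_morphism (W m) (W m') ?F'" using ind_morphism_above[OF W F'] .
  define C where "C = ?F ` Y"
  have "C = {z \<in> pts (W m). ?F' z \<in> Y}"
  proof
    show "C \<subseteq> {z \<in> pts (W m). ?F' z \<in> Y}"
      unfolding C_def using variety_morphismD(1)[OF m(2)] YD(3) F'F Yc by auto
    show "{z \<in> pts (W m). ?F' z \<in> Y} \<subseteq> C"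
    proof
      fix z assume z: "z \<in> {z \<in> pts (W m). ?F' z \<in> Y}"
      then have "z \<in> carrier G" unfolding GD(3) by (auto intro: pts_ind_set)
      then have "z = ?F (?F' z)" using FF' by simp
      then show "z \<in> C" unfolding C_def using z by blast
    qed
  qed
  moreover have "closedin (zariski (W m')) Y" using ind_closed_iff(1)[OF W m'(1) YD(3)] YD(1) by simp
  ultimately have Ccl: "closedin (zariski (W m)) C"
    using variety_morphism_closed_preimage[OF Al Al m'(2)] by simp
  have Cirr: "irreducible_closed (W m) C"
    using irreducible_closed_closure_image[OF Al Al m(2) Y] closure_of_closedin[OF Ccl] unfolding C_def by simp
  note CD = irreducible_closedD[OF Al Cirr]
  have Cc: "z \<in> carrier G" if "z \<in> C" for z
    unfolding GD(3) by (rule pts_ind_set) (rule subsetD[OF CD(3) that])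
  let ?A = "closed_subvar (W l) Y" and ?B = "closed_subvar (W m) C"
  have A: "irreducible_variety ?A" by (rule irreducible_variety_closed_subvar[OF Al Y])
  have B: "irreducible_variety ?B" by (rule irreducible_variety_closed_subvar[OF Al Cirr])
  note Aa = irreducible_varietyD(1)[OF A] and Ba = irreducible_varietyD(1)[OF B]
  have AB: "variety_morphism ?A ?B ?F"
    by (rule variety_morphism_restrict[OF m(2) YD(3)]) (simp add: C_def)
  have F'C: "?F' ` C \<subseteq> Y" unfolding C_def using F'F Yc by auto
  have BA: "variety_morphism ?B ?A ?F'"
    using variety_morphism_restrict[OF m'(2) CD(3) F'C] ind_closed_iff(2)[OF W m'(1) YD(3)] by simp
  have Fx: "?F x = \<one>\<^bsub>G\<^esub>" using xc by simp
  have eC: "\<one>\<^bsub>G\<^esub> \<in> C" unfolding C_def using x Fx by (metis imageI)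
  have "trdeg ?A \<le> trdeg ?B"
  proof -
    obtain y where y: "alg_indep_on ?A (pts ?A) (trdeg ?A) y" using trdeg(1)[OF A] ..
    have "alg_indep_on ?B (pts ?B) (trdeg ?A) (\<lambda>i. pullback ?B ?F' (y i))"
    proof (rule dominant_alg_indep_pullback[OF Aa BA y subset_refl])
      fix h assume h: "h \<in> cring ?A" "\<forall>z\<in>pts ?B. h (?F' z) = 0"
      have "h z = 0" if z: "z \<in> Y" for z
      proof -
        have "?F z \<in> pts ?B" using z by (simp add: C_def)
        from bspec[OF h(2) this] show ?thesis using F'F[OF Yc[OF z]] by simp
      qed
      then show "h \<in> zero_ideal ?A (pts ?A)" using h(1) by (simp add: zero_ideal_def)
    qed
    from trdeg(2)[OF B this] show ?thesis .
  qed
  moreover have "fun_vs.dim (tangent ?B \<one>\<^bsub>G\<^esub>) \<le> fun_vs.dim (tangent ?A x)"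
  proof (rule fin_dim_inj(2)[OF linear_push_forward subspace_tangent[OF Ba]])
    show "fin_dim (tangent ?A x)" by (rule fin_dim_tangent[OF Aa]) (simp add: x)
    show "push_forward ?B ?A ?F' ` tangent ?B \<one>\<^bsub>G\<^esub> \<subseteq> tangent ?A x"
      using push_forward_tangent[OF Aa BA, of "\<one>\<^bsub>G\<^esub>"] eC xc by auto
    show "inj_on (push_forward ?B ?A ?F') (tangent ?B \<one>\<^bsub>G\<^esub>)"
    proof (rule inj_onI)
      fix \<epsilon> \<eta> assume *: "\<epsilon> \<in> tangent ?B \<one>\<^bsub>G\<^esub>" "\<eta> \<in> tangent ?B \<one>\<^bsub>G\<^esub>"
        "push_forward ?B ?A ?F' \<epsilon> = push_forward ?B ?A ?F' \<eta>"
      show "\<epsilon> = \<eta>"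
      proof
        fix g
        show "\<epsilon> g = \<eta> g"
        proof (cases "g \<in> cring ?B")
          case True
          have "pullback ?B ?F' (pullback ?A ?F g) = g"
          proof
            fix z
            show "pullback ?B ?F' (pullback ?A ?F g) z = g z"
            proof (cases "z \<in> C")
              case z: True
              then have "?F' z \<in> Y" using F'C by blast
              then show ?thesis using z FF'[OF Cc[OF z]] by simp
            next
              case False
              then have "g z = 0" using cring_outside[OF Ba True] by simp
              then show ?thesis using False by (simp add: pullback_def res_def)
            qed
          qed
          moreover have "pullback ?A ?F g \<in> cring ?A" by (rule variety_morphismD(2)[OF AB True])
          ultimately show ?thesis using fun_cong[OF *(3), of "pullback ?A ?F g"] by (simp add: push_forward_def)
        qed (simp add: tangentD(4)[OF *(1)] tangentD(4)[OF *(2)])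
      qed
    qed
  qed
  ultimately have dimC: "fun_vs.dim (tangent ?B \<one>\<^bsub>G\<^esub>) \<le> trdeg ?B" using dim by simp
  have "push_forward ?A ?B ?F \<delta> \<in> tangent ?B (?F x)"
    by (rule push_forward_tangent[OF Ba AB _ \<delta>]) (simp add: x)
  then have "push_forward ?A ?B ?F \<delta> \<in> tangent ?B \<one>\<^bsub>G\<^esub>" unfolding Fx .
  from irreducible_smooth_in_L_space[OF G Cirr eC dimC this]
  show ?thesis
    using differential_push_tangent[OF W F YD(3) CD(3), of \<delta>] by (simp add: C_def)
qed

lemma subspace_L_space: "fun_vs.subspace (L_space G W)"
  unfolding L_space_def by (rule fun_vs.subspace_span)

lemma hom_translation:
  assumes H: "group H" and G: "group G" and \<phi>: "\<phi> \<in> hom H G" and x: "x \<in> carrier H" and y: "y \<in> carrier H"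
  shows "\<phi> (inv\<^bsub>H\<^esub> x \<otimes>\<^bsub>H\<^esub> y) = inv\<^bsub>G\<^esub> (\<phi> x) \<otimes>\<^bsub>G\<^esub> \<phi> y"
proof -
  interpret group_hom H G \<phi> by (intro group_hom.intro group_hom_axioms.intro H G \<phi>)
  show ?thesis using x y by simp
qed

lemma differential_translation:
  fixes V :: "nat \<Rightarrow> ('a, 'k::field) variety" and W :: "nat \<Rightarrow> ('b, 'k) variety"
  assumes H: "ind_group H V" and G: "ind_group G W" and \<phi>: "ind_group_hom H V G W \<phi>" and x: "x \<in> carrier H"
  shows "differential W W (\<lambda>z. inv\<^bsub>G\<^esub> (\<phi> x) \<otimes>\<^bsub>G\<^esub> z) (differential V W \<phi> \<theta>) = differential V W (\<lambda>y. \<phi> (inv\<^bsub>H\<^esub> x \<otimes>\<^bsub>H\<^esub> y)) \<theta>"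
    "differential V W \<phi> (differential V V (\<lambda>y. inv\<^bsub>H\<^esub> x \<otimes>\<^bsub>H\<^esub> y) \<theta>) = differential V W (\<lambda>y. \<phi> (inv\<^bsub>H\<^esub> x \<otimes>\<^bsub>H\<^esub> y)) \<theta>"
proof -
  note HD = ind_groupD[OF H] and GD = ind_groupD[OF G]
  have hom: "\<phi> \<in> hom H G" and mor: "ind_morphism V W \<phi>" using \<phi> by (simp_all add: ind_group_hom_def)
  have px: "\<phi> x \<in> carrier G" using hom x by (auto simp: hom_def)
  have "differential W W (\<lambda>z. inv\<^bsub>G\<^esub> (\<phi> x) \<otimes>\<^bsub>G\<^esub> z) (differential V W \<phi> \<theta>) =
      differential V W (\<lambda>y. inv\<^bsub>G\<^esub> (\<phi> x) \<otimes>\<^bsub>G\<^esub> \<phi> y) \<theta>"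
    by (rule differential_comp[OF mor translation_ind_morphism[OF G group.inv_closed[OF GD(1) px]]])
  also have "\<dots> = differential V W (\<lambda>y. \<phi> (inv\<^bsub>H\<^esub> x \<otimes>\<^bsub>H\<^esub> y)) \<theta>"
    by (rule differential_cong) (simp add: hom_translation[OF HD(1) GD(1) hom x] flip: HD(3))
  finally show "differential W W (\<lambda>z. inv\<^bsub>G\<^esub> (\<phi> x) \<otimes>\<^bsub>G\<^esub> z) (differential V W \<phi> \<theta>) = differential V W (\<lambda>y. \<phi> (inv\<^bsub>H\<^esub> x \<otimes>\<^bsub>H\<^esub> y)) \<theta>" .
  show "differential V W \<phi> (differential V V (\<lambda>y. inv\<^bsub>H\<^esub> x \<otimes>\<^bsub>H\<^esub> y) \<theta>) = differential V W (\<lambda>y. \<phi> (inv\<^bsub>H\<^esub> x \<otimes>\<^bsub>H\<^esub> y)) \<theta>"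
    by (rule differential_comp[OF translation_ind_morphism[OF H group.inv_closed[OF HD(1) x]] mor])
qed

text \<open>Let \<open>Y\<close> be the closure of the image of \<open>C\<close>. Generic points of \<open>C\<close> map to points at which \<open>Y\<close> is
  smooth, and the translates of the tangent spaces of \<open>Y\<close> at such points lie in \<open>L\<close>.\<close>

lemma differential_L_space_subset:
  fixes V :: "nat \<Rightarrow> ('a, 'k::{alg_closed_field,field_char_0}) variety" and W :: "nat \<Rightarrow> ('b, 'k) variety"
  assumes H: "ind_group H V" and G: "ind_group G W" and \<phi>: "ind_group_hom H V G W \<phi>"
  shows "differential V W \<phi> ` L_space H V \<subseteq> L_space G W"
proof -
  note HD = ind_groupD[OF H] and GD = ind_groupD[OF G]
  have mor: "ind_morphism V W \<phi>" using \<phi> by (simp add: ind_group_hom_def)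
  note lin = linear_differential[of V W \<phi>]
  note L = subspace_L_space[of G W]
  let ?T = "{\<theta>. differential V W \<phi> \<theta> \<in> L_space G W}"
  have T: "fun_vs.subspace ?T"
    by (rule fun_vs.subspaceI)
      (simp_all add: fun_pair.linear_0[OF lin] fun_pair.linear_add[OF lin] fun_pair.linear_scale[OF lin]
        fun_vs.subspace_0[OF L] fun_vs.subspace_add[OF L] fun_vs.subspace_scale[OF L])
  have "L_space H V \<subseteq> ?T"
  proof (rule L_space_minimal[OF H T])
    fix k C \<delta> assume C: "irreducible_closed (V k) C" and e: "\<one>\<^bsub>H\<^esub> \<in> C"
      and dim: "fun_vs.dim (tangent (closed_subvar (V k) C) \<one>\<^bsub>H\<^esub>) \<le> trdeg_on (V k) C"
      and \<delta>: "\<delta> \<in> tangent (closed_subvar (V k) C) \<one>\<^bsub>H\<^esub>"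
    note Vk = ind_varietyD(1)[OF HD(2), of k]
    note CD = irreducible_closedD[OF Vk C]
    obtain l where l: "variety_morphism (V k) (W l) \<phi>" using mor unfolding ind_morphism_def by blast
    note Wl = ind_varietyD(1)[OF GD(2), of l]
    define Y where "Y = zariski (W l) closure_of (\<phi> ` C)"
    have Y: "irreducible_closed (W l) Y" unfolding Y_def by (rule irreducible_closed_closure_image[OF Vk Wl l C])
    note YD = irreducible_closedD[OF Wl Y]
    have CY: "\<phi> ` C \<subseteq> Y"
      unfolding Y_def using variety_morphismD(1)[OF l] CD(3)
      by (intro closure_of_subset) (auto simp: topspace_zariski[OF Wl])
    let ?A = "closed_subvar (V k) C" and ?B = "closed_subvar (W l) Y"
    have A: "irreducible_variety ?A" by (rule irreducible_variety_closed_subvar[OF Vk C])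
    have B: "irreducible_variety ?B" by (rule irreducible_variety_closed_subvar[OF Wl Y])
    note Aa = irreducible_varietyD(1)[OF A] and Ba = irreducible_varietyD(1)[OF B]
    have AB: "variety_morphism ?A ?B \<phi>" by (rule variety_morphism_restrict[OF l CD(3) CY])
    obtain y where y: "alg_indep_on ?B (pts ?B) (trdeg ?B) y" using trdeg(1)[OF B] ..
    obtain g where g: "nonvanishing ?B g" "unramified_off ?B (trdeg ?B) y g" using generically_unramified[OF B y] by blast
    define D where "D = {x \<in> C. g (\<phi> x) \<noteq> 0}"
    have "\<not> (\<forall>x\<in>C. g (\<phi> x) = 0)"
    proof
      assume *: "\<forall>x\<in>C. g (\<phi> x) = 0"
      have "closedin (zariski ?B) (zero_set ?B {g})" using g(1) by (intro closedin_zero_set[OF Ba]) simp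
      then have cl: "closedin (zariski (W l)) (zero_set ?B {g})" using closedin_closed_subvar[OF Wl YD(1)] by blast
      have "\<phi> ` C \<subseteq> zero_set ?B {g}" using * CY by (auto simp: zero_set_def)
      then have "Y \<subseteq> zero_set ?B {g}" unfolding Y_def by (rule closure_of_minimal[OF _ cl[unfolded Y_def]])
      then show False using g(1) by (auto simp: zero_set_def zero_ideal_def)
    qed
    then obtain x0 where x0: "x0 \<in> C" "g (\<phi> x0) \<noteq> 0" by blast
    have pg: "nonvanishing ?A (pullback ?A \<phi> g)"
      using variety_morphismD(2)[OF AB] g(1) x0 by (intro nonvanishingI[of _ _ x0]) simp_all
    have "differential V W \<phi> (push_tangent V C \<delta>) \<in> L_space G W"
    proof (rule differential_at_identity[OF H GD(2) mor C e dim _ _ L _ \<delta>])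
      show "D \<subseteq> C" by (auto simp: D_def)
      fix f assume f: "f \<in> cring ?A" "\<And>x. x \<in> D \<Longrightarrow> f x = 0"
      show "f \<one>\<^bsub>H\<^esub> = 0"
      proof (rule ccontr)
        assume "f \<one>\<^bsub>H\<^esub> \<noteq> 0"
        then have "nonvanishing ?A f" using e f(1) by (intro nonvanishingI[of _ _ "\<one>\<^bsub>H\<^esub>"]) simp_all
        from nonvanishing_mult[OF A this pg] obtain x where "x \<in> C" "f x \<noteq> 0" "g (\<phi> x) \<noteq> 0"
          by (auto simp: zero_ideal_def)
        then show False using f(2)[of x] by (simp add: D_def)
      qed
    next
      fix x \<epsilon> assume x: "x \<in> D" and \<epsilon>: "\<epsilon> \<in> tangent ?A x"
      have xC: "x \<in> C" and gx: "g (\<phi> x) \<noteq> 0" using x by (auto simp: D_def)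
      have xc: "x \<in> carrier H" unfolding HD(3) by (rule pts_ind_set) (rule subsetD[OF CD(3) xC])
      have xY: "\<phi> x \<in> Y" using CY xC by blast
      have "push_forward ?A ?B \<phi> \<epsilon> \<in> tangent ?B (\<phi> x)"
        by (rule push_forward_tangent[OF Ba AB _ \<epsilon>]) (simp add: xC)
      moreover have "fun_vs.dim (tangent ?B (\<phi> x)) \<le> trdeg ?B"
        by (rule dim_tangent_unramified[OF Ba g(2) _ gx]) (simp add: xY)
      ultimately have "differential W W (\<lambda>z. inv\<^bsub>G\<^esub> (\<phi> x) \<otimes>\<^bsub>G\<^esub> z) (push_tangent W Y (push_forward ?A ?B \<phi> \<epsilon>)) \<in> L_space G W"
        by (intro translated_tangent_in_L_space[OF G Y xY])
      then show "differential V W (\<lambda>y. \<phi> (inv\<^bsub>H\<^esub> x \<otimes>\<^bsub>H\<^esub> y)) (push_tangent V C \<epsilon>) \<in> L_space G W"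
        unfolding differential_push_tangent[OF GD(2) mor CD(3) YD(3) CY, symmetric] differential_translation(1)[OF H G \<phi> xc] .
    qed
    then show "push_tangent V C \<delta> \<in> ?T" by simp
  qed
  then show ?thesis by blast
qed

lemma differential_identity:
  assumes "\<And>f. f \<notin> ind_cring V \<Longrightarrow> \<theta> f = 0"
  shows "differential V V (\<lambda>x. x) \<theta> = \<theta>"
proof
  fix g
  show "differential V V (\<lambda>x. x) \<theta> g = \<theta> g"
    using assms[of g] ind_cringD(1)[of g V] by (simp add: differential_def o_def)
qed

text \<open>Tangent vectors are functions on all functions of the type, with default value zero off the ring of the
  ind-variety; only with this convention does the differential of the identity map act as the identity.\<close>

lemma L_space_outside:
  assumes "ind_group G W" "\<theta> \<in> L_space G W" "f \<notin> ind_cring W"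
  shows "\<theta> f = 0"
proof -
  have "\<theta> \<in> ind_tangent W \<one>\<^bsub>G\<^esub>" using L_space_subset_Lie[OF assms(1)] assms(2) unfolding Lie_def by blast
  then show ?thesis using assms(3) by (auto simp: ind_tangent_def push_tangent_def)
qed

lemma differential_automorphism:
  fixes W :: "nat \<Rightarrow> ('b, 'k::{alg_closed_field,field_char_0}) variety"
  assumes G: "ind_group G W" and \<alpha>: "ind_group_aut G W \<alpha>"
  shows "differential W W \<alpha> ` L_space G W = L_space G W"
proof
  note GD = ind_groupD[OF G]
  let ?\<beta> = "inv_into (carrier G) \<alpha>"
  have iso: "\<alpha> \<in> iso G G" and mor: "ind_morphism W W \<alpha>" "ind_morphism W W ?\<beta>"
    using \<alpha> by (simp_all add: ind_group_aut_def)
  have "?\<beta> \<in> iso G G" by (rule group.iso_set_sym[OF GD(1) iso])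
  then have hom: "ind_group_hom G W G W \<alpha>" "ind_group_hom G W G W ?\<beta>"
    using iso mor by (simp_all add: ind_group_hom_def iso_def)
  show "differential W W \<alpha> ` L_space G W \<subseteq> L_space G W" by (rule differential_L_space_subset[OF G G hom(1)])
  show "L_space G W \<subseteq> differential W W \<alpha> ` L_space G W"
  proof
    fix \<theta> assume \<theta>: "\<theta> \<in> L_space G W"
    have surj: "\<alpha> ` carrier G = carrier G" using iso by (simp add: iso_def bij_betw_def)
    have "differential W W \<alpha> (differential W W ?\<beta> \<theta>) = differential W W (\<lambda>x. \<alpha> (?\<beta> x)) \<theta>"
      by (rule differential_comp[OF mor(2,1)])
    also have "\<dots> = differential W W (\<lambda>x. x) \<theta>"
      by (rule differential_cong) (simp add: f_inv_into_f surj flip: GD(3))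
    also have "\<dots> = \<theta>" by (rule differential_identity) (rule L_space_outside[OF G \<theta>])
    finally have "\<theta> = differential W W \<alpha> (differential W W ?\<beta> \<theta>)" by (rule sym)
    moreover have "differential W W ?\<beta> \<theta> \<in> L_space G W" using differential_L_space_subset[OF G G hom(2)] \<theta> by blast
    ultimately show "\<theta> \<in> differential W W \<alpha> ` L_space G W" by (rule image_eqI)
  qed
qed

text \<open>The image of \<open>L\<close> is a subspace, so membership of \<open>T\<^sub>e C\<close> can be tested at the images of generic points
  of a variety dominating \<open>C\<close>, where the tangent spaces of \<open>C\<close> are images of tangent spaces at smooth
  points.\<close>

lemma differential_L_space_surj:
  fixes V :: "nat \<Rightarrow> ('a, 'k::{alg_closed_field,field_char_0}) variety" and W :: "nat \<Rightarrow> ('b, 'k) variety"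
  assumes H: "ind_group H V" and G: "ind_group G W" and \<phi>: "ind_group_hom H V G W \<phi>"
    and unc: "uncountable (UNIV :: 'k set)" and surj: "\<phi> ` carrier H = carrier G"
  shows "L_space G W \<subseteq> differential V W \<phi> ` L_space H V"
proof -
  note HD = ind_groupD[OF H] and GD = ind_groupD[OF G]
  have mor: "ind_morphism V W \<phi>" using \<phi> by (simp add: ind_group_hom_def)
  let ?S = "differential V W \<phi> ` L_space H V"
  have S: "fun_vs.subspace ?S" by (rule fun_pair.linear_subspace_image[OF linear_differential subspace_L_space])
  show ?thesis
  proof (rule L_space_minimal[OF G S])
    fix k C \<delta> assume C: "irreducible_closed (W k) C" and e: "\<one>\<^bsub>G\<^esub> \<in> C"
      and dim: "fun_vs.dim (tangent (closed_subvar (W k) C) \<one>\<^bsub>G\<^esub>) \<le> trdeg_on (W k) C"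
      and \<delta>: "\<delta> \<in> tangent (closed_subvar (W k) C) \<one>\<^bsub>G\<^esub>"
    note Wk = ind_varietyD(1)[OF GD(2), of k]
    note CD = irreducible_closedD[OF Wk C]
    let ?B = "closed_subvar (W k) C"
    have B: "irreducible_variety ?B" by (rule irreducible_variety_closed_subvar[OF Wk C])
    note Ba = irreducible_varietyD(1)[OF B]
    define Z where "Z j = {x \<in> pts (V j). \<phi> x \<in> C}" for j
    have Zj: "closedin (zariski (V j)) (Z j) \<and> variety_morphism (closed_subvar (V j) (Z j)) ?B \<phi>" for j
    proof -
      obtain l where l: "k \<le> l" "variety_morphism (V j) (W l) \<phi>" using ind_morphism_above[OF GD(2) mor] .
      have "closedin (zariski (W l)) C" using ind_closed_iff(1)[OF GD(2) l(1) CD(3)] CD(1) by simp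
      then have "closedin (zariski (V j)) (Z j)"
        unfolding Z_def by (rule variety_morphism_closed_preimage[OF ind_varietyD(1)[OF HD(2)] ind_varietyD(1)[OF GD(2)] l(2)])
      moreover have "variety_morphism (closed_subvar (V j) (Z j)) (closed_subvar (W l) C) \<phi>"
        by (rule variety_morphism_restrict[OF l(2)]) (auto simp: Z_def)
      ultimately show ?thesis using ind_closed_iff(2)[OF GD(2) l(1) CD(3)] by simp
    qed
    have "pts ?B \<subseteq> (\<Union>j. \<phi> ` pts (closed_subvar (V j) (Z j)))"
    proof
      fix c assume "c \<in> pts ?B"
      then have c: "c \<in> C" by simp
      then have "c \<in> carrier G" unfolding GD(3) by (intro pts_ind_set[of _ _ k] subsetD[OF CD(3)])
      then have "c \<in> \<phi> ` carrier H" using surj by simp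
      then obtain x where x: "x \<in> ind_set V" "c = \<phi> x" using HD(3) by blast
      then obtain j where "x \<in> pts (V j)" by (auto simp: ind_set_def)
      then have "x \<in> Z j" using x(2) c by (simp add: Z_def)
      then show "c \<in> (\<Union>j. \<phi> ` pts (closed_subvar (V j) (Z j)))" using x(2) by auto
    qed
    then have "\<exists>j Z'. irreducible_closed (closed_subvar (V j) (Z j)) Z' \<and>
        dominant (closed_subvar (closed_subvar (V j) (Z j)) Z') ?B \<phi>"
      using Zj by (intro irreducible_subset_dominating[OF B unc])
        (auto intro: affine_closed_subvar[OF ind_varietyD(1)[OF HD(2)]])
    then obtain j X where X: "irreducible_closed (closed_subvar (V j) (Z j)) X"
      and domX: "dominant (closed_subvar (closed_subvar (V j) (Z j)) X) ?B \<phi>" by blast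
    note Vj = ind_varietyD(1)[OF HD(2), of j]
    have Zc: "closedin (zariski (V j)) (Z j)" using Zj by blast
    have XZ: "X \<subseteq> Z j" using irreducible_closedD(3)[OF affine_closed_subvar[OF Vj Zc] X] by simp
    have Xirr: "irreducible_closed (V j) X" using irreducible_closed_closed_subvar[OF Vj Zc XZ] X by simp
    note XD = irreducible_closedD[OF Vj Xirr]
    let ?A = "closed_subvar (V j) X"
    have A: "irreducible_variety ?A" by (rule irreducible_variety_closed_subvar[OF Vj Xirr])
    have dom: "dominant ?A ?B \<phi>" using domX unfolding closed_subvar_closed_subvar[OF XZ] .
    have AB: "variety_morphism ?A ?B \<phi>" using dom by (simp add: dominant_def)
    define D where "D = {\<phi> z | z. z \<in> X \<and> fun_vs.dim (tangent ?A z) \<le> trdeg ?A \<and>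
      tangent ?B (\<phi> z) \<subseteq> push_forward ?A ?B \<phi> ` tangent ?A z}"
    have XC: "\<phi> ` X \<subseteq> C" using XZ by (auto simp: Z_def)
    have "differential W W (\<lambda>x. x) (push_tangent W C \<delta>) \<in> ?S"
    proof (rule differential_at_identity[OF G GD(2) ind_morphism_id[OF GD(2)] C e dim _ _ S _ \<delta>])
      show "D \<subseteq> C" using XC by (auto simp: D_def)
      fix f assume f: "f \<in> cring ?B" "\<And>x. x \<in> D \<Longrightarrow> f x = 0"
      show "f \<one>\<^bsub>G\<^esub> = 0"
      proof (rule ccontr)
        assume "f \<one>\<^bsub>G\<^esub> \<noteq> 0"
        then have "f \<notin> zero_ideal ?B (pts ?B)" using e by (auto simp: zero_ideal_def)
        then have "\<not> (\<forall>x\<in>pts ?A. f (\<phi> x) = 0)" using dom f(1) unfolding dominant_def by blast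
        then obtain x where "x \<in> X" "f (\<phi> x) \<noteq> 0" by auto
        then have "nonvanishing ?A (pullback ?A \<phi> f)"
          using variety_morphismD(2)[OF AB f(1)] by (intro nonvanishingI[of _ _ x]) simp_all
        from generic_smoothness[OF A B dom this] obtain z where z: "z \<in> X" "pullback ?A \<phi> f z \<noteq> 0"
          "fun_vs.dim (tangent ?A z) \<le> trdeg ?A" "tangent ?B (\<phi> z) \<subseteq> push_forward ?A ?B \<phi> ` tangent ?A z" by auto
        then have "\<phi> z \<in> D" unfolding D_def by blast
        then show False using f(2) z(1,2) by simp
      qed
    next
      fix x \<epsilon> assume x: "x \<in> D" and \<epsilon>: "\<epsilon> \<in> tangent ?B x"
      obtain z where z: "x = \<phi> z" "z \<in> X" "fun_vs.dim (tangent ?A z) \<le> trdeg ?A"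
        "tangent ?B (\<phi> z) \<subseteq> push_forward ?A ?B \<phi> ` tangent ?A z" using x unfolding D_def by blast
      then obtain \<eta> where \<eta>: "\<eta> \<in> tangent ?A z" "\<epsilon> = push_forward ?A ?B \<phi> \<eta>" using \<epsilon> by blast
      have zc: "z \<in> carrier H" unfolding HD(3) by (rule pts_ind_set) (rule subsetD[OF XD(3) z(2)])
      have "push_tangent W C \<epsilon> = differential V W \<phi> (push_tangent V X \<eta>)"
        unfolding \<eta>(2) by (rule differential_push_tangent[OF GD(2) mor XD(3) CD(3) XC, symmetric])
      then have "differential W W (\<lambda>y. inv\<^bsub>G\<^esub> x \<otimes>\<^bsub>G\<^esub> y) (push_tangent W C \<epsilon>) =
          differential V W \<phi> (differential V V (\<lambda>y. inv\<^bsub>H\<^esub> z \<otimes>\<^bsub>H\<^esub> y) (push_tangent V X \<eta>))"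
        using differential_translation[OF H G \<phi> zc] z(1) by simp
      moreover have "differential V V (\<lambda>y. inv\<^bsub>H\<^esub> z \<otimes>\<^bsub>H\<^esub> y) (push_tangent V X \<eta>) \<in> L_space H V"
        by (rule translated_tangent_in_L_space[OF H Xirr z(2,3) \<eta>(1)])
      ultimately show "differential W W (\<lambda>y. inv\<^bsub>G\<^esub> x \<otimes>\<^bsub>G\<^esub> y) (push_tangent W C \<epsilon>) \<in> ?S" by blast
    qed
    moreover have "differential W W (\<lambda>x. x) (push_tangent W C \<delta>) = push_tangent W C \<delta>"
      by (rule differential_identity) (simp add: push_tangent_def)
    ultimately show "push_tangent W C \<delta> \<in> ?S" by simp
  qed
qed

theorem proposition7p2p1:
  fixes H :: "('a, 'm) monoid_scheme" and G :: "('b, 'n) monoid_scheme"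
    and V :: "nat \<Rightarrow> ('a, 'k::{alg_closed_field, field_char_0}) variety"
    and W :: "nat \<Rightarrow> ('b, 'k) variety"
    and \<phi> :: "'a \<Rightarrow> 'b"
  assumes "ind_group H V" and "ind_group G W" and "ind_group_hom H V G W \<phi>"
  shows "(differential V W \<phi> ` L_space H V \<subseteq> L_space G W \<and>
      (\<forall>\<alpha>. ind_group_aut G W \<alpha> \<longrightarrow> differential W W \<alpha> ` L_space G W = L_space G W)) \<and>
    (uncountable (UNIV :: 'k set) \<and> \<phi> ` carrier H = carrier G \<longrightarrow>
      differential V W \<phi> ` L_space H V = L_space G W)"
proof (intro conjI allI impI)
  show sub: "differential V W \<phi> ` L_space H V \<subseteq> L_space G W" by (rule differential_L_space_subset[OF assms])
  show "differential W W \<alpha> ` L_space G W = L_space G W" if "ind_group_aut G W \<alpha>" for \<alpha>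
    by (rule differential_automorphism[OF assms(2) that])
  show "differential V W \<phi> ` L_space H V = L_space G W" if "uncountable (UNIV :: 'k set) \<and> \<phi> ` carrier H = carrier G"
    using sub differential_L_space_surj[OF assms conjunct1[OF that] conjunct2[OF that]] by (rule subset_antisym)
qed

end
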